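(* Let $E\subset\mathbf R^n$ be a 2-dimensional $C^0$ submanifold with $0\in E$, such that $E-\{0\}$ is an orientable $C^2$ submanifold of $\mathbf R^n$ of dimension 2. Suppose that $0$ is an $M$-regular singularity of $E$. Then $0$ is a conformally point-like singularity of $E$; that is, there exists $r>0$ such that $B(0,r)\cap(E-\{0\})$ is the union of connected components each conformal to the punctured unit disc $\Delta^*$.
   Context: Notation: $B(0,r)$ and $S(0,r)$ are the ball and the sphere of center $0$ and radius $r$ in $\mathbf R^n$ for the Euclidean metric; $\Delta^*=\{z\in\mathbf C: 0<|z|<1\}$; $L(X)$ denotes the length (one-dimensional Hausdorff measure) of a one-dimensional set $X$. Conformal structure: an orientable $C^2$ two-dimensional submanifold of $\mathbf R^n$ carries the Riemannian metric induced by $\mathbf R^n$, and this metric determines (via isothermal parameters, in which $ds^2=\lambda\,dw\,d\overline w$ with $\lambda>0$) a Riemann surface structure. "Conformal" means isomorphic with respect to these conformal structures. Whitney condition for a pair $(M,\{0\})$: let $M$ be a $C^1$ submanifold of $\mathbf R^n$ with $0\in\overline M$, $0\notin M$. For $x\in M$ let $\theta(T_xM,\overline{x0})\in[0,\pi/2]$ be the angle between the line $\overline{x0}$ joining $x$ and $0$ and its orthogonal projection onto the affine tangent space $T_xM$ through $x$, and set $W(x,0)=\sin\theta(T_xM,\overline{x0})$. The pair $(M,\{0\})$ satisfies a Whitney condition if $W(\cdot,0)$ extends to a continuous function on $M\cup\{0\}$ with value $0$ at $0$. $M$-regular singularity: $0$ is an $M$-regular singularity of $E$ if 1) the pair $(E-\{0\},\{0\})$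 satisfies a Whitney condition; and 2) there exist $r_0>0$ and a constant $C$ such that $L(S(0,r)\cap E)\le Cr$ for all $0<r\le r_0$. *)

theory Defs
  imports "HOL-Complex_Analysis.Complex_Analysis"
begin

section \<open>Submanifolds of Euclidean space\<close>

primrec Ck_on :: "nat \<Rightarrow> ('p::euclidean_space \<Rightarrow> 'a::euclidean_space) \<Rightarrow> 'p set \<Rightarrow> bool" where
  "Ck_on 0 f U \<longleftrightarrow> continuous_on U f"
| "Ck_on (Suc k) f U \<longleftrightarrow>
     (\<forall>u\<in>U. f differentiable (at u)) \<and>
     (\<forall>v. Ck_on k (\<lambda>u. frechet_derivative f (at u) v) U)"

text \<open>Surfaces are parametrized over open subsets of \<open>\<complex>\<close>, regarded as the Euclidean plane.
  For \<open>k = 0\<close> there is no immersion condition.\<close>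

definition local_param ::
    "nat \<Rightarrow> 'a::euclidean_space set \<Rightarrow> (complex \<Rightarrow> 'a) \<Rightarrow> complex set \<Rightarrow> bool" where
  "local_param k M \<phi> U \<longleftrightarrow>
     open U \<and> openin (top_of_set M) (\<phi> ` U) \<and>
     (\<exists>\<psi>. homeomorphism U (\<phi> ` U) \<phi> \<psi>) \<and>
     Ck_on k \<phi> U \<and>
     (k \<ge> 1 \<longrightarrow> (\<forall>u\<in>U. inj (frechet_derivative \<phi> (at u))))"

definition Ck_surface :: "nat \<Rightarrow> 'a::euclidean_space set \<Rightarrow> bool" where
  "Ck_surface k M \<longleftrightarrow> (\<forall>p\<in>M. \<exists>\<phi> U. local_param k M \<phi> U \<and> p \<in> \<phi> ` U)"

definition tangent_space :: "'a::euclidean_space set \<Rightarrow> 'a \<Rightarrow> 'a set" where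
  "tangent_space M x =
     {v. \<exists>\<gamma> e. e > (0::real) \<and> \<gamma> C1_differentiable_on {-e<..<e} \<and> \<gamma> ` {-e<..<e} \<subseteq> M \<and>
            \<gamma> 0 = x \<and> (\<gamma> has_vector_derivative v) (at 0)}"

definition affine_tangent_space :: "'a::euclidean_space set \<Rightarrow> 'a \<Rightarrow> 'a set" where
  "affine_tangent_space M x = (\<lambda>v. x + v) ` tangent_space M x"


section \<open>Orientations\<close>

definition jacobian_det :: "(complex \<Rightarrow> complex) \<Rightarrow> complex \<Rightarrow> real" where
  "jacobian_det \<tau> w =
     (let D = frechet_derivative \<tau> (at w) in Re (D 1) * Im (D \<i>) - Im (D 1) * Re (D \<i>))"

definition co_oriented ::
    "(complex \<Rightarrow> 'a::euclidean_space) \<Rightarrow> complex set \<Rightarrow> (complex \<Rightarrow> 'a) \<Rightarrow> complex set \<Rightarrow> bool" where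
  "co_oriented \<phi> U \<psi> V \<longleftrightarrow>
     (\<forall>w\<in>U. \<phi> w \<in> \<psi> ` V \<longrightarrow> jacobian_det (\<lambda>z. inv_into V \<psi> (\<phi> z)) w > 0)"

definition oriented_atlas ::
    "'a::euclidean_space set \<Rightarrow> ((complex \<Rightarrow> 'a) \<times> complex set) set \<Rightarrow> bool" where
  "oriented_atlas M \<A> \<longleftrightarrow>
     (\<forall>(\<phi>, U)\<in>\<A>. local_param 2 M \<phi> U) \<and>
     M = (\<Union>(\<phi>, U)\<in>\<A>. \<phi> ` U) \<and>
     (\<forall>(\<phi>, U)\<in>\<A>. \<forall>(\<psi>, V)\<in>\<A>. co_oriented \<phi> U \<psi> V)"

definition orientable_C2_surface :: "'a::euclidean_space set \<Rightarrow> bool" where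
  "orientable_C2_surface M \<longleftrightarrow> Ck_surface 2 M \<and> (\<exists>\<A>. oriented_atlas M \<A>)"


section \<open>The conformal structure\<close>

text \<open>The condition on \<open>\<mu>\<close> says that the metric induced by the ambient space is
  \<open>ds\<^sup>2 = \<mu> dw d\<bar>w\<close>.  Isothermal parameters are only required to be \<open>C\<^sup>1\<close>: the induced metric of
  a \<open>C\<^sup>2\<close> surface is \<open>C\<^sup>1\<close>, and isothermal parameters for such a metric need not be \<open>C\<^sup>2\<close>.\<close>

definition isothermal_param ::
    "'a::euclidean_space set \<Rightarrow> (complex \<Rightarrow> 'a) \<Rightarrow> complex set \<Rightarrow> bool" where
  "isothermal_param M \<phi> U \<longleftrightarrow>
     local_param 1 M \<phi> U \<and>
     (\<forall>w\<in>U. \<exists>\<mu>>0. \<forall>h. (norm (frechet_derivative \<phi> (at w) h))\<^sup>2 = \<mu> * (cmod h)\<^sup>2)"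

text \<open>The charts of the Riemann surface \<open>M\<close>.  Here \<open>M\<close> may be an open piece of the surface
  oriented by \<open>\<A>\<close>; it then carries the restricted orientation.\<close>

definition conformal_chart ::
    "'a::euclidean_space set \<Rightarrow> ((complex \<Rightarrow> 'a) \<times> complex set) set \<Rightarrow>
     (complex \<Rightarrow> 'a) \<Rightarrow> complex set \<Rightarrow> bool" where
  "conformal_chart M \<A> \<phi> U \<longleftrightarrow>
     isothermal_param M \<phi> U \<and> (\<forall>(\<psi>, V)\<in>\<A>. co_oriented \<phi> U \<psi> V)"

text \<open>Isomorphism of the Riemann surface \<open>M\<close> with a plane domain.  Holomorphy is tested
  in some chart around each point, so the existence of isothermal parameters is part of the claim;
  it then holds in all charts, as changes of chart are holomorphic.\<close>

definition conformal_to_domain ::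
    "'a::euclidean_space set \<Rightarrow> ((complex \<Rightarrow> 'a) \<times> complex set) set \<Rightarrow> complex set \<Rightarrow> bool" where
  "conformal_to_domain M \<A> D \<longleftrightarrow>
     (\<exists>f g. homeomorphism M D f g \<and>
        (\<forall>p\<in>M. \<exists>\<phi> U. conformal_chart M \<A> \<phi> U \<and> p \<in> \<phi> ` U \<and>
           (f \<circ> \<phi>) holomorphic_on U \<and>
           (inv_into U \<phi> \<circ> g) holomorphic_on (f ` \<phi> ` U)))"

definition punctured_disc :: "complex set" where
  "punctured_disc = {z. 0 < cmod z \<and> cmod z < 1}"

definition conformally_point_like :: "'a::euclidean_space set \<Rightarrow> bool" where
  "conformally_point_like E \<longleftrightarrow>
     (\<exists>r>0. \<forall>\<A>. oriented_atlas (E - {0}) \<A> \<longrightarrow>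
        (\<forall>K \<in> components (ball 0 r \<inter> (E - {0})). conformal_to_domain K \<A> punctured_disc))"


section \<open>\<open>M\<close>-regular singularities\<close>

definition orth_proj :: "'a::euclidean_space set \<Rightarrow> 'a \<Rightarrow> 'a" where
  "orth_proj A z = (THE p. p \<in> A \<and> (\<forall>q\<in>A. orthogonal (z - p) (q - p)))"

definition vec_angle :: "'a::euclidean_space \<Rightarrow> 'a \<Rightarrow> real" where
  "vec_angle u v = arccos (u \<bullet> v / (norm u * norm v))"

text \<open>The projection of the line through \<open>x\<close> and \<open>0\<close> is spanned by \<open>x\<close> and the foot of \<open>0\<close>.  If the
  line is orthogonal to the tangent space, the foot is \<open>x\<close> and the angle is \<open>arccos 0 = \<pi>/2\<close>, as it
  should be, since division by zero yields zero.\<close>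

definition whitney_angle :: "'a::euclidean_space set \<Rightarrow> 'a \<Rightarrow> real" where
  "whitney_angle M x = vec_angle (0 - x) (orth_proj (affine_tangent_space M x) 0 - x)"

definition whitney_condition :: "'a::euclidean_space set \<Rightarrow> bool" where
  "whitney_condition M \<longleftrightarrow>
     (\<exists>W. continuous_on (M \<union> {0}) W \<and> W 0 = 0 \<and> (\<forall>x\<in>M. W x = sin (whitney_angle M x)))"

text \<open>One-dimensional Hausdorff measure.  \<open>diameter\<close> is meaningful for bounded sets only.\<close>

definition hausdorff1 :: "'a::metric_space set \<Rightarrow> ennreal" where
  "hausdorff1 X =
     (SUP \<delta>\<in>{0::real<..}.
        INF A\<in>{A :: nat \<Rightarrow> 'a set. X \<subseteq> (\<Union>i. A i) \<and> (\<forall>i. bounded (A i) \<and> diameter (A i) \<le> \<delta>)}.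
          (\<Sum>i. ennreal (diameter (A i))))"

definition M_regular_singularity :: "'a::euclidean_space set \<Rightarrow> bool" where
  "M_regular_singularity E \<longleftrightarrow>
     whitney_condition (E - {0}) \<and>
     (\<exists>r0>0. \<exists>C::real. \<forall>r. 0 < r \<and> r \<le> r0 \<longrightarrow> hausdorff1 (sphere 0 r \<inter> E) \<le> ennreal (C * r))"

end

theory Submission
 imports Defs
begin

text \<open>The singularity is uniformized and then shown to be a puncture by a length-area argument. By the
 Whitney condition \<open>|x|\<close> has no local extremum on \<open>E - {0}\<close> near \<open>0\<close>, so small pieces
 \<open>E \<inter> ball 0 r\<close> are discs. Isothermal parameters come from the Beltrami equation, solved on a strip by
 iterating the Beurling transform of Fourier series in one variable. The logarithm turns the punctured
 disc into a half plane with a second complex structure, whose Green function (Perron) yields a Riemann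
 map by Heins' argument. The deck transformation becomes a disc automorphism without fixed points, and
 the quotient is an annulus \<open>\<rho> < |w| < 1\<close>. If the end at \<open>0\<close> were a boundary circle of positive radius,
 the bound \<open>L(S(0,t) \<inter> E) <= C t\<close> would force every shell \<open>T/2 <= |x| <= 4 T\<close> to have parameter area bounded
 below, and infinitely many of them are disjoint. So \<open>\<rho> = 0\<close> and \<open>0\<close> corresponds to the puncture.\<close>

text \<open>The complex structure is known only through local isothermal charts, so the argument
  runs on a plane domain to which a homeomorphism onto a piece of \<open>E\<close> lends a foreign
  atlas. On the punctured disc a Riemann map built from the Green function would be multivalued; on
  its universal cover, a half plane in the logarithmic coordinate, local branches glue over
  rectangles without monodromy. Passing to the smaller half plane \<open>Re z < -1\<close> leaves an
  open strip outside it, and that strip is what bounds the Perron family. A C^2 surface has only a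
  C^1 metric, so the Beurling transform must act on a space that contains C^1 coefficients and is
  closed under products: summable Fourier tails of order N^(-1/2) provide one. An annulus has two
  ends. The length-area argument excludes the outer circle; for a positive inner radius the
  inversion \<open>rh / w\<close> turns the inner circle into the outer one, so both cases meet the
  same contradiction. A small piece of \<open>E\<close> then corresponds to a simply connected
  region that need not be round, and one more Riemann map makes it the disc.\<close>

abbreviation D1 :: "complex set" where "D1 \<equiv> ball 0 1"

section \<open>The maximum principle and the Dirichlet problem on discs\<close>

text \<open>If the maximum exceeds \<open>c\<close>, the set of maximum points is compact by
  continuity and open in the whole space by \<open>loc\<close>, which forces it to be empty.\<close>

lemma compact_max_principle:
 fixes B :: "'a::euclidean_space => real"
 assumes K: "compact K" and cont: "continuous_on K B"
  and loc: "\<And>p. p \<in> K ==> c < B p ==> (\<And>x. x \<in> K ==> B x <= B p) ==>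
        \<exists>e>0. ball p e \<subseteq> K & (\<forall>x\<in>ball p e. B x = B p)"
  and x: "x \<in> K"
 shows "B x <= c"
proof (rule ccontr)
 assume nle: "\<not> B x <= c"
 obtain p where p: "p \<in> K" "\<And>y. y \<in> K ==> B y <= B p"
  using continuous_attains_sup[OF K _ cont] x by blast
 have cp: "c < B p" using p(2)[OF x] nle by simp
 define M where "M = {y\<in>K. B y = B p}"
 have "closedin (top_of_set K) M"
  unfolding M_def using continuous_closedin_preimage_constant[OF cont] by simp
 hence "compact M" using K closedin_compact by blast
 moreover have "open M"
  unfolding open_contains_ball
 proof
  fix y assume y: "y \<in> M"
  thus "\<exists>e>0. ball y e \<subseteq> M" using loc[of y] p cp y by (auto simp: M_def)
 qed
 ultimately have "M = {}" using compact_open by blast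
 thus False using p by (auto simp: M_def)
qed

text \<open>This is the maximum modulus principle for \<open>exp (F x)\<close>, whose modulus is the
  exponential of the real part.\<close>

lemma Re_local_max_const:
 assumes F: "F holomorphic_on ball p e" and e: "0 < e"
  and le: "\<And>x. x \<in> ball p e ==> Re (F x) <= Re (F p)" and x: "x \<in> ball p e"
 shows "Re (F x) = Re (F p)"
proof -
 have "(%x. exp (F x)) constant_on ball p e"
 proof (rule maximum_modulus_principle[where U = "ball p e" and \<xi> = p])
  show "(%x. exp (F x)) holomorphic_on ball p e"
   using F by (intro holomorphic_intros)
 qed (use e le in auto)
 hence "exp (F x) = exp (F p)" using x e by (auto simp: constant_on_def)
 hence "cmod (exp (F x)) = cmod (exp (F p))" by simp
 thus ?thesis by simp
qed

lemma Re_max_principle: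
 assumes r: "0 < r" and u: "continuous_on (cball 0 r) u" and F: "F holomorphic_on ball 0 r"
  and uF: "\<And>w. w \<in> ball 0 r ==> u w = Re (F w)"
  and b: "\<And>w. w \<in> sphere 0 r ==> u w <= c" and w: "w \<in> cball 0 r"
 shows "u w <= (c::real)"
proof (rule compact_max_principle[where K = "cball 0 r" and B = u])
 fix p :: complex
 assume p: "p \<in> cball 0 r" "c < u p" and mx: "\<And>x. x \<in> cball 0 r ==> u x <= u p"
 have "p \<notin> sphere 0 r" using b[of p] p by force
 hence pb: "p \<in> ball 0 r" using p by auto
 then obtain e where e: "e > 0" "ball p e \<subseteq> ball 0 r"
  using open_contains_ball_eq by blast
 have F': "F holomorphic_on ball p e" using F e holomorphic_on_subset by blast
 have "Re (F x) <= Re (F p)" if "x \<in> ball p e" for x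
  using mx[of x] uF[of x] uF[of p] pb e that by (auto simp: subset_iff)
 hence "Re (F x) = Re (F p)" if "x \<in> ball p e" for x
  using Re_local_max_const[OF F' e(1) _ that] by blast
 hence "\<forall>x\<in>ball p e. u x = u p" using uF e pb by (metis subsetD)
 moreover have "ball p e \<subseteq> cball 0 r" using e ball_subset_cball by blast
 ultimately show "\<exists>e>0. ball p e \<subseteq> cball 0 r & (\<forall>x\<in>ball p e. u x = u p)"
  using e by blast
qed (use u w in auto)

text \<open>On the unit circle \<open>cnj w\<close> is the inverse of \<open>w\<close>, so the
  product is a trigonometric polynomial; conjugating its terms of negative frequency does not change
  the real part. This makes the real parts of polynomials an algebra on the circle, as
  Stone-Weierstrass demands.\<close>

lemma Re_poly_times_cnj:
 "\<exists>r. \<forall>w. cmod w = 1 --> Re (poly p w * cnj (poly q w)) = Re (poly r w)"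
proof (induction p q rule: poly_induct2)
 case 0
 show ?case by (intro exI[of _ 0]) simp
next
 case (pCons a p b q)
 then obtain r where r: "\<And>w. cmod w = 1 ==> Re (poly p w * cnj (poly q w)) = Re (poly r w)"
  by blast
 show ?case
 proof (intro exI allI impI)
  fix w :: complex assume w: "cmod w = 1"
  hence ww: "w * cnj w = 1" by (simp add: complex_mult_cnj cmod_def)
  have "poly (pCons a p) w * cnj (poly (pCons b q) w) =
    a * cnj (poly (pCons b q) w) + w * poly p w * cnj b + (w * cnj w) * (poly p w * cnj (poly q w))"
   by (simp add: algebra_simps)
  hence "Re (poly (pCons a p) w * cnj (poly (pCons b q) w)) =
    Re (a * cnj (poly (pCons b q) w)) + Re (w * poly p w * cnj b) + Re (poly r w)"
   using r[OF w] by (simp only: ww) simp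
  also have "Re (a * cnj (poly (pCons b q) w)) = Re (cnj a * poly (pCons b q) w)"
   by (simp add: algebra_simps)
  finally show "Re (poly (pCons a p) w * cnj (poly (pCons b q) w)) =
    Re (poly (smult (cnj a) (pCons b q) + pCons 0 (smult (cnj b) p) + r) w)"
   by (simp add: algebra_simps)
 qed
qed

lemma unit_circle_approx:
 fixes b :: "complex => real"
 assumes b: "continuous_on (sphere 0 1) b" and e: "0 < e"
 shows "\<exists>p. \<forall>w\<in>sphere 0 1. \<bar>b w - Re (poly p w)\<bar> < e"
proof -
 define P where "P f \<longleftrightarrow> (\<exists>p. \<forall>w. cmod w = 1 --> f w = Re (poly p w))" for f
 have "\<exists>g. P g & (\<forall>x \<in> sphere 0 1. \<bar>b x - g x\<bar> < e)"
 proof (rule Stone_Weierstrass_HOL)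
  show "P (%x. c)" for c
   unfolding P_def by (intro exI[of _ "[:of_real c:]"]) simp
  show "continuous_on (sphere 0 1) f" if Pf: "P f" for f
  proof -
   obtain p where "\<forall>w. cmod w = 1 --> f w = Re (poly p w)" using Pf unfolding P_def ..
   moreover have "continuous_on (sphere 0 1) (%w. Re (poly p w))"
    by (intro continuous_intros)
   ultimately show ?thesis
    using continuous_on_cong[of "sphere 0 1" "sphere 0 1" f "%w. Re (poly p w)"] by simp
  qed
  show "P (%x. f x + g x)" if "P f & P g" for f g
  proof -
   from that obtain p q where "\<And>w. cmod w = 1 ==> f w = Re (poly p w)"
    "\<And>w. cmod w = 1 ==> g w = Re (poly q w)"
    unfolding P_def by blast
   thus ?thesis unfolding P_def by (intro exI[of _ "p + q"]) simp
  qed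
  show "P (%x. f x * g x)" if "P f & P g" for f g
  proof -
   from that obtain p q where pq: "\<And>w. cmod w = 1 ==> f w = Re (poly p w)"
    "\<And>w. cmod w = 1 ==> g w = Re (poly q w)"
    unfolding P_def by blast
   obtain r where r: "\<And>w. cmod w = 1 ==> Re (poly p w * cnj (poly q w)) = Re (poly r w)"
    using Re_poly_times_cnj by blast
   \<comment> \<open>The identity behind the witness: Re a Re b is half of Re (a b) + Re (a cnj
     b).\<close>
   have "f w * g w = Re (poly (smult (1/2) (p * q + r)) w)" if w: "cmod w = 1" for w
    using r[OF w] pq[OF w] by (simp add: field_simps)
   thus ?thesis unfolding P_def by blast
  qed
  show "\<exists>f. P f & f x ~= f y" if "x \<in> sphere 0 1 & y \<in> sphere 0 1 & x ~= y" for x y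
  proof -
   have "P Re" unfolding P_def by (intro exI[of _ "[:0,1:]"]) simp
   moreover have "P Im" unfolding P_def by (intro exI[of _ "[:0,-\<i>:]"]) simp
   ultimately show ?thesis using that complex_eqI by blast
  qed
 qed (use b e in auto)
 then obtain g p where g: "\<forall>x\<in>sphere 0 1. \<bar>b x - g x\<bar> < e" and p: "\<forall>w. cmod w = 1 --> g w = Re (poly p w)"
  unfolding P_def by blast
 show ?thesis using g p by auto
qed

lemma circle_approx:
 fixes b :: "complex => real"
 assumes r: "0 < r" and b: "continuous_on (sphere 0 r) b" and e: "0 < e"
 shows "\<exists>p. p holomorphic_on UNIV & (\<forall>w\<in>sphere 0 r. \<bar>b w - Re (p w)\<bar> < e)"
proof -
 have "continuous_on (sphere 0 1) (%w. b (of_real r * w))"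
 proof (rule continuous_on_compose2[OF b])
  show "continuous_on (sphere 0 1) (%w. complex_of_real r * w)" by (intro continuous_intros)
  show "(%w. complex_of_real r * w) ` sphere 0 1 \<subseteq> sphere 0 r"
   using r by (auto simp: norm_mult)
 qed
 then obtain p where p: "\<And>w. w \<in> sphere 0 1 ==> \<bar>b (of_real r * w) - Re (poly p w)\<bar> < e"
  using unit_circle_approx e by meson
 have "\<bar>b w - Re (poly p (w / of_real r))\<bar> < e" if "w \<in> sphere 0 r" for w
  using p[of "w / of_real r"] that r by (auto simp: norm_divide)
 moreover have "(%w. poly p (w / of_real r)) holomorphic_on UNIV"
  using r by (intro holomorphic_intros) auto
 ultimately show ?thesis by blast
qed

text \<open>The imaginary parts are not controlled, so Montel's theorem is applied to
  \<open>exp (F n w)\<close>. The two-sided bound on the real parts keeps the limit away from 0, and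
  on a ball such a limit has a logarithm.\<close>

lemma harmonic_limit:
 assumes F: "\<And>n. F n holomorphic_on ball 0 r"
  and bd: "\<And>n w. w \<in> ball 0 r ==> \<bar>Re (F n w)\<bar> <= M"
 obtains G s where "G holomorphic_on ball 0 r" "strict_mono (s :: nat => nat)"
  "\<And>w. w \<in> ball 0 r ==> (%n. Re (F (s n) w)) \<longlonglongrightarrow> Re (G w)"
proof -
 let ?E = "%n w. exp (F n w)"
 obtain g s where g: "g holomorphic_on ball 0 r" and s: "strict_mono (s :: nat => nat)"
  and lim: "\<And>x. x \<in> ball 0 r ==> (%n. ?E (s n) x) \<longlonglongrightarrow> g x"
 proof (rule Montel[of "ball 0 r" "range ?E" ?E])
  show "h holomorphic_on ball 0 r" if "h \<in> range ?E" for h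
   using that F by (auto intro!: holomorphic_intros)
  show "\<exists>B. \<forall>h\<in>range ?E. \<forall>z\<in>K. cmod (h z) <= B" if "compact K" "K \<subseteq> ball 0 r" for K
   using bd that(2) by (intro exI[of _ "exp M"]) (auto simp: abs_le_iff subset_iff)
 qed auto
 have low: "exp (-M) <= cmod (g x)" if x: "x \<in> ball 0 r" for x
 proof (rule LIMSEQ_le_const)
  show "(%n. cmod (?E (s n) x)) \<longlonglongrightarrow> cmod (g x)"
   using lim[OF x] by (rule tendsto_norm)
  show "\<exists>N. \<forall>n\<ge>N. exp (- M) <= cmod (?E (s n) x)"
   using bd[OF x] by (auto simp: abs_le_iff intro: exI[of _ 0]) (metis minus_le_iff)
 qed
 have nz: "g x ~= 0" if "x \<in> ball 0 r" for x
  using low[OF that] by (auto simp: not_le)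
 obtain G where G: "G holomorphic_on ball 0 r" "\<And>z. z \<in> ball 0 r ==> g z = exp (G z)"
  using g nz simply_connected_eq_holomorphic_log[of "ball 0 r"]
   convex_imp_simply_connected[OF convex_ball] by (metis open_ball)
 have "(%n. Re (F (s n) w)) \<longlonglongrightarrow> Re (G w)" if w: "w \<in> ball 0 r" for w using nz[OF w] tendsto_norm[OF lim[OF w]] G(2)[OF w] tendsto_ln by force
 thus ?thesis using that G s by blast
qed

text \<open>Real parts of entire functions approximate the boundary values, and the maximum
  principle makes them uniformly Cauchy on the closed disc. The last clause matters because the
  holomorphic \<open>F\<close> need not extend continuously to the circle, while the approximants
  do; \<open>subat\<close> is tested only against functions that extend.\<close>

lemma dirichlet_disc:
 fixes b :: "complex => real"
 assumes r: "0 < r" and b: "continuous_on (sphere 0 r) b"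
 obtains u F where "continuous_on (cball 0 r) u" "\<And>w. w \<in> sphere 0 r ==> u w = b w"
  "F holomorphic_on ball 0 r" "\<And>w. w \<in> ball 0 r ==> u w = Re (F w)"
  "\<And>e. 0 < e ==> \<exists>p. p holomorphic_on UNIV & (\<forall>w\<in>cball 0 r. \<bar>u w - Re (p w)\<bar> < e)"
proof -
 have "\<exists>p. p holomorphic_on UNIV & (\<forall>w\<in>sphere 0 r. \<bar>b w - Re (p w)\<bar> < inverse (Suc n))" for n
  using circle_approx[OF r b, of "inverse (Suc n)"] by simp
 then obtain p where ph: "\<And>n::nat. p n holomorphic_on UNIV"
  and pb: "\<And>n w. w \<in> sphere 0 r ==> \<bar>b w - Re (p n w)\<bar> < inverse (Suc n)"
  by metis
 have cont: "continuous_on A (%w. Re (p n w))" for n A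
  using holomorphic_on_imp_continuous_on[OF ph[of n]]
  by (intro continuous_intros) (auto intro: continuous_on_subset)
 have cauchy: "Re (p n w) - Re (p m w) <= inverse (Suc n) + inverse (Suc m)"
  if w: "w \<in> cball 0 r" for n m w
 proof (rule Re_max_principle[OF r, where F = "%w. p n w - p m w" and u = "%w. Re (p n w) - Re (p m w)"])
  show "continuous_on (cball 0 r) (%w. Re (p n w) - Re (p m w))"
   by (intro continuous_intros cont)
  show "(%w. p n w - p m w) holomorphic_on ball 0 r"
   using ph by (intro holomorphic_intros) (auto intro: holomorphic_on_subset)
  show "Re (p n w) - Re (p m w) <= inverse (Suc n) + inverse (Suc m)" if "w \<in> sphere 0 r" for w
   using pb[OF that, of n] pb[OF that, of m] by linarith
 qed (use w in auto)
 have "uniformly_Cauchy_on (cball 0 r) (%n w. Re (p n w))"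
  unfolding uniformly_Cauchy_on_def
 proof (intro allI impI)
  fix e :: real assume e: "0 < e"
  then obtain N where N: "inverse (real (Suc N)) < e / 2"
   using reals_Archimedean[of "e/2"] by auto
  have small: "inverse (real (Suc n)) < e / 2" if "n \<ge> N" for n
   using N that le_less_trans[OF le_imp_inverse_le[of "real (Suc N)" "real (Suc n)"] N] by simp
  have "dist (Re (p m x)) (Re (p n x)) < e" if "x \<in> cball 0 r" "m \<ge> N" "n \<ge> N" for x m n
   using cauchy[OF that(1), of n m] cauchy[OF that(1), of m n] small[OF that(2)] small[OF that(3)]
   unfolding dist_real_def by linarith
  thus "\<exists>M. \<forall>x\<in>cball 0 r. \<forall>m\<ge>M. \<forall>n\<ge>M. dist (Re (p m x)) (Re (p n x)) < e"
   by blast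
 qed
 then obtain u where u: "uniform_limit (cball 0 r) (%n w. Re (p n w)) u sequentially"
  using Cauchy_uniformly_convergent unfolding uniformly_convergent_on_def by blast
 have cu: "continuous_on (cball 0 r) u"
  by (rule uniform_limit_theorem[OF _ u]) (use cont in auto)
 have ulim: "(%n. Re (p n w)) \<longlonglongrightarrow> u w" if "w \<in> cball 0 r" for w
  using tendsto_uniform_limitI[OF u that] .
 have ub: "u w = b w" if w: "w \<in> sphere 0 r" for w
 proof (rule LIMSEQ_unique)
  show "(%n. Re (p n w)) \<longlonglongrightarrow> u w" using ulim w by auto
  have "(%n. \<bar>Re (p n w) - b w\<bar>) \<longlonglongrightarrow> 0"
  proof (rule tendsto_sandwich[OF _ _ tendsto_const LIMSEQ_inverse_real_of_nat])
   show "\<forall>\<^sub>F n in sequentially. \<bar>Re (p n w) - b w\<bar> <= inverse (real (Suc n))"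
    using pb[OF w] by (intro always_eventually allI) (metis abs_minus_commute less_eq_real_def)
  qed auto
  thus "(%n. Re (p n w)) \<longlonglongrightarrow> b w"
   by (simp add: LIM_zero_iff tendsto_rabs_zero_iff)
 qed
 have approx: "\<exists>q. q holomorphic_on UNIV & (\<forall>w\<in>cball 0 r. \<bar>u w - Re (q w)\<bar> < e)" if "0 < e" for e
 proof -
  have "\<forall>\<^sub>F n in sequentially. \<forall>w\<in>cball 0 r. dist (Re (p n w)) (u w) < e"
   using u that by (auto simp: uniform_limit_iff)
  then obtain n where "\<forall>w\<in>cball 0 r. dist (Re (p n w)) (u w) < e"
   using eventually_sequentially by auto
  thus ?thesis using ph[of n]
   by (intro exI[of _ "p n"]) (auto simp: dist_real_def abs_minus_commute)
 qed
 have bnd: "\<exists>M. \<forall>n. \<forall>w\<in>cball 0 r. \<bar>Re (p n w)\<bar> <= M"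
 proof -
  have "compact ((%w. Re (p 0 w)) ` cball 0 r)"
   by (intro compact_continuous_image cont compact_cball)
  then obtain M0 where M0: "\<And>w. w \<in> cball 0 r ==> \<bar>Re (p 0 w)\<bar> <= M0"
   using compact_imp_bounded[of "(%w. Re (p 0 w)) ` cball 0 r"] unfolding bounded_real by blast
  have i: "inverse (real (Suc n)) <= 1" for n by (simp add: inverse_le_1_iff)
  have "\<bar>Re (p n w)\<bar> <= M0 + 2" if w: "w \<in> cball 0 r" for n w
   using M0[OF w] cauchy[OF w, of n 0] cauchy[OF w, of 0 n] i[of n] by simp
  thus ?thesis by blast
 qed
 then obtain M where M: "\<And>n w. w \<in> ball 0 r ==> \<bar>Re (p n w)\<bar> <= M" by force
 have hol: "p n holomorphic_on ball 0 r" for n using ph holomorphic_on_subset by blast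
 obtain G s where G: "G holomorphic_on ball 0 r" and s: "strict_mono (s :: nat => nat)"
  and lim: "\<And>w. w \<in> ball 0 r ==> (%n. Re (p (s n) w)) \<longlonglongrightarrow> Re (G w)"
  using harmonic_limit[of p, OF hol M] by metis
 have "u w = Re (G w)" if w: "w \<in> ball 0 r" for w
 proof (rule LIMSEQ_unique)
  show "(%n. Re (p (s n) w)) \<longlonglongrightarrow> Re (G w)" using lim w by blast
  show "(%n. Re (p (s n) w)) \<longlonglongrightarrow> u w"
   using LIMSEQ_subseq_LIMSEQ[OF ulim s] w by (auto simp: o_def)
 qed
 with cu ub G show ?thesis by (rule that[OF _ _ _ _ approx]) auto
qed

section \<open>Subharmonic functions and the Green function\<close>

text \<open>A second complex structure on the plane domain \<open>X\<close>: the charts need not be holomorphic in the usual sense.\<close>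

locale planar_atlas =
 fixes X :: "complex set" and CC :: "(complex => complex) set"
 assumes open_X: "open X" and conn_X: "connected X"
  and chart_cont: "k \<in> CC ==> continuous_on D1 k"
  and chart_inj: "k \<in> CC ==> inj_on k D1"
  and chart_sub: "k \<in> CC ==> k ` D1 \<subseteq> X"
  and chart_at: "p \<in> X ==> \<exists>k\<in>CC. k 0 = p"
  and transition: "k \<in> CC ==> k' \<in> CC ==>
   (inv_into D1 k' \<circ> k) holomorphic_on {w\<in>D1. k w \<in> k' ` D1}"
begin

abbreviation coord :: "(complex => complex) => complex => complex" where
 "coord k \<equiv> inv_into D1 k"

lemma chart_open:
 assumes "k \<in> CC" "open U" "U \<subseteq> D1"
 shows "open (k ` U)"
 using assms chart_cont chart_inj
 by (intro invariance_of_domain) (auto intro: continuous_on_subset inj_on_subset)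

lemma coord_chart: "k \<in> CC ==> w \<in> D1 ==> coord k (k w) = w"
 using chart_inj by (simp add: inv_into_f_f)

lemma coord_image: "k \<in> CC ==> U \<subseteq> D1 ==> coord k ` k ` U = U"
 using coord_chart by force

lemma coord_cont:
 assumes "k \<in> CC"
 shows "continuous_on (k ` D1) (coord k)"
proof -
 obtain g where g: "homeomorphism D1 (k ` D1) k g"
  using invariance_of_domain_homeomorphism[OF open_ball chart_cont[OF assms] _ chart_inj[OF assms]]
  by auto
 have "continuous_on (k ` D1) g" using g by (simp add: homeomorphism_def)
 moreover have "g x = coord k x" if "x \<in> k ` D1" for x
  using that g coord_chart[OF assms] by (auto simp: homeomorphism_def)
 ultimately show ?thesis using continuous_on_cong by metis
qed

lemma chart_preimage_open:
 assumes "k \<in> CC" "open S"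
 shows "open {w\<in>D1. k w \<in> S}"
 using continuous_open_preimage[OF chart_cont[OF assms(1)] open_ball assms(2)]
 by (simp add: vimage_def Int_def conj_commute)

lemma chart_small:
 assumes "k \<in> CC" "open S" "w \<in> D1" "k w \<in> S"
 obtains e where "0 < e" "ball w e \<subseteq> D1" "k ` ball w e \<subseteq> S"
proof -
 have "w \<in> {w\<in>D1. k w \<in> S}" using assms by auto
 then obtain e where "0 < e" "ball w e \<subseteq> {w\<in>D1. k w \<in> S}"
  using chart_preimage_open[OF assms(1,2)] open_contains_ball_eq by blast
 thus ?thesis using that by blast
qed

definition holo :: "(complex => complex) => complex set => bool" where
 "holo f S \<longleftrightarrow> (\<forall>k\<in>CC. (f \<circ> k) holomorphic_on {w\<in>D1. k w \<in> S})"

lemma holo_change_chart: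
 assumes k: "k \<in> CC" and U: "open U" "U \<subseteq> D1" and F: "F holomorphic_on U"
  and k': "k' \<in> CC" and w: "w \<in> D1" "k' w \<in> k ` U"
 obtains e F' where "0 < e" "ball w e \<subseteq> D1" "k' ` ball w e \<subseteq> k ` U" "F' holomorphic_on ball w e"
  "\<And>v. v \<in> ball w e ==> F' v = F (coord k (k' v))"
proof -
 have oU: "open (k ` U)" using chart_open k U by blast
 obtain e where e: "0 < e" "ball w e \<subseteq> D1" "k' ` ball w e \<subseteq> k ` U"
  using chart_small[OF k' oU w] .
 have "(coord k \<circ> k') holomorphic_on ball w e"
  using transition[OF k' k] by (rule holomorphic_on_subset) (use e U in blast)
 moreover have "(coord k \<circ> k') ` ball w e \<subseteq> U"
  using e(3) U(2) coord_chart[OF k] by fastforce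
 ultimately have "(F \<circ> (coord k \<circ> k')) holomorphic_on ball w e"
  using F holomorphic_on_compose_gen by blast
 thus ?thesis using that[OF e, of "F \<circ> (coord k \<circ> k')"] by auto
qed

text \<open>Transition maps are holomorphic, so one chart around each point decides the matter for
  all charts.\<close>

lemma holoI:
 assumes loc: "\<And>p. p \<in> S ==> \<exists>k\<in>CC. \<exists>U. open U & U \<subseteq> D1 & p \<in> k ` U & (f \<circ> k) holomorphic_on U"
 shows "holo f S"
 unfolding holo_def
proof (intro ballI)
 fix k' assume k': "k' \<in> CC"
 have "(f \<circ> k') field_differentiable at w within {w\<in>D1. k' w \<in> S}"
  if w: "w \<in> D1" "k' w \<in> S" for w
 proof -
  obtain k U where k: "k \<in> CC" and U: "open U" "U \<subseteq> D1" "k' w \<in> k ` U" "(f \<circ> k) holomorphic_on U"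
   using loc[OF w(2)] by blast
  obtain e F' where e: "0 < e" "k' ` ball w e \<subseteq> k ` U" "F' holomorphic_on ball w e"
   and F': "\<And>v. v \<in> ball w e ==> F' v = (f \<circ> k) (coord k (k' v))"
   using holo_change_chart[OF k U(1,2,4) k' w(1) U(3)] by metis
  have eq: "F' v = (f \<circ> k') v" if "v \<in> ball w e" for v using e(2) U(2) that F'[OF that] by (force simp: f_inv_into_f)
  have "F' field_differentiable at w"
   using e(1,3) by (meson centre_in_ball holomorphic_on_imp_differentiable_at open_ball)
  thus ?thesis using field_differentiable_transform_within[OF e(1), of w UNIV F' "f \<circ> k'"] eq field_differentiable_at_within by (auto simp: dist_commute)
 qed
 thus "(f \<circ> k') holomorphic_on {w\<in>D1. k' w \<in> S}"
  by (auto simp: holomorphic_on_def)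
qed

lemma holo_subset: "holo f S ==> T \<subseteq> S ==> holo f T"
 unfolding holo_def by (blast intro: holomorphic_on_subset)

lemma holo_near:
 assumes "holo f S" "open S" "p \<in> S" "k \<in> CC" "k 0 = p"
 obtains e where "0 < e" "e <= 1" "k ` ball 0 e \<subseteq> S" "(f \<circ> k) holomorphic_on ball 0 e"
proof -
 obtain e where e: "0 < e" "ball 0 e \<subseteq> D1" "k ` ball 0 e \<subseteq> S"
  using chart_small[OF assms(4,2), of 0] assms by auto
 have "(f \<circ> k) holomorphic_on ball 0 e"
  using assms(1,4) e unfolding holo_def by (blast intro: holomorphic_on_subset)
 moreover have "e <= 1" using e by (simp add: ball_subset_ball_iff)
 ultimately show ?thesis using that e by blast
qed

text \<open>The condition speaks of every chart centred at the point, which makes it easy to apply;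
  \<open>harm_atI\<close> derives it from any single chart covering the point.\<close>

definition harm_at :: "(complex => real) => complex => bool" where
 "harm_at u p \<longleftrightarrow> (\<forall>k\<in>CC. k 0 = p -->
   (\<exists>e F. 0 < e & e <= 1 & F holomorphic_on ball 0 e & (\<forall>w\<in>ball 0 e. u (k w) = Re (F w))))"

lemma harm_atI:
 assumes k: "k \<in> CC" and U: "open U" "U \<subseteq> D1" and F: "F holomorphic_on U"
  and u: "\<And>w. w \<in> U ==> u (k w) = Re (F w)" and p: "p \<in> k ` U"
 shows "harm_at u p"
 unfolding harm_at_def
proof (intro ballI impI)
 fix k' assume k': "k' \<in> CC" "k' 0 = p"
 obtain e F' where e: "0 < e" "ball 0 e \<subseteq> D1" "k' ` ball 0 e \<subseteq> k ` U" "F' holomorphic_on ball 0 e"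
  and F': "\<And>v. v \<in> ball 0 e ==> F' v = F (coord k (k' v))"
  using holo_change_chart[OF k U F k'(1), of 0] k'(2) p by auto
 have "u (k' w) = Re (F' w)" if w: "w \<in> ball 0 e" for w
 proof -
  obtain v where v: "v \<in> U" "k' w = k v" using e(3) w by blast
  thus ?thesis using coord_chart[OF k, of v] U F'[OF w] u[OF v(1)] v(2) by auto
 qed
 moreover have "e <= 1" using e by (simp add: ball_subset_ball_iff)
 ultimately show "\<exists>e F. 0 < e & e <= 1 & F holomorphic_on ball 0 e & (\<forall>w\<in>ball 0 e. u (k' w) = Re (F w))"
  using e by blast
qed

lemma harm_at_minus: "harm_at u p ==> harm_at (%x. - u x) p"
 unfolding harm_at_def
proof (intro ballI impI)
 fix k assume "k \<in> CC" "k 0 = p"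
  "\<forall>k\<in>CC. k 0 = p --> (\<exists>e F. 0 < e & e <= 1 & F holomorphic_on ball 0 e & (\<forall>w\<in>ball 0 e. u (k w) = Re (F w)))"
 then obtain e F where e: "0 < e" "e <= 1" "F holomorphic_on ball 0 e" "\<forall>w\<in>ball 0 e. u (k w) = Re (F w)"
  by blast
 have "(%w. - F w) holomorphic_on ball 0 e" using e(3) by (intro holomorphic_intros)
 thus "\<exists>e F. 0 < e & e <= 1 & F holomorphic_on ball 0 e & (\<forall>w\<in>ball 0 e. - u (k w) = Re (F w))"
  using e by (intro exI[of _ e] exI[of _ "%w. - F w"]) auto
qed

text \<open>Subharmonicity at a point, expressed by harmonic majorants on small circles instead of a
  mean value integral. One chart centred at \<open>p\<close> suffices, so invariance under change of
  chart is never an issue.\<close>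

definition subat :: "(complex => real) => complex => bool" where
 "subat v p \<longleftrightarrow> (\<exists>k\<in>CC. k 0 = p & (\<exists>e. 0 < e & e <= 1 &
   (\<forall>r F. 0 < r --> r < e --> continuous_on (cball 0 r) F --> F holomorphic_on ball 0 r -->
    (\<forall>w\<in>sphere 0 r. v (k w) <= Re (F w)) --> v p <= Re (F 0))))"

text \<open>Any competitor that dominates \<open>v'\<close> on a small circle also dominates
  \<open>v\<close>. This is how maxima and Perron modifications inherit subharmonicity at the points
  where they agree with the old function.\<close>

lemma subat_mono:
 assumes v: "subat v p" and eq: "v' p = v p" and S: "open S" "p \<in> S" "\<And>x. x \<in> S ==> v x <= v' x"
 shows "subat v' p"
proof -
 obtain k e where k: "k \<in> CC" "k 0 = p" and e: "0 < e" "e <= 1"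
  and *: "\<And>r F. 0 < r ==> r < e ==> continuous_on (cball 0 r) F ==> F holomorphic_on ball 0 r ==>
    (\<forall>w\<in>sphere 0 r. v (k w) <= Re (F w)) ==> v p <= Re (F 0)"
  using v unfolding subat_def by blast
 obtain d where d: "0 < d" "ball 0 d \<subseteq> D1" "k ` ball 0 d \<subseteq> S"
  using chart_small[OF k(1) S(1), of 0] k S(2) by auto
 have "v' p <= Re (F 0)" if "0 < r" "r < min e d" "continuous_on (cball 0 r) F" "F holomorphic_on ball 0 r"
  "\<forall>w\<in>sphere 0 r. v' (k w) <= Re (F w)" for r F
  unfolding eq
 proof (rule *)
  show "\<forall>w\<in>sphere 0 r. v (k w) <= Re (F w)" using d(3) that(2) S(3) that(5) order_trans by fastforce
 qed (use that in auto)
 thus ?thesis unfolding subat_def using k e d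
  by (intro bexI[of _ k] conjI exI[of _ "min e d"]) auto
qed

lemma subat_diff:
 assumes v: "subat v p" and u: "harm_at u p"
 shows "subat (%x. v x - u x) p"
proof -
 obtain k e where k: "k \<in> CC" "k 0 = p" and e: "0 < e" "e <= 1"
  and *: "\<And>r F. 0 < r ==> r < e ==> continuous_on (cball 0 r) F ==> F holomorphic_on ball 0 r ==>
    (\<forall>w\<in>sphere 0 r. v (k w) <= Re (F w)) ==> v p <= Re (F 0)"
  using v unfolding subat_def by blast
 obtain d G where d: "0 < d" "d <= 1" "G holomorphic_on ball 0 d" and G: "\<And>w. w \<in> ball 0 d ==> u (k w) = Re (G w)"
  using u k unfolding harm_at_def by metis
 have "v p - u p <= Re (F 0)" if r: "0 < r" "r < min e d" and F: "continuous_on (cball 0 r) F" "F holomorphic_on ball 0 r"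
  "\<forall>w\<in>sphere 0 r. v (k w) - u (k w) <= Re (F w)" for r F
 proof -
  have sub: "cball 0 r \<subseteq> ball (0::complex) d" using r by (auto simp: subset_iff)
  have "v p <= Re ((%w. F w + G w) 0)"
  proof (rule *[of r])
   show "continuous_on (cball 0 r) (%w. F w + G w)"
    using F(1) continuous_on_subset[OF holomorphic_on_imp_continuous_on[OF d(3)] sub]
    by (rule continuous_on_add)
   have "G holomorphic_on ball 0 r" using d(3) sub ball_subset_cball holomorphic_on_subset by blast
   thus "(%w. F w + G w) holomorphic_on ball 0 r" using F(2) by (intro holomorphic_intros)
   show "\<forall>w\<in>sphere 0 r. v (k w) <= Re (F w + G w)" using sub sphere_cball G F(3) by force
  qed (use r in auto)
  thus ?thesis using G[of 0] d k by simp
 qed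
 thus ?thesis unfolding subat_def using k e d
  by (intro bexI[of _ k] conjI exI[of _ "min e d"]) auto
qed

lemma subat_zero: "p \<in> X ==> subat (%x. 0) p"
proof -
 assume "p \<in> X"
 then obtain k where k: "k \<in> CC" "k 0 = p" using chart_at by blast
 have "0 <= Re (F 0)" if r: "0 < r" and F: "continuous_on (cball 0 r) F" "F holomorphic_on ball 0 r"
  "\<forall>w\<in>sphere 0 r. 0 <= Re (F w)" for r F
 proof -
  have "- Re (F 0) <= 0"
   by (rule Re_max_principle[OF r, of "%w. - Re (F w)" "%w. - F w"])
     (use F r in \<open>auto intro!: continuous_intros holomorphic_intros\<close>)
  thus ?thesis by simp
 qed
 thus ?thesis unfolding subat_def using k
  by (intro bexI[of _ k] conjI exI[of _ 1]) auto
qed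

lemma subat_harm:
 assumes "harm_at u p" "p \<in> X"
 shows "subat u p"
 using subat_diff[OF subat_zero[OF assms(2)] harm_at_minus[OF assms(1)]] by simp

lemma subat_add:
 assumes "subat v p" "harm_at u p"
 shows "subat (%x. v x + u x) p"
 using subat_diff[OF assms(1) harm_at_minus[OF assms(2)]] by simp

lemma subat_max:
 assumes "open S" "p \<in> S" "v p \<ge> v' p ==> subat v p" "v' p \<ge> v p ==> subat v' p"
 shows "subat (%x. max (v x) (v' x)) p"
proof (cases "v p \<ge> v' p")
 case True
 show ?thesis by (rule subat_mono[OF assms(3)[OF True] _ assms(1,2)]) (use True in auto)
next
 case False
 hence le: "v p <= v' p" by simp
 show ?thesis by (rule subat_mono[OF assms(4)[OF le] _ assms(1,2)]) (use le in auto)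
qed

text \<open>Suppose the value drops at some \<open>w\<close> of a small disc. The harmonic function
  with the values of \<open>v\<close> on the circle through \<open>w\<close> is then strictly below
  the maximum at the centre, since otherwise it would be constant. An entire approximant of it is an
  admissible competitor and contradicts \<open>subat\<close>.\<close>

lemma subat_max_const:
 assumes v: "subat v p" and N: "open N" "p \<in> N" "continuous_on N v" and mx: "\<And>x. x \<in> N ==> v x <= v p"
 shows "\<exists>d>0. ball p d \<subseteq> N & (\<forall>x\<in>ball p d. v x = v p)"
proof -
 obtain k e where k: "k \<in> CC" "k 0 = p" and e: "0 < e" "e <= 1"
  and *: "\<And>r F. 0 < r ==> r < e ==> continuous_on (cball 0 r) F ==> F holomorphic_on ball 0 r ==>
    (\<forall>w\<in>sphere 0 r. v (k w) <= Re (F w)) ==> v p <= Re (F 0)"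
  using v unfolding subat_def by blast
 obtain d where d: "0 < d" "ball 0 d \<subseteq> D1" "k ` ball 0 d \<subseteq> N"
  using chart_small[OF k(1) N(1), of 0] k N(2) by auto
 define m where "m = min e d"
 have m: "0 < m" "m <= e" "m <= d" using e d by (auto simp: m_def)
 have vc: "continuous_on (ball 0 m) (%w. v (k w))"
 proof (rule continuous_on_compose2[OF N(3)])
  show "continuous_on (ball 0 m) k"
   using chart_cont[OF k(1)] by (rule continuous_on_subset) (use m e in auto)
  show "k ` ball 0 m \<subseteq> N" using d(3) m(3) by auto
 qed
 have mx': "v (k w) <= v p" if "w \<in> ball 0 m" for w using that m(3) mx d(3) by force
 have const: "v (k w) = v p" if w: "w \<in> ball 0 m" for w
 proof (rule ccontr)
  assume ne: "v (k w) ~= v p"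
  define r where "r = cmod w"
  have r: "0 < r" "r < m" using w ne k by (auto simp: r_def)
  have sub: "cball 0 r \<subseteq> ball (0::complex) m" using r by (auto simp: subset_iff)
  have lt: "v (k w) < v p" using mx'[OF w] ne by simp
  have cs: "continuous_on (sphere 0 r) (%w. v (k w))"
   using vc sub sphere_cball by (meson continuous_on_subset order_trans)
  obtain u F where u: "continuous_on (cball 0 r) u" "\<And>w. w \<in> sphere 0 r ==> u w = v (k w)"
   "F holomorphic_on ball 0 r" "\<And>w. w \<in> ball 0 r ==> u w = Re (F w)"
   and ap: "\<And>e. 0 < e ==> \<exists>p. p holomorphic_on UNIV & (\<forall>w\<in>cball 0 r. \<bar>u w - Re (p w)\<bar> < e)"
   using dirichlet_disc[OF r(1) cs] by metis
  have ule: "u z <= v p" if "z \<in> cball 0 r" for z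
  proof (rule Re_max_principle[OF r(1) u(1,3,4) _ that])
   show "u z <= v p" if "z \<in> sphere 0 r" for z
    using u(2)[OF that] mx'[of z] sub sphere_cball that by (metis subsetD)
  qed
  have u0: "u 0 < v p"
  proof (rule ccontr)
   assume "\<not> u 0 < v p"
   hence u0: "u 0 = v p" using ule[of 0] r by simp
   have "Re (F z) = Re (F 0)" if "z \<in> ball 0 r" for z
   proof (rule Re_local_max_const[OF u(3) r(1) _ that])
    fix x :: complex assume "x \<in> ball 0 r"
    thus "Re (F x) <= Re (F 0)" using ule[of x] u(4)[of x] u(4)[of 0] u0 r(1) by simp
   qed
   hence c: "u z = v p" if "z \<in> ball 0 r" for z
    using u0 u(4)[OF that] u(4)[of 0] r that by (metis centre_in_ball)
   have "u w = v p"
   proof (rule continuous_constant_on_closure[of "ball 0 r" u])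
    show "continuous_on (closure (ball 0 r)) u" using u(1) r by simp
    show "w \<in> closure (ball 0 r)" using r by (simp add: r_def)
   qed (use c in auto)
   thus False using lt u(2)[of w] by (simp add: r_def)
  qed
  \<comment> \<open>A third of the gap: the approximation error enters twice, once in the upward
    shift on the circle and once at the centre.\<close>
  define ep where "ep = (v p - u 0) / 3"
  have ep: "0 < ep" using u0 by (simp add: ep_def)
  obtain P where P: "P holomorphic_on UNIV" "\<And>w. w \<in> cball 0 r ==> \<bar>u w - Re (P w)\<bar> < ep"
   using ap[OF ep] by blast
  have hP: "(%w. P w + of_real ep) holomorphic_on A" for A
   using P(1) by (intro holomorphic_intros) (auto intro: holomorphic_on_subset)
  have "v p <= Re (P 0 + of_real ep)"
  proof (rule *[OF r(1)])
   show "r < e" using r m by simp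
   show "continuous_on (cball 0 r) (%w. P w + of_real ep)"
    using hP by (rule holomorphic_on_imp_continuous_on)
   show "\<forall>w\<in>sphere 0 r. v (k w) <= Re (P w + of_real ep)"
    using u(2) P(2) by (force simp: abs_less_iff)
  qed (rule hP)
  moreover have "Re (P 0) < u 0 + ep" using P(2)[of 0] r by (simp add: abs_less_iff)
  ultimately show False using u0 by (simp add: ep_def field_simps)
 qed
 have "open (k ` ball 0 m)" by (intro chart_open[OF k(1)] open_ball subset_ball) (use m e in simp)
 moreover have "p \<in> k ` ball 0 m" using k m by (metis centre_in_ball imageI)
 ultimately obtain D where D: "0 < D" "ball p D \<subseteq> k ` ball 0 m"
  using open_contains_ball_eq by blast
 moreover have "ball p D \<subseteq> N" using D d(3) m(3) by force
 moreover have "\<forall>x\<in>ball p D. v x = v p" using D const by blast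
 ultimately show ?thesis by blast
qed

text \<open>The difference \<open>v - u\<close> is subharmonic inside the disc, so the maximum
  principle compares it with the circle. A maximum in the coordinate is carried to the surface,
  where \<open>subat_max_const\<close> applies, and the resulting ball is carried back.\<close>

lemma subat_le_dirichlet:
 assumes k: "k \<in> CC" and r: "0 < r" "r < 1"
  and v: "continuous_on (k ` cball 0 r) v" "\<And>p. p \<in> k ` ball 0 r ==> subat v p"
  and u: "continuous_on (cball 0 r) u" "F holomorphic_on ball 0 r" "\<And>w. w \<in> ball 0 r ==> u w = Re (F w)"
  and le: "\<And>w. w \<in> sphere 0 r ==> v (k w) <= u w" and w: "w \<in> cball 0 r"
 shows "v (k w) <= u w"
proof -
 have sub: "cball 0 r \<subseteq> D1" "ball 0 r \<subseteq> D1" using r by (auto simp: subset_iff)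
 have ck: "continuous_on (cball 0 r) k" using chart_cont[OF k] sub continuous_on_subset by blast
 have cB: "continuous_on (cball 0 r) (%w. v (k w) - u w)"
  by (intro continuous_on_diff u(1) continuous_on_compose2[OF v(1) ck]) auto
 have "v (k w) - u w <= 0"
 proof (rule compact_max_principle[OF compact_cball cB _ w])
  fix q :: complex assume q: "q \<in> cball 0 r" "0 < v (k q) - u q"
   and mx: "\<And>x. x \<in> cball 0 r ==> v (k x) - u x <= v (k q) - u q"
  have "q \<notin> sphere 0 r" using le[of q] q by auto
  hence qb: "q \<in> ball 0 r" using q by auto
  let ?g = "%x. v x - u (coord k x)"
  have oU: "open (k ` ball 0 r)" using chart_open k sub by blast
  have "harm_at (%x. u (coord k x)) (k q)"
   by (rule harm_atI[OF k open_ball sub(2) u(2)]) (use u(3) coord_chart[OF k] sub qb in auto)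
  hence "subat ?g (k q)" using v(2) qb by (intro subat_diff) auto
  moreover have "continuous_on (k ` ball 0 r) ?g"
  proof (intro continuous_on_diff)
   show "continuous_on (k ` ball 0 r) v" using v(1) by (rule continuous_on_subset) auto
   show "continuous_on (k ` ball 0 r) (%x. u (coord k x))"
   proof (rule continuous_on_compose2[OF u(1)])
    show "continuous_on (k ` ball 0 r) (coord k)"
     using coord_cont[OF k] by (rule continuous_on_subset) (use sub in auto)
    show "coord k ` k ` ball 0 r \<subseteq> cball 0 r" using coord_image[OF k sub(2)] by auto
   qed
  qed
  moreover have "?g x <= ?g (k q)" if x: "x \<in> k ` ball 0 r" for x
  proof -
   obtain y where "y \<in> ball 0 r" "x = k y" using x by blast
   thus ?thesis using mx[of y] coord_chart[OF k] sub qb by (auto simp: subset_iff)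
  qed
  ultimately obtain d where d: "0 < d" "ball (k q) d \<subseteq> k ` ball 0 r" "\<forall>x\<in>ball (k q) d. ?g x = ?g (k q)"
   using subat_max_const[of ?g "k q" "k ` ball 0 r"] oU qb by blast
  obtain e where e: "0 < e" "ball q e \<subseteq> D1" "k ` ball q e \<subseteq> ball (k q) d"
   using chart_small[OF k open_ball, of q "k q" d] qb sub d(1) by (auto simp: subset_iff)
  have inb: "y \<in> ball 0 r" if y: "y \<in> ball q e" for y
  proof -
   obtain z where "z \<in> ball 0 r" "k y = k z" using e(3) d(2) y by blast
   thus ?thesis using coord_chart[OF k, of y] coord_chart[OF k, of z] e(2) sub y by (metis subsetD)
  qed
  have "v (k y) - u y = v (k q) - u q" if y: "y \<in> ball q e" for y
   using d(3) e(3) y coord_chart[OF k, of y] coord_chart[OF k, of q] e(2) qb sub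
   by (metis image_subset_iff subsetD)
  thus "\<exists>e>0. ball q e \<subseteq> cball 0 r & (\<forall>x\<in>ball q e. v (k x) - u x = v (k q) - u q)"
   using e(1) inb ball_subset_cball by blast
 qed
 thus ?thesis by simp
qed

end

section \<open>Perron's method\<close>

lemma Re_max_const:
 assumes F: "F holomorphic_on S" and S: "open S" "connected S" "p \<in> S"
  and le: "\<And>x. x \<in> S ==> Re (F x) <= Re (F p)" and x: "x \<in> S"
 shows "Re (F x) = Re (F p)"
proof -
 have "(%x. exp (F x)) constant_on S"
 proof (rule maximum_modulus_principle[where U = S and \<xi> = p])
  show "(%x. exp (F x)) holomorphic_on S"
   using F by (intro holomorphic_intros)
 qed (use S le in auto)
 hence "exp (F x) = exp (F p)" using x S by (auto simp: constant_on_def)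
 hence "cmod (exp (F x)) = cmod (exp (F p))" by simp
 thus ?thesis by simp
qed

text \<open>One increasing sequence of members reaches the supremum at all points of a countable
  dense set at once. The limit of its harmonic replacements therefore majorizes every member on that
  set, and by continuity everywhere, so it equals \<open>g\<close>.\<close>

lemma perron_disc:
 fixes f :: "'i => complex => real"
 assumes r: "0 < r" and I: "I ~= {}"
  and cont: "\<And>i. i \<in> I ==> continuous_on (ball 0 r) (f i)"
  and dir: "\<And>i j. i \<in> I ==> j \<in> I ==> \<exists>k\<in>I. \<forall>w\<in>ball 0 r. f i w <= f k w & f j w <= f k w"
  and modif: "\<And>i. i \<in> I ==> \<exists>j\<in>I. \<exists>F. F holomorphic_on ball 0 r & (\<forall>w\<in>ball 0 r. f i w <= f j w & f j w = Re (F w))"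
  and bd: "\<And>i w. i \<in> I ==> w \<in> ball 0 r ==> \<bar>f i w\<bar> <= M"
  and up: "\<And>i w. i \<in> I ==> w \<in> ball 0 r ==> f i w <= g w"
  and app: "\<And>w e. w \<in> ball 0 r ==> 0 < e ==> \<exists>i\<in>I. g w - e < f i w"
 obtains G where "G holomorphic_on ball 0 r" "\<And>w. w \<in> ball 0 r ==> g w = Re (G w)"
proof -
 obtain D0 :: "complex set" where D0: "countable D0" "\<And>U. open U ==> U ~= {} ==> \<exists>d\<in>D0. d \<in> U"
  using countable_dense_exists by metis
 define D where "D = D0 \<inter> ball 0 r"
 have D: "countable D" "D ~= {}" "D \<subseteq> ball 0 r"
  using D0(1) D0(2)[of "ball 0 r"] r by (auto simp: D_def)
 define d where "d = from_nat_into D"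
 have d: "range d = D" using D by (simp add: d_def range_from_nat_into)
 hence dB: "d k \<in> ball 0 r" for k using D(3) by blast
 \<comment> \<open>The index \<open>n\<close> codes a pair: the first component chooses a point of
   the dense set, the second the precision required there.\<close>
 have "\<exists>i\<in>I. g (d (fst (prod_decode n))) - inverse (Suc (snd (prod_decode n))) < f i (d (fst (prod_decode n)))" for n
  using app[OF dB] by simp
 then obtain W where WI: "\<And>n. W n \<in> I"
  and W: "\<And>n. g (d (fst (prod_decode n))) - inverse (Suc (snd (prod_decode n))) < f (W n) (d (fst (prod_decode n)))"
  by metis
 obtain J where J: "\<And>i j. i \<in> I ==> j \<in> I ==> J i j \<in> I"
  "\<And>i j w. i \<in> I ==> j \<in> I ==> w \<in> ball 0 r ==> f i w <= f (J i j) w"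
  "\<And>i j w. i \<in> I ==> j \<in> I ==> w \<in> ball 0 r ==> f j w <= f (J i j) w"
  using dir by metis
 define v where "v = rec_nat (W 0) (%n y. J y (W (Suc n)))"
 have v0: "v 0 = W 0" and vS: "v (Suc n) = J (v n) (W (Suc n))" for n by (simp_all add: v_def)
 have vI: "v n \<in> I" for n by (induction n) (use v0 vS J(1) WI in auto)
 have vW: "f (W m) w <= f (v n) w" if "m <= n" "w \<in> ball 0 r" for m n w
  using that
 proof (induction n)
  case 0 thus ?case using v0 by simp
 next
  case (Suc n)
  show ?case
  proof (cases "m <= n")
   case True
   thus ?thesis using Suc J(2)[OF vI[of n] WI[of "Suc n"] Suc.prems(2)] vS[of n] by force
  next
   case False
   hence "m = Suc n" using Suc.prems by simp
   thus ?thesis using J(3)[OF vI[of n] WI[of "Suc n"] Suc.prems(2)] vS[of n] by simp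
  qed
 qed
 obtain h F where hI: "\<And>i. i \<in> I ==> h i \<in> I" and Fh: "\<And>i. i \<in> I ==> F i holomorphic_on ball 0 r"
  and hF: "\<And>i w. i \<in> I ==> w \<in> ball 0 r ==> f i w <= f (h i) w & f (h i) w = Re (F i w)"
  using modif by metis
 have bdF: "\<bar>Re (F (v n) w)\<bar> <= M" if "w \<in> ball 0 r" for n w
  using bd[OF hI[OF vI] that] hF[OF vI that] by metis
 obtain G s where G: "G holomorphic_on ball 0 r" and s: "strict_mono (s :: nat => nat)"
  and lim: "\<And>w. w \<in> ball 0 r ==> (%n. Re (F (v (s n)) w)) \<longlonglongrightarrow> Re (G w)"
  using harmonic_limit[of "%n. F (v n)" r M, OF Fh[OF vI] bdF] by metis
 have Gg: "Re (G w) <= g w" if w: "w \<in> ball 0 r" for w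
 proof (rule LIMSEQ_le_const2[OF lim[OF w]])
  have "Re (F (v n) w) <= g w" for n using up[OF hI[OF vI] w] hF[OF vI w] by metis
  thus "\<exists>N. \<forall>n\<ge>N. Re (F (v (s n)) w) <= g w" by blast
 qed
 have Gd: "g (d k) <= Re (G (d k))" for k
 proof (rule field_le_epsilon)
  fix e :: real assume "0 < e"
  then obtain m where m: "inverse (real (Suc m)) < e" using reals_Archimedean by blast
  have "g (d k) - e <= Re (G (d k))"
  proof (rule LIMSEQ_le_const[OF lim[OF dB]])
   show "\<exists>N. \<forall>n\<ge>N. g (d k) - e <= Re (F (v (s n)) (d k))"
   proof (intro exI allI impI)
    fix n assume n: "prod_encode (k, m) <= n"
    hence "prod_encode (k, m) <= s n" using seq_suble[OF s, of n] by linarith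
    hence "f (W (prod_encode (k, m))) (d k) <= f (v (s n)) (d k)" by (rule vW) (rule dB)
    also have "\<dots> <= Re (F (v (s n)) (d k))" using hF[OF vI dB] by metis
    finally show "g (d k) - e <= Re (F (v (s n)) (d k))"
     using W[of "prod_encode (k, m)"] m by simp
   qed
  qed
  thus "g (d k) <= Re (G (d k)) + e" by simp
 qed
 have le: "f i w <= Re (G w)" if i: "i \<in> I" and w: "w \<in> ball 0 r" for i w
 proof (rule ccontr)
  assume nle: "\<not> f i w <= Re (G w)"
  define U where "U = {w\<in>ball 0 r. 0 < f i w - Re (G w)}"
  have "continuous_on (ball 0 r) (%w. f i w - Re (G w))"
   using cont[OF i] holomorphic_on_imp_continuous_on[OF G] by (intro continuous_intros)
  hence "open ((%w. f i w - Re (G w)) -` {0<..} \<inter> ball 0 r)"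
   by (subst (asm) continuous_on_open_vimage) auto
  moreover have "(%w. f i w - Re (G w)) -` {0<..} \<inter> ball 0 r = U" by (auto simp: U_def)
  ultimately have "open U" by simp
  moreover have "w \<in> U" using w nle by (simp add: U_def)
  ultimately obtain x where x: "x \<in> D0" "x \<in> U" using D0(2) by blast
  hence "x \<in> D" by (auto simp: U_def D_def)
  then obtain k where "x = d k" using d by blast
  thus False using x(2) Gd[of k] up[OF i dB, of k] by (simp add: U_def)
 qed
 have "g w = Re (G w)" if w: "w \<in> ball 0 r" for w
 proof (rule antisym[OF _ Gg[OF w]], rule field_le_epsilon)
  fix e :: real assume "0 < e"
  then obtain i where "i \<in> I" "g w - e < f i w" using app w by blast
  thus "g w <= Re (G w) + e" using le[OF _ w, of i] by simp
 qed
 thus ?thesis using that G by blast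
qed

context planar_atlas
begin

lemma subat_scale:
 assumes v: "subat v p" and c: "0 < c"
 shows "subat (%x. c * v x) p"
proof -
 obtain k e where k: "k \<in> CC" "k 0 = p" and e: "0 < e" "e <= 1"
  and *: "\<And>r F. 0 < r ==> r < e ==> continuous_on (cball 0 r) F ==> F holomorphic_on ball 0 r ==>
    (\<forall>w\<in>sphere 0 r. v (k w) <= Re (F w)) ==> v p <= Re (F 0)"
  using v unfolding subat_def by blast
 have "c * v p <= Re (F 0)" if r: "0 < r" "r < e" and F: "continuous_on (cball 0 r) F" "F holomorphic_on ball 0 r"
  "\<forall>w\<in>sphere 0 r. c * v (k w) <= Re (F w)" for r F
 proof -
  have "v p <= Re ((%w. F w / of_real c) 0)"
  proof (rule *[OF r])
   show "continuous_on (cball 0 r) (%w. F w / of_real c)" using F c by (intro continuous_intros) auto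
   show "(%w. F w / of_real c) holomorphic_on ball 0 r" using F c by (intro holomorphic_intros) auto
   show "\<forall>w\<in>sphere 0 r. v (k w) <= Re (F w / of_real c)" using F(3) c by (auto simp: field_simps)
  qed
  thus ?thesis using c by (simp add: field_simps)
 qed
 thus ?thesis unfolding subat_def using k e
  by (intro bexI[of _ k] conjI exI[of _ e]) auto
qed

text \<open>The points near which all admissible \<open>v\<close> share a bound below 1 form an open
  set containing \<open>O'\<close>. It is closed in \<open>Y\<close>, because a bound on a small arc
  of a circle pulls the Dirichlet majorant below 1 in the whole disc; connectedness then gives all
  of \<open>Y\<close>. The constant is the contraction factor used in
  \<open>T_bound\<close>.\<close>

lemma uniformly_less_one:
 assumes Y: "open Y" "connected Y" "Y \<subseteq> X" and O: "open O'" "O' ~= {}" "O' \<subseteq> Y"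
  and C: "compact C" "C \<subseteq> Y"
 shows "\<exists>k<1. \<forall>v. continuous_on Y v --> (\<forall>p\<in>Y. subat v p) --> (\<forall>x\<in>Y. v x <= 1) --> (\<forall>x\<in>O'. v x <= 0) -->
      (\<forall>x\<in>C. v x <= k)"
proof -
 define Q where "Q = {v. continuous_on Y v & (\<forall>p\<in>Y. subat v p) & (\<forall>x\<in>Y. v x <= 1) & (\<forall>x\<in>O'. v x <= 0)}"
 define Z where "Z = {p\<in>Y. \<exists>e>0. \<exists>k<1. ball p e \<subseteq> Y & (\<forall>v\<in>Q. \<forall>x\<in>ball p e. v x <= k)}"
 have opZ: "open Z"
  unfolding open_contains_ball
 proof
  fix p assume "p \<in> Z"
  then obtain e k where e: "e > 0" "k < 1" "ball p e \<subseteq> Y" "\<forall>v\<in>Q. \<forall>x\<in>ball p e. v x <= k"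
   by (auto simp: Z_def)
  have "ball p e \<subseteq> Z"
  proof
   fix x assume x: "x \<in> ball p e"
   then obtain d where d: "d > 0" "ball x d \<subseteq> ball p e" using open_contains_ball_eq[OF open_ball] by blast
   thus "x \<in> Z" using e x unfolding Z_def by blast
  qed
  thus "\<exists>e>0. ball p e \<subseteq> Z" using e by blast
 qed
 have OZ: "O' \<subseteq> Z"
 proof
  fix x assume x: "x \<in> O'"
  then obtain e where e: "e > 0" "ball x e \<subseteq> O'" using O open_contains_ball_eq by blast
  hence "\<forall>v\<in>Q. \<forall>y\<in>ball x e. v y <= 0" by (auto simp: Q_def)
  moreover have "x \<in> Y" "ball x e \<subseteq> Y" using e x O(3) by auto
  moreover have "(0::real) < 1" by simp
  ultimately show "x \<in> Z" using e(1) unfolding Z_def by blast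
 qed
 have clZ: "p \<in> Z" if p: "p \<in> Y" "p \<in> closure Z" for p
 proof -
  obtain ka where ka: "ka \<in> CC" "ka 0 = p" using chart_at p Y(3) by blast
  obtain e where e: "0 < e" "ball 0 e \<subseteq> D1" "ka ` ball 0 e \<subseteq> Y"
   using chart_small[OF ka(1) Y(1), of 0] ka p by auto
  have e1: "e <= 1" using e by (simp add: ball_subset_ball_iff)
  have oe: "open (ka ` ball 0 e)" using chart_open[OF ka(1)] e by blast
  have pe: "p \<in> ka ` ball 0 e" using ka e by (metis centre_in_ball imageI)
  then obtain z where z: "z \<in> Z" "z \<in> ka ` ball 0 e"
   using p(2) oe by (meson closure_iff_nhds_not_empty disjoint_iff subset_refl)
  show ?thesis
  proof (cases "z = p")
   case True thus ?thesis using z by simp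
  next
   case False
   obtain w0 where w0: "w0 \<in> ball 0 e" "z = ka w0" using z by blast
   define r where "r = cmod w0"
   have r: "0 < r" "r < e" using w0 False ka by (auto simp: r_def)
   have sub: "cball 0 r \<subseteq> ball (0::complex) e" using r by (auto simp: subset_iff)
   obtain ez k where ez: "ez > 0" "k < 1" and k: "\<And>v x. v \<in> Q ==> x \<in> ball z ez ==> v x <= k"
    using z(1) unfolding Z_def by blast
   obtain D where D: "0 < D" "ka ` ball w0 D \<subseteq> ball z ez"
    using chart_small[OF ka(1) open_ball, of w0 z ez] w0 e(2) ez(1) by (metis centre_in_ball subsetD)
   \<comment> \<open>A continuous majorant on the circle of all admissible \<open>v\<close>: it
     rises from \<open>k\<close> at \<open>w0\<close>, where the bound is known, to the trivial
     bound 1 at distance \<open>D\<close>.\<close>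
   define b where "b w = min 1 (k + (1 - k) * (cmod (w - w0) / D))" for w
   have cb: "continuous_on (sphere 0 r) b" unfolding b_def using D by (intro continuous_intros) auto
   have b1: "b w = 1" if "w \<notin> ball w0 D" for w
   proof -
    have "1 <= cmod (w - w0) / D" using that D by (simp add: dist_norm norm_minus_commute)
    hence "(1 - k) * 1 <= (1 - k) * (cmod (w - w0) / D)" using ez by (intro mult_left_mono) auto
    thus ?thesis by (simp add: b_def)
   qed
   have bk: "k <= b w" for w using ez D by (simp add: b_def)
   obtain u F where u: "continuous_on (cball 0 r) u" "\<And>w. w \<in> sphere 0 r ==> u w = b w"
    "F holomorphic_on ball 0 r" "\<And>w. w \<in> ball 0 r ==> u w = Re (F w)"
    using dirichlet_disc[OF r(1) cb] by metis
   have u1: "u w <= 1" if "w \<in> cball 0 r" for w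
    by (rule Re_max_principle[OF r(1) u(1,3,4) _ that]) (use u(2) in \<open>auto simp: b_def\<close>)
   have ult: "u w < 1" if w: "w \<in> ball 0 r" for w
   proof (rule ccontr)
    assume "\<not> u w < 1"
    hence uw: "u w = 1" using u1[of w] w by simp
    have c: "u x = 1" if "x \<in> ball 0 r" for x
    proof -
     have "Re (F x) = Re (F w)"
     proof (rule Re_max_const[OF u(3) open_ball connected_ball w _ that])
      fix y :: complex assume y: "y \<in> ball 0 r"
      thus "Re (F y) <= Re (F w)" using u1[of y] u(4)[OF y] u(4)[OF w] uw by simp
     qed
     thus ?thesis using u(4)[OF that] u(4)[OF w] uw by simp
    qed
    have "u w0 = 1"
    proof (rule continuous_constant_on_closure[of "ball 0 r" u])
     show "continuous_on (closure (ball 0 r)) u" using u(1) r by simp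
     show "w0 \<in> closure (ball 0 r)" using r by (simp add: r_def)
    qed (use c in auto)
    thus False using u(2)[of w0] ez by (simp add: r_def b_def)
   qed
   have vu: "v (ka w) <= u w" if v: "v \<in> Q" and w: "w \<in> cball 0 r" for v w
   proof (rule subat_le_dirichlet[OF ka(1) r(1) _ _ _ u(1,3,4) _ w])
    show "r < 1" using r e1 by simp
    have img: "ka ` cball 0 r \<subseteq> Y" "ka ` ball 0 r \<subseteq> Y" using sub e(3) by fastforce+
    show "continuous_on (ka ` cball 0 r) v" using v img by (auto simp: Q_def intro: continuous_on_subset)
    show "subat v p" if "p \<in> ka ` ball 0 r" for p using v img that by (auto simp: Q_def)
    show "v (ka w) <= u w" if w: "w \<in> sphere 0 r" for w
    proof (cases "w \<in> ball w0 D")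
     case True
     thus ?thesis using k[OF v] D bk[of w] u(2)[OF w] by force
    next
     case False
     show ?thesis using img(1) w b1[OF False] u(2)[OF w] v by (force simp: Q_def)
    qed
   qed
   have sub2: "cball 0 (r/2) \<subseteq> ball (0::complex) r" using r by (auto simp: subset_iff)
   have "continuous_on (cball 0 (r/2)) u"
    using u(1) sub2 ball_subset_cball by (meson continuous_on_subset order_trans)
   then obtain x where x: "x \<in> cball 0 (r/2)" "\<And>y. y \<in> cball 0 (r/2) ==> u y <= u x"
    using continuous_attains_sup[of "cball 0 (r/2)" u] r by (metis centre_in_cball compact_cball empty_iff half_gt_zero less_imp_le)
   have ux: "u x < 1" using ult sub2 x(1) by blast
   have op2: "open (ka ` ball 0 (r/2))" by (rule chart_open[OF ka(1)]) (use r e1 in auto)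
   have "p \<in> ka ` ball 0 (r/2)" using ka(2) r by (metis centre_in_ball half_gt_zero imageI)
   then obtain d where d: "d > 0" "ball p d \<subseteq> ka ` ball 0 (r/2)" using op2 open_contains_ball_eq by blast
   have "v y <= u x" if v: "v \<in> Q" and y: "y \<in> ball p d" for v y
   proof -
    obtain w where w: "w \<in> ball 0 (r/2)" "y = ka w" using d y by blast
    hence "v y <= u w" using vu[OF v, of w] r by simp
    also have "\<dots> <= u x" using x(2)[of w] w by simp
    finally show ?thesis .
   qed
   moreover have "ball p d \<subseteq> Y" using r d(2) e(3) by force
   ultimately show ?thesis unfolding Z_def using p(1) d(1) ux by blast
  qed
 qed
 have ZY: "Z \<subseteq> Y" by (auto simp: Z_def)
 have "closedin (top_of_set Y) Z"
  using clZ ZY closure_subset by (auto simp: closedin_closed intro!: exI[of _ "closure Z"])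
 moreover have "openin (top_of_set Y) Z" using opZ ZY by (simp add: open_subset)
 ultimately have "Z = Y" using Y(2) O OZ by (auto simp: connected_clopen)
 hence "\<forall>p\<in>C. \<exists>e>0. \<exists>k<1. \<forall>v\<in>Q. \<forall>x\<in>ball p e. v x <= k" using C(2) unfolding Z_def by blast
 then obtain e k where e: "\<And>p. p \<in> C ==> e p > 0" and k: "\<And>p. p \<in> C ==> k p < (1::real)"
  and v: "\<And>p v x. p \<in> C ==> v \<in> Q ==> x \<in> ball p (e p) ==> v x <= k p" by metis
 obtain C' where C': "C' \<subseteq> C" "finite C'" "C \<subseteq> (\<Union>p\<in>C'. ball p (e p))"
  by (rule compactE_image[OF C(1), of C "%p. ball p (e p)"]) (use e in auto)
 define k0 where "k0 = Max (insert 0 (k ` C'))"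
 have fin: "finite (insert 0 (k ` C'))" using C' by simp
 have "k0 \<in> insert 0 (k ` C')" unfolding k0_def by (rule Max_in[OF fin]) simp
 hence "k0 < 1" using k C' by auto
 moreover have "v x <= k0" if "v \<in> Q" "x \<in> C" for v x
 proof -
  obtain p where p: "p \<in> C'" "x \<in> ball p (e p)" using C'(3) \<open>x \<in> C\<close> by blast
  hence "v x <= k p" using v C' that by blast
  also have "k p <= k0" unfolding k0_def using Max_ge[OF fin] p by blast
  finally show ?thesis .
 qed
 ultimately show ?thesis unfolding Q_def by blast
qed

text \<open>The ring around the closed disc is connected, hence on one side of any separation.
  Adding the punctured disc to that side would separate \<open>X\<close> minus the centre, although
  deleting a point cannot disconnect a connected plane domain.\<close>

lemma connected_minus_disc:
 assumes k: "k \<in> CC" and r: "0 < r" "r < 1"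
 shows "connected (X - k ` cball 0 r)"
proof (rule connectedI)
 fix A B :: "complex set"
 define Y where "Y = X - k ` cball 0 r"
 assume AB: "open A" "open B" "A \<inter> (X - k ` cball 0 r) ~= {}" "B \<inter> (X - k ` cball 0 r) ~= {}"
  "A \<inter> B \<inter> (X - k ` cball 0 r) = {}" "X - k ` cball 0 r \<subseteq> A \<union> B"
 have key: False if AB: "open A" "open B" "A \<inter> Y ~= {}" "B \<inter> Y ~= {}" "A \<inter> B \<inter> Y = {}" "Y \<subseteq> A \<union> B"
  and sub: "k ` (D1 - cball 0 r) \<subseteq> A" for A B
 proof -
  let ?q = "k 0"
  have c1: "compact (k ` cball 0 r)"
   using r by (intro compact_continuous_image continuous_on_subset[OF chart_cont[OF k]]) auto
  hence oY: "open Y" unfolding Y_def using open_X by (intro open_Diff compact_imp_closed)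
  \<comment> \<open>The side that contains the ring absorbs the whole punctured disc.\<close>
  define A' where "A' = (A \<inter> Y) \<union> (k ` (D1 - {0}))"
  have "open A'" unfolding A'_def
   by (intro open_Un open_Int AB(1) oY chart_open[OF k]) (auto intro: open_delete)
  moreover have "open (B \<inter> Y)" using AB oY by blast
  moreover have "connected (X - {?q})" using open_X conn_X by (simp add: connected_open_delete)
  moreover have "X - {?q} \<subseteq> A' \<union> (B \<inter> Y)" using AB(6) calculation r by (force simp: A'_def Y_def)
  moreover have "A' \<inter> (B \<inter> Y) \<inter> (X - {?q}) = {}" using sub AB(5) by (auto simp: Y_def A'_def)
  moreover have "B \<inter> Y \<inter> (X - {?q}) ~= {}" using r AB(4) by (auto simp: Y_def)
  moreover have "A' \<inter> (X - {?q}) ~= {}" using r AB(3) by (auto simp: Y_def A'_def)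
  ultimately show False using connectedD by blast
 qed
 have con: "connected (k ` (D1 - cball 0 r))"
 proof (rule connected_continuous_image)
  show "continuous_on (D1 - cball 0 r) k" using chart_cont[OF k] by (rule continuous_on_subset) auto
  have "connected (D1 - cball 0 r)"
  proof -
   have "connected {w::complex. r < norm (w - 0) & norm (w - 0) < 1}"
    by (rule connected_annulus) simp
   moreover have "{w::complex. r < norm (w - 0) & norm (w - 0) < 1} = D1 - cball 0 r" by auto
   ultimately show ?thesis by simp
  qed
  thus "connected (D1 - cball 0 r)" .
 qed
 have subY: "k ` (D1 - cball 0 r) \<subseteq> Y"
 proof
  fix x assume "x \<in> k ` (D1 - cball 0 r)"
  then obtain w where w: "w \<in> D1" "w \<notin> cball 0 r" "x = k w" by blast
  hence "x \<notin> k ` cball 0 r" using coord_chart[OF k] r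
   by (smt (verit, best) image_iff mem_ball_0 mem_cball_0)
  thus "x \<in> Y" using w chart_sub[OF k] by (auto simp: Y_def)
 qed
 hence "k ` (D1 - cball 0 r) \<subseteq> A | k ` (D1 - cball 0 r) \<subseteq> B"
  using AB con unfolding Y_def
  by (smt (verit, del_insts) connectedD disjoint_iff inf.orderE inf_le1 subset_iff Un_iff)
 thus False
  using key[of A B] key[of B A] AB unfolding Y_def by (metis inf_commute sup_commute)
qed

end

section \<open>The Green function and its Perron family\<close>

text \<open>\<open>q\<close> is the pole and \<open>kq\<close> a chart centred there with a disc
  inside \<open>W\<close>. The open set \<open>O'\<close> lies outside \<open>W\<close>, so
  functions supported in \<open>W\<close> vanish on it; this is what bounds the Perron
  family.\<close>

locale green_pole = planar_atlas +
 fixes W O' :: "complex set" and q :: complex and kq :: "complex => complex" and R :: real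
 assumes W: "open W" "W \<subseteq> X" and O': "open O'" "O' ~= {}" "O' \<subseteq> X" "O' \<inter> W = {}"
  and kq: "kq \<in> CC" "kq 0 = q" and R: "0 < R" "R < 1" "kq ` cball 0 R \<subseteq> W"
begin

text \<open>The positive part of the logarithmic pole in the coordinate \<open>kq\<close>. Its value
  at \<open>q\<close> itself carries no meaning, and statements about \<open>s\<close> avoid that
  point.\<close>

definition s :: "complex => real" where
 "s x = (if x \<in> kq ` ball 0 R then ln (R / cmod (coord kq x)) else 0)"

lemma sub_R: "cball 0 R \<subseteq> D1" "ball 0 R \<subseteq> D1"
 using R by (auto simp: subset_iff)

lemma compact_disc: "r < 1 ==> compact (kq ` cball 0 r)"
 by (intro compact_continuous_image continuous_on_subset[OF chart_cont[OF kq(1)]]) auto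

lemma qW: "q \<in> W" using kq R by (metis centre_in_cball image_subset_iff less_imp_le)

lemma s_chart: "w \<in> D1 ==> w ~= 0 ==> s (kq w) = max 0 (ln (R / cmod w))"
proof -
 assume w: "w \<in> D1" "w ~= 0"
 have mem: "kq w \<in> kq ` ball 0 R \<longleftrightarrow> w \<in> ball 0 R"
  using inj_on_image_mem_iff[OF chart_inj[OF kq(1)] w(1) sub_R(2)] .
 show ?thesis using w R mem coord_chart[OF kq(1) w(1)] by (simp add: field_simps s_def)
qed

lemma s_out: "x \<notin> kq ` ball 0 R ==> s x = 0"
 by (simp add: s_def)

lemma s_nonneg: "x ~= q ==> 0 <= s x"
proof (cases "x \<in> kq ` ball 0 R")
 case True
 assume "x ~= q"
 then obtain w where "w \<in> ball 0 R" "x = kq w" "w ~= 0" using True kq by blast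
 thus ?thesis using s_chart[of w] sub_R by auto
qed (simp add: s_out)

lemma open_annular: "open (kq ` (D1 - {0}))"
 by (rule chart_open[OF kq(1)]) (auto intro: open_delete)

lemma s_cont: "continuous_on (X - {q}) s"
proof -
 have "continuous_on (kq ` (D1 - {0})) (%x. max 0 (ln (R / cmod (coord kq x))))"
 proof (intro continuous_intros)
  show "continuous_on (kq ` (D1 - {0})) (coord kq)"
   using coord_cont[OF kq(1)] by (rule continuous_on_subset) auto
  show "\<forall>x\<in>kq ` (D1 - {0}). cmod (coord kq x) ~= 0" using coord_chart[OF kq(1)] by auto
  show "\<forall>x\<in>kq ` (D1 - {0}). R / cmod (coord kq x) ~= 0" using coord_chart[OF kq(1)] R by auto
 qed
 hence 1: "continuous_on (kq ` (D1 - {0})) s"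
 proof (rule continuous_on_eq)
  fix x assume "x \<in> kq ` (D1 - {0})"
  then obtain w where "w \<in> D1" "w ~= 0" "x = kq w" by blast
  thus "max 0 (ln (R / cmod (coord kq x))) = s x" using s_chart coord_chart[OF kq(1)] by simp
 qed
 have "continuous_on (X - kq ` cball 0 R) (%x. 0::real)" by simp
 hence 2: "continuous_on (X - kq ` cball 0 R) s"
  by (rule continuous_on_eq) (use s_out in force)
 have "open (X - kq ` cball 0 R)"
  using open_X compact_disc[OF R(2)] by (intro open_Diff compact_imp_closed)
 hence "continuous_on (kq ` (D1 - {0}) \<union> (X - kq ` cball 0 R)) s"
  using continuous_on_open_Un[OF open_annular _ 1 2] by blast
 thus ?thesis using kq sub_R continuous_on_subset by blast
qed

lemma s_harm: "p \<in> kq ` ball 0 R ==> p ~= q ==> harm_at s p"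
proof -
 assume p: "p \<in> kq ` ball 0 R" "p ~= q"
 then obtain w0 where w0: "w0 \<in> ball 0 R" "p = kq w0" "w0 ~= 0" using kq by blast
 have "w0 \<in> ball 0 R - {0}" "open (ball 0 R - {0::complex})" using w0 by (auto intro: open_delete)
 then obtain e where e: "0 < e" "ball w0 e \<subseteq> ball 0 R - {0}" using open_contains_ball_eq by blast
 have "(%w. w) holomorphic_on ball w0 e" by (intro holomorphic_intros)
 moreover have "\<forall>w\<in>ball w0 e. w ~= 0" using e by blast
 ultimately obtain g where g: "g holomorphic_on ball w0 e" "\<forall>w\<in>ball w0 e. w = exp (g w)"
  using simply_connected_eq_holomorphic_log[of "ball w0 e"]
   convex_imp_simply_connected[OF convex_ball] by (metis open_ball)
 show ?thesis
 proof (rule harm_atI[OF kq(1) open_ball, of w0 e "%w. of_real (ln R) - g w"])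
  show "ball w0 e \<subseteq> D1" using e sub_R by blast
  show "(%w. of_real (ln R) - g w) holomorphic_on ball w0 e" using g(1) by (intro holomorphic_intros)
  show "s (kq w) = Re (of_real (ln R) - g w)" if w: "w \<in> ball w0 e" for w
  proof -
   have w': "w \<in> ball 0 R" "w ~= 0" "w \<in> D1" using e w sub_R by blast+
   have "cmod w = exp (Re (g w))" using g(2) w by (metis norm_exp_eq_Re)
   thus ?thesis using R w' coord_chart[OF kq(1) w'(3)] by (simp add: ln_div s_def)
  qed
  show "p \<in> kq ` ball w0 e" using w0 e by auto
 qed
qed

lemma s_sub: "p \<in> X ==> p ~= q ==> subat s p"
proof (cases "p \<in> kq ` ball 0 R")
 case True
 assume "p \<in> X" "p ~= q"
 thus ?thesis using s_harm[OF True] subat_harm by blast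
next
 case False
 assume p: "p \<in> X" "p ~= q"
 show ?thesis
 proof (rule subat_mono[OF subat_zero[OF p(1)]])
  show "s p = 0" using s_out[OF False] .
  show "open (- {q})" by (rule open_Compl) simp
 qed (use p s_nonneg in auto)
qed

text \<open>Perron's family for the Green function of \<open>W\<close>, with the singular part
  \<open>s\<close> subtracted so that its members are continuous on all of \<open>X\<close>. The
  compact supports encode boundary values 0. Away from \<open>q\<close> it is \<open>t + s\<close>
  that is subharmonic; at \<open>q\<close>, where \<open>s\<close> is singular, the condition falls
  on \<open>t\<close>.\<close>

definition T :: "(complex => real) set" where
 "T = {t. continuous_on X t & (\<forall>x\<in>X. 0 <= t x) & (\<exists>K. compact K & K \<subseteq> W & (\<forall>x\<in>X - K. t x = 0)) &
    (\<forall>p\<in>W - {q}. subat (%x. t x + s x) p) & subat t q}"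

lemma T_zero: "(%x. 0) \<in> T" using s_sub W subat_zero qW by (auto simp: T_def)

lemma T_max:
 assumes t: "t \<in> T" "t' \<in> T"
 shows "(%x. max (t x) (t' x)) \<in> T"
proof -
 obtain K K' where K: "compact K" "K \<subseteq> W" "\<forall>x\<in>X - K. t x = 0" "compact K'" "K' \<subseteq> W" "\<forall>x\<in>X - K'. t' x = 0"
  using t by (auto simp: T_def)
 have "continuous_on X (%x. max (t x) (t' x))" using t by (intro continuous_intros) (auto simp: T_def)
 moreover have "\<forall>x\<in>X. 0 <= max (t x) (t' x)" using t by (auto simp: T_def)
 moreover have "compact (K \<union> K')" "K \<union> K' \<subseteq> W" "\<forall>x\<in>X - (K \<union> K'). max (t x) (t' x) = 0"
  using K by auto
 moreover have "subat (%x. max (t x) (t' x) + s x) p" if p: "p \<in> W - {q}" for p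
 proof -
  have "subat (%x. max (t x + s x) (t' x + s x)) p"
   by (rule subat_max[OF W(1)]) (use p t in \<open>auto simp: T_def\<close>)
  thus ?thesis by (simp add: max_add_distrib_left)
 qed
 moreover have "subat (%x. max (t x) (t' x)) q"
  by (rule subat_max[OF W(1) qW]) (use t in \<open>auto simp: T_def\<close>)
 ultimately show ?thesis unfolding T_def by blast
qed

lemma T_sub_disc:
 assumes t: "t \<in> T" and p: "p \<in> kq ` ball 0 R"
 shows "subat t p"
proof (cases "p = q")
 case True thus ?thesis using t by (simp add: T_def)
next
 case False
 have "subat (%x. t x + s x) p" using p R(3) t False by (force simp: T_def)
 from subat_diff[OF this s_harm[OF p False]] show ?thesis by simp
qed

lemma T_sub_off:
 assumes t: "t \<in> T" and p: "p \<in> X" "p ~= q"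
 shows "subat (%x. t x + s x) p"
proof (cases "p \<in> W")
 case True thus ?thesis using t p by (simp add: T_def)
next
 case False
 show ?thesis
 proof (rule subat_mono[OF subat_zero[OF p(1)]])
  show "open (X - {q})" using open_X by blast
  have "p \<notin> kq ` ball 0 R" using False R(3) by force
  moreover have "t p = 0" using t False p by (auto simp: T_def)
  ultimately show "t p + s p = 0" using s_out by simp
  show "0 <= t x + s x" if "x \<in> X - {q}" for x using that t s_nonneg by (auto simp: T_def)
 qed (use p in auto)
qed

lemma T_cont: "t \<in> T ==> A \<subseteq> X - {q} ==> continuous_on A (%x. t x + s x)"
 by (intro continuous_on_add) (auto simp: T_def intro: continuous_on_subset[OF s_cont] continuous_on_subset)

text \<open>Let \<open>m\<close> be the maximum of \<open>t + s\<close> on an inner circle around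
  \<open>q\<close>. By the maximum principle \<open>m\<close> bounds \<open>t + s\<close> outside
  that circle, and \<open>uniformly_less_one\<close> lowers the bound to \<open>k * m\<close> on the
  circle of radius \<open>R\<close>, where \<open>s\<close> vanishes. Hence
  \<open>t <= k * m\<close> on the disc, and on the inner circle this reads
  \<open>m <= k * m + ln 2\<close>, which bounds \<open>m\<close> independently of
  \<open>t\<close>.\<close>

lemma T_bound: "\<exists>M. \<forall>t\<in>T. \<forall>x\<in>X. t x <= M"
proof -
 \<comment> \<open>With this choice \<open>s\<close> equals \<open>ln 2\<close> on the inner
   circle.\<close>
 define r where "r = R / 2"
 have r: "0 < r" "r < R" "r < 1" using R by (auto simp: r_def)
 define Y where "Y = X - kq ` cball 0 r"
 have inW: "kq ` cball 0 r \<subseteq> W" using R(3) r by force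
 have Y: "open Y" "connected Y" "Y \<subseteq> X" "q \<notin> Y"
  unfolding Y_def using open_X compact_disc[OF r(3)] connected_minus_disc[OF kq(1) r(1,3)] kq(2) r
  by (auto intro!: open_Diff compact_imp_closed)
 have OY: "O' \<subseteq> Y" using O' inW by (auto simp: Y_def)
 have mem: "kq w \<in> kq ` cball 0 r \<longleftrightarrow> w \<in> cball 0 r" if "w \<in> D1" for w
  using inj_on_image_mem_iff[OF chart_inj[OF kq(1)] that, of "cball 0 r"] r by (auto simp: subset_iff)
 have C: "compact (kq ` sphere 0 R)" "kq ` sphere 0 R \<subseteq> Y"
 proof -
  show "compact (kq ` sphere 0 R)"
   by (intro compact_continuous_image continuous_on_subset[OF chart_cont[OF kq(1)]]) (use R in auto)
  show "kq ` sphere 0 R \<subseteq> Y" using R r mem chart_sub[OF kq(1)] by (force simp: Y_def)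
 qed
 obtain k0 where k0: "k0 < 1" and k0': "\<And>v x. continuous_on Y v ==> (\<forall>p\<in>Y. subat v p) ==> (\<forall>x\<in>Y. v x <= 1) ==>
   (\<forall>x\<in>O'. v x <= 0) ==> x \<in> kq ` sphere 0 R ==> v x <= k0"
  using uniformly_less_one[OF Y(1,2,3) O'(1,2) OY C] by blast
 define k where "k = max 0 k0"
 have k: "0 <= k" "k < 1" "k0 <= k" using k0 by (auto simp: k_def)
 have "t x <= ln 2 / (1 - k)" if t: "t \<in> T" and x: "x \<in> X" for t x
 proof -
  define v where "v y = t y + s y" for y
  have vc: "continuous_on A v" if "A \<subseteq> X - {q}" for A using T_cont[OF t that] by (simp add: v_def[abs_def])
  have vsub: "subat v p" if "p \<in> X" "p ~= q" for p using T_sub_off[OF t that] by (simp add: v_def[abs_def])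
  have vt: "t y <= v y" if "y ~= q" for y using s_nonneg[OF that] by (simp add: v_def)
  have sphere_sub: "kq ` sphere 0 r \<subseteq> X - {q}"
  proof
   fix y assume "y \<in> kq ` sphere 0 r"
   then obtain w where w: "w \<in> sphere 0 r" "y = kq w" by blast
   hence "w \<in> D1" "w ~= 0" using r by auto
   thus "y \<in> X - {q}" using coord_chart[OF kq(1), of w] coord_chart[OF kq(1), of 0] w kq(2) chart_sub[OF kq(1)] \<open>w \<in> D1\<close>  by auto
  qed
  have cs: "compact (kq ` sphere 0 r)"
   by (intro compact_continuous_image continuous_on_subset[OF chart_cont[OF kq(1)]]) (use r in auto)
  have "kq ` sphere 0 r ~= {}" using r by simp
  then obtain y0 where y0: "y0 \<in> kq ` sphere 0 r" "\<And>y. y \<in> kq ` sphere 0 r ==> v y <= v y0"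
   using continuous_attains_sup[OF cs _ vc[OF sphere_sub]] by metis
  define m where "m = v y0"
  have my: "m = t y0 + ln 2"
  proof -
   obtain w where w: "w \<in> sphere 0 r" "y0 = kq w" using y0(1) by blast
   hence "s y0 = max 0 (ln (R / r))" using s_chart[of w] r by auto
   also have "R / r = 2" using R by (simp add: r_def)
   finally show ?thesis by (simp add: m_def v_def)
  qed
  have tn: "0 <= t y" if "y \<in> X" for y using t that by (simp add: T_def)
  have "y0 \<in> X" using y0(1) sphere_sub by blast
  hence m0: "0 < m" using my tn by (smt (verit) ln_gt_zero)
  obtain K where K: "compact K" "K \<subseteq> W" "\<forall>x\<in>X - K. t x = 0" using t by (auto simp: T_def)
  have vm: "v y <= m" if y: "y \<in> Y" for y
  proof (cases "y \<in> K \<union> kq ` cball 0 R")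
   case False
   hence "t y = 0" "s y = 0" using K y Y(3) s_out by (auto simp: image_iff)
   thus ?thesis using m0 by (simp add: v_def)
  next
   case True
   define K' where "K' = (K \<union> kq ` cball 0 R) - kq ` ball 0 r"
   have ob: "open (kq ` ball 0 r)" by (rule chart_open[OF kq(1)]) (use r in auto)
   have K'c: "compact K'" unfolding K'_def using K(1) compact_disc[OF R(2)] ob by (intro compact_diff compact_Un)
   have qb: "q \<in> kq ` ball 0 r" using kq(2) r by (metis centre_in_ball imageI)
   have K'X: "K' \<subseteq> X - {q}" using K(2) R(3) W(2) qb unfolding K'_def by blast
   show ?thesis
   proof (rule compact_max_principle[OF K'c vc[OF K'X]])
    show "y \<in> K'" using True y by (auto simp: K'_def Y_def)
    fix p assume p: "p \<in> K'" "m < v p" and mx: "\<And>x. x \<in> K' ==> v x <= v p"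
    have "p \<notin> kq ` sphere 0 r" using p(2) y0(2) by (force simp: m_def)
    moreover have "p \<notin> kq ` ball 0 r" using p by (simp add: K'_def)
    moreover have "cball 0 r = ball 0 r \<union> sphere (0::complex) r" by auto
    ultimately have "p \<notin> kq ` cball 0 r" by (simp add: image_Un)
    hence pY: "p \<in> Y" using p K'X by (auto simp: Y_def)
    define N where "N = {x\<in>Y. 0 < v x}"
    have YX: "Y \<subseteq> X - {q}" using Y by auto
    have "open (v -` {0<..} \<inter> Y)" using vc[OF YX] Y(1) by (simp add: continuous_on_open_vimage)
    moreover have "v -` {0<..} \<inter> Y = N" by (auto simp: N_def)
    ultimately have oN: "open N" by simp
    have NK: "N \<subseteq> K'"
    proof
     fix x assume x: "x \<in> N"
     have "x \<in> X" "0 < t x + s x" using x Y(3) by (auto simp: N_def v_def)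
     moreover have "s x = 0" if "x \<notin> kq ` cball 0 R" using s_out[of x] that by force
     ultimately have "x \<in> K | x \<in> kq ` cball 0 R" using K(3) by force
     moreover have "x \<notin> kq ` ball 0 r" using x by (auto simp: N_def Y_def)
     ultimately show "x \<in> K'" by (auto simp: K'_def)
    qed
    have "\<exists>d>0. ball p d \<subseteq> N & (\<forall>x\<in>ball p d. v x = v p)"
    proof (rule subat_max_const)
     show "subat v p" using vsub pY YX by auto
     show "p \<in> N" using pY p m0 by (simp add: N_def)
     show "continuous_on N v" by (rule vc) (use YX in \<open>auto simp: N_def\<close>)
     show "v x <= v p" if "x \<in> N" for x using mx NK that by blast
    qed (rule oN)
    thus "\<exists>e>0. ball p e \<subseteq> K' & (\<forall>x\<in>ball p e. v x = v p)" using NK by blast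
   qed
  qed
  have on_sphere: "t y <= k * m" if y: "y \<in> kq ` sphere 0 R" for y
  proof -
   have "(%x. (1/m) * v x) y <= k0"
   proof (rule k0'[OF _ _ _ _ y])
    show "continuous_on Y (%x. 1 / m * v x)" by (intro continuous_intros vc) (use Y in auto)
    show "\<forall>p\<in>Y. subat (%x. 1 / m * v x) p" using subat_scale[OF vsub, of _ "1/m"] m0 Y by auto
    show "\<forall>x\<in>Y. 1 / m * v x <= 1" using vm m0 by (auto simp: field_simps)
    show "\<forall>x\<in>O'. 1 / m * v x <= 0"
    proof
     fix x assume x: "x \<in> O'"
     hence "x \<notin> W" "x \<in> X" using O' by auto
     hence "t x = 0" using K by blast
     moreover have "s x = 0" using \<open>x \<notin> W\<close> R(3) by (intro s_out) force
     ultimately show "1 / m * v x <= 0" by (simp add: v_def)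
    qed
   qed
   hence "v y <= k0 * m" using m0 by (simp add: field_simps)
   moreover have "k0 * m <= k * m" using k m0 by (intro mult_right_mono) auto
   moreover have "y ~= q" using y C(2) Y(4) by auto
   hence "t y <= v y" by (rule vt)
   ultimately show ?thesis by linarith
  qed
  have on_disc: "t y <= k * m" if y: "y \<in> kq ` cball 0 R" for y
  proof (rule compact_max_principle[OF compact_disc[OF R(2)] _ _ y])
   have DX: "kq ` cball 0 R \<subseteq> X" using R(3) W(2) by blast
   thus ct: "continuous_on (kq ` cball 0 R) t" using t by (auto simp: T_def intro: continuous_on_subset)
   fix p assume p: "p \<in> kq ` cball 0 R" "k * m < t p" and mx: "\<And>x. x \<in> kq ` cball 0 R ==> t x <= t p"
   have "p \<notin> kq ` sphere 0 R" using on_sphere p by force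
   moreover have "cball 0 R = ball 0 R \<union> sphere (0::complex) R" by auto
   ultimately have pb: "p \<in> kq ` ball 0 R" using p by (metis Un_iff image_Un)
   have sb: "kq ` ball 0 R \<subseteq> kq ` cball 0 R" by auto
   have "\<exists>d>0. ball p d \<subseteq> kq ` ball 0 R & (\<forall>x\<in>ball p d. t x = t p)"
   proof (rule subat_max_const[OF T_sub_disc[OF t pb] chart_open[OF kq(1) open_ball sub_R(2)] pb
      continuous_on_subset[OF ct sb]])
    show "t x <= t p" if "x \<in> kq ` ball 0 R" for x using mx sb that by blast
   qed
   thus "\<exists>e>0. ball p e \<subseteq> kq ` cball 0 R & (\<forall>x\<in>ball p e. t x = t p)"
    using sb by (meson order_trans)
  qed
  have "m <= k * m + ln 2" using y0(1) r on_disc[of y0] my by auto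
  hence mb: "m <= ln 2 / (1 - k)" using k by (simp add: field_simps)
  have "k * m <= 1 * m" using k m0 by (intro mult_right_mono) auto
  have "t x <= m"
  proof (cases "x \<in> Y")
   case True
   thus ?thesis using Y(4) vm[OF True] vt[of x] by force
  next
   case False
   hence "x \<in> kq ` cball 0 r" using x by (simp add: Y_def)
   moreover have "kq ` cball 0 r \<subseteq> kq ` cball 0 R" using r by (intro image_mono) auto
   ultimately show ?thesis using on_disc[of x] \<open>k * m <= 1 * m\<close> by auto
  qed
  thus ?thesis using mb by simp
 qed
 thus ?thesis by blast
qed

text \<open>Harmonic replacement on a disc inside \<open>W\<close>. Away from the pole it is
  \<open>t + s\<close> that becomes harmonic; on the disc of \<open>kq\<close> it is
  \<open>t\<close> alone, since there \<open>s\<close> is the exact logarithmic pole. The two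
  alternatives for \<open>si\<close> express these cases.\<close>

lemma T_modify:
 assumes t: "t \<in> T" and k': "k' \<in> CC" and r: "0 < r" "r < 1" and D: "k' ` cball 0 r \<subseteq> W"
  and alt: "(si = s & q \<notin> k' ` cball 0 r) | (si = (%x. 0) & k' = kq & r = R)"
 shows "\<exists>t'\<in>T. \<exists>F. F holomorphic_on ball 0 r & (\<forall>x\<in>X. t x <= t' x) &
      (\<forall>w\<in>ball 0 r. t' (k' w) + si (k' w) = Re (F w))"
proof -
 have sub: "cball 0 r \<subseteq> D1" "ball 0 r \<subseteq> D1" using r by (auto simp: subset_iff)
 have DX: "k' ` cball 0 r \<subseteq> X" using D W by blast
 have tX: "continuous_on X t" using t by (simp add: T_def)
 have cs: "continuous_on (k' ` cball 0 r) si"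
  using alt DX by (auto intro: continuous_on_subset[OF s_cont])
 have cv: "continuous_on (k' ` cball 0 r) (%x. t x + si x)"
  by (intro continuous_on_add cs continuous_on_subset[OF tX DX])
 have vsub: "subat (%x. t x + si x) p" if p: "p \<in> k' ` ball 0 r" for p using p DX T_sub_off[OF t, of p] alt T_sub_disc[OF t, of p] by force
 have ck: "continuous_on (cball 0 r) k'" using chart_cont[OF k'] sub continuous_on_subset by blast
 have cvs: "continuous_on (sphere 0 r) (%w. t (k' w) + si (k' w))"
  by (rule continuous_on_compose2[OF cv continuous_on_subset[OF ck]]) auto
 obtain u F where u: "continuous_on (cball 0 r) u" "\<And>w. w \<in> sphere 0 r ==> u w = t (k' w) + si (k' w)"
  "F holomorphic_on ball 0 r" "\<And>w. w \<in> ball 0 r ==> u w = Re (F w)"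
  using dirichlet_disc[OF r(1) cvs] by metis
 have vu: "t (k' w) + si (k' w) <= u w" if "w \<in> cball 0 r" for w
  using subat_le_dirichlet[OF k' r cv vsub u(1,3,4) _ that] u(2) by simp
 define B where "B = k' ` ball 0 r"
 have oB: "open B" unfolding B_def by (rule chart_open[OF k' open_ball sub(2)])
 define t' where "t' x = (if x \<in> B then u (coord k' x) - si x else t x)" for x
 have t'B: "t' (k' w) = u w - si (k' w)" if "w \<in> ball 0 r" for w
  using that coord_chart[OF k', of w] sub by (auto simp: t'_def B_def)
 have tt': "t x <= t' x" for x
 proof (cases "x \<in> B")
  case True
  then obtain w where w: "w \<in> ball 0 r" "x = k' w" by (auto simp: B_def)
  thus ?thesis using t'B[OF w(1)] vu[of w] by simp
 qed (simp add: t'_def)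
 have ct': "continuous_on X t'"
 proof -
  have "continuous_on (k' ` cball 0 r \<union> (X - B)) (%x. if x \<in> B then u (coord k' x) - si x else t x)"
  proof (rule continuous_on_cases_local)
   have Xeq: "k' ` cball 0 r \<union> (X - B) = X" using DX by (auto simp: B_def)
   have "compact (k' ` cball 0 r)" by (rule compact_continuous_image[OF ck compact_cball])
   thus "closedin (top_of_set (k' ` cball 0 r \<union> (X - B))) (k' ` cball 0 r)"
    by (intro closed_subset compact_imp_closed) auto
   have "openin (top_of_set X) B" using oB DX by (intro open_subset) (auto simp: B_def)
   thus "closedin (top_of_set (k' ` cball 0 r \<union> (X - B))) (X - B)"
    unfolding Xeq by (metis closedin_diff closedin_topspace topspace_euclidean_subtopology)
   show "continuous_on (k' ` cball 0 r) (%x. u (coord k' x) - si x)"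
   proof (intro continuous_on_diff cs continuous_on_compose2[OF u(1)])
    show "continuous_on (k' ` cball 0 r) (coord k')"
     using coord_cont[OF k'] by (rule continuous_on_subset) (use sub in auto)
    show "coord k' ` k' ` cball 0 r \<subseteq> cball 0 r" using coord_image[OF k' sub(1)] by auto
   qed
   show "continuous_on (X - B) t" using tX by (rule continuous_on_subset) auto
   fix x assume x: "x \<in> k' ` cball 0 r & x \<notin> B | x \<in> X - B & x \<in> B"
   hence "x \<in> k' ` cball 0 r" "x \<notin> B" by auto
   then obtain w where w: "w \<in> cball 0 r" "x = k' w" "w \<notin> ball 0 r" unfolding B_def by blast
   thus "u (coord k' x) - si x = t x" using u(2) coord_chart[OF k', of w] w sub by auto
  qed
  moreover have "k' ` cball 0 r \<union> (X - B) = X" using DX by (auto simp: B_def)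
  ultimately show ?thesis by (simp add: t'_def[abs_def])
 qed
 have harmB: "harm_at (%x. t' x + si x) p" if "p \<in> B" for p
  by (rule harm_atI[OF k' open_ball sub(2) u(3)]) (use t'B u(4) that in \<open>auto simp: B_def\<close>)
 have "t' \<in> T"
 proof -
  have "\<forall>x\<in>X. 0 <= t' x" using tt' t by (auto simp: T_def intro: order_trans)
  moreover have "\<exists>K. compact K & K \<subseteq> W & (\<forall>x\<in>X - K. t' x = 0)"
  proof -
   obtain K where "compact K" "K \<subseteq> W" "\<forall>x\<in>X - K. t x = 0" using t by (auto simp: T_def)
   moreover have "compact (k' ` cball 0 r)" by (rule compact_continuous_image[OF ck compact_cball])
   ultimately show ?thesis using D
    by (intro exI[of _ "K \<union> k' ` cball 0 r"]) (auto simp: t'_def B_def)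
  qed
  moreover have "subat (%x. t' x + s x) p" if p: "p \<in> W - {q}" for p
  proof (cases "p \<in> B")
   case False
   have "subat (%x. t x + s x) p" using t p by (simp add: T_def)
   thus ?thesis
    by (rule subat_mono[where S = UNIV]) (use tt' False in \<open>auto simp: t'_def\<close>)
  next
   case True
   have pX: "p \<in> X" using p W by auto
   show ?thesis using subat_harm[OF harmB[OF \<open>p \<in> B\<close>] pX] alt s_harm p \<open>p \<in> B\<close>  subat_add by (auto simp: B_def)
  qed
  moreover have "subat t' q"
  proof (cases "q \<in> B")
   case False
   have "subat t q" using t by (simp add: T_def)
   thus ?thesis
    by (rule subat_mono[where S = UNIV]) (use tt' False in \<open>auto simp: t'_def\<close>)
  next
   case True
   hence "si = (%x. 0)" using alt by (auto simp: B_def)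
   thus ?thesis using subat_harm[OF harmB[OF True]] qW W by auto
  qed
  ultimately show ?thesis using ct' unfolding T_def by blast
 qed
 moreover have "\<forall>w\<in>ball 0 r. t' (k' w) + si (k' w) = Re (F w)" using t'B u(4) by simp
 ultimately show ?thesis using u(3) tt' by blast
qed

text \<open>\<open>G + s\<close> is the Green function of \<open>W\<close> with pole
  \<open>q\<close>; in the disc of \<open>kq\<close> the summand \<open>G\<close> is its regular
  part.\<close>

definition G :: "complex => real" where "G x = (SUP t\<in>T. t x)"

lemma T_bdd: "x \<in> X ==> bdd_above ((%t. t x) ` T)"
 using T_bound by (auto simp: bdd_above_def)

lemma G_upper: "t \<in> T ==> x \<in> X ==> t x <= G x"
 unfolding G_def by (rule cSUP_upper[OF _ T_bdd])

lemma G_approx: "x \<in> X ==> 0 < e ==> \<exists>t\<in>T. G x - e < t x"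
 unfolding G_def using T_zero by (subst less_cSUP_iff[OF _ T_bdd, symmetric]) auto

lemma G_local:
 assumes k': "k' \<in> CC" and r: "0 < r" "r < 1" and D: "k' ` cball 0 r \<subseteq> W"
  and alt: "(S = s & q \<notin> k' ` cball 0 r) | (S = (%x. 0) & k' = kq & r = R)"
 obtains H where "H holomorphic_on ball 0 r" "\<And>w. w \<in> ball 0 r ==> G (k' w) + S (k' w) = Re (H w)"
proof -
 have sub: "cball 0 r \<subseteq> D1" using r by (auto simp: subset_iff)
 have inX: "k' w \<in> X" if "w \<in> cball 0 r" for w using that D W by blast
 have ck: "continuous_on (cball 0 r) k'" using chart_cont[OF k'] sub continuous_on_subset by blast
 have cs: "continuous_on (k' ` cball 0 r) S"
 proof (cases "S = s & q \<notin> k' ` cball 0 r")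
  case True
  hence "k' ` cball 0 r \<subseteq> X - {q}" using inX by blast
  thus ?thesis using True continuous_on_subset[OF s_cont] by blast
 next
  case False
  thus ?thesis using alt by auto
 qed
 obtain M where M: "\<And>t x. t \<in> T ==> x \<in> X ==> t x <= M" using T_bound by blast
 have "compact (S ` k' ` cball 0 r)" using cs ck by (intro compact_continuous_image) auto
 then obtain M' where M': "\<And>w. w \<in> cball 0 r ==> \<bar>S (k' w)\<bar> <= M'"
  using compact_imp_bounded[of "S ` k' ` cball 0 r"] unfolding bounded_real by blast
 show ?thesis
 proof (rule perron_disc[OF r(1), of T "%t w. t (k' w) + S (k' w)" "M + M'" "%w. G (k' w) + S (k' w)"])
  show "T ~= {}" using T_zero by blast
  show "continuous_on (ball 0 r) (%w. t (k' w) + S (k' w))" if "t \<in> T" for t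
  proof -
   have "continuous_on (cball 0 r) (%w. t (k' w) + S (k' w))"
    by (intro continuous_on_add continuous_on_compose2[OF _ ck, of X t] continuous_on_compose2[OF cs ck])
      (use that inX in \<open>auto simp: T_def\<close>)
   thus ?thesis by (rule continuous_on_subset) auto
  qed
  show "\<exists>k\<in>T. \<forall>w\<in>ball 0 r. t (k' w) + S (k' w) <= k (k' w) + S (k' w) & t' (k' w) + S (k' w) <= k (k' w) + S (k' w)"
   if "t \<in> T" "t' \<in> T" for t t'
   using T_max[OF that] by (intro bexI[of _ "%x. max (t x) (t' x)"]) auto
  show "\<exists>j\<in>T. \<exists>F. F holomorphic_on ball 0 r & (\<forall>w\<in>ball 0 r. t (k' w) + S (k' w) <= j (k' w) + S (k' w) & j (k' w) + S (k' w) = Re (F w))"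
   if tT: "t \<in> T" for t
  proof -
   obtain t' F where t': "t' \<in> T" "F holomorphic_on ball 0 r" "\<forall>x\<in>X. t x <= t' x"
    "\<forall>w\<in>ball 0 r. t' (k' w) + S (k' w) = Re (F w)"
    using T_modify[OF tT k' r D alt] by blast
   have "t (k' w) <= t' (k' w)" if "w \<in> ball 0 r" for w
    using t'(3) inX[of w] that by simp
   thus ?thesis using t'(4) t'(1,2) by (metis add_right_mono)
  qed
  show "\<bar>t (k' w) + S (k' w)\<bar> <= M + M'" if "t \<in> T" "w \<in> ball 0 r" for t w
  proof -
   have "0 <= t (k' w)" using that inX by (auto simp: T_def)
   thus ?thesis using M[OF that(1), of "k' w"] M'[of w] inX[of w] that(2) by auto
  qed
  show "t (k' w) + S (k' w) <= G (k' w) + S (k' w)" if "t \<in> T" "w \<in> ball 0 r" for t w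
   using G_upper that inX by auto
  show "\<exists>t\<in>T. G (k' w) + S (k' w) - e < t (k' w) + S (k' w)" if "w \<in> ball 0 r" "0 < e" for w e
   using G_approx[of "k' w" e] that inX[of w] by force
 qed (use that in blast)
qed

text \<open>The modulus of the Riemann map: \<open>exp (- (G + s))\<close>, continued by \<open>0\<close> at the pole.\<close>

definition A :: "complex => real" where
 "A x = (if x = q then 0 else exp (- (G x + s x)))"

text \<open>Locally \<open>G + s\<close> is the real part of a holomorphic function, and
  \<open>H\<close> is the exponential of its negative. On the disc around the pole the logarithm
  turns into the factor \<open>w / R\<close>, so \<open>H\<close> acquires a simple zero
  there.\<close>

lemma A_local:
 assumes p: "p \<in> W"
 obtains k' r H where "k' \<in> CC" "0 < r" "r < 1" "k' 0 = p" "k' ` ball 0 r \<subseteq> W" "H holomorphic_on ball 0 r"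
  "\<And>w. w \<in> ball 0 r ==> cmod (H w) = A (k' w)"
proof (cases "p = q")
 case True
 obtain H where H: "H holomorphic_on ball 0 R" "\<And>w. w \<in> ball 0 R ==> G (kq w) + 0 = Re (H w)"
  using G_local[OF kq(1) R(1,2,3), of "%x. 0"] by blast
 have "(%w. w / of_real R * exp (- H w)) holomorphic_on ball 0 R"
  using H(1) R by (intro holomorphic_intros) auto
 moreover have "cmod (w / of_real R * exp (- H w)) = A (kq w)" if w: "w \<in> ball 0 R" for w
 proof (cases "w = 0")
  case True thus ?thesis using kq(2) by (simp add: A_def)
 next
  case False
  have wb: "w \<in> D1" using w sub_R by blast
  have "kq w ~= q" using coord_chart[OF kq(1) wb] coord_chart[OF kq(1), of 0] kq(2) False by auto
  moreover have "s (kq w) = ln (R / cmod w)" using w coord_chart[OF kq(1) wb] by (simp add: s_def)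
  moreover have "exp (- (Re (H w) + ln (R / cmod w))) = exp (- Re (H w)) * (cmod w / R)"
   using R False by (simp add: exp_diff exp_minus exp_ln field_simps)
  ultimately show ?thesis using H(2)[OF w] R by (simp add: A_def norm_mult norm_divide)
 qed
 moreover have "kq ` ball 0 R \<subseteq> W" using R(3) by force
 ultimately show ?thesis using that[of kq R "%w. w / of_real R * exp (- H w)"] kq R True by blast
next
 case False
 obtain k' where k': "k' \<in> CC" "k' 0 = p" using chart_at p W by blast
 obtain e where e: "0 < e" "ball 0 e \<subseteq> D1" "k' ` ball 0 e \<subseteq> W - {q}"
  using chart_small[OF k'(1), of "W - {q}" 0] k' p False W by auto
 define r where "r = e / 2"
 have e1: "e <= 1" using e by (simp add: ball_subset_ball_iff)
 have r: "0 < r" "r < 1" "r < e" using e e1 by (auto simp: r_def)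
 have D: "k' ` cball 0 r \<subseteq> W - {q}" using e(3) r(3) by (force simp: subset_iff)
 obtain H where H: "H holomorphic_on ball 0 r" "\<And>w. w \<in> ball 0 r ==> G (k' w) + s (k' w) = Re (H w)"
  using G_local[OF k'(1) r(1,2), of s] D by blast
 have "(%w. exp (- H w)) holomorphic_on ball 0 r" using H(1) by (intro holomorphic_intros)
 moreover have "cmod (exp (- H w)) = A (k' w)" if w: "w \<in> ball 0 r" for w using D w H(2)[OF w] by (force simp: A_def)
 moreover have "k' ` ball 0 r \<subseteq> W" using D by force
 ultimately show ?thesis using that[of k' r "%w. exp (- H w)"] k' r by blast
qed

end

text \<open>Pieces of length \<open>e\<close> are attached at steps of \<open>e / 2\<close>, so that
  consecutive intervals overlap in an open interval, as \<open>glue\<close> requires.\<close>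

lemma interval_chain:
 fixes P :: "real => real => bool"
 assumes e: "0 < e"
  and small: "\<And>u v. a <= u ==> u < v ==> v <= b ==> v - u <= e ==> P u v"
  and glue: "\<And>u v u' v'. a <= u ==> u < u' ==> u' < v ==> v < v' ==> v' <= b ==> P u v ==> P u' v' ==> P u v'"
  and ab: "a < b"
 shows "P a b"
proof -
 have "P u v" if "a <= u" "u < v" "v <= b" "v - u <= real (n + 1) * (e / 2)" for n u v
  using that
 proof (induction n arbitrary: u v)
  case 0
  thus ?case using e by (intro small) auto
 next
  case (Suc n)
  show ?case
  proof (cases "v - u <= e")
   case True thus ?thesis using Suc.prems by (intro small) auto
  next
   case False
   have "P u (v - e / 2)" using Suc False e by (intro Suc.IH) (auto simp: field_simps)
   moreover have "P (v - e) v" using Suc.prems False e by (intro small) auto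
   ultimately show ?thesis
    using glue[of u "v - e" "v - e / 2" v] Suc.prems False e by simp
  qed
 qed
 moreover obtain n where "(b - a) / (e / 2) < real n" using reals_Archimedean2 by blast
 hence "b - a <= real (n + 1) * (e / 2)" using e by (simp add: field_simps)
 ultimately show ?thesis using ab by (meson order_refl)
qed

section \<open>Holomorphic functions for the atlas and the extremal property of the Green
  function\<close>

context planar_atlas
begin

lemma holo_cong: "holo f S ==> (\<And>x. x \<in> S ==> f x = g x) ==> holo g S"
 unfolding holo_def using ballI holomorphic_transform by force

lemma holo_Un: "holo f S ==> holo f T ==> open S ==> open T ==> holo f (S \<union> T)"
proof -
 assume a: "holo f S" "holo f T" "open S" "open T"
 have "{w\<in>D1. k w \<in> S \<union> T} = {w\<in>D1. k w \<in> S} \<union> {w\<in>D1. k w \<in> T}" for k :: "complex => complex"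
  by auto
 thus ?thesis
  using a chart_preimage_open unfolding holo_def by (simp add: holomorphic_on_Un)
qed

lemma holo_chart:
 assumes "k \<in> CC" "open U" "U \<subseteq> D1" "H holomorphic_on U"
 shows "holo (%x. H (coord k x)) (k ` U)"
proof (rule holoI)
 fix p assume "p \<in> k ` U"
 have "((%x. H (coord k x)) \<circ> k) holomorphic_on U"
  using assms(4) by (rule holomorphic_transform) (use coord_chart[OF assms(1)] assms(3) in auto)
 thus "\<exists>k'\<in>CC. \<exists>V. open V & V \<subseteq> D1 & p \<in> k' ` V & ((%x. H (coord k x)) \<circ> k') holomorphic_on V"
  using assms \<open>p \<in> k ` U\<close> by blast
qed

lemma holo_cont:
 assumes f: "holo f S" and S: "open S" "S \<subseteq> X"
 shows "continuous_on S f"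
 unfolding continuous_on_eq_continuous_at[OF S(1)]
proof
 fix p assume p: "p \<in> S"
 then obtain k where k: "k \<in> CC" "k 0 = p" using chart_at S by blast
 obtain e where e: "0 < e" "e <= 1" "k ` ball 0 e \<subseteq> S" "(f \<circ> k) holomorphic_on ball 0 e"
  using holo_near[OF f S(1) p k] .
 have sub: "ball 0 e \<subseteq> D1" using e by auto
 have o: "open (k ` ball 0 e)" by (rule chart_open[OF k(1) open_ball sub])
 have "continuous_on (k ` ball 0 e) ((f \<circ> k) \<circ> coord k)"
 proof (rule continuous_on_compose)
  show "continuous_on (k ` ball 0 e) (coord k)"
   using coord_cont[OF k(1)] by (rule continuous_on_subset) (use sub in auto)
  show "continuous_on (coord k ` k ` ball 0 e) (f \<circ> k)"
   unfolding coord_image[OF k(1) sub] by (rule holomorphic_on_imp_continuous_on[OF e(4)])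
 qed
 hence "continuous_on (k ` ball 0 e) f"
  by (rule continuous_on_eq) (use coord_chart[OF k(1)] sub in auto)
 moreover have "p \<in> k ` ball 0 e" using k e by (metis centre_in_ball imageI)
 ultimately show "isCont f p" using o continuous_on_eq_continuous_at by blast
qed

lemma holo_max_modulus:
 assumes f: "holo f S" and S: "open S" "connected S" "S \<subseteq> X" and x0: "x0 \<in> S"
  and mx: "\<And>x. x \<in> S ==> cmod (f x) <= cmod (f x0)" and x: "x \<in> S"
 shows "cmod (f x) = cmod (f x0)"
proof -
 define Z where "Z = {x\<in>S. cmod (f x) = cmod (f x0)}"
 have "continuous_on S (%x. cmod (f x))" using holo_cont[OF f S(1,3)] by (intro continuous_intros)
 hence "closedin (top_of_set S) Z"
  unfolding Z_def by (rule continuous_closedin_preimage_constant)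
 moreover have "open Z" unfolding open_contains_ball
 proof
  fix p assume p: "p \<in> Z"
  hence pS: "p \<in> S" by (simp add: Z_def)
  then obtain k where k: "k \<in> CC" "k 0 = p" using chart_at S by blast
  obtain e where e: "0 < e" "e <= 1" "k ` ball 0 e \<subseteq> S" "(f \<circ> k) holomorphic_on ball 0 e"
   using holo_near[OF f S(1) pS k] .
  have "(f \<circ> k) constant_on ball 0 e" using e mx p k maximum_modulus_principle[OF e(4) open_ball connected_ball open_ball order_refl, of 0] by (force simp: Z_def)
  hence "f (k w) = f p" if "w \<in> ball 0 e" for w
   using that e(1) k(2) by (auto simp: constant_on_def)
  hence sub: "k ` ball 0 e \<subseteq> Z" using e(3) p by (auto simp: Z_def)
  have "open (k ` ball 0 e)" by (rule chart_open[OF k(1)]) (use e in auto)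
  moreover have "p \<in> k ` ball 0 e" using k e by (metis centre_in_ball imageI)
  ultimately obtain d where "d > 0" "ball p d \<subseteq> k ` ball 0 e" using open_contains_ball_eq by blast
  thus "\<exists>d>0. ball p d \<subseteq> Z" using sub by blast
 qed
 hence "openin (top_of_set S) Z" by (intro open_subset) (auto simp: Z_def)
 ultimately have "Z = S" using S(2) x0 by (auto simp: connected_clopen Z_def)
 thus ?thesis using x by (auto simp: Z_def)
qed

lemma harm_at_ln:
 assumes k: "k \<in> CC" and U: "open U" "U \<subseteq> D1" and H: "H holomorphic_on U" and w0: "w0 \<in> U" "H w0 ~= 0"
  and u: "\<And>w. w \<in> U ==> u (k w) = ln (cmod (H w))"
 shows "harm_at u (k w0)"
proof -
 have "open (H -` (- {0}) \<inter> U)"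
  using continuous_open_preimage[OF holomorphic_on_imp_continuous_on[OF H] U(1) open_Compl[OF closed_singleton[of 0]]]
  by (simp add: Int_commute)
 moreover have "w0 \<in> H -` (- {0}) \<inter> U" using w0 by simp
 ultimately obtain e where e: "0 < e" "ball w0 e \<subseteq> H -` (- {0}) \<inter> U" using open_contains_ball_eq by blast
 have He: "H holomorphic_on ball w0 e" using H e holomorphic_on_subset by blast
 have "\<forall>w\<in>ball w0 e. H w ~= 0" using e by blast
 then obtain g where g: "g holomorphic_on ball w0 e" "\<forall>w\<in>ball w0 e. H w = exp (g w)"
  using simply_connected_eq_holomorphic_log[of "ball w0 e"]
   convex_imp_simply_connected[OF convex_ball] He by (metis open_ball)
 show ?thesis
 proof (rule harm_atI[OF k open_ball _ g(1)])
  show "ball w0 e \<subseteq> D1" using e U by blast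
  show "u (k w) = Re (g w)" if w: "w \<in> ball w0 e" for w using g(2) w u[of w] e by auto
 qed (use e in auto)
qed

end

context green_pole
begin

lemma A_le_1: "x \<in> X ==> A x <= 1"
 using G_upper[OF T_zero, of x] s_nonneg[of x] by (auto simp: A_def)

text \<open>For each member \<open>t\<close> of the family the logarithm of
  \<open>cmod (f x) * exp (t x + s x)\<close> is subharmonic where the product exceeds 1: the zero
  of \<open>f\<close> at \<open>q\<close> compensates the pole of \<open>s\<close>. Off a compact
  set the product is just \<open>cmod (f x)\<close>, so the maximum principle bounds it by 1, and
  the supremum over \<open>t\<close> gives the claim.\<close>

lemma A_minimal:
 assumes f: "holo f W" "\<And>x. x \<in> W ==> cmod (f x) <= 1" "f q = 0" and x: "x \<in> W"
 shows "cmod (f x) <= A x"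
proof (cases "x = q")
 case True thus ?thesis using f(3) by (simp add: A_def)
next
 case False
 have kR: "kq ` ball 0 R \<subseteq> W" using R(3) by force
 have "(f \<circ> kq) holomorphic_on ball 0 R"
 proof (rule holomorphic_on_subset)
  show "(f \<circ> kq) holomorphic_on {w\<in>D1. kq w \<in> W}" using f(1) kq(1) by (simp add: holo_def)
  show "ball 0 R \<subseteq> {w\<in>D1. kq w \<in> W}" using kR sub_R(2) by blast
 qed
 then obtain g where g: "g holomorphic_on ball 0 R" "\<And>z. cmod z < R ==> (f \<circ> kq) z = z * g z"
  using Schwarz3[of "f \<circ> kq" R] kq(2) f(3) by auto
 have main: "cmod (f x) * exp (t x + s x) <= 1" if t: "t \<in> T" for t
 proof (rule ccontr)
  assume gt: "\<not> cmod (f x) * exp (t x + s x) <= 1"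
  \<comment> \<open>The product is extended continuously across \<open>q\<close>: there
    \<open>f\<close> is the coordinate times \<open>g\<close>, while \<open>exp\<close> of
    \<open>s\<close> is \<open>R\<close> divided by its modulus.\<close>
  define b where "b y = (if y = q then cmod (g 0) * R * exp (t q) else cmod (f y) * exp (t y + s y))" for y
  have b_disc: "b (kq w) = cmod (g w) * R * exp (t (kq w))" if w: "w \<in> ball 0 R" for w
  proof (cases "w = 0")
   case True thus ?thesis using kq(2) by (simp add: b_def)
  next
   case False
   have wb: "w \<in> D1" using w sub_R by blast
   have "kq w ~= q" using coord_chart[OF kq(1) wb] coord_chart[OF kq(1), of 0] kq(2) False by auto
   moreover have "s (kq w) = ln (R / cmod w)" using w coord_chart[OF kq(1) wb] by (simp add: s_def)
   moreover have "f (kq w) = w * g w" using g(2)[of w] w by simp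
   ultimately show ?thesis using False R by (simp add: b_def exp_add exp_ln norm_mult)
  qed
  have tc: "continuous_on X t" using t by (simp add: T_def)
  have oR: "open (kq ` ball 0 R)" using chart_open[OF kq(1) open_ball sub_R(2)] .
  have bc1: "continuous_on (kq ` ball 0 R) b"
  proof -
   have "continuous_on (kq ` ball 0 R) (%y. cmod (g (coord kq y)) * R * exp (t y))"
   proof (intro continuous_intros)
    show "continuous_on (kq ` ball 0 R) (%y. g (coord kq y))"
     using continuous_on_compose2[OF holomorphic_on_imp_continuous_on[OF g(1)]
       continuous_on_subset[OF coord_cont[OF kq(1)]]] coord_image[OF kq(1) sub_R(2)] sub_R(2)
     by (metis image_mono order_refl)
    show "continuous_on (kq ` ball 0 R) t" using tc by (rule continuous_on_subset) (use kR W in auto)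
   qed
   thus ?thesis
    by (rule continuous_on_eq) (use b_disc coord_chart[OF kq(1)] sub_R(2) in auto)
  qed
  have bc2: "continuous_on (W - {q}) b"
  proof -
   have "continuous_on (W - {q}) (%y. cmod (f y) * exp (t y + s y))"
    by (intro continuous_intros T_cont[OF t] continuous_on_subset[OF holo_cont[OF f(1) W]]) (use W in auto)
   thus ?thesis by (rule continuous_on_eq) (auto simp: b_def)
  qed
  have "continuous_on (kq ` ball 0 R \<union> (W - {q})) b"
   using continuous_on_open_Un[OF oR _ bc1 bc2] W(1) by (simp add: open_delete)
  moreover have "kq ` ball 0 R \<union> (W - {q}) = W" using kq(2) R(1) kR by auto
  ultimately have bc: "continuous_on W b" by simp
  obtain K where K: "compact K" "K \<subseteq> W" "\<forall>x\<in>X - K. t x = 0" using t by (auto simp: T_def)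
  define K' where "K' = K \<union> kq ` cball 0 R"
  have K': "compact K'" "K' \<subseteq> W" using K R compact_disc[OF R(2)] by (auto simp: K'_def)
  have off: "b y <= 1" if "y \<in> W" "y \<notin> K'" for y using that kq(2) R(1) K W f(2)[OF that(1)] s_out by (auto simp: K'_def image_iff b_def)
  have "b y <= 1" if "y \<in> K'" for y
  proof (rule compact_max_principle[OF K'(1) continuous_on_subset[OF bc K'(2)] _ that])
   fix p assume p: "p \<in> K'" "1 < b p" and mx: "\<And>x. x \<in> K' ==> b x <= b p"
   \<comment> \<open>Restricting to values above 1 keeps zeros of \<open>b\<close> away, so that its
     logarithm makes sense.\<close>
   define N where "N = {y\<in>W. 1 < b y}"
   have "open (b -` {1<..} \<inter> W)" using bc W(1) by (simp add: continuous_on_open_vimage)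
   moreover have "b -` {1<..} \<inter> W = N" by (auto simp: N_def)
   ultimately have oN: "open N" by simp
   have NK: "N \<subseteq> K'" using off by (force simp: N_def)
   have pN: "p \<in> N" using p K' by (auto simp: N_def)
   have sub: "subat (%y. ln (b y)) p"
   proof (cases "p = q")
    case True
    have g0: "g 0 ~= 0" using p True by (auto simp: b_def)
    have "harm_at (%y. ln (cmod (of_real R * g (coord kq y)))) (kq 0)"
    proof (rule harm_at_ln[OF kq(1) open_ball sub_R(2), of "%w. of_real R * g w"])
     show "(%w. of_real R * g w) holomorphic_on ball 0 R" using g(1) by (intro holomorphic_intros)
    qed (use R g0 coord_chart[OF kq(1)] sub_R(2) in auto)
    hence "subat (%y. t y + ln (cmod (of_real R * g (coord kq y)))) q"
     using subat_add t kq(2) by (auto simp: T_def)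
    thus ?thesis unfolding True
    proof (rule subat_mono)
     show "open (N \<inter> kq ` ball 0 R)" using oN oR by blast
     show "q \<in> N \<inter> kq ` ball 0 R" using pN True kq(2) R(1) by (metis IntI centre_in_ball imageI)
     have eq: "t y + ln (cmod (of_real R * g (coord kq y))) = ln (b y)" if "y \<in> N \<inter> kq ` ball 0 R" for y
     proof -
      obtain w where w: "w \<in> ball 0 R" "y = kq w" using \<open>y \<in> _\<close> by blast
      have cw: "coord kq y = w" using w coord_chart[OF kq(1), of w] sub_R(2) by auto
      have "g w ~= 0" using that b_disc[OF w(1)] w(2) by (auto simp: N_def)
      hence "ln (cmod (g w) * R * exp (t y)) = ln (cmod (g w) * R) + t y"
       using R by (subst ln_mult) auto
      thus ?thesis using b_disc[OF w(1)] w(2) cw R by (simp add: norm_mult mult.commute)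
     qed
     show "t x + ln (cmod (of_real R * g (coord kq x))) <= ln (b x)" if "x \<in> N \<inter> kq ` ball 0 R" for x
      using eq[OF that] by simp
     show "ln (b q) = t q + ln (cmod (of_real R * g (coord kq q)))"
      using eq[of q] \<open>q \<in> N \<inter> kq ` ball 0 R\<close> by simp
    qed
   next
    case False
    have pW: "p \<in> W" using p K' by blast
    obtain k' where k': "k' \<in> CC" "k' 0 = p" using chart_at pW W by blast
    obtain e where e: "0 < e" "e <= 1" "k' ` ball 0 e \<subseteq> W" "(f \<circ> k') holomorphic_on ball 0 e"
     using holo_near[OF f(1) W(1) pW k'] .
    have "f p ~= 0" using p False by (auto simp: b_def)
    hence "harm_at (%y. ln (cmod (f y))) (k' 0)"
     by (intro harm_at_ln[OF k'(1) open_ball _ e(4)]) (use e k' in auto)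
    hence "subat (%y. (t y + s y) + ln (cmod (f y))) p"
     using subat_add t pW False k'(2) by (auto simp: T_def)
    thus ?thesis
    proof (rule subat_mono)
     show "open (N - {q})" using oN by (rule open_delete)
     show "p \<in> N - {q}" using pN False by simp
     have eq: "t y + s y + ln (cmod (f y)) = ln (b y)" if "y \<in> N - {q}" for y using that by (auto simp: N_def b_def ln_mult)
     show "t x + s x + ln (cmod (f x)) <= ln (b x)" if "x \<in> N - {q}" for x using eq[OF that] by simp
     show "ln (b p) = t p + s p + ln (cmod (f p))" using eq[OF \<open>p \<in> N - {q}\<close>] by simp
    qed
   qed
   have "\<exists>d>0. ball p d \<subseteq> N & (\<forall>y\<in>ball p d. ln (b y) = ln (b p))"
   proof (rule subat_max_const[OF sub oN pN])
    show "continuous_on N (%y. ln (b y))"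
     by (intro continuous_intros continuous_on_subset[OF bc]) (auto simp: N_def)
    show "ln (b y) <= ln (b p)" if "y \<in> N" for y using NK that mx[of y] by (auto simp: N_def)
   qed
   then obtain d where d: "d > 0" "ball p d \<subseteq> N" "\<And>y. y \<in> ball p d ==> ln (b y) = ln (b p)" by blast
   have "b y = b p" if "y \<in> ball p d" for y using d(2) that p d(3)[OF that] by (auto simp: N_def)
   thus "\<exists>e>0. ball p e \<subseteq> K' & (\<forall>x\<in>ball p e. b x = b p)" using d NK by blast
  qed
  hence "b x <= 1" using off x by blast
  thus False using gt False by (simp add: b_def)
 qed
 show ?thesis
 proof (cases "f x = 0")
  case True thus ?thesis by (simp add: A_def)
 next
  case nz: False
  have xX: "x \<in> X" using x W by blast
  have "G x <= - s x - ln (cmod (f x))"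
  proof (rule field_le_epsilon)
   fix e :: real assume "0 < e"
   then obtain t where t: "t \<in> T" "G x - e < t x" using G_approx[OF xX] by blast
   have "ln (cmod (f x) * exp (t x + s x)) <= 0" using main[OF t(1)] nz by simp
   thus "G x <= - s x - ln (cmod (f x)) + e" using nz t(2) by (simp add: ln_mult)
  qed
  hence "exp (ln (cmod (f x))) <= exp (- (G x + s x))" by (simp only: exp_le_cancel_iff)
  thus ?thesis using nz False by (simp add: A_def)
 qed
qed

end

section \<open>Gluing local branches of the Riemann map\<close>

context green_pole
begin

text \<open>A local branch of the Riemann map: the modulus is prescribed by the Green function, so
  only a rotation remains free.\<close>

definition good :: "complex set => (complex => complex) => bool" where
 "good N f \<longleftrightarrow> open N & N \<subseteq> W & holo f N & (\<forall>x\<in>N. cmod (f x) = A x)"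

lemma good_subset: "good N f ==> N' \<subseteq> N ==> open N' ==> good N' f"
 unfolding good_def using holo_subset by blast

lemma good_local: "p \<in> W ==> \<exists>e>0. \<exists>f. good (ball p e) f"
proof -
 assume p: "p \<in> W"
 obtain k' r H where k': "k' \<in> CC" "0 < r" "r < 1" "k' 0 = p" "k' ` ball 0 r \<subseteq> W" "H holomorphic_on ball 0 r"
  "\<And>w. w \<in> ball 0 r ==> cmod (H w) = A (k' w)" using A_local[OF p] by blast
 have sub: "ball 0 r \<subseteq> D1" using k'(3) by auto
 have o: "open (k' ` ball 0 r)" by (rule chart_open[OF k'(1) open_ball sub])
 have "good (k' ` ball 0 r) (%x. H (coord k' x))"
  unfolding good_def using holo_chart[OF k'(1) open_ball sub k'(6)] o k'(5,7) coord_chart[OF k'(1)] sub by auto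
 moreover have "p \<in> k' ` ball 0 r" using k' by (metis centre_in_ball imageI)
 then obtain e where "e > 0" "ball p e \<subseteq> k' ` ball 0 r" using o open_contains_ball_eq by blast
 ultimately show ?thesis using good_subset open_ball by blast
qed

text \<open>The quotient of two branches has modulus 1 off \<open>q\<close>, hence is locally
  constant by the maximum modulus principle. Deleting \<open>q\<close> keeps the open set connected,
  and at \<open>q\<close> both branches vanish.\<close>

lemma good_unique:
 assumes f: "good N f" and g: "good N g" and N: "connected N" "N ~= {}"
 shows "\<exists>c. cmod c = 1 & (\<forall>x\<in>N. g x = c * f x)"
proof -
 have N': "open N" "N \<subseteq> W" "N \<subseteq> X" using f W by (auto simp: good_def)
 have A0: "A x ~= 0" if "x ~= q" for x using that by (simp add: A_def)
 have nz: "f x ~= 0" "cmod (g x / f x) = 1" if "x \<in> N - {q}" for x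
  using f g A0[of x] that by (auto simp: good_def norm_divide)
 have "N - {q} ~= {}"
 proof
  assume "N - {q} = {}"
  hence "finite N" by (metis Diff_eq_empty_iff finite.emptyI finite.insertI finite_subset)
  thus False using N(2) N'(1) by (simp add: finite_imp_not_open)
 qed
 then obtain x0 where x0: "x0 \<in> N - {q}" by blast
 have con: "connected (N - {q})" using N(1) N'(1) by (simp add: connected_open_delete)
 have const: "g x / f x = g x0 / f x0" if x: "x \<in> N - {q}" for x
 proof (rule connected_local_const[OF con x x0])
  show "\<forall>a\<in>N - {q}. \<forall>\<^sub>F b in at a within N - {q}. g a / f a = g b / f b"
  proof
   fix a assume a: "a \<in> N - {q}"
   have oN: "open (N - {q})" using N'(1) by (rule open_delete)
   have "holo (%x. g x / f x) (N - {q})"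
    unfolding holo_def
   proof
    fix k' assume k': "k' \<in> CC"
    have "(g \<circ> k') holomorphic_on {w\<in>D1. k' w \<in> N - {q}}" "(f \<circ> k') holomorphic_on {w\<in>D1. k' w \<in> N - {q}}"
     using f g k' holo_subset[of _ N "N - {q}"] unfolding good_def holo_def by blast+
    hence "(%w. (g \<circ> k') w / (f \<circ> k') w) holomorphic_on {w\<in>D1. k' w \<in> N - {q}}"
     by (rule holomorphic_on_divide) (use nz(1) in auto)
    thus "((%x. g x / f x) \<circ> k') holomorphic_on {w\<in>D1. k' w \<in> N - {q}}" by (simp add: o_def)
   qed
   moreover obtain k' where k': "k' \<in> CC" "k' 0 = a" using chart_at a N' by blast
   ultimately obtain e where e: "0 < e" "e <= 1" "k' ` ball 0 e \<subseteq> N - {q}" "((%x. g x / f x) \<circ> k') holomorphic_on ball 0 e"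
    using holo_near[OF _ oN a] by blast
   have "((%x. g x / f x) \<circ> k') constant_on ball 0 e" using e that nz(2) a k'(2) maximum_modulus_principle[OF e(4) open_ball connected_ball open_ball order_refl, of 0] by force
   hence eq: "g (k' w) / f (k' w) = g a / f a" if "w \<in> ball 0 e" for w
    using that e(1) k'(2) by (auto simp: constant_on_def)
   have "open (k' ` ball 0 e)" by (rule chart_open[OF k'(1)]) (use e in auto)
   moreover have "a \<in> k' ` ball 0 e" using k' e by (metis centre_in_ball imageI)
   ultimately have "\<forall>\<^sub>F b in at a within N - {q}. b \<in> k' ` ball 0 e" by (auto simp: eventually_at_topological)
   thus "\<forall>\<^sub>F b in at a within N - {q}. g a / f a = g b / f b"
    by (rule eventually_mono) (use eq in auto)
  qed
 qed
 have "g x = (g x0 / f x0) * f x" if x: "x \<in> N" for x using f g x const[of x] nz(1)[of x] by (force simp: A_def field_simps good_def)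
 thus ?thesis using nz(2)[OF x0] by blast
qed

lemma good_rotate: "good N f ==> cmod c = 1 ==> good N (%x. c * f x)"
proof -
 assume f: "good N f" and c: "cmod c = 1"
 have "holo (%x. c * f x) N"
  unfolding holo_def o_def
 proof
  fix k' assume "k' \<in> CC"
  hence "(%w. f (k' w)) holomorphic_on {w\<in>D1. k' w \<in> N}"
   using f unfolding good_def holo_def o_def by blast
  thus "(%w. c * f (k' w)) holomorphic_on {w\<in>D1. k' w \<in> N}"
   by (intro holomorphic_intros)
 qed
 thus ?thesis using f c by (simp add: good_def norm_mult)
qed

lemma good_glue:
 assumes f: "good N f" and g: "good N' g" and N: "connected (N \<inter> N')" "N \<inter> N' ~= {}"
 shows "\<exists>h. good (N \<union> N') h & (\<forall>x\<in>N. h x = f x)"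
proof -
 have o: "open N" "open N'" "N \<subseteq> W" "N' \<subseteq> W" using f g by (auto simp: good_def)
 obtain c where c: "cmod c = 1" "\<forall>x\<in>N \<inter> N'. f x = c * g x"
  using good_unique[OF good_subset[OF g] good_subset[OF f] N] o by blast
 have g': "good N' (%x. c * g x)" using good_rotate[OF g c(1)] .
 define h where "h x = (if x \<in> N then f x else c * g x)" for x
 have hN: "h x = f x" if "x \<in> N" for x using that by (simp add: h_def)
 have hN': "h x = c * g x" if "x \<in> N'" for x using that c(2) by (simp add: h_def)
 have "holo h N" by (rule holo_cong[of f]) (use f hN in \<open>auto simp: good_def\<close>)
 moreover have "holo h N'" by (rule holo_cong[of "%x. c * g x"]) (use g' hN' in \<open>auto simp: good_def\<close>)
 ultimately have "holo h (N \<union> N')" using holo_Un o by blast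
 thus ?thesis using f g' hN hN' o unfolding good_def by auto
qed

end

context green_pole
begin

definition rect :: "real => real => real => real => complex set" where
 "rect a b c d = {z. a < Re z & Re z < b & c < Im z & Im z < d}"

lemma rect_eq_box: "rect a b c d = box (Complex a c) (Complex b d)"
 by (auto simp: rect_def in_box_complex_iff)

lemma open_rect: "open (rect a b c d)" and connected_rect: "connected (rect a b c d)"
 by (simp_all add: rect_eq_box open_box convex_box(2) convex_connected)

text \<open>Two overlapping rectangles of a row, or two overlapping rows, meet in a rectangle. The
  overlap is connected, so one rotation aligns the two branches and no monodromy can occur.\<close>

lemma good_rect:
 assumes ab: "a < b" "c < d" and sub: "cbox (Complex a c) (Complex b d) \<subseteq> W"
 shows "\<exists>f. good (rect a b c d) f"
proof -
 let ?C = "cbox (Complex a c) (Complex b d)"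
 define \<G> where "\<G> = {B. \<exists>p e f. B = ball p e & 0 < e & good B f}"
 have cov: "?C \<subseteq> \<Union>\<G>"
 proof
  fix x assume "x \<in> ?C"
  then obtain e f where "e > 0" "good (ball x e) f" using good_local sub by blast
  thus "x \<in> \<Union>\<G>" unfolding \<G>_def by (intro UnionI[of "ball x e"]) auto
 qed
 have "\<And>G. G \<in> \<G> ==> open G" by (auto simp: \<G>_def)
 then obtain e where e: "0 < e" "\<And>x. x \<in> ?C ==> \<exists>G\<in>\<G>. ball x e \<subseteq> G"
  using Heine_Borel_lemma[OF compact_cbox cov] by blast
 \<comment> \<open>Sides of at most \<open>e / 3\<close> keep the rectangle within distance
   \<open>e\<close> of its lower left corner, hence within one set of the cover.\<close>
 have small: "\<exists>f. good (rect u v y z) f"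
  if h: "a <= u" "u < v" "v <= b" "v - u <= e / 3" "c <= y" "y < z" "z <= d" "z - y <= e / 3" for u v y z
 proof -
  have x: "Complex u y \<in> ?C" using h by (simp add: in_cbox_complex_iff)
  obtain G where G: "G \<in> \<G>" "ball (Complex u y) e \<subseteq> G" using e(2)[OF x] by blast
  have "rect u v y z \<subseteq> ball (Complex u y) e"
  proof
   fix w assume w: "w \<in> rect u v y z"
   have "cmod (Complex u y - w) <= \<bar>Re (Complex u y - w)\<bar> + \<bar>Im (Complex u y - w)\<bar>" by (rule cmod_le)
   also have "\<dots> < e" using w h e(1) by (auto simp: rect_def abs_if)
   finally show "w \<in> ball (Complex u y) e" by (simp add: dist_norm)
  qed
  hence sub': "rect u v y z \<subseteq> G" using G(2) by blast
  obtain f where "good G f" using G(1) unfolding \<G>_def by blast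
  thus ?thesis using good_subset[OF _ sub' open_rect] by blast
 qed
 have row: "\<exists>f. good (rect a b y z) f" if h: "c <= y" "y < z" "z <= d" "z - y <= e / 3" for y z
 proof (rule interval_chain[of "e / 3" a b "%u v. \<exists>f. good (rect u v y z) f"])
  fix u v u' v' assume uv: "a <= u" "u < u'" "u' < v" "v < v'" "v' <= b"
   "\<exists>f. good (rect u v y z) f" "\<exists>f. good (rect u' v' y z) f"
  have i: "rect u v y z \<inter> rect u' v' y z = rect u' v y z" using uv by (auto simp: rect_def)
  have un: "rect u v y z \<union> rect u' v' y z = rect u v' y z" using uv by (auto simp: rect_def)
  have "Complex ((u' + v) / 2) ((y + z) / 2) \<in> rect u' v y z" using uv h by (simp add: rect_def)
  hence ne: "rect u v y z \<inter> rect u' v' y z ~= {}" unfolding i by blast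
  obtain f g where "good (rect u v y z) f" "good (rect u' v' y z) g" using uv by blast
  from good_glue[OF this _ ne] show "\<exists>f. good (rect u v' y z) f" unfolding i un using connected_rect by blast
 next
  show "\<exists>f. good (rect u v y z) f" if "a <= u" "u < v" "v <= b" "v - u <= e / 3" for u v
   using small[OF that h] .
 qed (use e(1) ab in auto)
 show ?thesis
 proof (rule interval_chain[of "e / 3" c d "%y z. \<exists>f. good (rect a b y z) f"])
  fix u v u' v' assume uv: "c <= u" "u < u'" "u' < v" "v < v'" "v' <= d"
   "\<exists>f. good (rect a b u v) f" "\<exists>f. good (rect a b u' v') f"
  have i: "rect a b u v \<inter> rect a b u' v' = rect a b u' v" using uv by (auto simp: rect_def)
  have un: "rect a b u v \<union> rect a b u' v' = rect a b u v'" using uv by (auto simp: rect_def)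
  have "Complex ((a + b) / 2) ((u' + v) / 2) \<in> rect a b u' v" using uv ab by (simp add: rect_def)
  hence ne: "rect a b u v \<inter> rect a b u' v' ~= {}" unfolding i by blast
  obtain f g where "good (rect a b u v) f" "good (rect a b u' v') g" using uv by blast
  from good_glue[OF this _ ne] show "\<exists>f. good (rect a b u v') f" unfolding i un using connected_rect by blast
 qed (use e(1) ab row in auto)
qed

lemma good_halfplane:
 assumes W_eq: "W = {z. Re z < h}"
 shows "\<exists>f. good W f"
proof -
 \<comment> \<open>An increasing exhaustion of the half plane by rectangles whose closures stay
   inside it, as \<open>good_rect\<close> demands.\<close>
 define Q where "Q n = rect (h - 2 - real n) (h - inverse (Suc n)) (- 1 - real n) (1 + real n)" for n
 have "\<exists>f. good (Q n) f" for n
 proof -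
  have i: "inverse (real (Suc n)) <= 1" by (simp add: inverse_le_1_iff)
  show ?thesis unfolding Q_def
  proof (rule good_rect)
   show "cbox (Complex (h - 2 - real n) (- 1 - real n)) (Complex (h - inverse (Suc n)) (1 + real n)) \<subseteq> W"
   proof
    fix x assume "x \<in> cbox (Complex (h - 2 - real n) (- 1 - real n)) (Complex (h - inverse (Suc n)) (1 + real n))"
    hence "Re x <= h - inverse (Suc n)" by (simp add: in_cbox_complex_iff)
    moreover have "0 < inverse (real (Suc n))" by simp
    ultimately have "Re x < h" by linarith
    thus "x \<in> W" unfolding W_eq by simp
   qed
   show "h - 2 - real n < h - inverse (real (Suc n))" using i by linarith
  qed simp
 qed
 hence "\<forall>n. \<exists>f. good (Q n) f" by blast
 then obtain F where F: "\<And>n. good (Q n) (F n)" by (rule choice[THEN exE]) blast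
 have oQ: "open (Q n)" and conQ: "connected (Q n)" for n by (simp_all add: Q_def open_rect connected_rect)
 have mono: "Q n \<subseteq> Q m" if "n <= m" for n m
 proof -
  have "inverse (real (Suc m)) <= inverse (real (Suc n))" using that by (intro le_imp_inverse_le) auto
  moreover have "real n <= real m" using that by simp
  ultimately have "x \<in> Q m" if "x \<in> Q n" for x
   using that unfolding Q_def rect_def mem_Collect_eq by (intro conjI) linarith+
  thus ?thesis by blast
 qed
 have Q0: "Complex (h - 3/2) 0 \<in> Q n" for n
 proof -
  have "inverse (real (Suc n)) <= 1" by (simp add: inverse_le_1_iff)
  thus ?thesis by (simp add: Q_def rect_def del: of_nat_Suc)
 qed
 have step: "\<exists>g'. good (Q (Suc n)) g' & (\<forall>x\<in>Q n. g' x = g x)" if g: "good (Q n) g" for n g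
 proof -
  have i: "Q n \<inter> Q (Suc n) = Q n" "Q n \<union> Q (Suc n) = Q (Suc n)" using mono[of n "Suc n"] by auto
  have "connected (Q n \<inter> Q (Suc n))" "Q n \<inter> Q (Suc n) ~= {}" unfolding i(1) using conQ Q0[of n] by blast+
  thus ?thesis using good_glue[OF g F[of "Suc n"]] unfolding i(2) by blast
 qed
 define S where "S n g = (SOME g'. good (Q (Suc n)) g' & (\<forall>x\<in>Q n. g' x = g x))" for n g
 have S: "good (Q (Suc n)) (S n g)" "\<And>x. x \<in> Q n ==> S n g x = g x" if "good (Q n) g" for n g
  using someI_ex[OF step[OF that]] unfolding S_def by blast+
 define g where "g = rec_nat (F 0) S"
 have g0: "g 0 = F 0" and gS: "g (Suc n) = S n (g n)" for n by (simp_all add: g_def)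
 have gg: "good (Q n) (g n)" for n
 proof (induction n)
  case 0 thus ?case unfolding g0 by (rule F)
 next
  case (Suc n) thus ?case unfolding gS by (rule S(1))
 qed
 have gmono: "g m x = g n x" if "n <= m" "x \<in> Q n" for n m x
  using that
 proof (induction m)
  case (Suc m)
  show ?case
  proof (cases "n = Suc m")
   case False
   hence le: "n <= m" using Suc.prems by simp
   hence "x \<in> Q m" using mono Suc.prems by blast
   hence "g (Suc m) x = g m x" unfolding gS by (rule S(2)[OF gg])
   thus ?thesis using Suc.IH[OF le Suc.prems(2)] by simp
  qed simp
 qed simp
 define f where "f x = g (LEAST n. x \<in> Q n) x" for x
 have fg: "f x = g n x" if "x \<in> Q n" for x n
  unfolding f_def
  by (rule gmono[symmetric, OF Least_le[of "%n. x \<in> Q n", OF that] LeastI[of "%n. x \<in> Q n", OF that]])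
 have UQ: "\<exists>n. x \<in> Q n" if x: "x \<in> W" for x
 proof -
  obtain n1 where n1: "\<bar>Re x\<bar> + \<bar>Im x\<bar> + \<bar>h\<bar> < real n1" using reals_Archimedean2 by blast
  obtain n2 where n2: "inverse (real (Suc n2)) < h - Re x" using reals_Archimedean[of "h - Re x"] x W_eq by auto
  have "inverse (real (Suc (max n1 n2))) <= inverse (real (Suc n2))" by (intro le_imp_inverse_le) auto
  hence "Re x < h - inverse (real (Suc (max n1 n2)))" using n2 by linarith
  moreover have "real n1 <= real (max n1 n2)" by simp
  ultimately have "x \<in> Q (max n1 n2)" using n1 unfolding Q_def rect_def mem_Collect_eq by (intro conjI) linarith+
  thus ?thesis by blast
 qed
 have "holo f W"
 proof (rule holoI)
  fix p assume p: "p \<in> W"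
  then obtain n where n: "p \<in> Q n" using UQ by blast
  have Qn: "open (Q n)" "holo (g n) (Q n)" "Q n \<subseteq> X" using gg[of n] W by (auto simp: good_def)
  have hf: "holo f (Q n)" by (rule holo_cong[OF Qn(2)]) (use fg in auto)
  obtain k' where k': "k' \<in> CC" "k' 0 = p" using chart_at n Qn(3) by blast
  obtain e where e: "0 < e" "e <= 1" "k' ` ball 0 e \<subseteq> Q n" "(f \<circ> k') holomorphic_on ball 0 e"
   using holo_near[OF hf Qn(1) n k'] .
  thus "\<exists>k'\<in>CC. \<exists>U. open U & U \<subseteq> D1 & p \<in> k' ` U & (f \<circ> k') holomorphic_on U" using k'(2) k'(1) by force
 qed
 moreover have "cmod (f x) = A x" if x: "x \<in> W" for x
 proof -
  obtain n where "x \<in> Q n" using UQ[OF x] by blast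
  thus ?thesis using gg[of n] fg by (simp add: good_def)
 qed
 ultimately show ?thesis using W(1) by (auto simp: good_def)
qed

end

section \<open>Injectivity of the Riemann map\<close>

text \<open>Heins' argument: let \<open>f p\<close> be the extremal function with zero at
  \<open>p\<close>. Moving the value at \<open>q\<close> to 0 by a disc automorphism gives
  \<open>ph p q\<close>, which is dominated by \<open>f q\<close>; evaluation at \<open>p\<close>
  yields the symmetry of \<open>cmod (f p q)\<close>. Hence the ratio \<open>om\<close> has modulus
  at most 1 and attains 1 at \<open>p\<close>, so its modulus is constant, which excludes a second
  point with the value \<open>f p q\<close>.\<close>

theorem (in planar_atlas) halfplane_uniformization:
 assumes Wh: "W = {z. Re z < h}" "W \<subseteq> X" and O'h: "open O'" "O' ~= {}" "O' \<subseteq> X" "O' \<inter> W = {}"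
 shows "\<exists>F. holo F W & inj_on F W & F ` W \<subseteq> D1"
proof -
 have oW: "open W" unfolding Wh(1) by (rule open_halfspace_Re_lt)
 have cW: "connected W" unfolding Wh(1) by (intro convex_connected convex_halfspace_Re_lt)
 define P where "P p f \<longleftrightarrow> holo f W & (\<forall>x\<in>W. cmod (f x) <= 1) & (\<forall>x\<in>W. f x = 0 \<longleftrightarrow> x = p) &
   (\<forall>ph. holo ph W --> (\<forall>x\<in>W. cmod (ph x) <= 1) --> ph p = 0 --> (\<forall>x\<in>W. cmod (ph x) <= cmod (f x)))" for p f
 have ex: "\<exists>f. P p f"
  if p: "p \<in> W" for p
 proof -
  obtain k where k: "k \<in> CC" "k 0 = p" using chart_at p Wh by blast
  obtain e where e: "0 < e" "ball 0 e \<subseteq> D1" "k ` ball 0 e \<subseteq> W"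
   using chart_small[OF k(1) oW, of 0] k p by auto
  have e1: "e <= 1" using e by (simp add: ball_subset_ball_iff)
  have "cball 0 (e/2) \<subseteq> ball (0::complex) e" using e by (auto simp: subset_iff)
  hence eW: "k ` cball 0 (e/2) \<subseteq> W" using e(3) by blast
  interpret green_pole X CC W O' p k "e/2"
   by unfold_locales (use oW Wh O'h k e e1 eW in auto)
  obtain f where f: "good W f" using good_halfplane[OF Wh(1)] by blast
  have "f x = 0 \<longleftrightarrow> x = p" if x: "x \<in> W" for x
  proof -
   have "cmod (f x) = A x" using f x by (simp add: good_def)
   moreover have "A x = 0 \<longleftrightarrow> x = p" by (simp add: A_def)
   ultimately show ?thesis by (metis norm_eq_zero)
  qed
  moreover have "cmod (f x) <= 1" if "x \<in> W" for x using f that A_le_1[of x] Wh(2) by (auto simp: good_def)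
  moreover have "cmod (ph x) <= cmod (f x)" if "holo ph W" "\<forall>x\<in>W. cmod (ph x) <= 1" "ph p = 0" "x \<in> W" for ph x
   using A_minimal[of ph x] that f by (simp add: good_def)
  moreover have "holo f W" using f by (simp add: good_def)
  ultimately show ?thesis unfolding P_def by blast
 qed
 define f where "f p = (SOME f. P p f)" for p
 have Pf: "P p (f p)" if "p \<in> W" for p using someI_ex[OF ex[OF that]] by (simp add: f_def)
 have f: "holo (f p) W" "\<And>x. x \<in> W ==> cmod (f p x) <= 1" "\<And>x. x \<in> W ==> f p x = 0 \<longleftrightarrow> x = p"
  and fmin: "\<And>ph x. holo ph W ==> (\<forall>x\<in>W. cmod (ph x) <= 1) ==> ph p = 0 ==> x \<in> W ==> cmod (ph x) <= cmod (f p x)"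
  if "p \<in> W" for p
  using Pf[OF that] unfolding P_def by blast+
 have f1: "cmod (f p x) < 1" if p: "p \<in> W" and x: "x \<in> W" for p x
 proof (rule ccontr)
  assume "\<not> cmod (f p x) < 1"
  hence 1: "cmod (f p x) = 1" using f(2)[OF p x] by simp
  have "cmod (f p p) = cmod (f p x)"
   by (rule holo_max_modulus[OF f(1)[OF p] oW cW Wh(2) x _ p]) (use 1 f(2)[OF p] in auto)
  thus False using 1 f(3)[OF p p] by simp
 qed
 define ph where "ph p q x = (f p x - f p q) / (1 - cnj (f p q) * f p x)" for p q x
 have den: "1 - cnj (f p q) * f p x ~= 0" if "p \<in> W" "q \<in> W" "x \<in> W" for p q x
 proof
  assume "1 - cnj (f p q) * f p x = 0"
  hence "cmod (cnj (f p q) * f p x) = 1" by (metis eq_iff_diff_eq_0 norm_one)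
  moreover have "cmod (f p q) * cmod (f p x) < 1 * 1" using f1 that by (intro mult_strict_mono') auto
  ultimately show False by (simp add: norm_mult)
 qed
 have hf: "holo (ph p q) W" if "p \<in> W" "q \<in> W" for p q
  using f(1)[OF that(1)] den[OF that] unfolding holo_def ph_def o_def by (auto intro!: holomorphic_intros)
 have ph1: "cmod (ph p q x) <= 1" if "p \<in> W" "q \<in> W" "x \<in> W" for p q x
  using Moebius_function_norm_lt_1[of "f p q" "f p x" 0] f1 that
  by (simp add: ph_def Moebius_function_simple less_imp_le)
 have sym: "cmod (f p q) <= cmod (f q p)" if "p \<in> W" "q \<in> W" for p q
 proof -
  have "cmod (ph p q p) <= cmod (f q p)"
   by (rule fmin[OF that(2) hf[OF that]]) (use ph1 that in \<open>auto simp: ph_def\<close>)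
  moreover have "f p p = 0" using f(3) that by blast
  ultimately show ?thesis by (simp add: ph_def)
 qed
 have inj: "x = q" if p: "p \<in> W" and q: "q \<in> W" and x: "x \<in> W" and eq: "f p x = f p q" for p q x
 proof (rule ccontr)
  assume xq: "x ~= q"
  hence pq: "p ~= q" using f(3)[OF p] q x eq by metis
  define om where "om y = ph p q y / f q y" for y
  have nz: "f q y ~= 0" if "y \<in> W - {q}" for y using f(3)[OF q] that by auto
  have w1: "cmod (om y) <= 1" if "y \<in> W - {q}" for y
  proof -
   have "cmod (ph p q y) <= cmod (f q y)"
    by (rule fmin[OF q hf[OF p q]]) (use ph1 p q that in \<open>auto simp: ph_def\<close>)
   thus ?thesis using nz[OF that] by (simp add: om_def norm_divide)
  qed
  have "cmod (f p q) = cmod (f q p)" using sym p q by (meson antisym)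
  moreover have "f p p = 0" using f(3) p by blast
  ultimately have wp: "cmod (om p) = 1" using nz[of p] p pq by (simp add: om_def ph_def norm_divide)
  have oWq: "open (W - {q})" using oW by (rule open_delete)
  have "holo om (W - {q})"
   unfolding holo_def
  proof
   fix k' assume k': "k' \<in> CC"
   have "(ph p q \<circ> k') holomorphic_on {w\<in>D1. k' w \<in> W - {q}}" "(f q \<circ> k') holomorphic_on {w\<in>D1. k' w \<in> W - {q}}"
    using hf[OF p q] f(1)[OF q] k' holo_subset[of _ W "W - {q}"] unfolding holo_def by blast+
   hence "(%w. (ph p q \<circ> k') w / (f q \<circ> k') w) holomorphic_on {w\<in>D1. k' w \<in> W - {q}}"
    by (rule holomorphic_on_divide) (use nz in auto)
   thus "(om \<circ> k') holomorphic_on {w\<in>D1. k' w \<in> W - {q}}" by (simp add: o_def om_def)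
  qed
  moreover have "connected (W - {q})" using cW oW by (simp add: connected_open_delete)
  ultimately have "cmod (om x) = cmod (om p)"
   by (rule holo_max_modulus[OF _ oWq]) (use w1 wp p pq x xq Wh(2) in auto)
  moreover have "om x = 0" using eq by (simp add: om_def ph_def)
  ultimately show False using wp by simp
 qed
 have "of_real (h - 1) \<in> W" unfolding Wh(1) by simp
 then obtain p where p: "p \<in> W" by blast
 have "inj_on (f p) W" using inj[OF p] by (auto intro: inj_onI)
 moreover have "f p ` W \<subseteq> D1" using f1[OF p] by auto
 ultimately show ?thesis using f(1)[OF p] by blast
qed

section \<open>The Beltrami equation\<close>

text \<open>A family \<open>c k y\<close> stands for the Fourier series \<open>\<Sum>k. c k y e\<^sup>i\<^sup>k\<^sup>x\<close> on the strip
 \<open>\<bar>y\<bar> <= 1\<close>. The decay of its tails is a Besov type condition of order \<open>1/2\<close>, satisfied by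
 \<open>C\<^sup>1\<close> functions, stable under products and under the Beurling transform.\<close>

definition nice :: "real => (int => real => complex) => bool" where
 "nice b c \<longleftrightarrow> (\<forall>k. continuous_on {-1..1} (c k)) &
   (\<forall>y\<in>{-1..1}. \<forall>N F. finite F --> (\<forall>k\<in>F. int N <= \<bar>k\<bar>) --> (\<Sum>k\<in>F. cmod (c k y)) <= b / sqrt (1 + real N))"

lemma niceD:
 assumes "nice b c"
 shows nice_cont: "continuous_on {-1..1} (c k)"
  and nice_tail: "y \<in> {-1..1} ==> finite F ==> (\<And>k. k \<in> F ==> int N <= \<bar>k\<bar>) ==> (\<Sum>k\<in>F. cmod (c k y)) <= b / sqrt (1 + real N)"
  and nice_total: "y \<in> {-1..1} ==> finite F ==> (\<Sum>k\<in>F. cmod (c k y)) <= b"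
  and nice_bound: "y \<in> {-1..1} ==> cmod (c k y) <= b"
  and nice_nonneg: "0 <= b"
proof -
 show "continuous_on {-1..1} (c k)" using assms by (simp add: nice_def)
 show t: "(\<Sum>k\<in>F. cmod (c k y)) <= b / sqrt (1 + real N)"
  if "y \<in> {-1..1}" "finite F" "\<And>k. k \<in> F ==> int N <= \<bar>k\<bar>" for y F N
  using assms that by (simp add: nice_def)
 show t0: "(\<Sum>k\<in>F. cmod (c k y)) <= b" if "y \<in> {-1..1}" "finite F" for y F
  using t[OF that, of 0] by simp
 show "cmod (c k y) <= b" if "y \<in> {-1..1}" using t0[OF that, of "{k}"] by simp
 show "0 <= b" using t0[of 0 "{}"] by simp
qed

lemma nice_mono: "nice b c ==> b <= b' ==> nice b' c"
 unfolding nice_def by (meson divide_right_mono order_trans real_sqrt_ge_zero add_nonneg_nonneg zero_le_one of_nat_0_le_iff)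

lemma nice_add: "nice b c ==> nice b' c' ==> nice (b + b') (%k y. c k y + c' k y)"
 unfolding nice_def
proof (intro conjI allI ballI impI)
 fix y :: real and N F
 assume a: "(\<forall>k. continuous_on {-1..1} (c k)) & (\<forall>y\<in>{-1..1}. \<forall>N F. finite F --> (\<forall>k\<in>F. int N <= \<bar>k\<bar>) --> (\<Sum>k\<in>F. cmod (c k y)) <= b / sqrt (1 + real N))"
  "(\<forall>k. continuous_on {-1..1} (c' k)) & (\<forall>y\<in>{-1..1}. \<forall>N F. finite F --> (\<forall>k\<in>F. int N <= \<bar>k\<bar>) --> (\<Sum>k\<in>F. cmod (c' k y)) <= b' / sqrt (1 + real N))"
  and y: "y \<in> {-1..1}" and F: "finite F" "\<forall>k\<in>F. int N <= \<bar>k\<bar>"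
 have "(\<Sum>k\<in>F. cmod (c k y + c' k y)) <= (\<Sum>k\<in>F. cmod (c k y)) + (\<Sum>k\<in>F. cmod (c' k y))"
  unfolding sum.distrib[symmetric] by (intro sum_mono norm_triangle_ineq)
 also have "\<dots> <= b / sqrt (1 + real N) + b' / sqrt (1 + real N)" using a y F by (intro add_mono) auto
 finally show "(\<Sum>k\<in>F. cmod (c k y + c' k y)) <= (b + b') / sqrt (1 + real N)" by (simp add: add_divide_distrib)
qed (intro continuous_intros, auto)

lemma nice_cmult: "nice b c ==> nice (cmod a * b) (%k y. a * c k y)"
 unfolding nice_def
proof (intro conjI allI ballI impI)
 fix y :: real and N F
 assume a: "(\<forall>k. continuous_on {-1..1} (c k)) & (\<forall>y\<in>{-1..1}. \<forall>N F. finite F --> (\<forall>k\<in>F. int N <= \<bar>k\<bar>) --> (\<Sum>k\<in>F. cmod (c k y)) <= b / sqrt (1 + real N))"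
  and y: "y \<in> {-1..1}" and F: "finite F" "\<forall>k\<in>F. int N <= \<bar>k\<bar>"
 have "(\<Sum>k\<in>F. cmod (a * c k y)) = cmod a * (\<Sum>k\<in>F. cmod (c k y))" by (simp add: norm_mult sum_distrib_left)
 also have "\<dots> <= cmod a * (b / sqrt (1 + real N))" using a y F by (intro mult_left_mono) auto
 finally show "(\<Sum>k\<in>F. cmod (a * c k y)) <= cmod a * b / sqrt (1 + real N)" by simp
qed (intro continuous_intros, auto)

lemma nice_diff: "nice b c ==> nice b' c' ==> nice (b + b') (%k y. c k y - c' k y)"
 using nice_add[of b c b' "%k y. -1 * c' k y"] nice_cmult[of b' c' "-1"] by simp

lemma nice_summable: "nice b c ==> y \<in> {-1..1} ==> (%k. cmod (c k y)) summable_on A"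
 unfolding Infinite_Sum.abs_summable_iff_bdd_above by (rule bdd_aboveI2[of _ _ b]) (auto intro: nice_total)

lemma nice_infsum_bound:
 assumes c: "nice b c" and y: "y \<in> {-1..1}" and A: "\<And>k. k \<in> A ==> int N <= \<bar>k\<bar>"
  and d: "\<And>k. cmod (d k) <= cmod (c k y)"
 shows "d summable_on A" "cmod (infsum d A) <= b / sqrt (1 + real N)"
proof -
 have "(%k. cmod (d k)) summable_on A"
  using nice_summable[OF c y] d by (rule Infinite_Sum.abs_summable_on_comparison_test)
 thus s: "d summable_on A" by (rule Infinite_Sum.abs_summable_summable)
 show "cmod (infsum d A) <= b / sqrt (1 + real N)"
 proof (rule tendsto_upperbound[OF tendsto_norm[OF infsum_tendsto[OF s]]])
  show "\<forall>\<^sub>F F in finite_subsets_at_top A. cmod (sum d F) <= b / sqrt (1 + real N)"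
  proof (rule eventually_finite_subsets_at_top_weakI)
   fix F assume F: "finite F" "F \<subseteq> A"
   have "cmod (sum d F) <= (\<Sum>k\<in>F. cmod (c k y))" using d by (rule sum_norm_le)
   also have "\<dots> <= b / sqrt (1 + real N)" using nice_tail[OF c y F(1)] F A by blast
   finally show "cmod (sum d F) <= b / sqrt (1 + real N)" .
  qed
 qed simp
qed

lemma nice_uniform_tail:
 assumes c: "nice b c" and e: "0 < e"
 shows "\<forall>\<^sub>F n in sequentially. \<forall>y\<in>{-1..1}. \<forall>d A. (\<forall>k. cmod (d k) <= cmod (c k y)) --> (\<forall>k\<in>A. int n < \<bar>k\<bar>) --> cmod (infsum d A) < e"
proof -
 have "(%n. b / sqrt (1 + real n)) \<longlonglongrightarrow> 0"
  by (intro tendsto_divide_0[OF tendsto_const] filterlim_at_top_imp_at_infinity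
    filterlim_compose[OF sqrt_at_top] filterlim_tendsto_add_at_top[OF tendsto_const filterlim_real_sequentially])
 hence "\<forall>\<^sub>F n in sequentially. b / sqrt (1 + real n) < e" using e by (rule order_tendstoD)
 thus ?thesis
 proof (rule eventually_mono, intro ballI allI impI)
  fix n y d A assume "b / sqrt (1 + real n) < e" "y \<in> {-1..(1::real)}"
   and d: "\<forall>k. cmod (d k) <= cmod (c k y)" and A: "\<forall>k\<in>A. int n < \<bar>k\<bar>"
  moreover have "cmod (infsum d A) <= b / sqrt (1 + real n)"
   by (rule nice_infsum_bound[OF c \<open>y \<in> _\<close>]) (use d A in force)+
  ultimately show "cmod (infsum d A) < e" by simp
 qed
qed

lemma infsum_split_int:
 fixes d :: "int => complex"
 assumes "d summable_on UNIV"
 shows "infsum d UNIV = (\<Sum>k=-int n..int n. d k) + infsum d {k. int n < \<bar>k\<bar>}"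
proof -
 have U: "UNIV = {-int n..int n} \<union> {k. int n < \<bar>k\<bar>}" "{-int n..int n} \<inter> {k. int n < \<bar>k\<bar>} = {}" by auto
 have "d summable_on A" for A using assms summable_on_subset_banach by blast
 thus ?thesis
  using infsum_Un_disjoint[OF _ _ U(2), of d] U(1) by simp
qed

definition conv :: "(int => real => complex) => (int => real => complex) => int => real => complex" where
 "conv a c k y = (\<Sum>\<^sub>\<infinity>j. a j y * c (k - j) y)"

lemma conv_term:
 assumes "nice g c" "y \<in> {-1..1}"
 shows "cmod (a j y * c (k - j) y) <= cmod (complex_of_real g * a j y)"
proof -
 have "cmod (a j y) * cmod (c (k - j) y) <= cmod (a j y) * g"
  using nice_bound[OF assms] by (intro mult_left_mono) auto
 thus ?thesis using nice_nonneg[OF assms(1)] by (simp add: norm_mult mult.commute)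
qed

lemma conv_summable:
 assumes a: "nice al a" and c: "nice g c" and y: "y \<in> {-1..1}"
 shows "(%j. a j y * c (k - j) y) summable_on A"
proof (rule nice_infsum_bound(1)[OF nice_cmult[OF a, of "of_real g"] y, where N = 0])
qed (simp, rule conv_term[OF c y])

lemma conv_cont:
 assumes a: "nice al a" and c: "nice g c"
 shows "continuous_on {-1..1} (conv a c k)"
proof (rule uniform_limit_theorem[OF _ _ trivial_limit_sequentially])
 let ?f = "%n y. \<Sum>j=-int n..int n. a j y * c (k - j) y"
 show "\<forall>\<^sub>F n in sequentially. continuous_on {-1..1} (?f n)"
  by (intro always_eventually allI continuous_intros nice_cont[OF a] nice_cont[OF c])
 show "uniform_limit {-1..1} ?f (conv a c k) sequentially"
 proof (rule uniform_limitI)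
  fix e :: real assume "0 < e"
  from nice_uniform_tail[OF nice_cmult[OF a, of "of_real g"] this]
  show "\<forall>\<^sub>F n in sequentially. \<forall>y\<in>{-1..1}. dist (?f n y) (conv a c k y) < e"
  proof (rule eventually_mono, intro ballI)
   fix n y assume *: "\<forall>y\<in>{-1..1}. \<forall>d A. (\<forall>k. cmod (d k) <= cmod (complex_of_real g * a k y)) --> (\<forall>k\<in>A. int n < \<bar>k\<bar>) --> cmod (infsum d A) < e"
    and y: "y \<in> {-1..(1::real)}"
   have "cmod (infsum (%j. a j y * c (k - j) y) {j. int n < \<bar>j\<bar>}) < e"
    using * y conv_term[OF c y, of a] by simp
   thus "dist (?f n y) (conv a c k y) < e"
    using infsum_split_int[OF conv_summable[OF a c y], of k n]
    by (simp add: conv_def dist_norm norm_minus_commute)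
  qed
 qed
qed

lemma sum_norm_infsum_le:
 fixes x :: "'k => 'j => complex"
 assumes s: "\<And>k. k \<in> F ==> x k summable_on UNIV"
  and B: "\<And>G. finite G ==> (\<Sum>k\<in>F. cmod (\<Sum>j\<in>G. x k j)) <= B"
 shows "(\<Sum>k\<in>F. cmod (infsum (x k) UNIV)) <= B"
proof (rule tendsto_upperbound)
 show "((%G. \<Sum>k\<in>F. cmod (sum (x k) G)) \<longlongrightarrow> (\<Sum>k\<in>F. cmod (infsum (x k) UNIV))) (finite_subsets_at_top UNIV)"
  by (intro tendsto_sum tendsto_norm infsum_tendsto s)
 show "\<forall>\<^sub>F G in finite_subsets_at_top UNIV. (\<Sum>k\<in>F. cmod (sum (x k) G)) <= B"
  by (rule eventually_finite_subsets_at_top_weakI) (rule B)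
qed simp

text \<open>In each product one factor carries at least half of the frequency. Either factor
  contributes a tail at \<open>M\<close>, about half of \<open>N\<close>, and passing back from
  \<open>M\<close> to \<open>N\<close> raises the constant from 2 to 3.\<close>

lemma nice_conv:
 assumes a: "nice al a" and c: "nice g c"
 shows "nice (3 * al * g) (conv a c)"
 unfolding nice_def
proof (intro conjI allI ballI impI conv_cont[OF a c])
 fix y :: real and N F assume y: "y \<in> {-1..1}" and F: "finite F" "\<forall>k\<in>F. int N <= \<bar>k\<bar>"
 have ag: "0 <= al" "0 <= g" using nice_nonneg a c by auto
 \<comment> \<open>Half of \<open>N\<close>, rounded up: if \<open>\<bar>k\<bar>\<close> is at least
   \<open>N\<close> and \<open>\<bar>j\<bar>\<close> is below \<open>M\<close>, then
   \<open>\<bar>k - j\<bar>\<close> is at least \<open>M\<close>.\<close>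
 define M where "M = (N + 1) div 2"
 have M: "N <= 2 * M" "2 * M <= N + 1" by (auto simp: M_def)
 have "(\<Sum>k\<in>F. cmod (conv a c k y)) <= 2 * al * g / sqrt (1 + real M)"
  unfolding conv_def
 proof (rule sum_norm_infsum_le)
  fix G :: "int set" assume G: "finite G"
  have in1: "(\<Sum>k\<in>F. cmod (c (k - j) y)) <= g / sqrt (1 + real L)" if "\<And>k. k \<in> F ==> int L <= \<bar>k - j\<bar>" for j L
  proof -
   have "(\<Sum>k\<in>F. cmod (c (k - j) y)) = (\<Sum>l\<in>(%k. k - j) ` F. cmod (c l y))"
    by (subst sum.reindex) (auto simp: inj_on_def)
   also have "\<dots> <= g / sqrt (1 + real L)" using F that by (intro nice_tail[OF c y]) auto
   finally show ?thesis .
  qed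
  have "(\<Sum>k\<in>F. cmod (\<Sum>j\<in>G. a j y * c (k - j) y)) <= (\<Sum>k\<in>F. \<Sum>j\<in>G. cmod (a j y) * cmod (c (k - j) y))"
   by (intro sum_mono order_trans[OF norm_sum]) (simp add: norm_mult)
  also have "\<dots> = (\<Sum>j\<in>G. cmod (a j y) * (\<Sum>k\<in>F. cmod (c (k - j) y)))"
   by (subst sum.swap) (simp add: sum_distrib_left)
  also have "\<dots> <= (\<Sum>j\<in>G. cmod (a j y) * (if int M <= \<bar>j\<bar> then g else g / sqrt (1 + real M)))"
  proof (intro sum_mono mult_left_mono)
   fix j assume "j \<in> G"
   show "(\<Sum>k\<in>F. cmod (c (k - j) y)) <= (if int M <= \<bar>j\<bar> then g else g / sqrt (1 + real M))" using in1[of 0 j] F M in1[of M j] by force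
  qed simp
  also have "\<dots> = g * (\<Sum>j\<in>{j\<in>G. int M <= \<bar>j\<bar>}. cmod (a j y)) + g / sqrt (1 + real M) * (\<Sum>j\<in>{j\<in>G. \<not> int M <= \<bar>j\<bar>}. cmod (a j y))"
   unfolding if_distrib[of "(*) _"] sum.If_cases[OF G] by (simp add: sum_distrib_left mult.commute Int_def)
  also have "\<dots> <= g * (al / sqrt (1 + real M)) + g / sqrt (1 + real M) * al"
   using G y ag by (intro add_mono mult_left_mono nice_tail[OF a] nice_total[OF a]) auto
  finally show "(\<Sum>k\<in>F. cmod (\<Sum>j\<in>G. a j y * c (k - j) y)) <= 2 * al * g / sqrt (1 + real M)"
   by (simp add: mult_ac)
 qed (rule conv_summable[OF a c y])
 also have "\<dots> <= 3 * al * g / sqrt (1 + real N)"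
 proof -
  have "2 * sqrt (1 + real N) <= 3 * sqrt (1 + real M)"
   by (rule power2_le_imp_le) (use M in \<open>simp_all add: power_mult_distrib\<close>)
  hence "(al * g) * (2 * sqrt (1 + real N)) <= (al * g) * (3 * sqrt (1 + real M))"
   using ag by (intro mult_left_mono) auto
  moreover have "0 < sqrt (1 + real N)" "0 < sqrt (1 + real M)" by simp_all
  ultimately show ?thesis by (simp add: field_simps)
 qed
 finally show "(\<Sum>k\<in>F. cmod (conv a c k y)) <= 3 * al * g / sqrt (1 + real N)" .
qed

definition fsum :: "(int => real => complex) => complex => complex" where
 "fsum c z = (\<Sum>\<^sub>\<infinity>k. c k (Im z) * cis (of_int k * Re z))"

lemma fsum_bound: "nice b c ==> Im z \<in> {-1..1} ==> cmod (fsum c z) <= b"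
 using nice_infsum_bound(2)[of b c "Im z" UNIV 0 "%k. c k (Im z) * cis (of_int k * Re z)"]
 by (simp add: fsum_def norm_mult)

lemma fsum_summable: "nice b c ==> Im z \<in> {-1..1} ==> (%k. cmod (c k (Im z) * cis (of_int k * Re z))) summable_on UNIV"
 using nice_summable[of b c "Im z" UNIV] by (simp add: norm_mult)

lemma fsum_uniform:
 assumes c: "nice b c"
 shows "uniform_limit {z. Im z \<in> {-1..1}} (%n z. \<Sum>k=-int n..int n. c k (Im z) * cis (of_int k * Re z)) (fsum c) sequentially"
proof (rule uniform_limitI)
 fix e :: real assume "0 < e"
 from nice_uniform_tail[OF c this]
 show "\<forall>\<^sub>F n in sequentially. \<forall>z\<in>{z. Im z \<in> {-1..1}}. dist (\<Sum>k=-int n..int n. c k (Im z) * cis (of_int k * Re z)) (fsum c z) < e"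
 proof (rule eventually_mono, intro ballI)
  fix n z assume *: "\<forall>y\<in>{-1..1}. \<forall>d A. (\<forall>k. cmod (d k) <= cmod (c k y)) --> (\<forall>k\<in>A. int n < \<bar>k\<bar>) --> cmod (infsum d A) < e"
   and z: "z \<in> {z. Im z \<in> {-1..1}}"
  thus "dist (\<Sum>k=-int n..int n. c k (Im z) * cis (of_int k * Re z)) (fsum c z) < e" using infsum_split_int[OF Infinite_Sum.abs_summable_summable[OF fsum_summable[OF c]], of z n] z by (simp add: norm_mult fsum_def dist_norm norm_minus_commute)
 qed
qed

lemma fsum_cont: "nice b c ==> continuous_on {z. Im z \<in> {-1..1}} (fsum c)"
proof (rule uniform_limit_theorem[OF _ fsum_uniform trivial_limit_sequentially])
 assume c: "nice b c"
 have "continuous_on {z. Im z \<in> {-1..1}} (%z. c k (Im z))" for k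
  by (rule continuous_on_compose2[OF nice_cont[OF c] continuous_on_Im]) auto
 thus "\<forall>\<^sub>F n in sequentially. continuous_on {z. Im z \<in> {-1..1}} (%z. \<Sum>k=-int n..int n. c k (Im z) * cis (of_int k * Re z))"
  by (intro always_eventually allI continuous_intros) auto
qed

lemma fsum_conv:
 assumes a: "nice al a" and c: "nice ga c" and z: "Im z \<in> {-1..1}"
 shows "fsum (conv a c) z = fsum a z * fsum c z"
proof -
 let ?y = "Im z"
 define A where "A j = a j ?y * cis (of_int j * Re z)" for j
 define C where "C l = c l ?y * cis (of_int l * Re z)" for l
 have As: "(%j. cmod (A j)) summable_on UNIV" and Cs: "(%l. cmod (C l)) summable_on UNIV"
  using fsum_summable[OF a z] fsum_summable[OF c z] by (simp_all add: A_def C_def)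
 have AC: "(%(j, l). A j * C l) summable_on UNIV \<times> UNIV"
 proof (rule Infinite_Sum.abs_summable_summable, unfold Infinite_Sum.abs_summable_on_Sigma_iff, intro conjI ballI)
  show "(%l. cmod (case (j, l) of (j, l) => A j * C l)) summable_on UNIV" for j
   using Cs by (simp add: norm_mult summable_on_cmult_right)
  show "(%j. norm (\<Sum>\<^sub>\<infinity>l. norm (case (j, l) of (j, l) => A j * C l))) summable_on UNIV"
   using As by (simp add: norm_mult infsum_cmult_right' summable_on_cmult_left infsum_nonneg)
 qed
 have bij: "bij_betw (%(k, j). (j, k - j)) (UNIV \<times> UNIV) (UNIV \<times> (UNIV :: int set))"
  by (rule bij_betwI[where g = "%(j, l). (j + l, j)"]) auto
 have KJ: "(%(k, j). A j * C (k - j)) summable_on UNIV \<times> UNIV"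
  using summable_on_reindex_bij_betw[OF bij, of "%(j, l). A j * C l"] AC by (simp add: case_prod_unfold)
 have "fsum a z * fsum c z = (\<Sum>\<^sub>\<infinity>j. \<Sum>\<^sub>\<infinity>l. A j * C l)"
  by (simp add: fsum_def A_def C_def infsum_cmult_right' infsum_cmult_left')
 also have "\<dots> = infsum (%(j, l). A j * C l) (UNIV \<times> UNIV)" by (rule infsum_Sigma'_banach[OF AC])
 also have "\<dots> = infsum (%(k, j). A j * C (k - j)) (UNIV \<times> UNIV)"
  using infsum_reindex_bij_betw[OF bij, of "%(j, l). A j * C l"] by (simp add: case_prod_unfold)
 also have "\<dots> = (\<Sum>\<^sub>\<infinity>k. \<Sum>\<^sub>\<infinity>j. A j * C (k - j))" by (rule infsum_Sigma'_banach[OF KJ, symmetric])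
 also have "\<dots> = fsum (conv a c) z"
  unfolding fsum_def conv_def
 proof (rule infsum_cong)
  fix k :: int
  have "A j * C (k - j) = (a j ?y * c (k - j) ?y) * cis (of_int k * Re z)" for j by (simp add: cis_mult algebra_simps A_def C_def mult_ac)
  thus "(\<Sum>\<^sub>\<infinity>j. A j * C (k - j)) = (\<Sum>\<^sub>\<infinity>j. a j ?y * c (k - j) ?y) * cis (of_int k * Re z)"
   by (simp add: infsum_cmult_left')
 qed
 finally show ?thesis ..
qed

lemma conv_diff:
 assumes a: "nice al a" and c: "nice g c" "nice g' c'" and y: "y \<in> {-1..1}"
 shows "conv a c k y - conv a c' k y = conv a (%k y. c k y - c' k y) k y"
 unfolding conv_def
 using infsum_add[OF conv_summable[OF a nice_diff[OF c] y, of k UNIV] conv_summable[OF a c(2) y, of k UNIV]]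
 by (simp add: algebra_simps)

lemma nice_cong: "nice b c ==> (\<And>k y. y \<in> {-1..1} ==> c k y = c' k y) ==> nice b c'"
proof -
 assume c: "nice b c" and eq: "\<And>k y. y \<in> {-1..1} ==> c k y = c' k y"
 have "continuous_on {-1..1} (c' k)" for k
  using nice_cont[OF c, of k] eq by (rule continuous_on_eq)
 thus ?thesis using c eq unfolding nice_def by simp
qed

text \<open>The Fourier coefficients of a solution of \<open>f\<^sub>x + i f\<^sub>y = 2 h\<close>; the choice of the
 constants of integration makes the kernel decay in \<open>\<bar>k\<bar>\<close> on both sides.\<close>

definition prim :: "(int => real => complex) => int => real => complex" where
 "prim h k y = -2 * \<i> * of_real (exp (- of_int k * y)) *
   (integral {-1..y} (%t. of_real (exp (of_int k * t)) * h k t)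
   - (if k < 0 then integral {-1..1} (%t. of_real (exp (of_int k * t)) * h k t) else 0))"

text \<open>If \<open>f\<close> has the coefficients \<open>prim h\<close>, its derivative with
  respect to the conjugate variable is \<open>h\<close>, and the complex derivative is
  \<open>f_x\<close> minus this; these are the coefficients of that difference.\<close>

definition beurling :: "(int => real => complex) => int => real => complex" where
 "beurling h k y = \<i> * of_int k * prim h k y - h k y"

lemma exp_h_cont: "nice b h ==> A \<subseteq> {-1..1} ==> continuous_on A (%t. of_real (exp (of_int k * t)) * h k t)"
 by (intro continuous_intros continuous_on_subset[OF nice_cont]) auto

lemma prim_deriv:
 assumes h: "nice b h" and y: "y \<in> {-1..1}"
 shows "(prim h k has_vector_derivative (- of_int k * prim h k y - 2 * \<i> * h k y)) (at y within {-1..1})"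
proof -
 let ?I = "%y. integral {-1..y} (%t. of_real (exp (of_int k * t)) * h k t)"
 define c where "c = (if k < 0 then integral {-1..1} (%t. of_real (exp (of_int k * t)) * h k t) else 0)"
 have I: "(?I has_vector_derivative (of_real (exp (of_int k * y)) * h k y)) (at y within {-1..1})"
  by (rule integral_has_vector_derivative[OF exp_h_cont[OF h order_refl] y])
 have "((%y. exp (- of_int k * y)) has_real_derivative (- of_int k * exp (- of_int k * y))) (at y within {-1..1})"
  by (auto intro!: derivative_eq_intros)
 hence E: "((%y. complex_of_real (exp (- of_int k * y))) has_vector_derivative of_real (- of_int k * exp (- of_int k * y))) (at y within {-1..1})"
  by (rule has_vector_derivative_of_real)
 have "((%y. (-2 * \<i>) * (complex_of_real (exp (- of_int k * y)) * (?I y - c))) has_vector_derivative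
   (-2 * \<i>) * (of_real (exp (- of_int k * y)) * (of_real (exp (of_int k * y)) * h k y) + of_real (- of_int k * exp (- of_int k * y)) * (?I y - c))) (at y within {-1..1})"
  by (intro has_vector_derivative_mult_right has_vector_derivative_mult[OF E] has_vector_derivative_diff_const[THEN iffD2] I)
 moreover have "complex_of_real (exp (- of_int k * y)) * of_real (exp (of_int k * y)) = 1"
  by (simp only: of_real_mult[symmetric] exp_add[symmetric]) simp
 hence "(-2 * \<i>) * (of_real (exp (- of_int k * y)) * (of_real (exp (of_int k * y)) * h k y) + of_real (- of_int k * exp (- of_int k * y)) * (?I y - c))
   = - of_int k * prim h k y - 2 * \<i> * h k y"
  by (simp add: prim_def c_def[symmetric] algebra_simps)
 moreover have "prim h k = (%y. (-2 * \<i>) * (complex_of_real (exp (- of_int k * y)) * (?I y - c)))"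
  by (simp add: prim_def[abs_def] c_def mult.assoc)
 ultimately show ?thesis by simp
qed

lemma prim_cont: "nice b h ==> continuous_on {-1..1} (prim h k)"
 unfolding continuous_on_eq_continuous_within using prim_deriv has_vector_derivative_continuous by blast

lemma prim_bound:
 assumes h: "nice b h" and y: "y \<in> {-1..1}"
 shows "cmod (prim h k y) <= 2 * integral {-1..1} (%t. exp (- \<bar>of_int k\<bar> * \<bar>y - t\<bar>) * cmod (h k t))"
proof -
 let ?f = "%t. of_real (exp (of_int k * t)) * h k t" and ?w = "%t. exp (- \<bar>of_int k\<bar> * \<bar>y - t\<bar>) * cmod (h k t)"
 have int: "?f integrable_on {a..c}" "?w integrable_on {a..c}" if "{a..c} \<subseteq> {-1..1}" for a c
  by (intro integrable_continuous_interval exp_h_cont[OF h that] continuous_intros continuous_on_subset[OF nice_cont[OF h] that])+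
 have key: "cmod (of_real (exp (- of_int k * y)) * integral {a..c} ?f) <= integral {-1..1} ?w"
  if ac: "{a..c} \<subseteq> {-1..1}" and sgn: "\<And>t. t \<in> {a..c} ==> of_int k * (y - t) = \<bar>of_int k\<bar> * \<bar>y - t\<bar>" for a c
 proof -
  have "of_real (exp (- of_int k * y)) * integral {a..c} ?f = integral {a..c} (%t. of_real (exp (- of_int k * y)) * ?f t)"
   by (rule integral_mult_right[symmetric])
  also have "cmod \<dots> <= integral {a..c} ?w"
  proof (rule integral_norm_bound_integral)
   show "(%t. complex_of_real (exp (- of_int k * y)) * ?f t) integrable_on {a..c}"
    using int(1)[OF ac] by (intro integrable_on_mult_right)
   show "cmod (complex_of_real (exp (- of_int k * y)) * ?f t) <= ?w t" if "t \<in> {a..c}" for t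
   proof -
    have "exp (- of_int k * y) * exp (of_int k * t) = exp (- (of_int k * (y - t)))"
     unfolding exp_add[symmetric] by (simp add: algebra_simps)
    thus ?thesis using sgn[OF that] by (simp add: norm_mult mult.assoc[symmetric])
   qed
  qed (rule int(2)[OF ac])
  also have "\<dots> <= integral {-1..1} ?w"
   by (rule integral_subset_le[OF ac int(2)[OF ac] int(2)[OF order_refl]]) auto
  finally show ?thesis .
 qed
 show ?thesis
 proof (cases "k < 0")
  case False
  have "cmod (of_real (exp (- of_int k * y)) * integral {-1..y} ?f) <= integral {-1..1} ?w"
   by (rule key) (use False y in auto)
  thus ?thesis using False by (simp add: prim_def norm_mult)
 next
  case True
  have "integral {-1..y} ?f + integral {y..1} ?f = integral {-1..1} ?f"
   by (rule Henstock_Kurzweil_Integration.integral_combine) (use y int(1)[of "-1" 1] in auto)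
  hence "integral {-1..y} ?f - integral {-1..1} ?f = - integral {y..1} ?f" by (simp add: algebra_simps)
  moreover have "cmod (of_real (exp (- of_int k * y)) * integral {y..1} ?f) <= integral {-1..1} ?w"
   by (rule key) (use True y in \<open>auto simp: abs_if algebra_simps\<close>)
  ultimately show ?thesis using True by (simp add: prim_def norm_mult)
 qed
qed

lemma integral_exp_le:
 assumes M: "0 < M" and y: "y \<in> {-1..1}"
 shows "integral {-1..1} (%t. exp (- M * \<bar>y - t\<bar>)) <= 2 / (M::real)"
proof -
 have "((%t. exp (- M * (y - t))) has_integral (exp (- M * (y - y)) / M - exp (- M * (y - -1)) / M)) {-1..y}"
  using y M by (intro fundamental_theorem_of_calculus)
   (auto intro!: derivative_eq_intros simp: has_real_derivative_iff_has_vector_derivative[symmetric])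
 hence 1: "((%t. exp (- M * \<bar>y - t\<bar>)) has_integral (1 / M - exp (- M * (y - -1)) / M)) {-1..y}"
  by (subst has_integral_cong[where g = "%t. exp (- M * (y - t))"]) auto
 have "((%t. exp (- M * (t - y))) has_integral (- exp (- M * (1 - y)) / M - - exp (- M * (y - y)) / M)) {y..1}"
  using y M by (intro fundamental_theorem_of_calculus)
   (auto intro!: derivative_eq_intros simp: has_real_derivative_iff_has_vector_derivative[symmetric])
 hence 2: "((%t. exp (- M * \<bar>y - t\<bar>)) has_integral (1 / M - exp (- M * (1 - y)) / M)) {y..1}"
  by (subst has_integral_cong[where g = "%t. exp (- M * (t - y))"]) auto
 have "integral {-1..1} (%t. exp (- M * \<bar>y - t\<bar>)) = 1 / M - exp (- M * (y - -1)) / M + (1 / M - exp (- M * (1 - y)) / M)"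
  using y by (intro integral_unique has_integral_combine[OF _ _ 1 2]) auto
 moreover have "0 <= exp (- M * (y - -1)) / M" "0 <= exp (- M * (1 - y)) / M" using M by simp_all
 ultimately show ?thesis by simp
qed

text \<open>In a dyadic block every kernel lies below the one of rate \<open>M\<close>, so the sum
  over \<open>k\<close> can be taken under the integral before anything is lost. The factor
  \<open>\<bar>k\<bar>\<close>, at most \<open>2 * M\<close>, then cancels against the kernel's mass
  \<open>2 / M\<close>; the remaining 2 comes from \<open>prim_bound\<close>.\<close>

lemma prim_block:
 assumes h: "nice b h" and y: "y \<in> {-1..1}" and M: "1 <= M" and F: "finite F" "\<And>k. k \<in> F ==> int M <= \<bar>k\<bar> & \<bar>k\<bar> < 2 * int M"
 shows "(\<Sum>k\<in>F. \<bar>of_int k\<bar> * cmod (prim h k y)) <= 8 * b / sqrt (1 + real M)"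
proof -
 let ?w = "%k t. exp (- \<bar>of_int k\<bar> * \<bar>y - t\<bar>) * cmod (h k t)" and ?e = "%t. exp (- real M * \<bar>y - t\<bar>)"
 have wi: "(%t. exp (- L * \<bar>y - t\<bar>) * cmod (h k t)) integrable_on {-1..1}" for L k
  by (intro integrable_continuous_interval continuous_intros nice_cont[OF h])
 have ei: "?e integrable_on {-1..1}" by (intro integrable_continuous_interval continuous_intros)
 have "(\<Sum>k\<in>F. \<bar>of_int k\<bar> * cmod (prim h k y)) <= (\<Sum>k\<in>F. (2 * real M) * (2 * integral {-1..1} (%t. ?e t * cmod (h k t))))"
 proof (intro sum_mono mult_mono)
  fix k assume k: "k \<in> F"
  have rk: "real M <= \<bar>of_int k\<bar>" "\<bar>real_of_int k\<bar> <= 2 * real M" using F(2)[OF k] by linarith+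
  thus "\<bar>real_of_int k\<bar> <= 2 * real M" by simp
  have "integral {-1..1} (?w k) <= integral {-1..1} (%t. ?e t * cmod (h k t))" using rk(1) integral_le[OF wi wi] mult_right_mono by (simp add: mult_right_mono)
  thus "cmod (prim h k y) <= 2 * integral {-1..1} (%t. ?e t * cmod (h k t))"
   using prim_bound[OF h y, of k] by simp
 qed auto
 also have "\<dots> = 4 * real M * integral {-1..1} (%t. \<Sum>k\<in>F. ?e t * cmod (h k t))"
  by (subst integral_sum[OF F(1) wi]) (simp add: sum_distrib_left mult_ac)
 also have "\<dots> <= 4 * real M * integral {-1..1} (%t. b / sqrt (1 + real M) * ?e t)"
 proof (intro mult_left_mono integral_le)
  show "(%t. \<Sum>k\<in>F. ?e t * cmod (h k t)) integrable_on {-1..1}" using F(1) wi by (intro integrable_sum)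
  show "(%t. b / sqrt (1 + real M) * ?e t) integrable_on {-1..1}" using ei by (intro integrable_on_mult_right)
  fix t :: real assume t: "t \<in> {-1..1}"
  have "(\<Sum>k\<in>F. ?e t * cmod (h k t)) = ?e t * (\<Sum>k\<in>F. cmod (h k t))" by (simp add: sum_distrib_left)
  also have "\<dots> <= ?e t * (b / sqrt (1 + real M))" using nice_tail[OF h t F(1)] F(2) by (intro mult_left_mono) auto
  finally show "(\<Sum>k\<in>F. ?e t * cmod (h k t)) <= b / sqrt (1 + real M) * ?e t" by (simp add: mult.commute)
 qed auto
 also have "\<dots> = b / sqrt (1 + real M) * (4 * real M * integral {-1..1} ?e)" by (simp add: mult_ac)
 also have "\<dots> <= b / sqrt (1 + real M) * 8"
 proof (rule mult_left_mono)
  have "real M * integral {-1..1} ?e <= real M * (2 / real M)"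
   using integral_exp_le[OF _ y, of "real M"] M by (intro mult_left_mono) auto
  thus "4 * real M * integral {-1..1} ?e <= 8" using M by simp
  show "0 <= b / sqrt (1 + real M)" using nice_nonneg[OF h] by simp
 qed
 finally show ?thesis by (simp add: mult.commute)
qed

text \<open>Dyadic blocks are summed as a geometric series of ratio \<open>1 / sqrt 2\<close>. The
  constant must satisfy \<open>8 + c / sqrt 2 <= c\<close>, and 28 does.\<close>

lemma prim_tail:
 assumes h: "nice b h" and y: "y \<in> {-1..1}"
 shows "1 <= N ==> finite F ==> (\<And>k. k \<in> F ==> int N <= \<bar>k\<bar> & \<bar>k\<bar> < int N * 2 ^ n) ==>
  (\<Sum>k\<in>F. \<bar>of_int k\<bar> * cmod (prim h k y)) <= 28 * b / sqrt (real N)"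
proof (induction n arbitrary: N F)
 case 0
 hence "F = {}" by force
 thus ?case using nice_nonneg[OF h] by simp
next
 case (Suc n)
 let ?g = "%k. \<bar>of_int k\<bar> * cmod (prim h k y)"
 have "sum ?g F = sum ?g {k\<in>F. \<bar>k\<bar> < 2 * int N} + sum ?g {k\<in>F. \<not> \<bar>k\<bar> < 2 * int N}" using Suc.prems(2) sum.Int_Diff[of F ?g "{k. \<bar>k\<bar> < 2 * int N}"] by (simp add: Int_def set_diff_eq)
 also have "\<dots> <= 8 * b / sqrt (1 + real N) + 28 * b / sqrt (real (2 * N))"
 proof (rule add_mono)
  show "sum ?g {k\<in>F. \<bar>k\<bar> < 2 * int N} <= 8 * b / sqrt (1 + real N)"
   using Suc.prems by (intro prim_block[OF h y]) auto
  show "sum ?g {k\<in>F. \<not> \<bar>k\<bar> < 2 * int N} <= 28 * b / sqrt (real (2 * N))"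
  proof (rule Suc.IH)
   fix k assume "k \<in> {k\<in>F. \<not> \<bar>k\<bar> < 2 * int N}"
   thus "int (2 * N) <= \<bar>k\<bar> & \<bar>k\<bar> < int (2 * N) * 2 ^ n" using Suc.prems(3)[of k] by simp
  qed (use Suc.prems in auto)
 qed
 also have "\<dots> <= 8 * b / sqrt (real N) + 20 * b / sqrt (real N)"
 proof (rule add_mono)
  show "8 * b / sqrt (1 + real N) <= 8 * b / sqrt (real N)"
   using nice_nonneg[OF h] Suc.prems(1) by (intro divide_left_mono) auto
  have "7 <= 5 * sqrt 2" by (rule power2_le_imp_le) (simp_all add: power_mult_distrib)
  hence "28 * b / sqrt 2 <= 20 * b"
   using nice_nonneg[OF h] mult_left_mono[of 7 "5 * sqrt 2" "4 * b"] by (simp add: field_simps)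
  hence "28 * b / sqrt 2 / sqrt (real N) <= 20 * b / sqrt (real N)" by (rule divide_right_mono) simp
  thus "28 * b / sqrt (real (2 * N)) <= 20 * b / sqrt (real N)" by (simp add: real_sqrt_mult)
 qed
 finally show ?case by (simp add: add_divide_distrib[symmetric])
qed

text \<open>40 comes from the differentiated primitive and 1 from subtracting \<open>h\<close>. The
  passage from 28 to 40 absorbs the change from \<open>sqrt N\<close> to
  \<open>sqrt (1 + N)\<close>, worst at \<open>N = 1\<close>, where
  \<open>28 * sqrt 2 < 40\<close>.\<close>

lemma nice_beurling:
 assumes h: "nice b h"
 shows "nice (41 * b) (beurling h)"
proof -
 have "nice (40 * b) (%k y. \<i> * of_int k * prim h k y)"
  unfolding nice_def
 proof (intro conjI allI ballI impI)
  show "continuous_on {-1..1} (%y. \<i> * of_int k * prim h k y)" for k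
   by (intro continuous_intros prim_cont[OF h])
  fix y :: real and N F assume y: "y \<in> {-1..1}" and F: "finite F" "\<forall>k\<in>F. int N <= \<bar>k\<bar>"
  let ?g = "%k. \<bar>of_int k\<bar> * cmod (prim h k y)"
  \<comment> \<open>The term \<open>k = 0\<close> is annihilated by the factor \<open>k\<close>, so
    all frequencies that count are at least 1, where \<open>prim_tail\<close> applies.\<close>
  define N' where "N' = max 1 N"
  define n where "n = nat (Max (insert 0 (abs ` F)))"
  have "\<bar>k\<bar> < int N' * 2 ^ n" if "k \<in> F" for k
  proof -
   have "\<bar>k\<bar> <= Max (insert 0 (abs ` F))" using F that by (intro Max_ge) auto
   also have "\<dots> <= int n" by (simp add: n_def)
   also have "int n < int (N' * 2 ^ n)" unfolding of_nat_less_iff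
    by (rule less_le_trans[OF less_exp]) (simp add: N'_def)
   finally show ?thesis by simp
  qed
  hence "sum ?g (F - {0}) <= 28 * b / sqrt (real N')"
   using F by (intro prim_tail[OF h y]) (force simp: N'_def)+
  moreover have "(\<Sum>k\<in>F. cmod (\<i> * of_int k * prim h k y)) = sum ?g F" by (simp add: norm_mult)
  moreover have "sum ?g F = sum ?g (F - {0})" using F by (intro sum.mono_neutral_right) auto
  moreover have "28 * b / sqrt (real N') <= 40 * b / sqrt (1 + real N)"
  proof -
   have "7 * sqrt (1 + real N) <= 10 * sqrt (real N')"
    by (rule power2_le_imp_le) (auto simp: power_mult_distrib N'_def max_def)
   thus ?thesis using nice_nonneg[OF h] mult_left_mono[of "7 * sqrt (1 + real N)" "10 * sqrt (real N')" "4 * b"] by (simp add: N'_def field_simps)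
  qed
  ultimately show "(\<Sum>k\<in>F. cmod (\<i> * of_int k * prim h k y)) <= 40 * b / sqrt (1 + real N)" by simp
 qed
 from nice_diff[OF this h] show ?thesis by (simp add: beurling_def[abs_def])
qed

lemma beurling_diff:
 assumes h: "nice b h" "nice b' h'" and y: "y \<in> {-1..1}"
 shows "beurling h k y - beurling h' k y = beurling (%k y. h k y - h' k y) k y"
proof -
 let ?f = "%h t. of_real (exp (of_int k * t)) * h k t"
 have "integral {-1..c} (?f h) - integral {-1..c} (?f h') = integral {-1..c} (?f (%k y. h k y - h' k y))" if "c <= 1" for c
  unfolding right_diff_distrib
  by (rule integral_diff[symmetric]; intro integrable_continuous_interval exp_h_cont[OF h(1)] exp_h_cont[OF h(2)]) (use that in auto)
 from this[of y] this[of 1] have "prim h k y - prim h' k y = prim (%k y. h k y - h' k y) k y"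
  using y unfolding prim_def right_diff_distrib[symmetric] by (simp add: algebra_simps)
 thus ?thesis by (simp add: beurling_def algebra_simps)
qed

lemma beurling_zero: "beurling (%k y. 0) = (%k y. 0)"
 by (simp add: beurling_def prim_def fun_eq_iff)

lemma conv_zero: "conv a (%k y. 0) = (%k y. 0)"
 by (simp add: conv_def fun_eq_iff)

text \<open>For a solution of the form identity plus primitive of \<open>h\<close>, the Beltrami
  equation reads \<open>h = m + m * beurling h\<close>, solved by Neumann iteration. Multiplication
  by \<open>m\<close> costs \<open>3 * a\<close> and the transform costs 41, so
  \<open>1 / 246\<close>, that is 1 / (2 * 3 * 41), makes every step halve the error.\<close>

lemma nice_fixpoint:
 assumes m: "nice a m" and a: "a <= 1 / 246"
 obtains h where "nice (2 * a) h" "\<And>k y. y \<in> {-1..1} ==> h k y = m k y + conv m (beurling h) k y"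
proof -
 have a0: "0 <= a" using nice_nonneg[OF m] .
 define H where "H = rec_nat (%k y. 0) (%n h k y. m k y + conv m (beurling h) k y)"
 have H0: "H 0 = (%k y. 0)" and HS: "H (Suc n) k y = m k y + conv m (beurling (H n)) k y" for n k y
  by (simp_all add: H_def)
 have step: "nice (b / 2) (%k y. conv m (beurling h) k y - conv m (beurling h') k y)"
  if "nice c h" "nice c' h'" "nice b (%k y. h k y - h' k y)" for b c c' h h'
 proof -
  have eq: "conv m (beurling (%k y. h k y - h' k y)) k y = conv m (beurling h) k y - conv m (beurling h') k y"
   if y: "y \<in> {-1..1}" for k y
   using conv_diff[OF m nice_beurling nice_beurling y, OF \<open>nice c h\<close> \<open>nice c' h'\<close>]
    beurling_diff[OF \<open>nice c h\<close> \<open>nice c' h'\<close> y] by (simp add: conv_def)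
  have "a * b <= 1 / 246 * b" using nice_nonneg[OF that(3)] a by (intro mult_right_mono)
  hence "nice (b / 2) (conv m (beurling (%k y. h k y - h' k y)))"
   by (intro nice_mono[OF nice_conv[OF m nice_beurling[OF that(3)]]]) simp
  thus ?thesis by (rule nice_cong) (rule eq)
 qed
 have HH: "nice (2 * a - 2 * a / 2 ^ n) (H n) & nice (a / 2 ^ n) (%k y. H (Suc n) k y - H n k y)" for n
 proof (induction n)
  case 0
  show ?case using m by (simp add: nice_def HS H0 beurling_zero conv_zero)
 next
  case (Suc n)
  have "nice (2 * a - 2 * a / 2 ^ n + a / 2 ^ n) (%k y. H n k y + (H (Suc n) k y - H n k y))"
   using Suc by (intro nice_add) auto
  hence 1: "nice (2 * a - 2 * a / 2 ^ Suc n) (H (Suc n))" by (simp add: algebra_simps)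
  have "nice (a / 2 ^ n / 2) (%k y. conv m (beurling (H (Suc n))) k y - conv m (beurling (H n)) k y)"
   using 1 Suc by (intro step) auto
  thus ?case using 1 by (force simp: HS mult.commute)
 qed
 \<comment> \<open>The exact partial sum of the geometric series is carried along, so that the
   induction closes; its second term is dropped afterwards.\<close>
 have Hmn: "nice (2 * a / 2 ^ n - 2 * a / 2 ^ (n + j)) (%k y. H (n + j) k y - H n k y)" for n j
 proof (induction j)
  case 0 show ?case by (simp add: nice_def)
 next
  case (Suc j)
  have "nice (2 * a / 2 ^ n - 2 * a / 2 ^ (n + j) + a / 2 ^ (n + j)) (%k y. (H (n + j) k y - H n k y) + (H (Suc (n + j)) k y - H (n + j) k y))"
   using Suc HH by (intro nice_add) auto
  thus ?case by (simp add: algebra_simps)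
 qed
 have small: "(%n. c / 2 ^ n) \<longlonglongrightarrow> (0::real)" for c
  using LIMSEQ_divide_realpow_zero[of 2 c] by simp
 have dist: "dist (H (n + j) k y) (H n k y) <= 2 * a / 2 ^ n" if "y \<in> {-1..1}" for n j k y
 proof -
  have "dist (H (n + j) k y) (H n k y) <= 2 * a / 2 ^ n - 2 * a / 2 ^ (n + j)"
   using nice_bound[OF Hmn that] by (simp add: dist_norm)
  moreover have "0 <= 2 * a / 2 ^ (n + j)" using a0 by simp
  ultimately show ?thesis by simp
 qed
 have conv: "convergent (%n. H n k y)" if y: "y \<in> {-1..1}" for k y
 proof -
  have "Cauchy (%n. H n k y)"
  proof (rule metric_CauchyI)
   fix e :: real assume "0 < e"
   then obtain N where N: "2 * a / 2 ^ N < e / 2"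
    using order_tendstoD(2)[OF small, of "e / 2" "2 * a"] eventually_sequentially by (metis half_gt_zero order_refl)
   have "dist (H p k y) (H N k y) < e / 2" if "p \<ge> N" for p
    using dist[OF y, of N "p - N" k] N that by simp
   hence "dist (H p k y) (H r k y) < e" if "p \<ge> N" "r \<ge> N" for p r
    using that by (blast intro: dist_triangle_half_l)
   thus "\<exists>M. \<forall>m\<ge>M. \<forall>n\<ge>M. dist (H m k y) (H n k y) < e" by blast
  qed
  thus ?thesis by (simp add: Cauchy_convergent_iff)
 qed
 define h where "h k y = lim (%n. H n k y)" for k y
 have lim: "(%n. H n k y) \<longlonglongrightarrow> h k y" if "y \<in> {-1..1}" for k y
  using conv[OF that] by (simp add: h_def convergent_LIMSEQ_iff)
 have hcont: "continuous_on {-1..1} (h k)" for k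
 proof (rule uniform_limit_theorem[OF _ _ trivial_limit_sequentially])
  show "\<forall>\<^sub>F n in sequentially. continuous_on {-1..1} (H n k)" using HH nice_cont by (intro always_eventually) blast
  show "uniform_limit {-1..1} (%n. H n k) (h k) sequentially"
  proof (rule uniform_limitI)
   fix e :: real assume "0 < e"
   hence "\<forall>\<^sub>F n in sequentially. 2 * a / 2 ^ n < e" by (rule order_tendstoD(2)[OF small])
   thus "\<forall>\<^sub>F n in sequentially. \<forall>y\<in>{-1..1}. dist (H n k y) (h k y) < e"
   proof (rule eventually_mono, intro ballI)
    fix n and y :: real assume n: "2 * a / 2 ^ n < e" and y: "y \<in> {-1..1}"
    have "dist (h k y) (H n k y) <= 2 * a / 2 ^ n"
    proof (rule tendsto_upperbound[OF tendsto_dist[OF LIMSEQ_ignore_initial_segment[OF lim[OF y], of n] tendsto_const]])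
     show "\<forall>\<^sub>F j in sequentially. dist (H (j + n) k y) (H n k y) <= 2 * a / 2 ^ n"
      using dist[OF y, of n _ k] by (intro always_eventually allI) (simp add: add.commute)
    qed simp
    thus "dist (H n k y) (h k y) < e" using n by (simp add: dist_commute)
   qed
  qed
 qed
 have hH: "nice (2 * a / 2 ^ n) (%k y. h k y - H n k y)" for n
  unfolding nice_def
 proof (intro conjI allI ballI impI)
  show "continuous_on {-1..1} (%y. h k y - H n k y)" for k
   by (intro continuous_on_diff hcont nice_cont[OF HH[THEN conjunct1]])
  fix y :: real and N F assume y: "y \<in> {-1..1}" and F: "finite F" "\<forall>k\<in>F. int N <= \<bar>k\<bar>"
  show "(\<Sum>k\<in>F. cmod (h k y - H n k y)) <= 2 * a / 2 ^ n / sqrt (1 + real N)"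
  proof (rule tendsto_upperbound)
   show "(%j. \<Sum>k\<in>F. cmod (H (j + n) k y - H n k y)) \<longlonglongrightarrow> (\<Sum>k\<in>F. cmod (h k y - H n k y))"
    by (intro tendsto_sum tendsto_norm tendsto_diff tendsto_const LIMSEQ_ignore_initial_segment[OF lim[OF y]])
   show "\<forall>\<^sub>F j in sequentially. (\<Sum>k\<in>F. cmod (H (j + n) k y - H n k y)) <= 2 * a / 2 ^ n / sqrt (1 + real N)"
   proof (intro always_eventually allI)
    fix j
    have nn: "nice (2 * a / 2 ^ n) (%k y. H (n + j) k y - H n k y)"
     by (rule nice_mono[OF Hmn]) (use a0 in simp)
    thus "(\<Sum>k\<in>F. cmod (H (j + n) k y - H n k y)) <= 2 * a / 2 ^ n / sqrt (1 + real N)"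
     using nice_tail[OF nn y F(1), of N] F(2) by (simp add: add.commute)
   qed
  qed simp
 qed
 have h: "nice (2 * a) h" using hH[of 0] by (simp add: H0)
 show ?thesis
 proof (rule that[OF h])
  fix k and y :: real assume y: "y \<in> {-1..1}"
  let ?d = "h k y - (m k y + conv m (beurling h) k y)"
  have "cmod ?d <= 2 * a / 2 ^ n" for n
  proof -
   have "nice (2 * a / 2 ^ n / 2) (%k y. conv m (beurling h) k y - conv m (beurling (H n)) k y)"
    using h HH hH by (intro step) auto
   from nice_bound[OF this y, of k] nice_bound[OF hH[of "Suc n"] y, of k]
   have "cmod (h k y - H (Suc n) k y) + cmod (conv m (beurling h) k y - conv m (beurling (H n)) k y) <= 2 * a / 2 ^ n" by simp
   moreover have "?d = (h k y - H (Suc n) k y) - (conv m (beurling h) k y - conv m (beurling (H n)) k y)" by (simp add: HS)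
   ultimately show ?thesis by (metis norm_triangle_ineq4 order_trans)
  qed
  hence "cmod ?d <= 0" by (intro LIMSEQ_le_const[OF small]) auto
  thus "h k y = m k y + conv m (beurling h) k y" by simp
 qed
qed

text \<open>\<open>p\<close> and \<open>q\<close> are the two complex derivatives of the identity
  plus the primitive of \<open>h\<close>. The bound \<open>1 / 3\<close> is 41 * 2 / 246 for
  \<open>p - 1\<close>; the one for \<open>q\<close> is far smaller. Differentiability of the sum
  comes from uniform convergence of the derivatives on the convex strip.\<close>

lemma strip_solution:
 assumes m: "nice al m" and al: "al <= 1 / 246"
 obtains f p q where "\<And>z. \<bar>Im z\<bar> < 1 ==> (f has_derivative (%v. p z * v + q z * cnj v)) (at z)"
  "continuous_on {z. \<bar>Im z\<bar> < 1} p" "continuous_on {z. \<bar>Im z\<bar> < 1} q"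
  "\<And>z. \<bar>Im z\<bar> < 1 ==> q z = fsum m z * p z & cmod (p z - 1) <= 1 / 3 & cmod (q z) <= 1 / 3"
proof -
 obtain h where h: "nice (2 * al) h" and fix_h: "\<And>k y. y \<in> {-1..1} ==> h k y = m k y + conv m (beurling h) k y"
  using nice_fixpoint[OF m al] by blast
 have S: "nice (41 * (2 * al)) (beurling h)" by (rule nice_beurling[OF h])
 define Z where "Z = {z. \<bar>Im z\<bar> < 1}"
 define p where "p z = 1 + fsum (beurling h) z" for z
 define q where "q = fsum h"
 have Zsub: "Z \<subseteq> {z. Im z \<in> {-1..1}}" by (auto simp: Z_def)
 have oZ: "open Z" unfolding Z_def by (intro open_Collect_less continuous_intros)
 have "Z = {z. -1 < Im z} \<inter> {z. Im z < 1}" by (auto simp: Z_def)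
 hence cZ: "convex Z" by (simp add: convex_Int convex_halfspace_Im_gt convex_halfspace_Im_lt)
 define E where "E k z = cis (of_int k * Re z)" for k :: int and z
 \<comment> \<open>Subtracting \<open>prim h k 0\<close> gives \<open>f n 0 = 0\<close>, the
   convergence at one point that term-by-term differentiation asks for.\<close>
 define f where "f n z = z + (\<Sum>k=-int n..int n. prim h k (Im z) * E k z - prim h k 0)" for n z
 define f' where "f' n z v = v + (\<Sum>k=-int n..int n. beurling h k (Im z) * E k z) * v + (\<Sum>k=-int n..int n. h k (Im z) * E k z) * cnj v" for n z v
 have dE: "(E k has_derivative (%v. \<i> * of_int k * E k z * of_real (Re v))) (at z)" for k z
 proof -
  have "E k = (%z. exp ((\<i> * of_int k) * of_real (Re z)))" by (simp add: E_def[abs_def] cis_conv_exp mult.assoc)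
  moreover have "((%z. exp ((\<i> * of_int k) * of_real (Re z))) has_derivative (%v. (\<i> * of_int k) * exp ((\<i> * of_int k) * of_real (Re z)) * of_real (Re v))) (at z)"
  proof -
   have "((%z. (\<i> * of_int k) * complex_of_real (Re z)) has_derivative (%v. (\<i> * of_int k) * of_real (Re v))) (at z)"
    by (intro has_derivative_mult_right has_derivative_of_real has_derivative_Re has_derivative_ident)
   from has_derivative_compose[OF this, of exp "(*) (exp ((\<i> * of_int k) * of_real (Re z)))"]
   show ?thesis using DERIV_exp[of "(\<i> * of_int k) * complex_of_real (Re z)"]
    by (simp add: has_field_derivative_def mult_ac)
  qed
  ultimately show ?thesis by simp
 qed
 have dprim: "((%z. prim h k (Im z)) has_derivative (%v. Im v *\<^sub>R (- of_int k * prim h k (Im z) - 2 * \<i> * h k (Im z)))) (at z)"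
  if z: "z \<in> Z" for k z
 proof -
  have "(prim h k has_vector_derivative (- of_int k * prim h k (Im z) - 2 * \<i> * h k (Im z))) (at (Im z))" using z prim_deriv[OF h, of "Im z" k] at_within_interior[of "Im z" "{-1..1}"] by (force simp: Z_def)
  hence "(prim h k has_derivative (%s. s *\<^sub>R (- of_int k * prim h k (Im z) - 2 * \<i> * h k (Im z)))) (at (Im z))"
   by (simp add: has_vector_derivative_def)
  from has_derivative_compose[OF has_derivative_Im[OF has_derivative_ident] this] show ?thesis .
 qed
 have dterm: "((%z. prim h k (Im z) * E k z - prim h k 0) has_derivative
   (%v. beurling h k (Im z) * E k z * v + h k (Im z) * E k z * cnj v)) (at z)" if z: "z \<in> Z" for k z
 proof -
  have "((%z. prim h k (Im z) * E k z - prim h k 0) has_derivative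
   (%v. prim h k (Im z) * (\<i> * of_int k * E k z * of_real (Re v)) + Im v *\<^sub>R (- of_int k * prim h k (Im z) - 2 * \<i> * h k (Im z)) * E k z - 0)) (at z)"
   by (intro has_derivative_diff has_derivative_mult dprim[OF z] dE has_derivative_const)
  moreover have "prim h k (Im z) * (\<i> * of_int k * E k z * of_real (Re v)) + Im v *\<^sub>R (- of_int k * prim h k (Im z) - 2 * \<i> * h k (Im z)) * E k z - 0
    = beurling h k (Im z) * E k z * v + h k (Im z) * E k z * cnj v" for v
  proof -
   define P where "P = prim h k (Im z)"
   define Q where "Q = h k (Im z)"
   have "P * (\<i> * of_int k * E k z * of_real (Re v)) + of_real (Im v) * (- of_int k * P - 2 * \<i> * Q) * E k z
     = E k z * (\<i> * of_int k * P * (of_real (Re v) + \<i> * of_real (Im v)) - Q * (2 * \<i> * of_real (Im v)))"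
    by (simp add: algebra_simps)
   also have "of_real (Re v) + \<i> * of_real (Im v) = v" by (rule complex_eq[symmetric])
   also have "2 * \<i> * of_real (Im v) = v - cnj v" by (simp add: complex_eq_iff)
   finally show ?thesis by (simp add: P_def Q_def beurling_def scaleR_conv_of_real algebra_simps)
  qed
  ultimately show ?thesis by simp
 qed
 have "\<exists>g. \<forall>x\<in>Z. (%n. f n x) \<longlonglongrightarrow> g x & (g has_derivative (%v. p x * v + q x * cnj v)) (at x within Z)"
 proof (rule has_derivative_sequence[OF cZ, of f f' "%x v. p x * v + q x * cnj v" 0])
  show "(f n has_derivative f' n x) (at x within Z)" if "x \<in> Z" for n x
  proof -
   have "(f n has_derivative (%v. v + (\<Sum>k=-int n..int n. beurling h k (Im x) * E k x * v + h k (Im x) * E k x * cnj v))) (at x)"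
    unfolding f_def[abs_def] by (intro has_derivative_add has_derivative_ident has_derivative_sum dterm that)
   moreover have "(%v. v + (\<Sum>k=-int n..int n. beurling h k (Im x) * E k x * v + h k (Im x) * E k x * cnj v)) = f' n x"
    by (rule ext) (simp add: f'_def sum.distrib sum_distrib_right)
   ultimately show ?thesis using has_derivative_at_withinI by metis
  qed
  show "\<forall>\<^sub>F n in sequentially. \<forall>x\<in>Z. \<forall>v. norm (f' n x v - (p x * v + q x * cnj v)) <= e * norm v" if e: "0 < e" for e
  proof -
   have e2: "0 < e / 2" using e by simp
   from uniform_limitD[OF fsum_uniform[OF S] e2] uniform_limitD[OF fsum_uniform[OF h] e2] show ?thesis
   proof (rule eventually_elim2, intro ballI allI)
    fix n x v
    assume a: "\<forall>x\<in>{z. Im z \<in> {-1..1}}. dist (\<Sum>k=-int n..int n. beurling h k (Im x) * cis (of_int k * Re x)) (fsum (beurling h) x) < e / 2"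
     "\<forall>x\<in>{z. Im z \<in> {-1..1}}. dist (\<Sum>k=-int n..int n. h k (Im x) * cis (of_int k * Re x)) (fsum h x) < e / 2"
     and x: "x \<in> Z"
    let ?A = "(\<Sum>k=-int n..int n. beurling h k (Im x) * E k x) - fsum (beurling h) x" and ?B = "(\<Sum>k=-int n..int n. h k (Im x) * E k x) - fsum h x"
    have "f' n x v - (p x * v + q x * cnj v) = ?A * v + ?B * cnj v" by (simp add: f'_def p_def q_def algebra_simps)
    also have "norm \<dots> <= cmod ?A * cmod v + cmod ?B * cmod v"
     by (rule order_trans[OF norm_triangle_ineq]) (simp add: norm_mult)
    also have "\<dots> <= e / 2 * cmod v + e / 2 * cmod v"
     using a x Zsub by (intro add_mono mult_right_mono) (auto simp: dist_norm E_def less_imp_le)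
    finally show "norm (f' n x v - (p x * v + q x * cnj v)) <= e * norm v" by simp
   qed
  qed
  show "(%n. f n 0) \<longlonglongrightarrow> 0" by (simp add: f_def E_def)
 qed (simp add: Z_def)
 then obtain g where "\<And>x. x \<in> Z ==> (g has_derivative (%v. p x * v + q x * cnj v)) (at x within Z)" by blast
 hence g: "(g has_derivative (%v. p x * v + q x * cnj v)) (at x)" if "x \<in> Z" for x
  using that at_within_open[OF that oZ] by metis
 have q: "q z = fsum m z * p z" if z: "z \<in> Z" for z
 proof -
  have z': "Im z \<in> {-1..1}" using z Zsub by blast
  have "q z = fsum (%k y. m k y + conv m (beurling h) k y) z"
   unfolding q_def fsum_def using fix_h[OF z'] by simp
  also have "\<dots> = fsum m z + fsum (conv m (beurling h)) z"
   unfolding fsum_def distrib_right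
   by (rule infsum_add[OF Infinite_Sum.abs_summable_summable[OF fsum_summable[OF m z']]
      Infinite_Sum.abs_summable_summable[OF fsum_summable[OF nice_conv[OF m S] z']]])
  finally show ?thesis unfolding fsum_conv[OF m S z'] by (simp add: p_def algebra_simps)
 qed
 have "cmod (p z - 1) <= 1 / 3 & cmod (q z) <= 1 / 3" if "z \<in> Z" for z
  using fsum_bound[OF S, of z] fsum_bound[OF h, of z] that Zsub al by (auto simp: p_def q_def)
 moreover have "continuous_on Z p" "continuous_on Z q"
  unfolding p_def[abs_def] q_def
  by (intro continuous_intros continuous_on_subset[OF fsum_cont[OF S] Zsub] continuous_on_subset[OF fsum_cont[OF h] Zsub])+
 ultimately show ?thesis using that[of g p q] g q unfolding Z_def by blast
qed

section \<open>Fourier coefficients of functions on a period interval\<close>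

definition fc :: "(real => complex) => int => complex" where
 "fc g k = integral {0..2*pi} (%x. g x * cis (- of_int k * x)) / (2 * pi)"

lemma integral_cis: "integral {0..2*pi} (%x. cis (of_int m * x)) = (if m = 0 then 2 * pi else 0)"
proof (cases "m = 0")
 case False
 have "((%x. cis (of_int m * x)) has_integral (cis (of_int m * (2 * pi)) / (\<i> * of_int m) - cis (of_int m * 0) / (\<i> * of_int m))) {0..2*pi}"
 proof (rule fundamental_theorem_of_calculus)
  fix x assume "x \<in> {0..2*pi}"
  have "((%z. exp ((\<i> * of_int m) * z) / (\<i> * of_int m)) has_field_derivative exp ((\<i> * of_int m) * of_real x)) (at (of_real x))"
   using False by (auto intro!: derivative_eq_intros)
  from has_vector_derivative_real_field[OF this]
  show "((%x. cis (of_int m * x) / (\<i> * of_int m)) has_vector_derivative cis (of_int m * x)) (at x within {0..2*pi})"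
   by (simp add: cis_conv_exp mult.assoc)
 qed simp
 moreover have "cis (of_int m * (2 * pi)) = 1"
  using cis_multiple_2pi[of "of_int m"] by (simp add: mult_ac)
 ultimately show ?thesis using False by (simp add: integral_unique)
qed (simp add: scaleR_conv_of_real)

lemma bessel:
 assumes g: "continuous_on {0..2*pi} g" and b: "\<And>x. x \<in> {0..2*pi} ==> cmod (g x) <= h" and F: "finite F"
 shows "(\<Sum>k\<in>F. (cmod (fc g k))\<^sup>2) <= h\<^sup>2"
proof -
 let ?I = "integral {0..2*pi}" and ?e = "%k x. cis (of_int k * x)"
 define S where "S x = (\<Sum>k\<in>F. fc g k * ?e k x)" for x
 define N where "N = (\<Sum>k\<in>F. fc g k * cnj (fc g k))"
 have io: "f integrable_on {0..2*pi}" if "continuous_on {0..2*pi} f" for f :: "real => complex"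
  using that by (rule integrable_continuous_interval)
 have cS: "continuous_on {0..2*pi} S" unfolding S_def[abs_def] by (intro continuous_intros)
 have coef: "?I (%x. f x * cnj (S x)) = (\<Sum>k\<in>F. cnj (fc g k) * (2 * pi * fc f k))" if f: "continuous_on {0..2*pi} f" for f
 proof -
  have "?I (%x. f x * cnj (S x)) = ?I (%x. \<Sum>k\<in>F. cnj (fc g k) * (f x * cis (- of_int k * x)))"
   by (simp add: S_def sum_distrib_left mult_ac cis_cnj)
  also have "\<dots> = (\<Sum>k\<in>F. ?I (%x. cnj (fc g k) * (f x * cis (- of_int k * x))))"
   by (intro integral_sum F io continuous_intros f)
  also have "\<dots> = (\<Sum>k\<in>F. cnj (fc g k) * (2 * pi * fc f k))" by (simp add: fc_def)
  finally show ?thesis .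
 qed
 have gS: "?I (%x. g x * cnj (S x)) = 2 * pi * N"
  unfolding coef[OF g] N_def by (simp add: sum_distrib_left mult_ac)
 have fcS: "fc S k = fc g k" if "k \<in> F" for k
 proof -
  have "?I (%x. S x * cis (- of_int k * x)) = ?I (%x. \<Sum>j\<in>F. fc g j * cis (of_int (j - k) * x))"
   unfolding S_def sum_distrib_right by (intro integral_cong sum.cong refl) (simp add: mult.assoc cis_mult algebra_simps)
  also have "\<dots> = (\<Sum>j\<in>F. fc g j * (if j - k = 0 then 2 * pi else 0))"
   unfolding integral_cis[symmetric]
   by (subst integral_sum[OF F]) (auto intro!: io continuous_intros)
  also have "\<dots> = 2 * pi * fc g k" using F that by (simp add: if_distrib cong: if_cong)
  finally show ?thesis by (simp add: fc_def)
 qed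
 have SS: "?I (%x. S x * cnj (S x)) = 2 * pi * N"
  unfolding coef[OF cS] N_def using fcS by (simp add: sum_distrib_left mult_ac)
 have Sg: "?I (%x. cnj (g x) * S x) = 2 * pi * N"
 proof -
  have "?I (%x. cnj (g x) * S x) = cnj (?I (%x. g x * cnj (S x)))"
   unfolding Henstock_Kurzweil_Integration.integral_cnj by (simp add: mult.commute)
  also have "\<dots> = 2 * pi * N" unfolding gS by (simp add: N_def mult.commute)
  finally show ?thesis .
 qed
 have "?I (%x. (g x - S x) * cnj (g x - S x)) = ?I (%x. (g x * cnj (g x) - g x * cnj (S x)) - (cnj (g x) * S x - S x * cnj (S x)))"
  by (intro integral_cong) (simp add: algebra_simps)
 also have "\<dots> = (?I (%x. g x * cnj (g x)) - ?I (%x. g x * cnj (S x))) - (?I (%x. cnj (g x) * S x) - ?I (%x. S x * cnj (S x)))"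
  by (simp add: integral_diff io continuous_intros g cS)
 finally have main: "?I (%x. (g x - S x) * cnj (g x - S x)) = ?I (%x. g x * cnj (g x)) - 2 * pi * N"
  unfolding gS SS Sg by simp
 have re: "Re (?I (%x. f x * cnj (f x))) = ?I (%x. (cmod (f x))\<^sup>2)" if "continuous_on {0..2*pi} f" for f
 proof -
  have "Re (?I (%x. f x * cnj (f x))) = ?I (%x. Re (f x * cnj (f x)))"
   by (rule integral_linear[OF io bounded_linear_Re, unfolded o_def, symmetric]) (intro continuous_intros that)
  thus ?thesis by (simp add: complex_norm_square[symmetric] del: of_real_power complex_mult_cnj)
 qed
 have "0 <= ?I (%x. (cmod (g x - S x))\<^sup>2)" by (rule integral_nonneg) (auto intro!: integrable_continuous_interval continuous_intros g cS)
 also have "\<dots> = Re (?I (%x. (g x - S x) * cnj (g x - S x)))" by (rule re[symmetric]) (intro continuous_intros g cS)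
 also have "\<dots> = ?I (%x. (cmod (g x))\<^sup>2) - 2 * pi * Re N" unfolding main by (simp add: re[OF g])
 also have "?I (%x. (cmod (g x))\<^sup>2) <= ?I (%x. h\<^sup>2)"
  by (intro integral_le integrable_continuous_interval continuous_intros g power_mono b) auto
 finally have "Re N <= h\<^sup>2" by simp
 moreover have "Re N = (\<Sum>k\<in>F. (cmod (fc g k))\<^sup>2)"
  unfolding N_def complex_norm_square[symmetric] by simp
 ultimately show ?thesis by simp
qed

text \<open>The Riemann-Lebesgue lemma: by Bessel's inequality the squares of the coefficients are
  summable along any injective sequence of frequencies.\<close>

lemma fc_tendsto_0:
 assumes g: "continuous_on {0..2*pi} g"
 shows "(%n. fc g (int n)) \<longlonglongrightarrow> 0" "(%n. fc g (- int n)) \<longlonglongrightarrow> 0"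
proof -
 have "compact (g ` {0..2*pi})" using g by (intro compact_continuous_image) auto
 then obtain h where h: "\<And>x. x \<in> {0..2*pi} ==> cmod (g x) <= h"
  using compact_imp_bounded[of "g ` {0..2*pi}"] unfolding bounded_iff by blast
 have *: "(%n. fc g (i n)) \<longlonglongrightarrow> 0" if "inj i" for i :: "nat => int"
 proof -
  have "summable (%n. (cmod (fc g (i n)))\<^sup>2)"
  proof (rule bounded_imp_summable)
   fix n
   have "(\<Sum>k\<le>n. (cmod (fc g (i k)))\<^sup>2) = (\<Sum>k\<in>i ` {..n}. (cmod (fc g k))\<^sup>2)"
    using that by (subst sum.reindex) (auto intro: inj_on_subset)
   also have "\<dots> <= h\<^sup>2" by (rule bessel[OF g h]) auto
   finally show "(\<Sum>k\<le>n. (cmod (fc g (i k)))\<^sup>2) <= h\<^sup>2" .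
  qed simp
  hence "(%n. (cmod (fc g (i n)))\<^sup>2) \<longlonglongrightarrow> 0" by (rule summable_LIMSEQ_zero)
  thus ?thesis by (simp add: tendsto_norm_zero_iff)
 qed
 show "(%n. fc g (int n)) \<longlonglongrightarrow> 0" by (rule *) (simp add: inj_on_def)
 show "(%n. fc g (- int n)) \<longlonglongrightarrow> 0" by (rule *) (simp add: inj_on_def)
qed

lemma vector_derivative_quotient:
 fixes g :: "real => complex"
 assumes "(g has_vector_derivative d) (at x)"
 shows "((%y. (g y - g x) / (y - x)) \<longlongrightarrow> d) (at x)"
proof -
 have "((%y. norm (g y - g x - (y - x) *\<^sub>R d) / norm (y - x)) \<longlongrightarrow> 0) (at x)"
  using assms by (simp add: has_vector_derivative_def has_derivative_iff_norm)
 moreover have "\<forall>\<^sub>F y in at x. norm (g y - g x - (y - x) *\<^sub>R d) / norm (y - x) = norm ((g y - g x) / (y - x) - d)"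
  unfolding eventually_at_filter
 proof (intro always_eventually allI impI)
  fix y assume "y ~= x"
  hence "(g y - g x) / (y - x) - d = (g y - g x - (y - x) *\<^sub>R d) / of_real (y - x)"
   by (simp add: field_simps scaleR_conv_of_real)
  thus "norm (g y - g x - (y - x) *\<^sub>R d) / norm (y - x) = norm ((g y - g x) / (y - x) - d)"
   by (simp only: norm_divide norm_of_real real_norm_def)
 qed
 ultimately have "((%y. norm ((g y - g x) / (y - x) - d)) \<longlongrightarrow> 0) (at x)" by (rule Lim_transform_eventually)
 thus ?thesis by (simp only: tendsto_norm_zero_iff LIM_zero_iff)
qed

lemma cis_eq_1: "\<bar>t\<bar> < 2 * pi ==> cis t = 1 ==> t = 0" using cos_one_2pi_int by (auto simp: complex_eq_iff abs_mult)

text \<open>Chernoff's proof: \<open>g - g x\<^sub>0\<close> is \<open>cis (x - x\<^sub>0) - 1\<close> times a continuous function, so that the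
 partial sums telescope.\<close>

lemma fourier_pointwise:
 assumes g: "continuous_on {0..2*pi} g" and x0: "0 < x0" "x0 < 2 * pi" and d: "(g has_vector_derivative d) (at x0)"
 shows "(%n. \<Sum>k=-int n..int n. fc g k * cis (of_int k * x0)) \<longlonglongrightarrow> g x0"
proof -
 \<comment> \<open>The value \<open>d / \<i>\<close> is the limit of the quotient at
   \<open>x0\<close>, as \<open>cis (x - x0)\<close> has derivative \<open>\<i>\<close> there; it
   makes \<open>w\<close> continuous.\<close>
 define w where "w x = (if x = x0 then d / \<i> else (g x - g x0) / (cis (x - x0) - 1))" for x
 have nz: "cis (x - x0) - 1 ~= 0" if "x \<in> {0..2*pi}" "x ~= x0" for x using that x0 cis_eq_1[of "x - x0"] by force
 have cw: "continuous_on {0..2*pi} w"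
  unfolding continuous_on_eq_continuous_within
 proof
  fix x assume x: "x \<in> {0..2*pi}"
  show "continuous (at x within {0..2*pi}) w"
  proof (cases "x = x0")
   case False
   have "continuous (at x within {0..2*pi}) (%x. (g x - g x0) / (cis (x - x0) - 1))"
   proof -
    have "continuous_on UNIV (%x. cis (x - x0))" by (intro continuous_intros)
    hence "continuous (at x within {0..2*pi}) (%x. cis (x - x0))"
     by (simp add: continuous_on_eq_continuous_at continuous_at_imp_continuous_at_within)
    moreover have "continuous (at x within {0..2*pi}) g" using g x by (simp add: continuous_on_eq_continuous_within)
    ultimately show ?thesis using nz[OF x False] unfolding continuous_within by (intro tendsto_divide tendsto_diff tendsto_const)
   qed
   moreover have "\<forall>\<^sub>F y in at x within {0..2*pi}. (g y - g x0) / (cis (y - x0) - 1) = w y"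
   proof -
    have "\<forall>\<^sub>F y in at x within {0..2*pi}. y ~= x0" by (rule eventually_neq_at_within)
    thus ?thesis by (rule eventually_mono) (simp add: w_def)
   qed
   ultimately have "(w \<longlongrightarrow> (g x - g x0) / (cis (x - x0) - 1)) (at x within {0..2*pi})"
    unfolding continuous_within by (rule Lim_transform_eventually)
   thus ?thesis using False by (simp add: continuous_within w_def)
  next
   case True
   have "((%y. exp (\<i> * of_real (y - x0))) has_vector_derivative \<i>) (at x0)"
   proof -
    have "((%z. exp (\<i> * (z - of_real x0))) has_field_derivative \<i>) (at (of_real x0))"
     by (auto intro!: derivative_eq_intros)
    from has_vector_derivative_real_field[OF this] show ?thesis by simp
   qed
   hence cd: "((%y. (cis (y - x0) - 1) / (y - x0)) \<longlongrightarrow> \<i>) (at x0)"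
    using vector_derivative_quotient by (fastforce simp: cis_conv_exp)
   have gd: "((%y. (g y - g x0) / (y - x0)) \<longlongrightarrow> d) (at x0)"
    by (rule vector_derivative_quotient[OF d])
   have "((%y. ((g y - g x0) / (y - x0)) / ((cis (y - x0) - 1) / (y - x0))) \<longlongrightarrow> d / \<i>) (at x0)"
    by (intro tendsto_divide gd cd) simp
   moreover have "\<forall>\<^sub>F y in at x0. ((g y - g x0) / (y - x0)) / ((cis (y - x0) - 1) / (y - x0)) = w y"
   proof -
    have "\<forall>\<^sub>F y in at x0. y ~= x0" by (rule eventually_neq_at_within)
    thus ?thesis by (rule eventually_mono) (simp add: w_def)
   qed
   ultimately have "(w \<longlongrightarrow> d / \<i>) (at x0)" by (rule Lim_transform_eventually)
   thus ?thesis using True tendsto_within_subset[of w _ x0 UNIV] by (auto simp: continuous_within w_def)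
  qed
 qed
 define W where "W k = fc w k * cis (of_int k * x0)" for k
 have io: "f integrable_on {0..2*pi}" if "continuous_on {0..2*pi} f" for f :: "real => complex"
  using that by (rule integrable_continuous_interval)
 have key: "fc g k * cis (of_int k * x0) = (if k = 0 then g x0 else 0) + (W (k - 1) - W k)" for k
 proof -
  have eq: "g x = g x0 + (w x * cis (x - x0) - w x)" if "x \<in> {0..2*pi}" for x
  proof -
   have "w x * (cis (x - x0) - 1) = g x - g x0"
    using nz[OF that] by (cases "x = x0") (simp_all add: w_def)
   thus ?thesis by (simp add: algebra_simps)
  qed
  have "2 * pi * fc g k = integral {0..2*pi} (%x. g x * cis (- of_int k * x))" by (simp add: fc_def)
  also have "\<dots> = integral {0..2*pi} (%x. g x0 * cis (of_int (- k) * x) + (cis (- x0) * (w x * cis (- of_int (k - 1) * x)) - w x * cis (- of_int k * x)))"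
  proof (rule integral_cong)
   fix x assume x: "x \<in> {0..2*pi}"
   show "g x * cis (- of_int k * x) = g x0 * cis (of_int (- k) * x) + (cis (- x0) * (w x * cis (- of_int (k - 1) * x)) - w x * cis (- of_int k * x))" unfolding eq[OF x] by (simp add: cis_mult algebra_simps)
  qed
  also have "\<dots> = integral {0..2*pi} (%x. g x0 * cis (of_int (- k) * x)) +
    integral {0..2*pi} (%x. cis (- x0) * (w x * cis (- of_int (k - 1) * x)) - w x * cis (- of_int k * x))"
   by (rule integral_add; intro io continuous_intros cw)
  also have "integral {0..2*pi} (%x. cis (- x0) * (w x * cis (- of_int (k - 1) * x)) - w x * cis (- of_int k * x)) =
    integral {0..2*pi} (%x. cis (- x0) * (w x * cis (- of_int (k - 1) * x))) - integral {0..2*pi} (%x. w x * cis (- of_int k * x))"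
   by (rule integral_diff; intro io continuous_intros cw)
  also have "integral {0..2*pi} (%x. cis (- x0) * (w x * cis (- of_int (k - 1) * x))) = cis (- x0) * (2 * pi * fc w (k - 1))"
   unfolding integral_mult_right by (simp add: fc_def)
  also have "integral {0..2*pi} (%x. w x * cis (- of_int k * x)) = 2 * pi * fc w k" by (simp add: fc_def)
  also have "integral {0..2*pi} (%x. g x0 * cis (of_int (- k) * x)) = g x0 * (if k = 0 then 2 * pi else 0)"
   unfolding integral_mult_right integral_cis by simp
  finally have "2 * pi * fc g k = 2 * pi * ((if k = 0 then g x0 else 0) + (cis (- x0) * fc w (k - 1) - fc w k))" by (simp add: algebra_simps)
  hence fk: "fc g k = (if k = 0 then g x0 else 0) + (cis (- x0) * fc w (k - 1) - fc w k)" by simp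
  have "fc g k * cis (of_int k * x0) = (if k = 0 then g x0 else 0) * cis (of_int k * x0)
    + (fc w (k - 1) * (cis (- x0) * cis (of_int k * x0)) - fc w k * cis (of_int k * x0))"
   by (subst fk) (simp add: algebra_simps)
  moreover have "cis (- x0) * cis (of_int k * x0) = cis (of_int (k - 1) * x0)" by (simp add: cis_mult algebra_simps)
  ultimately show ?thesis by (simp add: W_def)
 qed
 have tele: "(\<Sum>k=-int n..int n. W (k - 1) - W k) = W (- int n - 1) - W (int n)" for n
 proof (induction n)
  case (Suc n)
  have "{-int (Suc n)..int (Suc n)} = insert (-int n - 1) (insert (int n + 1) {-int n..int n})" by auto
  thus ?case using Suc by (simp add: add.commute)
 qed simp
 have Wi: "(%n. W (i n)) \<longlonglongrightarrow> 0" if "(%n. fc w (i n)) \<longlonglongrightarrow> 0" for i :: "nat => int"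
 proof (rule tendsto_norm_zero_cancel)
  show "(%n. cmod (W (i n))) \<longlonglongrightarrow> 0" using tendsto_norm_zero[OF that] by (simp add: W_def norm_mult)
 qed
 have W0: "(%n. W (int n)) \<longlonglongrightarrow> 0" "(%n. W (- int n)) \<longlonglongrightarrow> 0"
  by (rule Wi[OF fc_tendsto_0(1)[OF cw]], rule Wi[OF fc_tendsto_0(2)[OF cw]])
 have "(%n. g x0 + (W (- int (Suc n)) - W (int n))) \<longlonglongrightarrow> g x0 + (0 - 0)"
  by (intro tendsto_add tendsto_diff tendsto_const W0(1) LIMSEQ_Suc[OF W0(2)])
 moreover have "(\<Sum>k=-int n..int n. fc g k * cis (of_int k * x0)) = g x0 + (W (- int (Suc n)) - W (int n))" for n
 proof -
  have e: "- int n - 1 = - int (Suc n)" by simp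
  show ?thesis unfolding key sum.distrib tele e by simp
 qed
 ultimately show ?thesis by simp
qed

lemma fc_deriv:
 assumes d: "\<And>x. x \<in> {0..2*pi} ==> (g has_vector_derivative g' x) (at x within {0..2*pi})" and per: "g 0 = g (2 * pi)"
  and c: "continuous_on {0..2*pi} g'"
 shows "fc g' k = \<i> * of_int k * fc g k"
proof -
 let ?e = "%x. cis (- of_int k * x)"
 have cg: "continuous_on {0..2*pi} g"
  unfolding continuous_on_eq_continuous_within using d has_vector_derivative_continuous by blast
 have io: "f integrable_on {0..2*pi}" if "continuous_on {0..2*pi} f" for f :: "real => complex"
  using that by (rule integrable_continuous_interval)
 have de: "(?e has_vector_derivative - (\<i> * of_int k) * ?e x) (at x within A)" for x A
 proof -
  have "((%z. exp (- (\<i> * of_int k) * z)) has_field_derivative - (\<i> * of_int k) * exp (- (\<i> * of_int k) * of_real x)) (at (of_real x))"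
   by (auto intro!: derivative_eq_intros)
  from has_vector_derivative_real_field[OF this] show ?thesis by (simp add: cis_conv_exp mult.assoc)
 qed
 have "((%x. g x * (- (\<i> * of_int k) * ?e x) + g' x * ?e x) has_integral (g (2*pi) * ?e (2*pi) - g 0 * ?e 0)) {0..2*pi}"
  by (intro fundamental_theorem_of_calculus has_vector_derivative_mult d de) simp_all
 moreover have "?e (2*pi) = 1" using cis_multiple_2pi[of "of_int (-k)"] by (simp add: mult_ac)
 ultimately have "integral {0..2*pi} (%x. - (\<i> * of_int k) * (g x * ?e x) + g' x * ?e x) = 0"
  using per by (simp add: integral_unique mult_ac)
 moreover have "integral {0..2*pi} (%x. - (\<i> * of_int k) * (g x * ?e x) + g' x * ?e x) =
   integral {0..2*pi} (%x. - (\<i> * of_int k) * (g x * ?e x)) + integral {0..2*pi} (%x. g' x * ?e x)"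
  by (rule integral_add; intro io continuous_intros cg c)
 ultimately have "- (\<i> * of_int k) * integral {0..2*pi} (%x. g x * ?e x) + integral {0..2*pi} (%x. g' x * ?e x) = 0"
  unfolding integral_mult_right by simp
 thus ?thesis by (simp add: fc_def field_simps)
qed

lemma sum_inverse_squares:
 assumes "1 <= N" "finite F" "\<And>k. k \<in> F ==> int N <= \<bar>k\<bar>"
 shows "(\<Sum>k\<in>F. (1 / real_of_int k)\<^sup>2) <= 4 / real N"
proof -
 have step: "(\<Sum>k=N..N+L. (1 / real k)\<^sup>2) <= 2 / real N - 1 / real (N + L)" for L
 proof (induction L)
  case 0
  have "1 / real N * (1 / real N) <= 1 / real N * 1" using assms(1) by (intro mult_left_mono) auto
  thus ?case by (simp add: power2_eq_square)
 next
  case (Suc L)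
  have "(1 / (a + 1))\<^sup>2 <= 1 / a - 1 / (a + 1)" if "0 < a" for a :: real
  proof -
   have "(1 / (a + 1))\<^sup>2 = 1 / ((a + 1) * (a + 1))" by (simp add: power2_eq_square)
   also have "\<dots> <= 1 / (a * (a + 1))" using that by (intro divide_left_mono mult_right_mono mult_pos_pos) auto
   also have "\<dots> = 1 / a - 1 / (a + 1)" using that by (simp add: field_simps)
   finally show ?thesis .
  qed
  from this[of "real (N + L)"] have "(1 / real (N + Suc L))\<^sup>2 <= 1 / real (N + L) - 1 / real (N + Suc L)"
   using assms(1) by (simp add: add_ac)
  thus ?case using Suc by simp
 qed
 have nat: "(\<Sum>k\<in>A. (1 / real k)\<^sup>2) <= 2 / real N" if A: "finite A" "\<And>k. k \<in> A ==> N <= k" for A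
 proof -
  have "A \<subseteq> {N..N + Max (insert 0 A)}"
  proof
   fix k assume k: "k \<in> A"
   hence "k <= Max (insert 0 A)" using A(1) by (intro Max_ge) auto
   thus "k \<in> {N..N + Max (insert 0 A)}" using A(2)[OF k] by simp
  qed
  hence "(\<Sum>k\<in>A. (1 / real k)\<^sup>2) <= (\<Sum>k=N..N+Max (insert 0 A). (1 / real k)\<^sup>2)" by (intro sum_mono2) auto
  also have "\<dots> <= 2 / real N - 1 / real (N + Max (insert 0 A))" by (rule step)
  also have "\<dots> <= 2 / real N" by simp
  finally show ?thesis .
 qed
 have part: "(\<Sum>k\<in>{k\<in>F. P k}. (1 / real_of_int k)\<^sup>2) <= 2 / real N" if "inj_on abs {k\<in>F. P k}" for P
 proof -
  have inj: "inj_on (%k. nat \<bar>k\<bar>) {k\<in>F. P k}" using that by (auto simp: inj_on_def)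
  have "(\<Sum>k\<in>{k\<in>F. P k}. (1 / real_of_int k)\<^sup>2) = (\<Sum>k\<in>{k\<in>F. P k}. (1 / real (nat \<bar>k\<bar>))\<^sup>2)" by (simp add: power_divide)
  also have "\<dots> = (\<Sum>k\<in>(%k. nat \<bar>k\<bar>) ` {k\<in>F. P k}. (1 / real k)\<^sup>2)" by (subst sum.reindex[OF inj]) simp
  also have "\<dots> <= 2 / real N" using assms by (intro nat) force+
  finally show ?thesis .
 qed
 have "(\<Sum>k\<in>F. (1 / real_of_int k)\<^sup>2) = (\<Sum>k\<in>{k\<in>F. 0 <= k}. (1 / real_of_int k)\<^sup>2) + (\<Sum>k\<in>{k\<in>F. \<not> 0 <= k}. (1 / real_of_int k)\<^sup>2)"
  using sum.Int_Diff[OF assms(2), of _ "{k. 0 <= k}"] by (simp add: Int_def set_diff_eq)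
 also have "\<dots> <= 2 / real N + 2 / real N" by (intro add_mono part) (auto simp: inj_on_def)
 finally show ?thesis by simp
qed

text \<open>The coefficients are those of the derivative divided by \<open>\<i> * k\<close>.
  Cauchy-Schwarz with Bessel's inequality and the tail \<open>4 / N\<close> of the inverse squares
  bounds the tail by \<open>2 * h / sqrt N\<close>, the source of the order 1/2. The coefficient at
  0 and the shift from \<open>N\<close> to \<open>1 + N\<close> raise 2 to 3.\<close>

lemma nice_fc:
 assumes c: "continuous_on ({-1..1} \<times> {0..2*pi}) (%(y, x). m x y)"
  and d: "\<And>x y. y \<in> {-1..1} ==> x \<in> {0..2*pi} ==> ((%x. m x y) has_vector_derivative m' x y) (at x within {0..2*pi})"
  and c': "\<And>y. y \<in> {-1..1} ==> continuous_on {0..2*pi} (%x. m' x y)"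
  and per: "\<And>y. y \<in> {-1..1} ==> m 0 y = m (2 * pi) y"
  and b: "\<And>x y. y \<in> {-1..1} ==> x \<in> {0..2*pi} ==> cmod (m x y) <= h" "\<And>x y. y \<in> {-1..1} ==> x \<in> {0..2*pi} ==> cmod (m' x y) <= h"
 shows "nice (3 * h) (%k y. fc (%x. m x y) k)"
 unfolding nice_def
proof (intro conjI allI ballI impI)
 fix k
 have "continuous_on ({-1..1} \<times> cbox 0 (2*pi)) (%(y, x). m x y * cis (- of_int k * x))"
 proof -
  have "continuous_on ({-1..1} \<times> cbox 0 (2*pi)) (%p. m (snd p) (fst p))" using c by (simp add: case_prod_unfold)
  moreover have "continuous_on ({-1..1} \<times> cbox 0 (2*pi)) (%p::real \<times> real. cis (- of_int k * snd p))"
   by (intro continuous_intros)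
  ultimately show ?thesis unfolding case_prod_unfold by (rule continuous_on_mult)
 qed
 thus "continuous_on {-1..1} (%y. fc (%x. m x y) k)"
  unfolding fc_def using integral_continuous_on_param[of "{-1..1}" 0 "2*pi"] by (intro continuous_intros) auto
next
 fix y :: real and N F assume y: "y \<in> {-1..1}" and F: "finite F" "\<forall>k\<in>F. int N <= \<bar>k\<bar>"
 let ?c = "%k. fc (%x. m x y) k"
 have h: "0 <= h" by (rule order_trans[OF norm_ge_zero b(1)[OF y, of 0]]) simp
 have cg: "continuous_on {0..2*pi} (%x. m x y)"
  unfolding continuous_on_eq_continuous_within using d[OF y] has_vector_derivative_continuous by blast
 have tail: "(\<Sum>k\<in>A. cmod (?c k)) <= 2 * h / sqrt (real L)" if A: "1 <= L" "finite A" "\<And>k. k \<in> A ==> int L <= \<bar>k\<bar>" for A L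
 proof -
  have k0: "k ~= 0" if "k \<in> A" for k using A(1) A(3)[OF that] by auto
  have "(\<Sum>k\<in>A. cmod (?c k)) = (\<Sum>k\<in>A. (1 / \<bar>real_of_int k\<bar>) * cmod (fc (%x. m' x y) k))"
  proof (rule sum.cong[OF refl])
   fix k assume "k \<in> A"
   thus "cmod (?c k) = (1 / \<bar>real_of_int k\<bar>) * cmod (fc (%x. m' x y) k)"
    using k0 fc_deriv[OF d[OF y] per[OF y] c'[OF y], of k] by (simp add: norm_mult)
  qed
  hence "(\<Sum>k\<in>A. cmod (?c k))\<^sup>2 <= (\<Sum>k\<in>A. (1 / \<bar>real_of_int k\<bar>)\<^sup>2) * (\<Sum>k\<in>A. (cmod (fc (%x. m' x y) k))\<^sup>2)"
   using Cauchy_Schwarz_ineq_sum[of "%k. 1 / \<bar>real_of_int k\<bar>" "%k. cmod (fc (%x. m' x y) k)" A] by simp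
  also have "\<dots> <= 4 / real L * h\<^sup>2"
  proof (rule mult_mono[OF _ bessel[OF c'[OF y] b(2)[OF y] A(2)]])
   show "(\<Sum>k\<in>A. (1 / \<bar>real_of_int k\<bar>)\<^sup>2) <= 4 / real L"
    using sum_inverse_squares[OF A] by (simp add: power_divide)
  qed (auto intro: sum_nonneg)
  also have "\<dots> = (2 * h / sqrt (real L))\<^sup>2" by (simp add: power_divide power_mult_distrib)
  finally show ?thesis by (rule power2_le_imp_le) (use h in simp)
 qed
 show "(\<Sum>k\<in>F. cmod (?c k)) <= 3 * h / sqrt (1 + real N)"
 proof (cases "N = 0")
  case True
  have "(\<Sum>k\<in>F. cmod (?c k)) <= cmod (?c 0) + (\<Sum>k\<in>F - {0}. cmod (?c k))"
   using F(1) by (cases "0 \<in> F") (simp_all add: sum.remove)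
  moreover have "(\<Sum>k\<in>F - {0}. cmod (?c k)) <= 2 * h / sqrt (real 1)" by (rule tail) (use F in auto)
  moreover have "cmod (?c 0) <= h" using bessel[OF cg b(1)[OF y], of "{0}"] power2_le_imp_le[OF _ h] by auto
  ultimately show ?thesis using True by simp
 next
  case False
  have "2 * sqrt (1 + real N) <= 3 * sqrt (real N)"
   by (rule power2_le_imp_le) (use False in \<open>auto simp: power_mult_distrib\<close>)
  hence "h * (2 * sqrt (1 + real N)) <= h * (3 * sqrt (real N))" using h by (rule mult_left_mono)
  hence "2 * h / sqrt (real N) <= 3 * h / sqrt (1 + real N)" using False by (simp add: field_simps)
  thus ?thesis using tail[of N F] F False by force
 qed
qed

lemma fsum_fc:
 assumes n: "nice b (%k y. fc (%x. m x y) k)" and z: "0 < Re z" "Re z < 2 * pi" "Im z \<in> {-1..1}"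
  and d: "\<And>x. x \<in> {0..2*pi} ==> ((%x. m x (Im z)) has_vector_derivative m' x) (at x within {0..2*pi})"
 shows "fsum (%k y. fc (%x. m x y) k) z = m (Re z) (Im z)"
proof (rule LIMSEQ_unique)
 show "(%n. \<Sum>k=-int n..int n. fc (%x. m x (Im z)) k * cis (of_int k * Re z)) \<longlonglongrightarrow> fsum (%k y. fc (%x. m x y) k) z"
  using tendsto_uniform_limitI[OF fsum_uniform[OF n], of z] z(3) by simp
 have "continuous_on {0..2*pi} (%x. m x (Im z))"
  unfolding continuous_on_eq_continuous_within using d has_vector_derivative_continuous by blast
 moreover have "((%x. m x (Im z)) has_vector_derivative m' (Re z)) (at (Re z))"
  using d[of "Re z"] z at_within_interior[of "Re z" "{0..2*pi}"] by simp
 ultimately show "(%n. \<Sum>k=-int n..int n. fc (%x. m x (Im z)) k * cis (of_int k * Re z)) \<longlonglongrightarrow> m (Re z) (Im z)"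
  by (rule fourier_pointwise[OF _ z(1,2)])
qed

section \<open>Local solutions of the Beltrami equation\<close>

text \<open>The derivative is required to be continuous direction by direction, in accordance with
  \<open>Ck_on\<close>.\<close>

definition C1 :: "('a::real_normed_vector => 'b::real_normed_vector) => 'a set => bool" where
 "C1 f U \<longleftrightarrow> (\<exists>f'. (\<forall>u\<in>U. (f has_derivative f' u) (at u)) & (\<forall>h. continuous_on U (%u. f' u h)))"

lemma C1_cont: "C1 f U ==> continuous_on U f"
 unfolding C1_def by (meson has_derivative_continuous continuous_at_imp_continuous_on)

lemma C1_subset: "C1 f U ==> V \<subseteq> U ==> C1 f V"
 unfolding C1_def by (meson continuous_on_subset subsetD)

lemma C1_bilinear:
 assumes "bounded_bilinear B" "C1 f U" "C1 g U"
 shows "C1 (%u. B (f u) (g u)) U"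
proof -
 interpret bounded_bilinear B by fact
 obtain f' g' where f: "\<forall>u\<in>U. (f has_derivative f' u) (at u)" "\<forall>h. continuous_on U (%u. f' u h)"
  and g: "\<forall>u\<in>U. (g has_derivative g' u) (at u)" "\<forall>h. continuous_on U (%u. g' u h)"
  using assms(2,3) unfolding C1_def by blast
 have "\<forall>u\<in>U. ((%u. B (f u) (g u)) has_derivative (%h. B (f u) (g' u h) + B (f' u h) (g u))) (at u)"
  using f(1) g(1) by (intro ballI FDERIV) simp_all
 moreover have "\<forall>h. continuous_on U (%u. B (f u) (g' u h) + B (f' u h) (g u))"
  by (intro allI continuous_on_add continuous_on[OF C1_cont[OF assms(2)] g(2)[rule_format]] continuous_on[OF f(2)[rule_format] C1_cont[OF assms(3)]])
 ultimately show ?thesis unfolding C1_def by (intro exI[of _ "%u h. B (f u) (g' u h) + B (f' u h) (g u)"]) auto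
qed

lemma C1_add:
 assumes "C1 f U" "C1 g U"
 shows "C1 (%u. f u + g u) U"
proof -
 obtain f' g' where f: "\<forall>u\<in>U. (f has_derivative f' u) (at u)" "\<forall>h. continuous_on U (%u. f' u h)"
  and g: "\<forall>u\<in>U. (g has_derivative g' u) (at u)" "\<forall>h. continuous_on U (%u. g' u h)"
  using assms unfolding C1_def by blast
 show ?thesis unfolding C1_def
  using f g by (intro exI[of _ "%u h. f' u h + g' u h"] conjI ballI allI has_derivative_add continuous_on_add) simp_all
qed

lemma C1_const: "C1 (%u. c) U"
 unfolding C1_def by (rule exI[of _ "%u h. 0"]) simp

lemma C1_linear_comp:
 assumes L: "bounded_linear L" and "C1 f U"
 shows "C1 (%u. L (f u)) U"
proof -
 obtain f' where f: "\<And>u. u \<in> U ==> (f has_derivative f' u) (at u)" "\<And>h. continuous_on U (%u. f' u h)"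
  using assms(2) unfolding C1_def by blast
 have "((%u. L (f u)) has_derivative (%h. L (f' u h))) (at u)" if "u \<in> U" for u
  by (rule bounded_linear.has_derivative[OF L f(1)[OF that]])
 moreover have "continuous_on U (%u. L (f' u h))" for h by (rule bounded_linear.continuous_on[OF L f(2)])
 ultimately show ?thesis unfolding C1_def by (intro exI[of _ "%u h. L (f' u h)"]) simp
qed

lemma C1_field_comp:
 fixes f :: "'a::real_normed_vector => 'b::real_normed_field"
 assumes "C1 f U" "\<And>u. u \<in> U ==> (g has_field_derivative g' (f u)) (at (f u))" "continuous_on (f ` U) g'"
 shows "C1 (%u. g (f u)) U"
proof -
 obtain f' where f: "\<forall>u\<in>U. (f has_derivative f' u) (at u)" "\<forall>h. continuous_on U (%u. f' u h)"
  using assms(1) unfolding C1_def by blast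
 have "\<forall>u\<in>U. ((%u. g (f u)) has_derivative (%h. g' (f u) * f' u h)) (at u)"
  by (rule ballI has_derivative_compose[OF f(1)[rule_format] assms(2)[unfolded has_field_derivative_def]] | assumption)+
 moreover have "\<forall>h. continuous_on U (%u. g' (f u) * f' u h)"
  using f(2) by (intro allI continuous_on_mult continuous_on_compose2[OF assms(3) C1_cont[OF assms(1)]]) auto
 ultimately show ?thesis unfolding C1_def by (intro exI[of _ "%u h. g' (f u) * f' u h"]) auto
qed

lemma C1_affine_pre:
 assumes "C1 f U" "bounded_linear A"
 shows "C1 (%z. f (c + A z)) {z. c + A z \<in> U}"
proof -
 obtain f' where f: "\<forall>u\<in>U. (f has_derivative f' u) (at u)" "\<forall>h. continuous_on U (%u. f' u h)"
  using assms(1) unfolding C1_def by blast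
 have a: "((%z. c + A z) has_derivative A) (at z)" for z
  using has_derivative_add[OF has_derivative_const[of c] bounded_linear_imp_has_derivative[OF assms(2)], of "at z"] by simp
 have "((%z. f (c + A z)) has_derivative (%h. f' (c + A z) (A h))) (at z)" if "c + A z \<in> U" for z
  by (rule has_derivative_compose[OF a[of z] f(1)[rule_format, OF that]])
 moreover have "continuous_on {z. c + A z \<in> U} (%z. f' (c + A z) (A h))" for h
  by (rule continuous_on_compose2[OF f(2)[rule_format, of "A h"]])
    (use continuous_on_add[OF continuous_on_const bounded_linear.continuous_on[OF assms(2) continuous_on_id]] in auto)
 ultimately show ?thesis unfolding C1_def by (intro exI[of _ "%z h. f' (c + A z) (A h)"]) auto
qed

lemma max_square_deriv: "((%s. (max 0 s)\<^sup>2) has_real_derivative 2 * max 0 s) (at s)"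
proof -
 consider "s < 0" | "s = 0" | "0 < s" by linarith
 thus ?thesis
 proof cases
  case 1
  show ?thesis
   by (rule has_field_derivative_transform_within_open[where f = "%s. 0" and S = "{..<0}"]) (use 1 in auto)
 next
  case 3
  have "((%s. s\<^sup>2) has_real_derivative 2 * max 0 s) (at s)" using 3 by (auto intro!: derivative_eq_intros)
  thus ?thesis
   by (rule has_field_derivative_transform_within_open[where S = "{0<..}"]) (use 3 in auto)
 next
  case 2
  have "((%h. ((max 0 h)\<^sup>2 - (max 0 0)\<^sup>2) / (h - 0)) \<longlongrightarrow> 0) (at (0::real))"
  proof (rule tendsto_0_le[where f = "%h. h" and K = 1])
   show "\<forall>\<^sub>F h in at 0. norm (((max 0 h)\<^sup>2 - (max 0 0)\<^sup>2) / (h - 0)) <= norm (h::real) * 1"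
    by (rule always_eventually) (simp add: max_def power2_eq_square)
  qed (rule tendsto_ident_at)
  thus ?thesis using 2 by (simp add: has_field_derivative_iff)
 qed
qed

text \<open>A \<open>C\<^sup>1\<close> function that is the identity near \<open>0\<close> and takes equal values at \<open>\<plusminus>\<pi>\<close>.\<close>

definition fold_pi :: "real => real" where
 "fold_pi s = s - pi / (pi - 1)\<^sup>2 * (max 0 (s - 1))\<^sup>2 + pi / (pi - 1)\<^sup>2 * (max 0 (- s - 1))\<^sup>2"

definition fold_pi' :: "real => real" where
 "fold_pi' s = 1 - pi / (pi - 1)\<^sup>2 * (2 * max 0 (s - 1)) - pi / (pi - 1)\<^sup>2 * (2 * max 0 (- s - 1))"

lemma fold_pi_deriv: "(fold_pi has_real_derivative fold_pi' s) (at s)"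
proof -
 have 1: "((%s. (max 0 (s - 1))\<^sup>2) has_real_derivative 2 * max 0 (s - 1) * 1) (at s)"
  by (rule DERIV_chain2[OF max_square_deriv]) (auto intro!: derivative_eq_intros)
 have 2: "((%s. (max 0 (- s - 1))\<^sup>2) has_real_derivative 2 * max 0 (- s - 1) * (- 1)) (at s)"
  by (rule DERIV_chain2[OF max_square_deriv]) (auto intro!: derivative_eq_intros)
 show ?thesis unfolding fold_pi_def[abs_def] fold_pi'_def
  by (rule derivative_eq_intros DERIV_cmult[OF 1] DERIV_cmult[OF 2] refl | simp)+
qed

lemma fold_pi_facts: "\<bar>s\<bar> <= 1 ==> fold_pi s = s" "fold_pi pi = 0" "fold_pi (- pi) = 0"
 "continuous_on A fold_pi" "continuous_on A fold_pi'"
proof -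
 have p: "pi - 1 > 0" using pi_gt3 by simp
 show "\<bar>s\<bar> <= 1 ==> fold_pi s = s" by (auto simp: fold_pi_def max_def)
 show "fold_pi pi = 0" "fold_pi (- pi) = 0" using p by (auto simp: fold_pi_def max_def)
 show "continuous_on A fold_pi" unfolding fold_pi_def[abs_def] by (intro continuous_intros)
 show "continuous_on A fold_pi'" unfolding fold_pi'_def[abs_def] by (intro continuous_intros)
qed

text \<open>Rescaling by a small \<open>D\<close> makes both the coefficient, which vanishes at 0,
  and its derivative as small as \<open>strip_solution\<close> requires. Folding the horizontal
  variable by \<open>fold_pi\<close> makes the rescaled coefficient periodic without changing it
  near the centre, so the solution on the strip solves the original equation there.\<close>

lemma beltrami_small:
 assumes r: "0 < r" and m1: "C1 m1 (ball 0 r)" and m0: "m1 0 = 0"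
 obtains e p f where "0 < e" "e <= r" "continuous_on (ball 0 e) p"
  "\<And>z. z \<in> ball 0 e ==> (f has_derivative (%v. p z * (v + m1 z * cnj v))) (at z)"
  "\<And>z. z \<in> ball 0 e ==> cmod (p z - 1) <= 1 / 3 & cmod (m1 z * p z) <= 1 / 3"
proof -
 obtain mu' where d: "\<And>z. z \<in> ball 0 r ==> (m1 has_derivative mu' z) (at z)" and cd: "continuous_on (ball 0 r) (%z. mu' z 1)"
  using m1 unfolding C1_def by blast
 have "compact (fold_pi ` {-pi..pi} \<union> fold_pi' ` {-pi..pi})"
  by (intro compact_Un compact_continuous_image fold_pi_facts) auto
 hence "bounded (fold_pi ` {-pi..pi} \<union> fold_pi' ` {-pi..pi})" by (rule compact_imp_bounded)
 then obtain B where B: "0 < B" "\<forall>x\<in>fold_pi ` {-pi..pi} \<union> fold_pi' ` {-pi..pi}. norm x <= B" using bounded_normE by metis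
 have cc: "cball 0 (r / 2) \<subseteq> ball (0::complex) r" using r by (auto simp: subset_iff)
 have "compact ((%z. mu' z 1) ` cball 0 (r / 2))"
  by (intro compact_continuous_image continuous_on_subset[OF cd cc]) auto
 from compact_imp_bounded[OF this] obtain M where M: "0 < M" "\<forall>x\<in>(%z. mu' z 1) ` cball 0 (r / 2). norm x <= M"
  using bounded_normE by metis
 \<comment> \<open>A third of \<open>1 / 246\<close>, because \<open>nice_fc\<close> multiplies the
   bound by 3.\<close>
 define h :: real where "h = 1 / 738"
 have "continuous (at 0) m1" using d[of 0] r has_derivative_continuous by auto
 moreover have "0 < h" by (simp add: h_def)
 ultimately obtain r1 where r1': "0 < r1" "\<forall>z. dist z 0 < r1 --> dist (m1 z) (m1 0) < h"
  unfolding continuous_at_eps_delta by metis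
 hence r1: "0 < r1" "\<And>z. cmod z < r1 ==> cmod (m1 z) < h"
  using m0 by auto
 define R where "R = min (r / 2) r1"
 \<comment> \<open>The first bound keeps the rescaled period rectangle within radius
   \<open>R\<close>, where the coefficient is below \<open>h\<close>; the second makes the
   horizontal derivative at most \<open>h\<close>.\<close>
 define D where "D = min (R / (2 * (B + 1))) (h / (B * M))"
 have D: "0 < D" "D * (B + 1) < R" "D * B * M <= h"
 proof -
  show d0: "0 < D" using r r1 B(1) M(1) by (auto simp: D_def R_def h_def)
  have "D * (B + 1) <= R / (2 * (B + 1)) * (B + 1)" using B(1) by (intro mult_right_mono) (auto simp: D_def)
  also have "\<dots> = R / 2" using B(1) by (simp add: field_simps)
  finally show "D * (B + 1) < R" using r r1 by (auto simp: R_def)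
  have "D * (B * M) <= h / (B * M) * (B * M)" using B(1) M(1) by (intro mult_right_mono) (auto simp: D_def)
  thus "D * B * M <= h" using B(1) M(1) by (simp add: mult.assoc)
 qed
 define P where "P x y = Complex (D * fold_pi (x - pi)) (D * y)" for x y
 have Pn: "cmod (P x y) < R" if "x \<in> {0..2*pi}" "y \<in> {-1..1}" for x y
 proof -
  have "\<bar>fold_pi (x - pi)\<bar> <= B" using B(2) that(1) by auto
  hence "D * \<bar>fold_pi (x - pi)\<bar> + D * \<bar>y\<bar> <= D * B + D * 1"
   using that(2) D(1) by (intro add_mono mult_left_mono) auto
  moreover have "cmod (P x y) <= D * \<bar>fold_pi (x - pi)\<bar> + D * \<bar>y\<bar>"
   using cmod_le[of "P x y"] D(1) by (simp add: P_def abs_mult)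
  ultimately show ?thesis using D(2) by (simp add: algebra_simps)
 qed
 have Pr: "P x y \<in> cball 0 (r / 2)" "P x y \<in> ball 0 r" "cmod (P x y) < r1" if "x \<in> {0..2*pi}" "y \<in> {-1..1}" for x y
  using Pn[OF that] r by (auto simp: R_def)
 define m where "m x y = m1 (P x y)" for x y
 define m' where "m' x y = of_real (D * fold_pi' (x - pi)) * mu' (P x y) 1" for x y
 have cP: "continuous_on A (%p. P (snd p) (fst p))" for A
  unfolding P_def Complex_eq by (intro continuous_intros continuous_on_compose2[OF fold_pi_facts(4)]) auto
 have dm: "((%x. m x y) has_vector_derivative m' x y) (at x within {0..2*pi})"
  if xy: "y \<in> {-1..1}" "x \<in> {0..2*pi}" for x y
 proof -
  have "((%x. D * fold_pi (x - pi)) has_real_derivative D * fold_pi' (x - pi)) (at x)"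
   by (auto intro!: derivative_eq_intros DERIV_chain2[OF fold_pi_deriv])
  from has_derivative_add[OF bounded_linear.has_derivative[OF bounded_linear_of_real this[unfolded has_field_derivative_def]] has_derivative_const]
  have "((%x. of_real (D * fold_pi (x - pi)) + \<i> * of_real (D * y)) has_derivative
    (%t. of_real (D * fold_pi' (x - pi) * t) + (0::complex))) (at x)" .
  hence "((%x. P x y) has_derivative (%t. of_real (D * fold_pi' (x - pi) * t))) (at x)"
   unfolding P_def Complex_eq by (simp only: add_0_right)
  from has_derivative_compose[OF this d[OF Pr(2)[OF xy(2,1)]]]
  have "((%x. m x y) has_derivative (%t. mu' (P x y) (of_real (D * fold_pi' (x - pi) * t)))) (at x)" by (simp add: m_def)
  moreover have "mu' (P x y) (of_real c) = of_real c * mu' (P x y) 1" for c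
   using linear_scale[OF has_derivative_linear[OF d[OF Pr(2)[OF xy(2,1)]]], of c 1] by (simp add: scaleR_conv_of_real)
  hence "(%t. mu' (P x y) (of_real (D * fold_pi' (x - pi) * t))) = (%t. t *\<^sub>R m' x y)"
   by (simp only:) (simp add: m'_def scaleR_conv_of_real mult_ac)
  ultimately show ?thesis unfolding has_vector_derivative_def by (simp add: has_derivative_at_withinI)
 qed
 have nm: "nice (3 * h) (%k y. fc (%x. m x y) k)"
 proof (rule nice_fc[OF _ dm])
  show "continuous_on ({-1..1} \<times> {0..2*pi}) (%(y, x). m x y)"
   unfolding m_def case_prod_unfold by (rule continuous_on_compose2[OF C1_cont[OF m1] cP]) (use Pr in auto)
  show "continuous_on {0..2*pi} (%x. m' x y)" if "y \<in> {-1..1}" for y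
  proof -
   have "continuous_on {0..2*pi} (%x. P x y)"
    using continuous_on_compose2[OF cP[of UNIV] continuous_on_Pair[OF continuous_on_const[of "{0..2*pi}" y] continuous_on_id]] by simp
   hence "continuous_on {0..2*pi} (%x. mu' (P x y) 1)" by (rule continuous_on_compose2[OF cd]) (use Pr that in auto)
   thus ?thesis unfolding m'_def by (intro continuous_intros continuous_on_compose2[OF fold_pi_facts(5)]) auto
  qed
  show "m 0 y = m (2 * pi) y" for y by (simp add: m_def P_def fold_pi_facts)
  show "cmod (m x y) <= h" if "y \<in> {-1..1}" "x \<in> {0..2*pi}" for x y
   using r1(2)[OF Pr(3)[OF that(2,1)]] by (simp add: m_def)
  show "cmod (m' x y) <= h" if "y \<in> {-1..1}" "x \<in> {0..2*pi}" for x y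
  proof -
   have "\<bar>fold_pi' (x - pi)\<bar> <= B" using B(2) that(2) by auto
   moreover have "cmod (mu' (P x y) 1) <= M" using M(2) Pr(1)[OF that(2,1)] by auto
   ultimately have "D * \<bar>fold_pi' (x - pi)\<bar> * cmod (mu' (P x y) 1) <= D * B * M"
    using D(1) B(1) by (intro mult_mono) auto
   from order_trans[OF this D(3)] show ?thesis using D(1) by (simp add: m'_def norm_mult abs_mult)
  qed
 qed
 obtain f p q where f: "\<And>z. \<bar>Im z\<bar> < 1 ==> (f has_derivative (%v. p z * v + q z * cnj v)) (at z)"
  and cp: "continuous_on {z. \<bar>Im z\<bar> < 1} p"
  and pq: "\<And>z. \<bar>Im z\<bar> < 1 ==> q z = fsum (%k y. fc (%x. m x y) k) z * p z & cmod (p z - 1) <= 1 / 3 & cmod (q z) <= 1 / 3"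
  by (rule strip_solution[OF nm], simp add: h_def) (rule that, assumption+)
 \<comment> \<open>Carries the ball of radius \<open>D\<close> to the unit disc around
   \<open>pi\<close>, the middle of the period, where the folding is the identity.\<close>
 define T where "T z = z / of_real D + of_real pi" for z :: complex
 have T: "\<bar>Im (T z)\<bar> < 1 & q (T z) = m1 z * p (T z)" if z: "z \<in> ball 0 D" for z
 proof -
  have "cmod (z / of_real D) < 1" using z D(1) by (simp add: norm_divide)
  hence c: "\<bar>Re (z / of_real D)\<bar> < 1" "\<bar>Im (z / of_real D)\<bar> < 1"
   using abs_Re_le_cmod abs_Im_le_cmod le_less_trans by blast+
  have c': "-1 < Re z / D" "Re z / D < 1" "-1 < Im z / D" "Im z / D < 1"
   using c by (simp_all only: Re_divide_of_real Im_divide_of_real abs_less_iff) linarith+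
  have I: "Im (T z) \<in> {-1..1}" "0 < Re (T z)" "Re (T z) < 2 * pi" using c' pi_gt3 by (auto simp: T_def)
  have "fsum (%k y. fc (%x. m x y) k) (T z) = m (Re (T z)) (Im (T z))"
   by (rule fsum_fc[OF nm I(2,3,1) dm[OF I(1)]])
  also have "\<dots> = m1 z" using c(1) D(1) fold_pi_facts(1) by (simp add: P_def T_def complex_eq_iff m_def)
  finally show ?thesis using pq[of "T z"] c by (simp add: T_def)
 qed
 show ?thesis
 proof (rule that[of D "%z. p (T z)" "%z. of_real D * f (T z)"])
  have "D * 1 <= D * (B + 1)" using D(1) B(1) by (intro mult_left_mono) auto
  thus "D <= r" using D(2) r by (auto simp: R_def)
  show "continuous_on (ball 0 D) (%z. p (T z))"
   by (rule continuous_on_compose2[OF cp]) (use T D(1) in \<open>auto simp: T_def[abs_def] intro!: continuous_intros\<close>)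
  fix z :: complex assume z: "z \<in> ball 0 D"
  have dT: "(T has_derivative (%v. v / of_real D)) (at z)"
   unfolding T_def[abs_def] using D(1) by (auto intro!: derivative_eq_intros)
  have "((%z. of_real D * f (T z)) has_derivative (%v. of_real D * (p (T z) * (v / of_real D) + q (T z) * cnj (v / of_real D)))) (at z)"
   by (intro has_derivative_mult_right has_derivative_compose[OF dT f]) (use T[OF z] in auto)
  moreover have "of_real D * (p (T z) * (v / of_real D) + q (T z) * cnj (v / of_real D)) = p (T z) * (v + m1 z * cnj v)" for v
   using T[OF z] D(1) by (simp add: field_simps)
  ultimately show "((%z. of_real D * f (T z)) has_derivative (%v. p (T z) * (v + m1 z * cnj v))) (at z)" by simp
  show "cmod (p (T z) - 1) <= 1 / 3 & cmod (m1 z * p (T z)) <= 1 / 3"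
   using pq[of "T z"] T[OF z] by auto
 qed (use D in auto)
qed

text \<open>The map minus the identity is a contraction, so two points with the same image would be
  strictly closer than they are.\<close>

lemma near_identity_inj:
 fixes f :: "'a::{real_normed_vector, perfect_space} => 'a"
 assumes S: "convex S" and d: "\<And>z. z \<in> S ==> (f has_derivative f' z) (at z)"
  and b: "\<And>z v. z \<in> S ==> norm (f' z v - v) <= k * norm v" and k: "k < 1"
 shows "inj_on f S"
proof (rule inj_onI)
 fix x y assume xy: "x \<in> S" "y \<in> S" "f x = f y"
 have "norm ((f x - x) - (f y - y)) <= k * norm (x - y)"
 proof (rule differentiable_bound[OF S, of "%z. f z - z" "%z v. f' z v - v"])
  fix z assume z: "z \<in> S"
  show "((%z. f z - z) has_derivative (%v. f' z v - v)) (at z within S)"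
   by (rule has_derivative_at_withinI[OF has_derivative_diff[OF d[OF z] has_derivative_ident]])
  show "onorm (%v. f' z v - v) <= k" by (rule onorm_le[OF b[OF z]])
 qed (use xy in auto)
 hence "(1 - k) * norm (x - y) <= 0" using xy(3) by (simp add: norm_minus_commute algebra_simps)
 thus "x = y" using k by (simp add: mult_le_0_iff)
qed

text \<open>The real linear map \<open>l\<close> solves the equation with the constant coefficient
  \<open>c = M u0\<close>. In the coordinate \<open>l (u - u0)\<close> the coefficient becomes
  \<open>n\<close>, the Moebius image of \<open>M\<close> that vanishes at the base point, which
  reduces the claim to \<open>beltrami_small\<close>. Injectivity follows because that solution is
  close to the identity.\<close>

lemma beltrami_local:
 assumes V: "open V" "u0 \<in> V" and M: "C1 M V" and m1: "\<And>u. u \<in> V ==> cmod (M u) < 1"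
 obtains N F P where "open N" "u0 \<in> N" "N \<subseteq> V" "inj_on F N" "continuous_on N P" "\<And>u. u \<in> N ==> P u ~= 0"
  "\<And>u. u \<in> N ==> (F has_derivative (%v. P u * (v + M u * cnj v))) (at u)"
proof -
 define c where "c = M u0"
 have c1: "cmod c < 1" using m1[OF V(2)] by (simp add: c_def)
 define D where "D = 1 - c * cnj c"
 have D: "D ~= 0"
 proof
  assume "D = 0"
  hence "(cmod c)\<^sup>2 = 1" unfolding D_def complex_norm_square[symmetric] by (metis eq_iff_diff_eq_0 of_real_eq_1_iff of_real_power)
  thus False using c1 by (simp add: abs_square_eq_1)
 qed
 define l where "l v = v + c * cnj v" for v
 define A where "A z = (z - c * cnj z) / D" for z
 have blc: "bounded_linear (%v. c * cnj v)" by (rule bounded_linear_const_mult[OF bounded_linear_cnj])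
 have bl1: "bounded_linear l" unfolding l_def[abs_def] by (rule bounded_linear_add[OF bounded_linear_ident blc])
 have bl2: "bounded_linear A" unfolding A_def[abs_def]
  by (rule bounded_linear_compose[OF bounded_linear_divide bounded_linear_sub[OF bounded_linear_ident blc]])
 note bl = bl1 bl2
 have cD: "cnj D = D" by (simp add: D_def mult.commute)
 have Al: "A (l v) = v" and lA: "l (A z) = z" for v z
 proof -
  have "l v - c * cnj (l v) = D * v" by (simp add: l_def D_def algebra_simps)
  thus "A (l v) = v" using D by (simp add: A_def)
  have "A z + c * cnj (A z) = (z - c * cnj z + c * cnj (z - c * cnj z)) / D" by (simp add: A_def cD add_divide_distrib diff_divide_distrib algebra_simps)
  also have "z - c * cnj z + c * cnj (z - c * cnj z) = D * z" by (simp add: D_def algebra_simps)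
  finally show "l (A z) = z" using D by (simp add: l_def)
 qed
 have den: "1 - cnj c * w ~= 0" if "cmod w < 1" for w
 proof
  assume "1 - cnj c * w = 0"
  hence "cmod (cnj c * w) = 1" by (metis eq_iff_diff_eq_0 norm_one)
  moreover have "cmod c * cmod w < 1 * 1" using c1 that by (intro mult_strict_mono') auto
  ultimately show False by (simp add: norm_mult)
 qed
 define n where "n z = (M (u0 + A z) - c) / (1 - cnj c * M (u0 + A z))" for z
 have A0: "A 0 = 0" by (simp add: A_def)
 have op: "open {z. u0 + A z \<in> V}"
  using open_vimage[OF V(1), of "%z. u0 + A z"] continuous_on_add[OF continuous_on_const bounded_linear.continuous_on[OF bl(2) continuous_on_id]]
  by (simp add: vimage_def)
 have "0 \<in> {z. u0 + A z \<in> V}" using V(2) by (simp add: A0)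
 from openE[OF op this] obtain r where r: "0 < r" "ball 0 r \<subseteq> {z. u0 + A z \<in> V}" .
 have "C1 (%z. M (u0 + A z)) {z. u0 + A z \<in> V}" by (rule C1_affine_pre[OF M bl(2)])
 hence "C1 n {z. u0 + A z \<in> V}"
  unfolding n_def
 proof (rule C1_field_comp[where g = "%w. (w - c) / (1 - cnj c * w)" and g' = "%w. D / (1 - cnj c * w)\<^sup>2"])
  fix z assume "z \<in> {z. u0 + A z \<in> V}"
  hence "1 - cnj c * M (u0 + A z) ~= 0" using m1 den by blast
  thus "((%w. (w - c) / (1 - cnj c * w)) has_field_derivative D / (1 - cnj c * M (u0 + A z))\<^sup>2) (at (M (u0 + A z)))"
   by (auto intro!: derivative_eq_intros simp: D_def power2_eq_square field_simps)
 next
  show "continuous_on ((%z. M (u0 + A z)) ` {z. u0 + A z \<in> V}) (%w. D / (1 - cnj c * w)\<^sup>2)"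
   by (intro continuous_intros) (use m1 den in auto)
 qed
 hence Cn: "C1 n (ball 0 r)" using r(2) by (rule C1_subset)
 have n0: "n 0 = 0" by (simp add: n_def A0 c_def)
 obtain e p f where e: "0 < e" "e <= r" and cp: "continuous_on (ball 0 e) p"
  and df: "\<And>z. z \<in> ball 0 e ==> (f has_derivative (%v. p z * (v + n z * cnj v))) (at z)"
  and pb: "\<And>z. z \<in> ball 0 e ==> cmod (p z - 1) <= 1 / 3 & cmod (n z * p z) <= 1 / 3"
  by (rule beltrami_small[OF r(1) Cn n0]) (rule that, assumption+)
 have inj: "inj_on f (ball 0 e)"
 proof (rule near_identity_inj[OF convex_ball df, where k = "2/3"])
  fix z v :: complex assume z: "z \<in> ball 0 e"
  have "p z * (v + n z * cnj v) - v = (p z - 1) * v + (n z * p z) * cnj v" by (simp add: algebra_simps)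
  also have "cmod \<dots> <= cmod (p z - 1) * cmod v + cmod (n z * p z) * cmod v"
   by (rule order_trans[OF norm_triangle_ineq]) (simp add: norm_mult)
  also have "\<dots> <= 1/3 * cmod v + 1/3 * cmod v" using pb[OF z] by (intro add_mono mult_right_mono) auto
  finally show "cmod (p z * (v + n z * cnj v) - v) <= 2 / 3 * cmod v" by simp
 qed auto
 have p0: "p z ~= 0" if "z \<in> ball 0 e" for z using pb[OF that] by auto
 define N where "N = {u. l (u - u0) \<in> ball 0 e}"
 have NA: "u0 + A (l (u - u0)) = u" for u by (simp add: Al)
 have cl: "continuous_on S (%u. l (u - u0))" for S
  by (intro bounded_linear.continuous_on[OF bl(1)] continuous_intros)
 have NV: "u \<in> V" if "u \<in> N" for u
 proof -
  have "u0 + A (l (u - u0)) \<in> V" using that e(2) r(2) by (force simp: N_def)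
  thus ?thesis by (simp only: NA)
 qed
 show ?thesis
 proof (rule that[of N "%u. f (l (u - u0))" "%u. p (l (u - u0)) * (1 + n (l (u - u0)) * cnj c)"])
  show "open N" using open_vimage[of "ball 0 e" "%u. l (u - u0)", OF open_ball cl] by (simp add: vimage_def N_def)
  show "u0 \<in> N" using e by (simp add: N_def l_def)
  show "N \<subseteq> V" using NV by blast
  have "u = u'" if "l (u - u0) = l (u' - u0)" for u u' using NA[of u] NA[of u'] that by metis
  thus "inj_on (%u. f (l (u - u0))) N"
   using inj by (auto simp: inj_on_def N_def)
  have cn: "continuous_on (ball 0 e) n" using C1_cont[OF Cn] by (rule continuous_on_subset) (use e in auto)
  show "continuous_on N (%u. p (l (u - u0)) * (1 + n (l (u - u0)) * cnj c))"
   by (intro continuous_intros continuous_on_compose2[OF cp cl] continuous_on_compose2[OF cn cl]) (auto simp: N_def)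
  fix u assume u: "u \<in> N"
  let ?z = "l (u - u0)" and ?m = "M u"
  have z: "?z \<in> ball 0 e" using u by (simp add: N_def)
  have nz: "n ?z = (?m - c) / (1 - cnj c * ?m)" by (simp add: n_def NA)
  have d0: "1 - cnj c * ?m ~= 0" using den m1 NV[OF u] by blast
  hence k: "1 + n ?z * cnj c = D / (1 - cnj c * ?m)" "c + n ?z = ?m * (D / (1 - cnj c * ?m))"
   by (simp_all add: nz D_def field_simps)
  thus "p ?z * (1 + n ?z * cnj c) ~= 0" using p0[OF z] d0 D by simp
  have "((%u. l (u - u0)) has_derivative l) (at u)"
   using bounded_linear.has_derivative[OF bl(1) has_derivative_diff[OF has_derivative_ident has_derivative_const]] by simp
  from has_derivative_compose[OF this df[OF z]]
  have "((%u. f (l (u - u0))) has_derivative (%v. p ?z * (l v + n ?z * cnj (l v)))) (at u)" .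
  moreover have "l v + n ?z * cnj (l v) = (1 + n ?z * cnj c) * (v + ?m * cnj v)" for v
  proof -
   have "l v + n ?z * cnj (l v) = (1 + n ?z * cnj c) * v + (c + n ?z) * cnj v" by (simp add: l_def algebra_simps)
   also have "c + n ?z = ?m * (1 + n ?z * cnj c)" unfolding k ..
   finally show ?thesis by (simp add: algebra_simps)
  qed
  ultimately show "((%u. f (l (u - u0))) has_derivative (%v. p ?z * (1 + n ?z * cnj c) * (v + M u * cnj v))) (at u)"
   by (simp add: mult.assoc)
 qed
qed

lemma beltrami_disc:
 assumes V: "open V" "u0 \<in> V" and m: "C1 m V" and m1: "\<And>u. u \<in> V ==> cmod (m u) < 1"
 obtains N F P where "open N" "u0 \<in> N" "N \<subseteq> V" "bij_betw F N D1" "F u0 = 0" "continuous_on N P" "\<And>u. u \<in> N ==> P u ~= 0"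
  "\<And>u. u \<in> N ==> (F has_derivative (%v. P u * (v + m u * cnj v))) (at u)"
proof -
 obtain N F P where N: "open N" "u0 \<in> N" "N \<subseteq> V" "inj_on F N" and P: "continuous_on N P" "\<And>u. u \<in> N ==> P u ~= 0"
  and F: "\<And>u. u \<in> N ==> (F has_derivative (%v. P u * (v + m u * cnj v))) (at u)"
  by (rule beltrami_local[OF V m m1]) (assumption, rule that, assumption+)
 have cF: "continuous_on N F" using F has_derivative_continuous continuous_at_imp_continuous_on by blast
 have "open (F ` N)" by (rule invariance_of_domain[OF cF N(1,4)])
 from openE[OF this imageI[OF N(2)]] obtain e where e: "0 < e" "ball (F u0) e \<subseteq> F ` N" .
 define N' where "N' = {u \<in> N. F u \<in> ball (F u0) e}"
 define F' where "F' u = (F u - F u0) / of_real e" for u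
 have e0: "complex_of_real e ~= 0" using e(1) by simp
 have mem: "F' u \<in> D1 \<longleftrightarrow> F u \<in> ball (F u0) e" for u
  using e(1) by (simp add: F'_def norm_divide dist_norm norm_minus_commute)
 show ?thesis
 proof (rule that[of N' F' "%u. P u / of_real e"])
  show "open N'" using continuous_open_preimage[OF cF N(1) open_ball[of "F u0" e]] unfolding N'_def vimage_def Int_def mem_Collect_eq .
  show "u0 \<in> N'" "N' \<subseteq> V" "F' u0 = 0" using N e by (auto simp: N'_def F'_def)
  show "bij_betw F' N' D1" unfolding bij_betw_def
  proof (intro conjI subset_antisym subsetI)
   show "inj_on F' N'" using N(4) e0 by (auto simp: inj_on_def N'_def F'_def)
   fix z assume "z \<in> F' ` N'" thus "z \<in> D1" using mem by (auto simp: N'_def)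
  next
   fix z :: complex assume z: "z \<in> D1"
   have "cmod (of_real e * z) < e * 1" unfolding norm_mult using z e(1) by (simp add: mult_strict_left_mono)
   hence "F u0 + of_real e * z \<in> F ` N" using e(2) by (auto simp: dist_norm)
   then obtain u where u: "u \<in> N" "F u = F u0 + of_real e * z" by auto
   hence "F' u = z" using e0 by (simp add: F'_def)
   moreover from this have "u \<in> N'" using mem[of u] z u by (simp add: N'_def)
   ultimately show "z \<in> F' ` N'" by blast
  qed
  show "continuous_on N' (%u. P u / of_real e)"
   by (intro continuous_intros continuous_on_subset[OF P(1)]) (use e0 in \<open>auto simp: N'_def\<close>)
  fix u assume "u \<in> N'"
  hence u: "u \<in> N" by (simp add: N'_def)
  show "P u / of_real e ~= 0" using P(2)[OF u] e0 by simp
  have "(F' has_derivative (%v. (P u * (v + m u * cnj v) - 0) / of_real e)) (at u)"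
   unfolding F'_def[abs_def]
   by (rule bounded_linear.has_derivative[OF bounded_linear_divide has_derivative_diff[OF F[OF u] has_derivative_const]])
  thus "(F' has_derivative (%v. P u / of_real e * (v + m u * cnj v))) (at u)" by simp
 qed
qed

section \<open>Isothermal charts\<close>

text \<open>\<open>\<xi>\<close> is only known to be continuous. Composed with the left inverse
  \<open>L\<close>, the map \<open>ps\<close> has the identity as derivative at
  \<open>\<xi> a\<close>, so the increments of \<open>\<xi>\<close> are controlled by those of
  \<open>F\<close>: first a Lipschitz bound at \<open>a\<close>, then the remainder estimate. The
  lemma serves both for inverse functions and for lifts through charts.\<close>

lemma immersion_lift:
 fixes \<xi> :: "'a::real_normed_vector => 'b::real_normed_vector"
 assumes ps: "(ps has_derivative D) (at (\<xi> a))" and L: "bounded_linear L" "\<And>v. L (D v) = v"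
  and F: "(F has_derivative D') (at a)" and c: "continuous (at a) \<xi>"
  and O: "open S" "a \<in> S" "\<And>w. w \<in> S ==> ps (\<xi> w) = F w"
 shows "(\<xi> has_derivative (%h. L (D' h))) (at a)"
proof -
 interpret L: bounded_linear L by fact
 let ?f = "%v. L (ps v)" and ?g = "%w. L (F w)"
 have f: "(?f has_derivative (%v. v)) (at (\<xi> a))" using L.has_derivative[OF ps] L(2) by simp
 have g: "(?g has_derivative (%h. L (D' h))) (at a)" by (rule L.has_derivative[OF F])
 have bl: "bounded_linear (%h. L (D' h))" using g has_derivative_bounded_linear by blast
 obtain K where K: "0 < K" "\<And>h. norm (L (D' h)) <= norm h * K" using bounded_linear.pos_bounded[OF bl] by blast
 show ?thesis unfolding has_derivative_at_alt
 proof (intro conjI allI impI)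
  show "bounded_linear (%h. L (D' h))" by fact
  fix e :: real assume e: "0 < e"
  \<comment> \<open>At most 1/2, so that the error proportional to the increment of
    \<open>\<xi>\<close> can be absorbed on the left; the second bound leaves half of
    \<open>e\<close> once the Lipschitz constant \<open>2 * (K + 1)\<close> is inserted.\<close>
  define ep where "ep = min (1/2) (e / (4 * (K + 1)))"
  have "2 * (K + 1) * ep <= 2 * (K + 1) * (e / (4 * (K + 1)))" using K(1) by (intro mult_left_mono) (auto simp: ep_def)
  also have "\<dots> = e / 2" using K(1) by (simp add: field_simps)
  finally have e3: "2 * (K + 1) * ep <= e / 2" .
  have "0 < ep" using e K(1) by (simp add: ep_def)
  moreover have "ep <= 1/2" unfolding ep_def by (rule min.cobounded1)
  ultimately have ep: "0 < ep" "ep <= 1/2" "2 * (K + 1) * ep <= e / 2" using e3 by auto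
  obtain d1 where d1: "0 < d1" "\<And>v. norm (v - \<xi> a) < d1 ==> norm (?f v - ?f (\<xi> a) - (v - \<xi> a)) <= ep * norm (v - \<xi> a)"
   using f ep(1) unfolding has_derivative_at_alt by metis
  obtain d2 where d2: "0 < d2" "\<And>w. dist w a < d2 ==> dist (\<xi> w) (\<xi> a) < d1"
   using c d1(1) unfolding continuous_at_eps_delta by metis
  obtain d3 where d3: "0 < d3" "\<And>w. norm (w - a) < d3 ==> norm (?g w - ?g a - L (D' (w - a))) <= min 1 (e / 2) * norm (w - a)"
   using g e unfolding has_derivative_at_alt by (metis half_gt_zero min_less_iff_conj zero_less_one)
  obtain d4 where d4: "0 < d4" "ball a d4 \<subseteq> S" using openE[OF O(1,2)] by blast
  show "\<exists>d>0. \<forall>y. norm (y - a) < d --> norm (\<xi> y - \<xi> a - L (D' (y - a))) <= e * norm (y - a)"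
  proof (intro exI[of _ "min d2 (min d3 d4)"] conjI allI impI)
   show "0 < min d2 (min d3 d4)" using d2 d3 d4 by simp
   fix w assume w: "norm (w - a) < min d2 (min d3 d4)"
   let ?E = "\<xi> w - \<xi> a" and ?r = "?f (\<xi> w) - ?f (\<xi> a) - (\<xi> w - \<xi> a)" and ?s = "?g w - ?g a - L (D' (w - a))"
   have wS: "w \<in> S" using w d4(2) by (auto simp: dist_norm norm_minus_commute subset_iff)
   have r: "norm ?r <= ep * norm ?E" using d1(2) d2(2)[of w] w by (simp add: dist_norm)
   have s: "norm ?s <= min 1 (e / 2) * norm (w - a)" using d3(2)[of w] w by simp
   have fg: "?f (\<xi> w) = ?g w" "?f (\<xi> a) = ?g a" using O wS by simp_all
   have "norm (L (D' (w - a)) + ?s - ?r) <= norm (L (D' (w - a))) + norm ?s + norm ?r"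
    by (meson add_right_mono norm_triangle_ineq norm_triangle_ineq4 order_trans)
   moreover have "?E = L (D' (w - a)) + ?s - ?r" by (simp add: fg)
   ultimately have "norm ?E <= norm (L (D' (w - a))) + norm ?s + norm ?r" by simp
   also have "\<dots> <= norm (w - a) * K + 1 * norm (w - a) + 1/2 * norm ?E"
    using K(2)[of "w - a"] s r mult_right_mono[OF ep(2) norm_ge_zero[of ?E]]
     mult_right_mono[OF min.cobounded1[of 1 "e / 2"] norm_ge_zero[of "w - a"]] by linarith
   finally have E: "norm ?E <= 2 * (K + 1) * norm (w - a)" by (simp add: algebra_simps)
   have "\<xi> w - \<xi> a - L (D' (w - a)) = ?s - ?r" by (simp add: fg)
   hence "norm (\<xi> w - \<xi> a - L (D' (w - a))) <= norm ?s + norm ?r" by (metis norm_triangle_ineq4)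
   also have "\<dots> <= e / 2 * norm (w - a) + ep * (2 * (K + 1) * norm (w - a))"
    using s r mult_left_mono[OF E, of ep] ep(1) mult_right_mono[OF min.cobounded2[of 1 "e / 2"] norm_ge_zero[of "w - a"]] by linarith
   also have "ep * (2 * (K + 1) * norm (w - a)) <= e / 2 * norm (w - a)"
    using mult_right_mono[OF ep(3) norm_ge_zero[of "w - a"]] by (simp add: algebra_simps)
   finally show "norm (\<xi> w - \<xi> a - L (D' (w - a))) <= e * norm (w - a)" by simp
  qed
 qed
qed

definition det2 :: "(complex => complex) => real" where
 "det2 D = Re (D 1) * Im (D \<i>) - Im (D 1) * Re (D \<i>)"

lemma linear_complex: "linear D ==> D h = Re h *\<^sub>R D 1 + Im h *\<^sub>R D \<i>"
proof -
 assume D: "linear D"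
 have "h = Re h *\<^sub>R 1 + Im h *\<^sub>R \<i>" by (simp add: complex_eq_iff)
 hence "D h = D (Re h *\<^sub>R 1 + Im h *\<^sub>R \<i>)" by (rule arg_cong)
 thus ?thesis using D by (simp only: linear_add linear_scale)
qed

lemma det2_comp:
 assumes "linear D"
 shows "det2 (%h. D (D' h)) = det2 D * det2 D'"
 unfolding det2_def linear_complex[OF assms, of "D' 1"] linear_complex[OF assms, of "D' \<i>"]
 by (simp add: algebra_simps)

lemma jacobian_det_eq: "(t has_derivative D) (at w) ==> jacobian_det t w = det2 D"
 by (simp add: jacobian_det_def det2_def Let_def frechet_derivative_at[symmetric])

text \<open>The images of 1 and \<open>\<i>\<close> have equal length and are orthogonal, and the
  positive determinant fixes the sense of rotation: the second is \<open>\<i>\<close> times the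
  first.\<close>

lemma conformal_linear:
 fixes D :: "complex => complex"
 assumes D: "linear D" and c: "\<And>h. (cmod (D h))\<^sup>2 = c * (cmod h)\<^sup>2" and d: "det2 D > 0"
 shows "D h = D 1 * h"
proof -
 define p q r s where "p = Re (D 1)" and "q = Im (D 1)" and "r = Re (D \<i>)" and "s = Im (D \<i>)"
 have "p\<^sup>2 + q\<^sup>2 = c" "r\<^sup>2 + s\<^sup>2 = c" using c[of 1] c[of \<i>] by (simp_all add: cmod_power2 p_def q_def r_def s_def)
 moreover have "(p + r)\<^sup>2 + (q + s)\<^sup>2 = 2 * c"
  using c[of "1 + \<i>"] linear_add[OF D, of 1 \<i>] by (simp add: cmod_power2 p_def q_def r_def s_def)
 moreover have pos: "p * s - q * r > 0" using d by (simp add: det2_def p_def q_def r_def s_def)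
 ultimately have o: "p * r + q * s = 0" and n: "p\<^sup>2 + q\<^sup>2 = c" "r\<^sup>2 + s\<^sup>2 = c" by (simp_all add: power2_eq_square algebra_simps)
 have "(p * s - q * r)\<^sup>2 = (p\<^sup>2 + q\<^sup>2) * (r\<^sup>2 + s\<^sup>2) - (p * r + q * s)\<^sup>2" by (simp add: power2_eq_square algebra_simps)
 hence "(p * s - q * r)\<^sup>2 = c * c - 0\<^sup>2" by (simp only: o n)
 hence "(p * s - q * r)\<^sup>2 = c\<^sup>2" by (simp add: power2_eq_square)
 moreover have "c \<ge> 0" using n(1) by (metis sum_power2_ge_zero)
 ultimately have "p * s - q * r = c" using pos by (simp add: power2_eq_iff)
 hence "(s - p)\<^sup>2 + (r + q)\<^sup>2 = 0" using n by (simp add: power2_eq_square algebra_simps)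
 hence "s = p" "r = - q" by (simp_all add: sum_power2_eq_zero_iff)
 thus ?thesis unfolding linear_complex[OF D, of h] by (simp add: complex_eq_iff p_def q_def r_def s_def algebra_simps)
qed

lemma local_param_inj: "local_param k M f U ==> inj_on f U"
 unfolding local_param_def homeomorphism_def by (metis inj_on_inverseI)

lemma local_param_cont: "local_param k M f U ==> continuous_on U f"
 unfolding local_param_def homeomorphism_def by blast

lemma local_param_sub: "local_param k M f U ==> f ` U \<subseteq> M"
 unfolding local_param_def by (metis openin_imp_subset)

lemma local_param_inv_cont: "local_param k M f U ==> continuous_on (f ` U) (inv_into U f)"
proof -
 assume l: "local_param k M f U"
 then obtain g where g: "homeomorphism U (f ` U) f g" unfolding local_param_def by blast
 have "inv_into U f y = g y" if "y \<in> f ` U" for y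
  using that g inv_into_f_f[OF local_param_inj[OF l]] unfolding homeomorphism_def by (metis imageE)
 thus ?thesis using g unfolding homeomorphism_def by (metis continuous_on_cong)
qed

lemma local_param_open:
 assumes l: "local_param k M f U" and "open U'" "U' \<subseteq> U"
 shows "openin (top_of_set M) (f ` U')"
proof -
 obtain g where g: "homeomorphism U (f ` U) f g" using l unfolding local_param_def by blast
 have "openin (top_of_set U) U'" using assms by (simp add: open_subset)
 hence "openin (top_of_set (f ` U)) (f ` U')" by (rule homeomorphism_imp_open_map[OF g])
 thus ?thesis using l unfolding local_param_def by (metis openin_trans)
qed

lemma local_param_preimage_open:
 assumes l: "local_param k M g V" and f: "open U" "continuous_on U f" "f ` U \<subseteq> M"
 shows "open {w \<in> U. f w \<in> g ` V}"
proof -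
 obtain T where T: "open T" "g ` V = M \<inter> T" using l unfolding local_param_def openin_open by blast
 have "{w \<in> U. f w \<in> g ` V} = U \<inter> f -` T" using T(2) f(3) by auto
 thus ?thesis using continuous_open_preimage[OF f(2,1) T(1)] by simp
qed

text \<open>The chart's derivative is injective, so it has a linear left inverse and
  \<open>immersion_lift\<close> differentiates the coordinate expression. The second conclusion
  factors the derivative of \<open>f\<close> through that of the chart.\<close>

lemma chart_lift:
 fixes g :: "complex => 'a::euclidean_space"
 assumes l: "local_param (Suc k) M g V" and f: "open U" "continuous_on U f" "f ` U \<subseteq> M"
  and w: "w \<in> U" "f w \<in> g ` V" and d: "(f has_derivative D) (at w)"
 obtains D' where "((%z. inv_into V g (f z)) has_derivative D') (at w)"
  "\<And>h. D h = frechet_derivative g (at (inv_into V g (f w))) (D' h)"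
proof -
 let ?\<xi> = "%z. inv_into V g (f z)" and ?S = "{z \<in> U. f z \<in> g ` V}"
 have v: "?\<xi> w \<in> V" by (rule inv_into_into[OF w(2)])
 have "g differentiable (at (?\<xi> w))" using l v unfolding local_param_def by simp
 hence dg: "(g has_derivative frechet_derivative g (at (?\<xi> w))) (at (?\<xi> w))" by (simp add: frechet_derivative_works)
 have lin: "linear (frechet_derivative g (at (?\<xi> w)))" using dg has_derivative_linear by blast
 moreover have "inj (frechet_derivative g (at (?\<xi> w)))" using l v unfolding local_param_def by simp
 ultimately obtain L where L: "linear L" "L \<circ> frechet_derivative g (at (?\<xi> w)) = id"
  using linear_injective_left_inverse by blast
 have oS: "open ?S" by (rule local_param_preimage_open[OF l f])
 have "continuous_on ?S ?\<xi>"
  by (rule continuous_on_compose2[OF local_param_inv_cont[OF l] continuous_on_subset[OF f(2)]]) auto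
 hence c: "continuous (at w) ?\<xi>" using oS w by (simp add: continuous_on_eq_continuous_at)
 have e: "g (?\<xi> z) = f z" if "z \<in> ?S" for z using that by (auto simp: f_inv_into_f)
 have d1: "(?\<xi> has_derivative (%h. L (D h))) (at w)"
  by (rule immersion_lift[OF dg linear_conv_bounded_linear[THEN iffD1, OF L(1)] _ d c oS _ e])
    (use L(2) w in \<open>auto simp: o_def fun_eq_iff\<close>)
 from has_derivative_compose[OF d1 dg]
 have "((%z. g (?\<xi> z)) has_derivative (%h. frechet_derivative g (at (?\<xi> w)) (L (D h)))) (at w)" .
 hence "(f has_derivative (%h. frechet_derivative g (at (?\<xi> w)) (L (D h)))) (at w)"
  by (rule has_derivative_transform_within_open[OF _ oS]) (use w e in auto)
 hence "D = (%h. frechet_derivative g (at (?\<xi> w)) (L (D h)))" by (rule has_derivative_unique[OF d])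
 thus ?thesis using that[OF d1] by metis
qed

text \<open>\<open>M\<close> is the classical Beltrami coefficient of the metric with coefficients
  \<open>E\<close>, \<open>F\<close>, \<open>G\<close>. Its modulus is below 1 because its square
  times \<open>E + G + 2 * D\<close> equals \<open>E + G - 2 * D\<close>.\<close>

lemma quadratic_form_complex:
 fixes E F G :: real
 assumes D: "D > 0" "D\<^sup>2 = E * G - F\<^sup>2" and EG: "E + G > 0"
 defines "M \<equiv> (of_real (E - G) + \<i> * of_real (2 * F)) * inverse (of_real (E + G + 2 * D))"
 shows "cmod M < 1"
  "E * (Re h)\<^sup>2 + 2 * F * (Re h * Im h) + G * (Im h)\<^sup>2 = (E + G + 2 * D) / 4 * (cmod (h + M * cnj h))\<^sup>2"
proof -
 define s where "s = E + G + 2 * D"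
 have s: "s > 0" using D EG by (simp add: s_def)
 define a b where "a = (E - G) / s" and "b = 2 * F / s"
 have m: "M = Complex a b" unfolding M_def s_def[symmetric]
  by (simp add: complex_eq_iff a_def b_def field_simps flip: of_real_inverse)
 have as: "a * s = E - G" "b * s = 2 * F" using s by (simp_all add: a_def b_def)
 have "(a\<^sup>2 + b\<^sup>2) * s * s = (a * s)\<^sup>2 + (b * s)\<^sup>2" by (simp add: power2_eq_square algebra_simps)
 also have "\<dots> = (E + G - 2 * D) * s" unfolding as using D(2) by (simp add: s_def power2_eq_square algebra_simps)
 finally have ab: "(a\<^sup>2 + b\<^sup>2) * s = E + G - 2 * D" using s by simp
 hence "(a\<^sup>2 + b\<^sup>2) * s < 1 * s" using D by (simp add: s_def)
 thus "cmod M < 1" using s by (simp add: m cmod_def)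
 define x y where "x = Re h" and "y = Im h"
 have "4 * (E * x\<^sup>2 + 2 * F * (x * y) + G * y\<^sup>2) = (s + (a\<^sup>2 + b\<^sup>2) * s) * (x\<^sup>2 + y\<^sup>2) + 2 * (a * s) * (x\<^sup>2 - y\<^sup>2) + 4 * (b * s) * (x * y)"
  unfolding ab as by (simp add: s_def algebra_simps)
 also have "\<dots> = s * ((x + (a * x + b * y))\<^sup>2 + (y + (b * x - a * y))\<^sup>2)" by (simp add: power2_eq_square algebra_simps)
 also have "(x + (a * x + b * y))\<^sup>2 + (y + (b * x - a * y))\<^sup>2 = (cmod (h + M * cnj h))\<^sup>2"
  by (simp add: cmod_power2 m x_def y_def)
 finally show "E * (Re h)\<^sup>2 + 2 * F * (Re h * Im h) + G * (Im h)\<^sup>2 = (E + G + 2 * D) / 4 * (cmod (h + M * cnj h))\<^sup>2"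
  by (simp add: s_def x_def y_def)
qed

lemma det2_affine: "det2 (%v. a * v + b * cnj v) = (cmod a)\<^sup>2 - (cmod b)\<^sup>2"
 unfolding det2_def cmod_power2 by (simp add: power2_eq_square algebra_simps)

text \<open>A solution of the Beltrami equation with the coefficient of the induced metric is an
  isothermal coordinate. The parametrization is C^2, so the coefficient is C^1 and
  \<open>beltrami_disc\<close> applies; \<open>G\<close> inverts the solution and is differentiated
  by \<open>immersion_lift\<close>.\<close>

lemma isothermal_disc:
 fixes ps :: "complex => 'a::euclidean_space"
 assumes l: "local_param 2 M ps V" and V0: "open V0" "u0 \<in> V0" "V0 \<subseteq> V"
 obtains G F D where "G 0 = u0" "G ` D1 \<subseteq> V0" "open (G ` D1)" "continuous_on D1 G" "continuous_on (G ` D1) F"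
  "\<And>w. w \<in> D1 ==> F (G w) = w"
  "\<And>w. w \<in> D1 ==> (G has_derivative D w) (at w)" "\<And>h. continuous_on D1 (%w. D w h)"
  "\<And>w. w \<in> D1 ==> det2 (D w) > 0"
  "\<And>w. w \<in> D1 ==> \<exists>n>0. \<forall>h. (norm (frechet_derivative ps (at (G w)) (D w h)))\<^sup>2 = n * (cmod h)\<^sup>2"
proof -
 let ?D = "%u. frechet_derivative ps (at u)"
 have dg: "(ps has_derivative ?D u) (at u)" and inj: "inj (?D u)" if "u \<in> V" for u
  using l that unfolding local_param_def by (auto simp: numeral_2_eq_2 frechet_derivative_works)
 have C1D: "C1 (%u. ?D u v) V" for v using l by (force simp: numeral_2_eq_2 frechet_derivative_works local_param_def C1_def)
 define X Y where "X u = ?D u 1" and "Y u = ?D u \<i>" for u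
 have C1XY: "C1 X V" "C1 Y V" unfolding X_def[abs_def] Y_def[abs_def] by (rule C1D)+
 have DXY: "?D u h = Re h *\<^sub>R X u + Im h *\<^sub>R Y u" if "u \<in> V" for u h
 proof -
  have lin: "linear (?D u)" using dg[OF that] has_derivative_linear by blast
  have "h = Re h *\<^sub>R 1 + Im h *\<^sub>R \<i>" by (simp add: complex_eq_iff)
  hence "?D u h = ?D u (Re h *\<^sub>R 1 + Im h *\<^sub>R \<i>)" by (rule arg_cong)
  thus ?thesis using lin by (simp only: linear_add linear_scale X_def Y_def)
 qed
 define e f g where "e u = X u \<bullet> X u" and "f u = X u \<bullet> Y u" and "g u = Y u \<bullet> Y u" for u
 have C1e: "C1 e V" "C1 f V" "C1 g V" unfolding e_def[abs_def] f_def[abs_def] g_def[abs_def]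
  by (rule C1_bilinear[OF bounded_bilinear_inner]; rule C1XY)+
 define q where "q u = e u * g u + (- 1) * (f u * f u)" for u
 have pos: "0 < e u" "0 < q u" if "u \<in> V" for u
 proof -
  have "X u ~= 0" using inj_eq[OF inj[OF that], of 1 0] DXY[OF that, of 0] by (simp add: X_def)
  thus e0: "0 < e u" by (simp add: e_def)
  \<comment> \<open>The combination of \<open>Y\<close> and \<open>X\<close> orthogonal to
    \<open>X\<close>; its squared length is \<open>e u\<close> times the Gram determinant, which is
    thereby positive.\<close>
  have "?D u (Complex (- f u) (e u)) = (- f u) *\<^sub>R X u + e u *\<^sub>R Y u" by (simp add: DXY[OF that])
  moreover have "?D u (Complex (- f u) (e u)) ~= 0"
   using inj_eq[OF inj[OF that], of "Complex (- f u) (e u)" 0] DXY[OF that, of 0] e0 by (auto simp: complex_eq_iff)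
  ultimately have "0 < ((- f u) *\<^sub>R X u + e u *\<^sub>R Y u) \<bullet> ((- f u) *\<^sub>R X u + e u *\<^sub>R Y u)" by simp
  also have "\<dots> = e u * q u" unfolding q_def
   by (simp add: inner_add_left inner_add_right inner_commute[of "Y u"] e_def[symmetric] f_def[symmetric] g_def[symmetric] algebra_simps)
  finally show "0 < q u" using e0 by (simp add: zero_less_mult_iff)
 qed
 define d where "d u = sqrt (q u)" for u
 have "C1 q V" unfolding q_def[abs_def]
  by (intro C1_add C1_bilinear[OF bounded_bilinear_mult] C1e C1_const)
 hence C1d: "C1 d V" unfolding d_def[abs_def]
 proof (rule C1_field_comp[where g' = "%x. inverse (sqrt x) / 2"])
  show "(sqrt has_real_derivative inverse (sqrt (q u)) / 2) (at (q u))" if "u \<in> V" for u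
   by (rule DERIV_real_sqrt[OF pos(2)[OF that]])
  show "continuous_on (q ` V) (%x. inverse (sqrt x) / 2)"
   by (intro continuous_intros) (use less_imp_neq[OF pos(2)] in auto)
 qed
 have d: "0 < d u" "(d u)\<^sup>2 = e u * g u - (f u)\<^sup>2" "0 < e u + g u" if "u \<in> V" for u
  using pos[OF that] by (simp_all add: d_def q_def power2_eq_square add_pos_nonneg g_def)
 define m where "m u = (of_real (e u - g u) + \<i> * of_real (2 * f u)) * inverse (of_real (e u + g u + 2 * d u))" for u
 have s0: "complex_of_real (e u + g u + 2 * d u) ~= 0" if "u \<in> V" for u
  unfolding of_real_eq_0_iff using d[OF that] by linarith
 have C1r: "C1 (%u. complex_of_real (r u)) V" if "C1 r V" for r by (rule C1_linear_comp[OF bounded_linear_of_real that])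
 have C1m: "C1 m V"
 proof -
  have 1: "C1 (%u. e u - g u) V"
   using C1_add[OF C1e(1) C1_linear_comp[OF bounded_linear_minus[OF bounded_linear_ident] C1e(3)]] by simp
  have 2: "C1 (%u. e u + g u + 2 * d u) V" "C1 (%u. 2 * f u) V"
   by (intro C1_add C1e C1d C1_bilinear[OF bounded_bilinear_mult] C1_const)+
  have 3: "C1 (%u. inverse (complex_of_real (e u + g u + 2 * d u))) V"
  proof (rule C1_field_comp[OF C1r[OF 2(1)], where g' = "%x. - (inverse x * inverse x)"])
   show "(inverse has_field_derivative - (inverse (complex_of_real (e u + g u + 2 * d u)) * inverse (of_real (e u + g u + 2 * d u)))) (at (of_real (e u + g u + 2 * d u)))"
    if "u \<in> V" for u using DERIV_inverse[OF s0[OF that]] by (simp add: power2_eq_square)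
   show "continuous_on ((%u. complex_of_real (e u + g u + 2 * d u)) ` V) (%x. - (inverse x * inverse x))"
    by (intro continuous_intros) (use s0 in auto)
  qed
  show ?thesis unfolding m_def[abs_def]
   by (rule C1_bilinear[OF bounded_bilinear_mult C1_add[OF C1r[OF 1] C1_bilinear[OF bounded_bilinear_mult C1_const C1r[OF 2(2)]]] 3])
 qed
 have m1: "cmod (m u) < 1" and
  form: "(norm (?D u h))\<^sup>2 = (e u + g u + 2 * d u) / 4 * (cmod (h + m u * cnj h))\<^sup>2" if "u \<in> V" for u h
 proof -
  note Q = quadratic_form_complex[OF d(1,2,3)[OF that], folded m_def]
  show "cmod (m u) < 1" by (rule Q(1))
  show "(norm (?D u h))\<^sup>2 = (e u + g u + 2 * d u) / 4 * (cmod (h + m u * cnj h))\<^sup>2" using Q(2) unfolding DXY[OF that] power2_norm_eq_inner by (simp add: inner_add_left inner_add_right inner_commute[of "Y u"] e_def[symmetric] f_def[symmetric] g_def[symmetric] power2_eq_square algebra_simps)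
 qed
 obtain N F P where N: "open N" "u0 \<in> N" "N \<subseteq> V0" "bij_betw F N D1" and F0: "F u0 = 0"
  and P: "continuous_on N P" "\<And>u. u \<in> N ==> P u ~= 0"
  and dF: "\<And>u. u \<in> N ==> (F has_derivative (%v. P u * (v + m u * cnj v))) (at u)"
  by (rule beltrami_disc[OF V0(1,2) C1_subset[OF C1m V0(3)]]) (use V0(3) m1 in blast, rule that, assumption+)
 have NV: "u \<in> V" if "u \<in> N" for u using N(3) V0(3) that by blast
 define G where "G = inv_into N F"
 have inj: "inj_on F N" using N(4) by (rule bij_betw_imp_inj_on)
 have G: "G w \<in> N" "F (G w) = w" if "w \<in> D1" for w
  using that N(4) unfolding G_def bij_betw_def by (auto simp: f_inv_into_f inv_into_into)
 have GF: "G (F u) = u" if "u \<in> N" for u unfolding G_def by (rule inv_into_f_f[OF inj that])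
 have FB: "F u \<in> D1" if "u \<in> N" for u using N(4) that unfolding bij_betw_def by blast
 have img: "G ` D1 = N" using G GF FB by (metis image_eqI image_subsetI subsetI subset_antisym)
 have cF: "continuous_on N F" using dF has_derivative_continuous continuous_at_imp_continuous_on by blast
 have "homeomorphism N (F ` N) F G"
 proof -
  obtain G' where G': "homeomorphism N (F ` N) F G'"
   by (rule invariance_of_domain_homeomorphism[OF N(1) cF _ inj]) simp_all
  moreover have "G' y = G y" if "y \<in> F ` N" for y using that G' GF unfolding homeomorphism_def by (metis imageE)
  ultimately show ?thesis by (metis homeomorphism_cong)
 qed
 hence cG: "continuous_on D1 G" using N(4) unfolding homeomorphism_def bij_betw_def by auto
 define k where "k u = complex_of_real (1 - (cmod (m u))\<^sup>2)" for u
 have k: "k u ~= 0" "0 < 1 - (cmod (m u))\<^sup>2" if "u \<in> N" for u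
 proof -
  show "0 < 1 - (cmod (m u))\<^sup>2" using m1[OF NV[OF that]] by (simp add: abs_square_less_1)
  thus "k u ~= 0" unfolding k_def of_real_eq_0_iff by linarith
 qed
 \<comment> \<open>Coefficients of the inverse of the real linear map sending \<open>v\<close> to
   \<open>P u * (v + m u * cnj v)\<close>.\<close>
 define al b where "al u = inverse (P u * k u)" and "b u = - m u * inverse (cnj (P u) * k u)" for u
 define D where "D w h = al (G w) * h + b (G w) * cnj h" for w h
 have kk: "k u = 1 - m u * cnj (m u)" for u unfolding k_def of_real_diff complex_norm_square by simp
 have Deq: "D w h + m (G w) * cnj (D w h) = h / P (G w)" if "w \<in> D1" for w h
 proof -
  let ?u = "G w"
  have nz: "P ?u ~= 0" "k ?u ~= 0" "cnj (P ?u) ~= 0" using P(2) k(1) G(1)[OF that] by auto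
  have ck: "cnj (k ?u) = k ?u" by (simp add: k_def)
  have "D w h + m ?u * cnj (D w h) = (1 - m ?u * cnj (m ?u)) * (inverse (k ?u)) * (h * inverse (P ?u))"
   using nz by (simp add: D_def al_def b_def ck algebra_simps)
  thus ?thesis using nz by (simp add: kk[symmetric] field_simps)
 qed
 have inv: "D w (P (G w) * (v + m (G w) * cnj v)) = v" if "w \<in> D1" for w v
 proof -
  let ?u = "G w"
  have nz: "P ?u ~= 0" "k ?u ~= 0" "cnj (P ?u) ~= 0" using P(2) k(1) G(1)[OF that] by auto
  have i: "inverse (P ?u * k ?u) * P ?u = inverse (k ?u)" "inverse (cnj (P ?u) * k ?u) * cnj (P ?u) = inverse (k ?u)"
   using nz by simp_all
  have "D w (P ?u * (v + m ?u * cnj v)) = (inverse (P ?u * k ?u) * P ?u) * (v + m ?u * cnj v)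
    - m ?u * (inverse (cnj (P ?u) * k ?u) * cnj (P ?u)) * cnj (v + m ?u * cnj v)"
   by (simp add: D_def al_def b_def)
  hence "D w (P ?u * (v + m ?u * cnj v)) = (1 - m ?u * cnj (m ?u)) * inverse (k ?u) * v"
   unfolding i by (simp add: algebra_simps)
  thus ?thesis using nz by (simp add: kk[symmetric])
 qed
 have bl: "bounded_linear (D w)" for w unfolding D_def[abs_def]
  by (rule bounded_linear_add[OF bounded_linear_mult_right bounded_linear_const_mult[OF bounded_linear_cnj]])
 have cm: "continuous_on N m" using continuous_on_subset[OF C1_cont[OF C1m]] NV by blast
 have cab: "continuous_on N al" "continuous_on N b" unfolding al_def[abs_def] b_def[abs_def]
 proof -
  have ck: "continuous_on N k" unfolding k_def[abs_def] by (intro continuous_intros cm)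
  show "continuous_on N (%u. inverse (P u * k u))" by (intro continuous_intros P(1) ck) (use P(2) k(1) in auto)
  show "continuous_on N (%u. - m u * inverse (cnj (P u) * k u))" by (intro continuous_intros P(1) ck cm) (use P(2) k(1) in auto)
 qed
 show ?thesis
 proof (rule that[of G F D])
  show "G 0 = u0" using GF[OF N(2)] F0 by simp
  show "G ` D1 \<subseteq> V0" "open (G ` D1)" "continuous_on (G ` D1) F" using img N cF by auto
  show "continuous_on D1 G" by fact
  show "continuous_on D1 (%w. D w h)" for h unfolding D_def
   by (intro continuous_intros continuous_on_compose2[OF cab(1) cG] continuous_on_compose2[OF cab(2) cG]) (use G(1) in auto)
  fix w :: complex assume w: "w \<in> D1"
  show "F (G w) = w" by (rule G(2)[OF w])
  have cGw: "continuous (at w) G" using cG w by (simp add: continuous_on_eq_continuous_at)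
  show "(G has_derivative D w) (at w)"
   using immersion_lift[OF dF[OF G(1)[OF w]] bl[of w] inv[OF w] has_derivative_ident cGw open_ball w G(2)] by simp
  have "det2 (D w) = (cmod (al (G w)))\<^sup>2 * (1 - (cmod (m (G w)))\<^sup>2)"
   unfolding D_def[abs_def] det2_affine by (simp add: al_def b_def norm_mult norm_inverse power_mult_distrib algebra_simps)
  moreover have "al (G w) ~= 0" using P(2) k(1) G(1)[OF w] by (simp add: al_def)
  ultimately show "det2 (D w) > 0" using k(2)[OF G(1)[OF w]] by simp
  let ?s = "(e (G w) + g (G w) + 2 * d (G w)) / 4"
  have "(norm (?D (G w) (D w h)))\<^sup>2 = ?s / (cmod (P (G w)))\<^sup>2 * (cmod h)\<^sup>2" for h
   using form[OF NV[OF G(1)[OF w]], of "D w h"] Deq[OF w] by (simp add: norm_divide power_divide)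
  moreover have "0 < ?s / (cmod (P (G w)))\<^sup>2" using d[OF NV[OF G(1)[OF w]]] P(2)[OF G(1)[OF w]] by simp
  ultimately show "\<exists>n>0. \<forall>h. (norm (?D (G w) (D w h)))\<^sup>2 = n * (cmod h)\<^sup>2" by blast
 qed
qed

text \<open>An oriented parametrization around \<open>p\<close> is composed with the inverse
  isothermal coordinate, shrunk so that the image stays in \<open>M0\<close>. The inner map has
  positive determinant, so the orientation is kept.\<close>

lemma conformal_chart_exists:
 fixes M :: "'a::euclidean_space set"
 assumes at: "oriented_atlas M AA" and M0: "openin (top_of_set M) M0" and p: "p \<in> M0"
 obtains f where "conformal_chart M0 AA f D1" "f 0 = p"
proof -
 have lp: "\<And>g V. (g, V) \<in> AA ==> local_param 2 M g V" and cov: "M = (\<Union>(f, U)\<in>AA. f ` U)"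
  and co: "\<And>f U g V. (f, U) \<in> AA ==> (g, V) \<in> AA ==> co_oriented f U g V"
  using at unfolding oriented_atlas_def by auto
 have "p \<in> M" using M0 p openin_imp_subset by blast
 then obtain g V where g: "(g, V) \<in> AA" "p \<in> g ` V" using cov by blast
 then obtain u0 where u0: "u0 \<in> V" "g u0 = p" by blast
 note l = lp[OF g(1)]
 have oV: "open V" using l unfolding local_param_def by blast
 note cg = local_param_cont[OF l] and sub = local_param_sub[OF l] and inj = local_param_inj[OF l]
 obtain T where T: "open T" "M0 = M \<inter> T" using M0 openin_open by blast
 define V0 where "V0 = V \<inter> g -` T"
 have V0: "open V0" "u0 \<in> V0" "V0 \<subseteq> V" using continuous_open_preimage[OF cg oV T(1)] u0 p T(2) by (auto simp: V0_def)
 obtain G F D where G0: "G 0 = u0" and GV: "G ` D1 \<subseteq> V0" and oG: "open (G ` D1)"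
  and cG: "continuous_on D1 G" and cF: "continuous_on (G ` D1) F"
  and FG: "\<And>w. w \<in> D1 ==> F (G w) = w"
  and dG: "\<And>w. w \<in> D1 ==> (G has_derivative D w) (at w)" and cD: "\<And>h. continuous_on D1 (%w. D w h)"
  and pos: "\<And>w. w \<in> D1 ==> det2 (D w) > 0"
  and iso: "\<And>w. w \<in> D1 ==> \<exists>n>0. \<forall>h. (norm (frechet_derivative g (at (G w)) (D w h)))\<^sup>2 = n * (cmod h)\<^sup>2"
  by (rule isothermal_disc[OF l V0], rule that, assumption+)
 define f where "f w = g (G w)" for w
 let ?D = "%u. frechet_derivative g (at u)"
 have GV': "G w \<in> V" if "w \<in> D1" for w using GV V0(3) that by blast
 have dg: "(g has_derivative ?D u) (at u)" and Dinj: "inj (?D u)" if "u \<in> V" for u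
  using l that unfolding local_param_def by (auto simp: numeral_2_eq_2 frechet_derivative_works)
 have df: "(f has_derivative (%h. ?D (G w) (D w h))) (at w)" if "w \<in> D1" for w
  unfolding f_def[abs_def] by (rule has_derivative_compose[OF dG[OF that] dg[OF GV'[OF that]]])
 have fd: "frechet_derivative f (at w) = (%h. ?D (G w) (D w h))" if "w \<in> D1" for w
  using frechet_derivative_at[OF df[OF that]] by simp
 have im: "f ` D1 = g ` (G ` D1)" by (auto simp: f_def)
 have sub0: "f ` D1 \<subseteq> M0" using GV sub unfolding im T(2) V0_def by blast
 have oim: "openin (top_of_set M) (f ` D1)"
  unfolding im using local_param_open[OF l oG] GV V0(3) by blast
 have hom: "homeomorphism D1 (f ` D1) f (%y. F (inv_into V g y))"
 proof (rule homeomorphismI)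
  show "continuous_on D1 f" unfolding f_def[abs_def]
   by (rule continuous_on_compose2[OF cg cG]) (use GV' in auto)
  have inv: "inv_into V g (f w) = G w" if "w \<in> D1" for w
   unfolding f_def by (rule inv_into_f_f[OF inj GV'[OF that]])
  show "continuous_on (f ` D1) (%y. F (inv_into V g y))"
   by (rule continuous_on_compose2[OF cF continuous_on_subset[OF local_param_inv_cont[OF l]]])
     (use GV' inv in \<open>auto simp: f_def\<close>)
  show "(%y. F (inv_into V g y)) ` (f ` D1) \<subseteq> D1" using inv FG by auto
  show "F (inv_into V g (f x)) = x" if "x \<in> D1" for x using inv FG that by simp
  thus "f (F (inv_into V g y)) = y" if "y \<in> f ` D1" for y using that by auto
 qed auto
 have lin: "linear (?D u)" if "u \<in> V" for u using dg[OF that] has_derivative_linear by blast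
 have ck: "Ck_on 1 f D1"
 proof -
  have cont: "continuous_on D1 (%w. frechet_derivative f (at w) h)" for h
  proof -
   have eq: "frechet_derivative f (at w) h = Re (D w h) *\<^sub>R ?D (G w) 1 + Im (D w h) *\<^sub>R ?D (G w) \<i>" if "w \<in> D1" for w
   proof -
    have "D w h = Re (D w h) *\<^sub>R 1 + Im (D w h) *\<^sub>R \<i>" by (simp add: complex_eq_iff)
    hence "?D (G w) (D w h) = ?D (G w) (Re (D w h) *\<^sub>R 1 + Im (D w h) *\<^sub>R \<i>)" by (rule arg_cong)
    thus ?thesis using lin[OF GV'[OF that]] fd[OF that] by (simp only: linear_add linear_scale)
   qed
   have c1: "continuous_on V (%u. ?D u v)" for v
   proof -
    have "\<forall>u\<in>V. (%u. ?D u v) differentiable (at u)" using l unfolding local_param_def by (simp add: numeral_2_eq_2)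
    thus ?thesis using differentiable_imp_continuous_within continuous_at_imp_continuous_on by blast
   qed
   have "continuous_on D1 (%w. Re (D w h) *\<^sub>R ?D (G w) 1 + Im (D w h) *\<^sub>R ?D (G w) \<i>)"
    by (intro continuous_intros cD continuous_on_compose2[OF c1 cG]) (use GV' in auto)
   thus ?thesis by (rule continuous_on_eq) (rule eq[symmetric])
  qed
  moreover have "f differentiable (at w)" if "w \<in> D1" for w using df[OF that] by (rule differentiableI)
  ultimately show ?thesis by simp
 qed
 have Dw0: "h = 0" if "w \<in> D1" "?D (G w) (D w h) = 0" for w h
  using iso[OF that(1)] that(2) by (metis mult_eq_0_iff norm_eq_zero power2_less_0 power_zero_numeral less_irrefl zero_eq_power2 norm_zero)
 have "inj (frechet_derivative f (at w))" if w: "w \<in> D1" for w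
 proof -
  have "linear (frechet_derivative f (at w))" using df[OF w] fd[OF w] has_derivative_linear by metis
  thus ?thesis unfolding linear_injective_0[OF \<open>linear (frechet_derivative f (at w))\<close>] using Dw0[OF w] fd[OF w] by simp
 qed
 moreover have "openin (top_of_set M0) (f ` D1)"
  by (rule openin_subset_trans[OF oim sub0]) (use T(2) in auto)
 ultimately have "local_param 1 M0 f D1" unfolding local_param_def using hom ck by blast
 hence "isothermal_param M0 f D1" unfolding isothermal_param_def using iso fd by simp
 moreover have "co_oriented f D1 g' V'" if g': "(g', V') \<in> AA" for g' V'
  unfolding co_oriented_def
 proof (intro ballI impI)
  fix w :: complex assume w: "w \<in> D1" "f w \<in> g' ` V'"
  let ?u = "G w"
  have l': "local_param (Suc 1) M g' V'" using lp[OF g'] by (simp add: numeral_2_eq_2)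
  obtain D' where D': "((%z. inv_into V' g' (g z)) has_derivative D') (at ?u)"
   using chart_lift[OF l' oV cg sub GV'[OF w(1)] w(2)[unfolded f_def] dg[OF GV'[OF w(1)]]] by metis
  have "0 < jacobian_det (%z. inv_into V' g' (g z)) ?u"
   using co[OF g(1) g'] GV'[OF w(1)] w(2) unfolding co_oriented_def f_def by blast
  hence "0 < det2 (%h. D' (D w h))" using pos[OF w(1)] det2_comp[OF has_derivative_linear[OF D'], of "D w"] by (simp add: jacobian_det_eq[OF D'])
  thus "0 < jacobian_det (%z. inv_into V' g' (f z)) w"
   unfolding f_def jacobian_det_eq[OF has_derivative_compose[OF dG[OF w(1)] D']] .
 qed
 ultimately have "conformal_chart M0 AA f D1" unfolding conformal_chart_def by blast
 moreover have "f 0 = p" by (simp add: f_def G0 u0)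
 ultimately show ?thesis by (rule that)
qed

text \<open>Both charts pull the metric back to multiples of the Euclidean one, so the transition
  has a similarity as derivative. Its orientation is read off by comparing both charts with one
  chart of the given atlas and dividing determinants.\<close>

lemma conformal_transition:
 fixes M :: "'a::euclidean_space set"
 assumes at: "oriented_atlas M AA" and M1: "M1 \<subseteq> M"
  and f: "conformal_chart M1 AA f U" and g: "conformal_chart M1 AA g V"
 shows "(%z. inv_into V g (f z)) holomorphic_on {w \<in> U. f w \<in> g ` V}"
proof -
 let ?S = "{w \<in> U. f w \<in> g ` V}" and ?\<xi> = "%z. inv_into V g (f z)"
 have lf: "local_param 1 M1 f U" and lg: "local_param (Suc 0) M1 g V"
  using f g unfolding conformal_chart_def isothermal_param_def by auto
 have oU: "open U" "open V" using lf lg unfolding local_param_def by auto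
 note cph = local_param_cont[OF lf] and cg = local_param_cont[OF lg]
 have oS: "open ?S" by (rule local_param_preimage_open[OF lg oU(1) cph local_param_sub[OF lf]])
 have "?\<xi> field_differentiable (at w)" if w: "w \<in> ?S" for w
 proof -
  let ?D = "frechet_derivative f (at w)" and ?v = "?\<xi> w"
  have wU: "w \<in> U" "f w \<in> g ` V" using w by auto
  have v: "?v \<in> V" "g ?v = f w" using wU(2) by (auto simp: inv_into_into f_inv_into_f)
  let ?E = "frechet_derivative g (at ?v)"
  have df: "(f has_derivative ?D) (at w)" using lf wU unfolding local_param_def by (simp add: frechet_derivative_works)
  have dg: "(g has_derivative ?E) (at ?v)" using lg v unfolding local_param_def by (simp add: frechet_derivative_works)
  obtain D' where D': "(?\<xi> has_derivative D') (at w)" "\<And>h. ?D h = ?E (D' h)"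
   by (rule chart_lift[OF lg oU(1) cph local_param_sub[OF lf] wU df]) (rule that)
  obtain m where m: "0 < m" "\<And>h. (norm (?D h))\<^sup>2 = m * (cmod h)\<^sup>2"
   using f wU(1) unfolding conformal_chart_def isothermal_param_def by blast
  obtain n where n: "0 < n" "\<And>h. (norm (?E h))\<^sup>2 = n * (cmod h)\<^sup>2"
   using g v(1) unfolding conformal_chart_def isothermal_param_def by blast
  have cf: "(cmod (D' h))\<^sup>2 = m / n * (cmod h)\<^sup>2" for h
   using m(2)[of h] n(2)[of "D' h"] n(1) unfolding D'(2) by (simp add: field_simps)
  have "f w \<in> M" using local_param_sub[OF lf] M1 wU by blast
  then obtain ze Z where Z: "(ze, Z) \<in> AA" "f w \<in> ze ` Z" using at unfolding oriented_atlas_def by blast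
  have lz: "local_param (Suc 1) M ze Z" using at Z(1) unfolding oriented_atlas_def by (auto simp: numeral_2_eq_2)
  obtain A where A: "((%z. inv_into Z ze (f z)) has_derivative A) (at w)"
   by (rule chart_lift[OF lz oU(1) cph _ wU(1) Z(2) df]) (use local_param_sub[OF lf] M1 in blast)
  obtain B where B: "((%z. inv_into Z ze (g z)) has_derivative B) (at ?v)"
   by (rule chart_lift[OF lz oU(2) cg _ v(1) _ dg]) (use local_param_sub[OF lg] M1 v(2) Z(2) in auto)
  have AB: "((%z. inv_into Z ze (f z)) has_derivative (%h. B (D' h))) (at w)"
   by (rule has_derivative_transform_within_open[OF has_derivative_compose[OF D'(1) B] oS w]) (auto simp: f_inv_into_f)
  have "0 < det2 A" "0 < det2 B"
   using f g Z wU v unfolding conformal_chart_def co_oriented_def jacobian_det_eq[OF A, symmetric] jacobian_det_eq[OF B, symmetric]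
   by fastforce+
  moreover have "det2 A = det2 B * det2 D'"
   unfolding has_derivative_unique[OF A AB] by (rule det2_comp[OF has_derivative_linear[OF B]])
  ultimately have "0 < det2 D'" by (simp add: zero_less_mult_iff)
  hence "D' h = D' 1 * h" for h by (rule conformal_linear[OF has_derivative_linear[OF D'(1)] cf])
  hence "D' = (*) (D' 1)" by blast
  thus ?thesis using D'(1) unfolding field_differentiable_def has_field_derivative_def by metis
 qed
 thus ?thesis using oS by (simp add: holomorphic_on_open field_differentiable_def)
qed

section \<open>The length-area inequality\<close>

text \<open>A lower bound for length by projections. On \<open>Q j\<close> distances shrink at most
  by \<open>s j\<close>, so a cover set of diameter d projects back into an interval of length
  \<open>2 * d / s j\<close>; hence the factor 1/2. The images of the pieces have positive mutual
  distance, so a fine enough cover set is charged to one piece only.\<close>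

lemma hausdorff1_projection:
 fixes G :: "complex => 'a::euclidean_space"
 assumes J: "finite J" and Q: "\<And>j. j \<in> J ==> compact (Q j)" "\<And>j. j \<in> J ==> continuous_on (Q j) G"
  and disj: "\<And>i j. i \<in> J ==> j \<in> J ==> i ~= j ==> G ` Q i \<inter> G ` Q j = {}"
  and s: "\<And>j. j \<in> J ==> 0 < s j" "\<And>j x y. j \<in> J ==> x \<in> Q j ==> y \<in> Q j ==> s j * dist x y <= dist (G x) (G y)"
  and A: "\<And>j. j \<in> J ==> A j \<subseteq> Re ` {z \<in> Q j. G z \<in> X}"
 shows "(\<Sum>j\<in>J. ennreal (s j / 2) * emeasure lborel (A j)) <= hausdorff1 X"
proof -
 have "\<forall>p\<in>J \<times> J. \<exists>d>0. fst p ~= snd p --> (\<forall>x\<in>G ` Q (fst p). \<forall>y\<in>G ` Q (snd p). d <= dist x y)"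
 proof
  fix p assume p: "p \<in> J \<times> J"
  show "\<exists>d>0. fst p ~= snd p --> (\<forall>x\<in>G ` Q (fst p). \<forall>y\<in>G ` Q (snd p). d <= dist x y)"
  proof (cases "fst p = snd p")
   case False
   have c: "compact (G ` Q j)" if "j \<in> J" for j using compact_continuous_image Q that by blast
   show ?thesis
    using separate_compact_closed[OF c compact_imp_closed[OF c] disj, of "fst p" "snd p"] p False by (auto simp: mem_Times_iff)
  qed (auto intro: exI[of _ 1])
 qed
 from bchoice[OF this] obtain d where d': "\<forall>p\<in>J \<times> J. 0 < d p & (fst p ~= snd p --> (\<forall>x\<in>G ` Q (fst p). \<forall>y\<in>G ` Q (snd p). d p <= dist x y))" ..
 hence d: "0 < d p" "fst p ~= snd p ==> x \<in> G ` Q (fst p) ==> y \<in> G ` Q (snd p) ==> d p <= dist x y"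
  if "p \<in> J \<times> J" for p x y using that by blast+
 \<comment> \<open>Half of the least distance between different pieces, the 1 covering the case
   without pairs: a set of this diameter cannot meet two images.\<close>
 define D where "D = Min (insert 1 (d ` (J \<times> J))) / 2"
 have fin: "finite (insert 1 (d ` (J \<times> J)))" using J by simp
 have "0 < Min (insert 1 (d ` (J \<times> J)))" using fin d(1) by (subst Min_gr_iff) auto
 hence D: "0 < D" by (simp add: D_def)
 have dd: "D < d p" if "p \<in> J \<times> J" for p
 proof -
  have "Min (insert 1 (d ` (J \<times> J))) <= d p" using fin that by (intro Min_le) auto
  thus ?thesis using d(1)[OF that] by (simp add: D_def)
 qed
 have main: "(\<Sum>j\<in>J. ennreal (s j / 2) * emeasure lborel (A j)) <= (\<Sum>i. ennreal (diameter (B i)))"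
  if B: "X \<subseteq> (\<Union>i. B i)" "\<And>i::nat. bounded (B i) & diameter (B i) <= D" for B
 proof -
  define m where "m i j \<longleftrightarrow> B i \<inter> G ` Q j ~= {}" for i j
  have uniq: "j = j'" if mm: "m i j" "m i j'" "j \<in> J" "j' \<in> J" for i j j'
  proof (rule ccontr)
   assume "j ~= j'"
   obtain x y where xy: "x \<in> B i" "x \<in> G ` Q j" "y \<in> B i" "y \<in> G ` Q j'" using mm unfolding m_def by blast
   have "dist x y <= D" using diameter_bounded_bound[of "B i" x y] B(2)[of i] xy by force
   moreover have "d (j, j') <= dist x y" using d(2)[of "(j, j')" x y] mm xy \<open>j ~= j'\<close> by simp
   ultimately show False using dd[of "(j, j')"] mm by simp
  qed
  have one: "ennreal (s j / 2) * emeasure lborel (A j) <= (\<Sum>i. if m i j then ennreal (diameter (B i)) else 0)" if j: "j \<in> J" for j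
  proof -
   define z where "z i = (SOME z. z \<in> Q j & G z \<in> B i)" for i
   have z: "z i \<in> Q j & G (z i) \<in> B i" if "m i j" for i
    unfolding z_def by (rule someI_ex) (use that in \<open>auto simp: m_def\<close>)
   \<comment> \<open>Centred at the projection of an arbitrary preimage of a point of the cover set,
     so its radius, not its length, is the scaled diameter.\<close>
   define I where "I i = (if m i j then {Re (z i) - diameter (B i) / s j .. Re (z i) + diameter (B i) / s j} else {})" for i
   have "A j \<subseteq> (\<Union>i. I i)"
   proof
    fix x assume "x \<in> A j"
    then obtain w where w: "w \<in> Q j" "G w \<in> X" "x = Re w" using A[OF j] by blast
    then obtain i where i: "G w \<in> B i" using B(1) by blast
    hence mi: "m i j" using w unfolding m_def by blast
    have "s j * dist w (z i) <= dist (G w) (G (z i))" using s(2)[OF j w(1)] z[OF mi] by blast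
    also have "\<dots> <= diameter (B i)" using diameter_bounded_bound[of "B i"] B(2)[of i] i z[OF mi] by blast
    finally have "dist w (z i) <= diameter (B i) / s j" using s(1)[OF j] by (simp add: field_simps)
    hence "x \<in> I i" using abs_Re_le_cmod[of "w - z i"] mi w(3) by (simp add: dist_norm I_def abs_le_iff)
    thus "x \<in> (\<Union>i. I i)" by blast
   qed
   hence "emeasure lborel (A j) <= emeasure lborel (\<Union>i. I i)" by (rule emeasure_mono) (auto simp: I_def)
   also have "\<dots> <= (\<Sum>i. emeasure lborel (I i))" by (rule emeasure_subadditive_countably) (auto simp: I_def)
   finally have "ennreal (s j / 2) * emeasure lborel (A j) <= ennreal (s j / 2) * (\<Sum>i. emeasure lborel (I i))" by (rule mult_left_mono) simp
   also have "\<dots> = (\<Sum>i. ennreal (s j / 2) * emeasure lborel (I i))" by (rule ennreal_suminf_cmult[symmetric])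
   also have "\<dots> = (\<Sum>i. if m i j then ennreal (diameter (B i)) else 0)"
   proof (rule suminf_cong)
    fix i
    have "0 <= diameter (B i)" using B(2) diameter_ge_0 by blast
    thus "ennreal (s j / 2) * emeasure lborel (I i) = (if m i j then ennreal (diameter (B i)) else 0)"
     using s(1)[OF j] by (simp add: I_def ennreal_mult[symmetric])
   qed
   finally show ?thesis .
  qed
  have "(\<Sum>j\<in>J. ennreal (s j / 2) * emeasure lborel (A j)) <= (\<Sum>j\<in>J. \<Sum>i. if m i j then ennreal (diameter (B i)) else 0)"
   by (rule sum_mono) (rule one)
  also have "\<dots> = (\<Sum>i. \<Sum>j\<in>J. if m i j then ennreal (diameter (B i)) else 0)" by (rule suminf_sum[symmetric]) simp
  also have "\<dots> <= (\<Sum>i. ennreal (diameter (B i)))"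
  proof (rule suminf_le)
   fix i
   show "(\<Sum>j\<in>J. if m i j then ennreal (diameter (B i)) else 0) <= ennreal (diameter (B i))"
   proof (cases "\<exists>j0\<in>J. m i j0")
    case True
    then obtain j0 where j0: "j0 \<in> J" "m i j0" by blast
    hence "(\<Sum>j\<in>J. if m i j then ennreal (diameter (B i)) else 0) = (\<Sum>j\<in>J. if j0 = j then ennreal (diameter (B i)) else 0)"
     using uniq by (intro sum.cong) auto
    thus ?thesis using j0 J by (simp add: sum.delta)
   next
    case False
    hence "(\<Sum>j\<in>J. if m i j then ennreal (diameter (B i)) else 0) = 0" by (intro sum.neutral) auto
    thus ?thesis by simp
   qed
  qed auto
  finally show ?thesis .
 qed
 have "(\<Sum>j\<in>J. ennreal (s j / 2) * emeasure lborel (A j)) <=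
   (INF A\<in>{A :: nat => 'a set. X \<subseteq> (\<Union>i. A i) & (\<forall>i. bounded (A i) & diameter (A i) <= D)}. (\<Sum>i. ennreal (diameter (A i))))"
  by (rule INF_greatest) (use main in blast)
 also have "\<dots> <= hausdorff1 X" unfolding hausdorff1_def by (rule SUP_upper) (use D in simp)
 finally show ?thesis .
qed

text \<open>The area between two graphs, sliced horizontally and vertically. It plays the part of
  the coarea formula: the left side integrates the projected sizes of level sets, the right side the
  variation between the two edges of a square.\<close>

lemma fubini_between:
 fixes p q :: "real => real"
 assumes p: "continuous_on UNIV p" and q: "continuous_on UNIV q"
 shows "(\<integral>\<^sup>+t. emeasure lborel {x\<in>{a..b}. min (p x) (q x) <= t & t <= max (p x) (q x)} \<partial>lborel)
    = (\<integral>\<^sup>+x\<in>{a..b}. ennreal \<bar>q x - p x\<bar> \<partial>lborel)"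
  and "(%t. emeasure lborel {x\<in>{a..b}. min (p x) (q x) <= t & t <= max (p x) (q x)}) \<in> borel_measurable lborel"
proof -
 define S where "S = {z :: real \<times> real. a <= fst z & fst z <= b & min (p (fst z)) (q (fst z)) <= snd z & snd z <= max (p (fst z)) (q (fst z))}"
 have c: "continuous_on UNIV (%z::real \<times> real. p (fst z))" "continuous_on UNIV (%z::real \<times> real. q (fst z))"
  by (auto intro!: continuous_on_compose2[OF p] continuous_on_compose2[OF q] continuous_intros)
 have "closed S" unfolding S_def by (intro closed_Collect_conj closed_Collect_le continuous_intros c)
 hence S: "S \<in> sets (lborel \<Otimes>\<^sub>M lborel)" by (simp only: lborel_prod sets_lborel borel_closed)
 have e: "(%x. (x, t)) -` S = {x\<in>{a..b}. min (p x) (q x) <= t & t <= max (p x) (q x)}" for t by (auto simp: S_def)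
 have f: "emeasure lborel (Pair x -` S) = ennreal \<bar>q x - p x\<bar> * indicator {a..b} x" for x
 proof -
  have "Pair x -` S = (if x \<in> {a..b} then {min (p x) (q x)..max (p x) (q x)} else {})" by (auto simp: S_def)
  thus ?thesis by (auto simp: min_def max_def)
 qed
 show "(\<integral>\<^sup>+t. emeasure lborel {x\<in>{a..b}. min (p x) (q x) <= t & t <= max (p x) (q x)} \<partial>lborel)
    = (\<integral>\<^sup>+x\<in>{a..b}. ennreal \<bar>q x - p x\<bar> \<partial>lborel)"
  using lborel_pair.emeasure_pair_measure_alt2[OF S] lborel.emeasure_pair_measure_alt[OF S] by (simp add: e f)
 show "(%t. emeasure lborel {x\<in>{a..b}. min (p x) (q x) <= t & t <= max (p x) (q x)}) \<in> borel_measurable lborel"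
  using lborel_pair.measurable_emeasure_Pair2[OF S] unfolding e .
qed

text \<open>A fine grid replaces the conformal density by a constant scale \<open>s p\<close> on
  each square. Let \<open>g p\<close> be the integrated change of \<open>u\<close> between the
  bottom and the top edge. The length bound gives \<open>\<Sum> s p * g p <= 128 * C * T^2\<close>;
  every vertical line crosses the shell, so \<open>\<Sum> g p >= T\<close>; and
  \<open>g p <= 4 * s p * h^2\<close>. Eliminating \<open>s p\<close> by Cauchy-Schwarz bounds the
  number of squares in the shell, hence its area, from below.\<close>

lemma shell_area:
 fixes G :: "complex => 'a::euclidean_space"
 assumes b: "0 < b" and B: "B = {z. 0 <= Re z & Re z <= 1 & 0 < Im z & Im z <= b}"
  and inj: "inj_on G B" and nz: "\<And>z. z \<in> B ==> G z ~= 0"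
  and qc: "\<And>z. z \<in> B ==> \<exists>e>0. \<exists>s>0. \<forall>x\<in>ball z e \<inter> B. \<forall>y\<in>ball z e \<inter> B.
   s * dist x y <= dist (G x) (G y) & dist (G x) (G y) <= 4 * s * dist x y"
  and lim: "\<And>T. 0 < T ==> \<exists>y0>0. \<forall>z\<in>B. Im z <= y0 --> norm (G z) < T"
  and r0: "0 < r0" and C: "0 < C" and len: "\<And>t. 0 < t ==> t <= r0 ==> hausdorff1 (sphere 0 t \<inter> G ` B) <= ennreal (C * t)"
 obtains T0 where "0 < T0" "\<And>T. 0 < T ==> T <= T0 ==>
  \<exists>U. open U & U \<subseteq> {z \<in> B. T / 2 <= norm (G z) & norm (G z) <= 4 * T} & ennreal (1 / (512 * C)) <= emeasure lborel U"
proof -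
 define u where "u z = norm (G z)" for z
 have cG: "continuous_on B G" unfolding continuous_on_iff
 proof (intro ballI allI impI)
  fix z and ep :: real assume z: "z \<in> B" and ep: "0 < ep"
  obtain e s where es: "0 < e" "0 < s" "\<forall>x\<in>ball z e \<inter> B. \<forall>y\<in>ball z e \<inter> B. s * dist x y <= dist (G x) (G y) & dist (G x) (G y) <= 4 * s * dist x y"
   using qc[OF z] by blast
  show "\<exists>d>0. \<forall>x'\<in>B. dist x' z < d --> dist (G x') (G z) < ep"
  proof (intro exI[of _ "min e (ep / (4 * s))"] conjI ballI impI)
   show "0 < min e (ep / (4 * s))" using es ep by simp
   fix x assume x: "x \<in> B" "dist x z < min e (ep / (4 * s))"
   have "dist (G x) (G z) <= 4 * s * dist x z" using es x z by (auto simp: dist_commute)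
   also have "\<dots> < 4 * s * (ep / (4 * s))" using x es by (intro mult_strict_left_mono) auto
   also have "\<dots> = ep" using es by simp
   finally show "dist (G x) (G z) < ep" .
  qed
 qed
 have cu: "continuous_on B u" unfolding u_def[abs_def] by (intro continuous_on_norm cG)
 have cbox_iff: "z \<in> cbox (Complex p q) (Complex p' q') \<longleftrightarrow> p <= Re z & Re z <= p' & q <= Im z & Im z <= q'" for z p q p' q'
  by (auto simp: in_cbox_complex_iff)
 have sub: "cbox (Complex 0 y) (Complex 1 b) \<subseteq> B" if "0 < y" for y using that by (auto simp: B cbox_iff)
 have "Complex 0 b \<in> cbox (Complex 0 b) (Complex 1 b)" by (simp add: cbox_iff)
 hence "cbox (Complex 0 b) (Complex 1 b) ~= {}" by blast
 from continuous_attains_inf[OF compact_cbox this continuous_on_subset[OF cu sub[OF b]]]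
 obtain zm where zm: "zm \<in> cbox (Complex 0 b) (Complex 1 b)" "\<And>z. z \<in> cbox (Complex 0 b) (Complex 1 b) ==> u zm <= u z"
  by blast
 have "0 < u zm" using nz sub[OF b] zm(1) by (auto simp: u_def)
 \<comment> \<open>Small enough that the upper edge of \<open>B\<close> lies above the shell and
   that the length bound holds at all levels up to \<open>4 * T\<close>.\<close>
 define T0 where "T0 = min (u zm / 4) (r0 / 4)"
 have T0: "0 < T0" using \<open>0 < u zm\<close> r0 by (simp add: T0_def)
 have shell: "\<exists>U. open U & U \<subseteq> {z \<in> B. T / 2 <= norm (G z) & norm (G z) <= 4 * T} & ennreal (1 / (512 * C)) <= emeasure lborel U"
  if T: "0 < T" "T <= T0" for T
 proof -
  have top: "4 * T <= u z" if "z \<in> cbox (Complex 0 b) (Complex 1 b)" for z using zm(2)[OF that] T by (simp add: T0_def)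
  have Tr: "4 * T <= r0" using T by (simp add: T0_def)
  obtain y1 where y1: "0 < y1" "\<And>z. z \<in> B ==> Im z <= y1 ==> u z < T / 2" using lim[of "T / 2"] T by (auto simp: u_def)
  define y0 where "y0 = min y1 (b / 2)"
  have y0: "0 < y0" "y0 < b" "\<And>z. z \<in> B ==> Im z <= y0 ==> u z < T / 2" using y1 b by (auto simp: y0_def)
  define Bx where "Bx = cbox (Complex 0 y0) (Complex 1 b)"
  have BxB: "Bx \<subseteq> B" unfolding Bx_def by (rule sub[OF y0(1)])
  have "uniformly_continuous_on Bx u"
   by (rule compact_uniformly_continuous[OF continuous_on_subset[OF cu BxB]]) (simp add: Bx_def)
  then obtain H where H: "0 < H" "\<And>x y. x \<in> Bx ==> y \<in> Bx ==> dist x y < H ==> dist (u x) (u y) < T / 2"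
   unfolding uniformly_continuous_on_def using T(1) by (metis half_gt_zero)
  define CA where "CA = {S. open S & (\<exists>s>0. \<forall>x\<in>S \<inter> B. \<forall>y\<in>S \<inter> B. s * dist x y <= dist (G x) (G y) & dist (G x) (G y) <= 4 * s * dist x y)}"
  have cov: "Bx \<subseteq> \<Union>CA"
  proof
   fix z assume "z \<in> Bx"
   hence "z \<in> B" using BxB by blast
   from qc[OF this] obtain e s where "0 < e" "0 < s" "\<forall>x\<in>ball z e \<inter> B. \<forall>y\<in>ball z e \<inter> B. s * dist x y <= dist (G x) (G y) & dist (G x) (G y) <= 4 * s * dist x y"
    by blast
   hence "ball z e \<in> CA" "z \<in> ball z e" by (auto simp: CA_def)
   thus "z \<in> \<Union>CA" by blast
  qed
  have Bx0: "Complex 0 y0 \<in> Bx" using y0 by (simp add: Bx_def cbox_iff)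
  obtain de where de: "0 < de" "\<And>S. S \<subseteq> Bx ==> diameter S < de ==> \<exists>D\<in>CA. S \<subseteq> D"
  proof (rule Lebesgue_number_lemma[of Bx CA])
   show "compact Bx" by (simp add: Bx_def)
   show "CA ~= {}" using cov Bx0 by blast
   show "Bx \<subseteq> \<Union>CA" by (rule cov)
   show "open D" if "D \<in> CA" for D using that by (simp add: CA_def)
  qed blast
  \<comment> \<open>With side \<open>1 / N\<close>, points of a square are at most two sides apart:
    \<open>u\<close> then varies by less than \<open>T / 2\<close> on it, and the square lies in a
    set with one distortion scale.\<close>
  obtain N :: nat where N: "2 / min H de < N" using reals_Archimedean2 by blast
  define h where "h = 1 / real N"
  have N0: "0 < real N" using N H(1) de(1) by (smt (verit) divide_pos_pos)
  have h: "0 < h" "2 * h < H" "2 * h < de"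
  proof -
   show "0 < h" using N0 by (simp add: h_def)
   have "2 / real N < min H de" using N H(1) de(1) N0 by (simp only: pos_divide_less_eq mult.commute[of "real N"])
   hence "2 * h < min H de" by (simp add: h_def)
   thus "2 * h < H" "2 * h < de" by auto
  qed
  have Nh: "real N * h = 1" using N0 by (simp add: h_def)
  \<comment> \<open>The number of complete rows of squares; the strip left over at the top is
    thinner than \<open>h\<close>.\<close>
  define K where "K = nat \<lfloor>(b - y0) / h\<rfloor>"
  have K: "y0 + real K * h <= b" "b < y0 + (real K + 1) * h"
  proof -
   have "real K = of_int \<lfloor>(b - y0) / h\<rfloor>" using y0(2) h(1) by (simp add: K_def)
   hence "real K <= (b - y0) / h" "(b - y0) / h < real K + 1" by linarith+
   thus "y0 + real K * h <= b" "b < y0 + (real K + 1) * h" using h(1) by (simp_all add: field_simps)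
  qed
  define Q where "Q p = cbox (Complex (real (fst p) * h) (y0 + real (snd p) * h)) (Complex ((real (fst p) + 1) * h) (y0 + (real (snd p) + 1) * h))" for p :: "nat \<times> nat"
  define W where "W = {..<N} \<times> {..<K}"
  have QBx: "Q p \<subseteq> Bx" if "p \<in> W" for p
  proof
   fix z assume z: "z \<in> Q p"
   have "(real (fst p) + 1) * h <= real N * h" "(real (snd p) + 1) * h <= real K * h"
    using that h(1) by (auto simp: W_def intro!: mult_right_mono)
   moreover have "0 <= real (fst p) * h" "0 <= real (snd p) * h" using h(1) by simp_all
   ultimately show "z \<in> Bx" using z K Nh by (auto simp: Q_def Bx_def cbox_iff)
  qed
  have Qd: "dist x y <= 2 * h" if "x \<in> Q p" "y \<in> Q p" for x y p using that cmod_le[of "x - y"] by (auto simp: Q_def cbox_iff algebra_simps abs_le_iff dist_norm)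
  have "\<exists>s>0. \<forall>x\<in>Q p. \<forall>y\<in>Q p. s * dist x y <= dist (G x) (G y) & dist (G x) (G y) <= 4 * s * dist x y" if p: "p \<in> W" for p
  proof -
   have "diameter (Q p) <= 2 * h" by (rule diameter_le) (use Qd h(1) in \<open>auto simp: dist_norm\<close>)
   hence "diameter (Q p) < de" using h(3) by linarith
   from de(2)[OF QBx[OF p] this] obtain D where D: "D \<in> CA" "Q p \<subseteq> D" by blast
   hence "Q p \<subseteq> D \<inter> B" using QBx[OF p] BxB by blast
   moreover obtain s where "0 < s" "\<forall>x\<in>D \<inter> B. \<forall>y\<in>D \<inter> B. s * dist x y <= dist (G x) (G y) & dist (G x) (G y) <= 4 * s * dist x y"
    using D(1) unfolding CA_def by blast
   ultimately show ?thesis by (meson subsetD)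
  qed
  then obtain s where s0: "\<forall>p\<in>W. 0 < s p & (\<forall>x\<in>Q p. \<forall>y\<in>Q p. s p * dist x y <= dist (G x) (G y) & dist (G x) (G y) <= 4 * s p * dist x y)"
   by metis
  hence s: "0 < s p" "x \<in> Q p ==> y \<in> Q p ==> s p * dist x y <= dist (G x) (G y)"
   "x \<in> Q p ==> y \<in> Q p ==> dist (G x) (G y) <= 4 * s p * dist x y" if "p \<in> W" for p x y using that by blast+
  \<comment> \<open>Only squares lying wholly in the shell are used, so that their area counts and
    their levels obey the length bound.\<close>
  define QA where "QA = {p \<in> W. \<forall>z\<in>Q p. T / 2 <= u z & u z <= 4 * T}"
  have fin: "finite QA" by (rule finite_subset[of _ W]) (auto simp: QA_def W_def)
  have QW: "p \<in> W" if "p \<in> QA" for p using that by (simp add: QA_def)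
  define I where "I p = {real (fst p) * h .. (real (fst p) + 1) * h}" for p :: "nat \<times> nat"
  \<comment> \<open>Clamping to the base of the square extends the edge functions continuously to
    the whole line, the form \<open>fubini_between\<close> takes.\<close>
  define cl where "cl p x = max (real (fst p) * h) (min x ((real (fst p) + 1) * h))" for p :: "nat \<times> nat" and x
  have cl: "cl p x \<in> I p" "x \<in> I p ==> cl p x = x" for p x using h(1) by (auto simp: cl_def I_def min_def max_def)
  define lo where "lo p x = u (Complex (cl p x) (y0 + real (snd p) * h))" for p x
  define up where "up p x = u (Complex (cl p x) (y0 + (real (snd p) + 1) * h))" for p x
  have inQ: "Complex x y \<in> Q p" if "x \<in> I p" "y \<in> {y0 + real (snd p) * h .. y0 + (real (snd p) + 1) * h}" for x y p
   using that by (auto simp: Q_def cbox_iff I_def)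
  have edge: "y0 + real (snd p) * h \<in> {y0 + real (snd p) * h .. y0 + (real (snd p) + 1) * h}"
   "y0 + (real (snd p) + 1) * h \<in> {y0 + real (snd p) * h .. y0 + (real (snd p) + 1) * h}" for p :: "nat \<times> nat"
   using h(1) by (auto simp: algebra_simps)
  have ccl: "continuous_on UNIV (cl p)" for p unfolding cl_def[abs_def] by (intro continuous_intros)
  have clu: "continuous_on UNIV (lo p)" "continuous_on UNIV (up p)" if "p \<in> W" for p
  proof -
   have cC: "continuous_on UNIV (%x. Complex (cl p x) c)" for c unfolding Complex_eq by (intro continuous_intros ccl)
   have "Q p \<subseteq> B" using QBx[OF that] BxB by blast
   hence "Complex (cl p x) (y0 + real (snd p) * h) \<in> B" "Complex (cl p x) (y0 + (real (snd p) + 1) * h) \<in> B" for x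
    using inQ[OF cl(1) edge(1), of p x] inQ[OF cl(1) edge(2), of p x] by blast+
   thus "continuous_on UNIV (lo p)" "continuous_on UNIV (up p)" unfolding lo_def[abs_def] up_def[abs_def]
    by (intro continuous_on_compose2[OF cu cC]; blast)+
  qed
  \<comment> \<open>Those \<open>x\<close> over which the level \<open>t\<close> lies between the
    values at the two edges. By the intermediate value theorem \<open>A p t\<close> lies in the
    projection of the level set inside the square.\<close>
  define A where "A p t = {x \<in> I p. min (lo p x) (up p x) <= t & t <= max (lo p x) (up p x)}" for p t
  have AQ: "\<exists>z\<in>Q p. u z = t & Re z = x" if "p \<in> W" "x \<in> A p t" for p x t
  proof -
   let ?c = "y0 + real (snd p) * h" and ?d = "y0 + (real (snd p) + 1) * h"
   have x: "x \<in> I p" using that(2) by (simp add: A_def)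
   have cv: "continuous_on {?c..?d} (%y. u (Complex x y))"
   proof (rule continuous_on_compose2[OF cu])
    show "continuous_on {?c..?d} (Complex x)" unfolding Complex_eq by (intro continuous_intros)
    show "Complex x ` {?c..?d} \<subseteq> B" using inQ[OF x] QBx[OF that(1)] BxB by blast
   qed
   have cd: "?c <= ?d" using edge(1)[of p] by simp
   have e: "lo p x = u (Complex x ?c)" "up p x = u (Complex x ?d)" by (simp_all add: lo_def up_def cl(2)[OF x])
   have "\<exists>y. ?c <= y & y <= ?d & u (Complex x y) = t"
   proof (cases "lo p x <= up p x")
    case True
    hence "u (Complex x ?c) <= t" "t <= u (Complex x ?d)" using that(2) e by (auto simp: A_def)
    from IVT'[OF this cd cv] show ?thesis by blast
   next
    case False
    hence "t <= u (Complex x ?c)" "u (Complex x ?d) <= t" using that(2) e by (auto simp: A_def)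
    from IVT2'[OF this(2,1) cd cv] show ?thesis by blast
   qed
   then obtain y where "?c <= y" "y <= ?d" "u (Complex x y) = t" by blast
   moreover from this have "Complex x y \<in> Q p" by (intro inQ[OF x]) simp
   ultimately show ?thesis by (intro bexI[of _ "Complex x y"]) simp_all
  qed
  define ga where "ga p = (\<integral>\<^sup>+x\<in>I p. ennreal \<bar>up p x - lo p x\<bar> \<partial>lborel)" for p
  have gA: "(\<integral>\<^sup>+t. emeasure lborel (A p t) \<partial>lborel) = ga p" "(%t. emeasure lborel (A p t)) \<in> borel_measurable lborel" if "p \<in> W" for p
   unfolding A_def ga_def I_def by (rule fubini_between[OF clu[OF that]])+
  have gle: "ga p <= ennreal (4 * s p * h * h)" if "p \<in> W" for p
  proof -
   have "ga p <= (\<integral>\<^sup>+x\<in>I p. ennreal (4 * s p * h) \<partial>lborel)" unfolding ga_def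
   proof (intro nn_integral_mono)
    fix x
    have "\<bar>up p x - lo p x\<bar> <= dist (G (Complex (cl p x) (y0 + (real (snd p) + 1) * h))) (G (Complex (cl p x) (y0 + real (snd p) * h)))"
     unfolding up_def lo_def u_def dist_norm by (rule norm_triangle_ineq3)
    also have "\<dots> <= 4 * s p * dist (Complex (cl p x) (y0 + (real (snd p) + 1) * h)) (Complex (cl p x) (y0 + real (snd p) * h))"
     by (rule s(3)[OF that]) (intro inQ cl edge)+
    also have "dist (Complex (cl p x) (y0 + (real (snd p) + 1) * h)) (Complex (cl p x) (y0 + real (snd p) * h)) = h"
     using h(1) by (simp add: dist_norm cmod_def algebra_simps)
    finally show "ennreal \<bar>up p x - lo p x\<bar> * indicator (I p) x <= ennreal (4 * s p * h) * indicator (I p) x"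
     by (intro mult_right_mono ennreal_leI) auto
   qed
   also have "\<dots> = ennreal (4 * s p * h) * ennreal h"
    using h(1) by (simp add: nn_integral_cmult I_def algebra_simps)
   also have "\<dots> = ennreal (4 * s p * h * h)" using s(1)[OF that] h(1) by (simp add: ennreal_mult[symmetric])
   finally show ?thesis .
  qed
  define g where "g p = enn2real (ga p)" for p
  have g: "ennreal (g p) = ga p" "0 <= g p" "g p <= 4 * s p * h\<^sup>2" if "p \<in> W" for p
  proof -
   have fin: "ga p < top" using gle[OF that] by (rule order_le_less_trans) simp
   thus e: "ennreal (g p) = ga p" by (simp add: g_def)
   show "0 <= g p" by (simp add: g_def)
   have "ennreal (g p) <= ennreal (4 * s p * h * h)" using e gle[OF that] by simp
   thus "g p <= 4 * s p * h\<^sup>2" using s(1)[OF that] h(1) by (simp add: power2_eq_square mult.assoc)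
  qed
  have disjQ: "Q p \<inter> Q p' = {}" if "p ~= p'" "fst p mod 2 = fst p' mod 2" "snd p mod 2 = snd p' mod 2" for p p' :: "nat \<times> nat"
  proof (rule ccontr)
   assume "Q p \<inter> Q p' ~= {}"
   then obtain z where z: "z \<in> Q p" "z \<in> Q p'" by blast
   have nat: "i = j" if "real i * h <= r" "r <= (real i + 1) * h" "real j * h <= r" "r <= (real j + 1) * h" "i mod 2 = j mod 2" for i j :: nat and r
   proof -
    have "real i * h <= (real j + 1) * h" "real j * h <= (real i + 1) * h" using that by linarith+
    hence "real i <= real j + 1" "real j <= real i + 1" using h(1) by (simp_all only: mult_le_cancel_right_pos)
    hence "i <= j + 1" "j <= i + 1" by linarith+
    thus ?thesis using that(5) by presburger
   qed
   have "fst p = fst p'" by (rule nat[of _ "Re z"]) (use z that(2) in \<open>auto simp: Q_def cbox_iff\<close>)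
   moreover have "snd p = snd p'" by (rule nat[of _ "Im z - y0"]) (use z that(3) in \<open>auto simp: Q_def cbox_iff\<close>)
   ultimately show False using that(1) by (simp add: prod_eq_iff)
  qed
  have colour: "(\<Sum>p\<in>QA. ennreal (s p / 2) * emeasure lborel (A p t)) <= ennreal (16 * C * T) * indicator {0..4 * T} t" for t
  proof (cases "T / 2 <= t & t <= 4 * T")
   case False
   have "A p t = {}" if "p \<in> QA" for p
    using AQ[OF QW[OF that], of _ t] that False unfolding QA_def by blast
   hence "(\<Sum>p\<in>QA. ennreal (s p / 2) * emeasure lborel (A p t)) = 0" by (intro sum.neutral) auto
   thus ?thesis by simp
  next
   case True
   \<comment> \<open>Neighbouring closed squares touch, while \<open>hausdorff1_projection\<close>
     needs disjoint pieces. The parities of row and column give four colours, and squares of equal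
     colour are disjoint.\<close>
   define col where "col p = (fst p mod 2, snd p mod 2)" for p :: "nat \<times> nat"
   have one: "(\<Sum>p\<in>{p \<in> QA. col p = c}. ennreal (s p / 2) * emeasure lborel (A p t)) <= ennreal (C * t)" for c
   proof (rule order_trans[OF hausdorff1_projection len])
    show "finite {p \<in> QA. col p = c}" using fin by simp
    show "compact (Q p)" for p by (simp add: Q_def)
    show "continuous_on (Q p) G" if "p \<in> {p \<in> QA. col p = c}" for p
     using continuous_on_subset[OF cG] QBx[OF QW] BxB that by blast
    show "G ` Q p \<inter> G ` Q p' = {}" if "p \<in> {p \<in> QA. col p = c}" "p' \<in> {p \<in> QA. col p = c}" "p ~= p'" for p p'
    proof -
     have "Q p \<inter> Q p' = {}" using that by (intro disjQ) (auto simp: col_def)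
     moreover have "Q p \<subseteq> B" "Q p' \<subseteq> B" using QBx[OF QW] BxB that by blast+
     ultimately show ?thesis using inj_on_image_Int[OF inj] by (metis image_empty)
    qed
    show "0 < s p" if "p \<in> {p \<in> QA. col p = c}" for p using s(1) QW that by blast
    show "s p * dist x y <= dist (G x) (G y)" if "p \<in> {p \<in> QA. col p = c}" "x \<in> Q p" "y \<in> Q p" for p x y
     using s(2) QW that by blast
    show "A p t \<subseteq> Re ` {z \<in> Q p. G z \<in> sphere 0 t \<inter> G ` B}" if p: "p \<in> {p \<in> QA. col p = c}" for p
    proof
     have pW: "p \<in> W" using p QW by blast
     fix x assume "x \<in> A p t"
     from AQ[OF pW this] obtain z where z: "z \<in> Q p" "u z = t" "Re z = x" by blast
     moreover have "z \<in> B" using z QBx[OF pW] BxB by blast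
     ultimately show "x \<in> Re ` {z \<in> Q p. G z \<in> sphere 0 t \<inter> G ` B}" by (auto simp: u_def)
    qed
   qed (use True T Tr in auto)
   have "(\<Sum>p\<in>QA. ennreal (s p / 2) * emeasure lborel (A p t))
     = (\<Sum>c\<in>{0,1} \<times> {0,1}. \<Sum>p\<in>{p \<in> QA. col p = c}. ennreal (s p / 2) * emeasure lborel (A p t))"
    by (rule sum.group[symmetric]) (use fin in \<open>auto simp: col_def\<close>)
   also have "\<dots> <= (\<Sum>c\<in>({0,1} \<times> {0,1} :: (nat \<times> nat) set). ennreal (4 * C * T))"
    by (rule sum_mono, rule order_trans[OF one], rule ennreal_leI) (use True C in \<open>auto simp: algebra_simps\<close>)
   also have "\<dots> = ennreal (16 * C * T)"
    using C T by (subst sum_ennreal) (simp_all add: card_cartesian_product)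
   finally show ?thesis using True T by (simp add: indicator_def)
  qed
  have len_sum: "(\<Sum>p\<in>QA. s p * g p) <= 128 * C * T\<^sup>2"
  proof -
   have sg: "0 <= s p / 2" "0 <= g p" "ga p = ennreal (g p)" if "p \<in> QA" for p
    using s(1)[OF QW[OF that]] g[OF QW[OF that]] by simp_all
   have "ennreal (\<Sum>p\<in>QA. s p / 2 * g p) = (\<Sum>p\<in>QA. ennreal (s p / 2 * g p))"
    by (rule sum_ennreal[symmetric]) (intro mult_nonneg_nonneg sg)
   also have "\<dots> = (\<Sum>p\<in>QA. ennreal (s p / 2) * ga p)" by (rule sum.cong) (simp_all only: sg ennreal_mult)
   also have "\<dots> = (\<Sum>p\<in>QA. \<integral>\<^sup>+t. ennreal (s p / 2) * emeasure lborel (A p t) \<partial>lborel)"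
    using gA[OF QW] by (intro sum.cong refl) (simp add: nn_integral_cmult)
   also have "\<dots> = (\<integral>\<^sup>+t. (\<Sum>p\<in>QA. ennreal (s p / 2) * emeasure lborel (A p t)) \<partial>lborel)"
    using gA(2)[OF QW] by (intro nn_integral_sum[symmetric] borel_measurable_times) auto
   also have "\<dots> <= (\<integral>\<^sup>+t. ennreal (16 * C * T) * indicator {0..4 * T} t \<partial>lborel)" by (rule nn_integral_mono) (rule colour)
   also have "\<dots> = ennreal (16 * C * T * (4 * T))" using C T by (simp add: nn_integral_cmult ennreal_mult[symmetric])
   finally have "(\<Sum>p\<in>QA. s p / 2 * g p) <= 16 * C * T * (4 * T)" using C T by (subst (asm) ennreal_le_iff) auto
   hence "(\<Sum>p\<in>QA. s p * g p) / 2 <= 16 * C * T * (4 * T)" by (simp add: sum_divide_distrib)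
   thus ?thesis by (simp add: power2_eq_square)
  qed
  define S where "S j = {k. k < K & (j, k) \<in> QA}" for j
  have finS: "finite (S j)" for j by (simp add: S_def)
  have column: "ennreal (T * h) <= (\<Sum>k\<in>S j. ga (j, k))" if j: "j < N" for j
  proof -
   have pt: "T <= (\<Sum>k\<in>S j. \<bar>up (j, k) x - lo (j, k) x\<bar>)" if x: "x \<in> I (j, 0)" for x
   proof -
    define w where "w k = u (Complex x (y0 + real k * h))" for k
    \<comment> \<open>Truncation to the range from \<open>T\<close> to \<open>2 * T\<close>. A
      square not wholly in the shell has, as \<open>u\<close> varies by less than
      \<open>T / 2\<close>, both edge values on the same side of that range, so only squares of
      \<open>QA\<close> contribute to the total increase \<open>T\<close>.\<close>
    define v where "v k = max T (min (2 * T) (w k))" for k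
    have xk: "x \<in> I (j, k)" for k using x by (simp add: I_def)
    have ul: "up (j, k) x = w (Suc k)" "lo (j, k) x = w k" for k
     by (simp_all add: up_def lo_def w_def cl(2)[OF xk] algebra_simps)
    have x01: "0 <= x" "x <= 1"
    proof -
     show "0 <= x" using x h(1) by (auto simp: I_def intro: order_trans[of 0 "real j * h"])
     have "(real j + 1) * h <= real N * h" using j h(1) by (intro mult_right_mono) auto
     thus "x <= 1" using x Nh by (simp add: I_def)
    qed
    have "w 0 < T / 2" unfolding w_def using y0 x01 by (intro y0(3)) (auto simp: B)
    hence v0: "v 0 = T" using T by (simp add: v_def)
    have vK: "v K = 2 * T"
    proof -
     have zb: "Complex x (y0 + real K * h) \<in> Bx" "Complex x b \<in> Bx" using x01 K y0 h(1) by (auto simp: Bx_def cbox_iff)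
     have "dist (Complex x (y0 + real K * h)) (Complex x b) = b - (y0 + real K * h)" using K by (simp add: dist_norm cmod_def)
     also have "\<dots> < H" using K h by (simp add: algebra_simps)
     finally have "dist (w K) (u (Complex x b)) < T / 2" unfolding w_def by (intro H(2) zb)
     moreover have "4 * T <= u (Complex x b)" using x01 by (intro top) (simp add: cbox_iff)
     ultimately have "2 * T <= w K" using T(1) unfolding dist_real_def by linarith
     thus ?thesis using T(1) by (simp add: v_def min_def max_def)
    qed
    have zero: "v (Suc k) = v k" if k: "k < K" "k \<notin> S j" for k
    proof -
     have p: "(j, k) \<in> W" using j k by (simp add: W_def)
     have "(j, k) \<notin> QA" using k by (simp add: S_def)
     then obtain z where z: "z \<in> Q (j, k)" "u z < T / 2 | 4 * T < u z" using p unfolding QA_def by force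
     have m: "Complex x (y0 + real k * h) \<in> Q (j, k)" "Complex x (y0 + real (Suc k) * h) \<in> Q (j, k)"
      using inQ[OF xk edge(1)[of "(j, k)"]] inQ[OF xk edge(2)[of "(j, k)"]] by (simp_all add: algebra_simps)
     have near: "dist (u y) (u z) < T / 2" if "y \<in> Q (j, k)" for y
      using Qd[OF that z(1)] QBx[OF p] that z(1) h(2) by (intro H(2)) auto
     have n: "\<bar>w k - u z\<bar> < T / 2" "\<bar>w (Suc k) - u z\<bar> < T / 2"
      using near[OF m(1)] near[OF m(2)] unfolding w_def dist_real_def by simp_all
     from z(2) have "w k <= T & w (Suc k) <= T | 2 * T <= w k & 2 * T <= w (Suc k)"
      using n T(1) by (elim disjE; linarith)
     thus ?thesis using T(1) by (auto simp: v_def)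
    qed
    have "T = (\<Sum>k<K. v (Suc k) - v k)" by (simp add: sum_lessThan_telescope v0 vK)
    also have "\<dots> = (\<Sum>k\<in>S j. v (Suc k) - v k)"
     by (rule sum.mono_neutral_right) (use zero in \<open>auto simp: S_def\<close>)
    also have "\<dots> <= (\<Sum>k\<in>S j. \<bar>up (j, k) x - lo (j, k) x\<bar>)"
     by (rule sum_mono) (auto simp: ul v_def min_def max_def abs_if)
    finally show ?thesis .
   qed
   have "ennreal (T * h) = (\<integral>\<^sup>+x\<in>I (j, 0). ennreal T \<partial>lborel)"
    using T h(1) by (simp add: nn_integral_cmult I_def ennreal_mult algebra_simps)
   also have "\<dots> <= (\<integral>\<^sup>+x. (\<Sum>k\<in>S j. ennreal \<bar>up (j, k) x - lo (j, k) x\<bar> * indicator (I (j, k)) x) \<partial>lborel)"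
   proof (rule nn_integral_mono)
    fix x
    have Ik: "I (j, k) = {real j * h..(real j + 1) * h}" for k by (simp add: I_def)
    show "ennreal T * indicator (I (j, 0)) x <= (\<Sum>k\<in>S j. ennreal \<bar>up (j, k) x - lo (j, k) x\<bar> * indicator (I (j, k)) x)"
    proof (cases "x \<in> I (j, 0)")
     case True
     from ennreal_leI[OF pt[OF True]] have "ennreal T <= (\<Sum>k\<in>S j. ennreal \<bar>up (j, k) x - lo (j, k) x\<bar>)"
      by (subst sum_ennreal) simp_all
     thus ?thesis using True unfolding Ik by (simp only: indicator_simps mult_1_right)
    next
     case False
     thus ?thesis unfolding Ik by (simp only: indicator_simps mult_zero_right zero_le simp_thms)
    qed
   qed
   also have "\<dots> = (\<Sum>k\<in>S j. ga (j, k))" unfolding ga_def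
   proof (rule nn_integral_sum)
    fix k assume "k \<in> S j"
    hence "(j, k) \<in> W" using j by (simp add: S_def W_def)
    from clu[OF this] have "up (j, k) \<in> borel_measurable borel" "lo (j, k) \<in> borel_measurable borel"
     by (auto intro: borel_measurable_continuous_onI)
    thus "(%x. ennreal \<bar>up (j, k) x - lo (j, k) x\<bar> * indicator (I (j, k)) x) \<in> borel_measurable lborel"
     by (simp add: I_def)
   qed
   finally show ?thesis .
  qed
  have "ennreal T <= (\<Sum>p\<in>QA. ga p)"
  proof -
   have "T = (\<Sum>j<N. T * h)" using Nh by simp
   hence "ennreal T = (\<Sum>j<N. ennreal (T * h))" using T h(1) by (simp only: sum_ennreal mult_nonneg_nonneg less_imp_le)
   also have "\<dots> <= (\<Sum>j<N. \<Sum>k\<in>S j. ga (j, k))" by (rule sum_mono) (use column in auto)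
   also have "\<dots> = (\<Sum>p\<in>Sigma {..<N} S. ga p)" by (subst sum.Sigma) (use finS in auto)
   also have "Sigma {..<N} S = QA" by (auto simp: S_def QA_def W_def)
   finally show ?thesis .
  qed
  also have "(\<Sum>p\<in>QA. ga p) = ennreal (\<Sum>p\<in>QA. g p)" using g[OF QW] by (simp add: sum_ennreal[symmetric])
  finally have gT: "T <= (\<Sum>p\<in>QA. g p)" using g(2)[OF QW] by (simp add: sum_nonneg)
  \<comment> \<open>Weight in the inequality of arithmetic and geometric means, chosen so that
    \<open>2 * al\<close> times the bound \<open>128 * C * T^2\<close> is exactly
    \<open>T / 2\<close>.\<close>
  define al where "al = 1 / (512 * C * T)"
  have al: "0 < al" using C T by (simp add: al_def)
  have "g p <= 2 * al * (s p * g p) + h\<^sup>2 / (2 * al)" if "p \<in> QA" for p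
  proof -
   note gp = g(2,3)[OF QW[OF that]]
   have "(g p)\<^sup>2 <= 4 * (s p * g p) * h\<^sup>2" using mult_right_mono[OF gp(2) gp(1)] by (simp add: power2_eq_square algebra_simps)
   moreover have "0 <= (2 * al * g p - 2 * h\<^sup>2)\<^sup>2" by simp
   ultimately have "8 * al * h\<^sup>2 * g p <= 4 * al\<^sup>2 * (4 * (s p * g p) * h\<^sup>2) + 4 * (h\<^sup>2)\<^sup>2"
    using mult_left_mono[of "(g p)\<^sup>2" "4 * (s p * g p) * h\<^sup>2" "4 * al\<^sup>2"] by (simp add: power2_eq_square algebra_simps)
   moreover have "8 * al * h\<^sup>2 * (2 * al * (s p * g p) + h\<^sup>2 / (2 * al)) = 4 * al\<^sup>2 * (4 * (s p * g p) * h\<^sup>2) + 4 * (h\<^sup>2)\<^sup>2"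
    using al by (simp add: power2_eq_square distrib_left)
   ultimately have "8 * al * h\<^sup>2 * g p <= 8 * al * h\<^sup>2 * (2 * al * (s p * g p) + h\<^sup>2 / (2 * al))"
    by (simp only:)
   moreover have "0 < 8 * al * h\<^sup>2" using al h(1) by simp
   ultimately show ?thesis by (simp only: mult_le_cancel_left_pos)
  qed
  hence "(\<Sum>p\<in>QA. g p) <= (\<Sum>p\<in>QA. 2 * al * (s p * g p) + h\<^sup>2 / (2 * al))" by (rule sum_mono)
  also have "\<dots> = 2 * al * (\<Sum>p\<in>QA. s p * g p) + real (card QA) * (h\<^sup>2 / (2 * al))" by (simp add: sum.distrib sum_distrib_left)
  also have "\<dots> <= 2 * al * (128 * C * T\<^sup>2) + real (card QA) * (h\<^sup>2 / (2 * al))"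
   using len_sum al by (intro add_right_mono mult_left_mono) auto
  finally have "T <= T / 2 + real (card QA) * h\<^sup>2 * (256 * C * T)"
   using gT C T by (simp add: al_def power2_eq_square)
  hence "T * 1 <= T * (512 * C * (real (card QA) * h\<^sup>2))" by (simp add: algebra_simps)
  hence "1 <= 512 * C * (real (card QA) * h\<^sup>2)" using T(1) by (simp only: mult_le_cancel_left_pos)
  hence card: "1 / (512 * C) <= real (card QA) * h\<^sup>2" using C by (simp add: field_simps)
  define R where "R p = box (Complex (real (fst p) * h) (y0 + real (snd p) * h)) (Complex ((real (fst p) + 1) * h) (y0 + (real (snd p) + 1) * h))" for p :: "nat \<times> nat"
  have RQ: "R p \<subseteq> Q p" for p unfolding R_def Q_def by (rule box_subset_cbox)
  have emR: "emeasure lborel (R p) = ennreal (h\<^sup>2)" for p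
   unfolding R_def using h(1) by (subst emeasure_lborel_box) (auto simp: Basis_complex_def algebra_simps power2_eq_square)
  have "disjoint_family_on R QA" unfolding disjoint_family_on_def
  proof (intro ballI impI, rule ccontr)
   fix p p' assume pp: "p ~= p'" "R p \<inter> R p' ~= {}"
   then obtain z where z: "z \<in> R p" "z \<in> R p'" by blast
   have nat: "i = j" if "real i * h < r" "r < (real i + 1) * h" "real j * h < r" "r < (real j + 1) * h" for i j :: nat and r
   proof -
    have "real i * h < (real j + 1) * h" "real j * h < (real i + 1) * h" using that by linarith+
    hence "real i < real j + 1" "real j < real i + 1" using h(1) by (simp_all only: mult_less_cancel_right_pos)
    thus ?thesis by linarith
   qed
   have "fst p = fst p'" by (rule nat[of _ "Re z"]) (use z in \<open>auto simp: R_def in_box_complex_iff\<close>)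
   moreover have "snd p = snd p'" by (rule nat[of _ "Im z - y0"]) (use z in \<open>auto simp: R_def in_box_complex_iff\<close>)
   ultimately show False using pp(1) by (simp add: prod_eq_iff)
  qed
  hence "(\<Sum>p\<in>QA. emeasure lborel (R p)) = emeasure lborel (\<Union>p\<in>QA. R p)"
   by (intro sum_emeasure fin) (simp add: R_def image_subset_iff)
  hence "emeasure lborel (\<Union>p\<in>QA. R p) = ennreal (real (card QA) * h\<^sup>2)"
   by (simp add: emR ennreal_mult ennreal_of_nat_eq_real_of_nat)
  hence "ennreal (1 / (512 * C)) <= emeasure lborel (\<Union>p\<in>QA. R p)" using card by (simp add: ennreal_leI)
  moreover have "open (\<Union>p\<in>QA. R p)" by (auto simp: R_def)
  moreover have "(\<Union>p\<in>QA. R p) \<subseteq> {z \<in> B. T / 2 <= norm (G z) & norm (G z) <= 4 * T}"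
   using RQ QBx[OF QW] BxB unfolding QA_def u_def by blast
  ultimately show ?thesis by blast
 qed
 show ?thesis by (rule that[OF T0 shell])
qed

lemma no_length_area_collapse:
 fixes G :: "complex => 'a::euclidean_space"
 assumes b: "0 < b" and B: "B = {z. 0 <= Re z & Re z <= 1 & 0 < Im z & Im z <= b}"
  and inj: "inj_on G B" and nz: "\<And>z. z \<in> B ==> G z ~= 0"
  and qc: "\<And>z. z \<in> B ==> \<exists>e>0. \<exists>s>0. \<forall>x\<in>ball z e \<inter> B. \<forall>y\<in>ball z e \<inter> B.
   s * dist x y <= dist (G x) (G y) & dist (G x) (G y) <= 4 * s * dist x y"
  and lim: "\<And>T. 0 < T ==> \<exists>y0>0. \<forall>z\<in>B. Im z <= y0 --> norm (G z) < T"
  and r0: "0 < r0" and len: "\<And>t. 0 < t ==> t <= r0 ==> hausdorff1 (sphere 0 t \<inter> G ` B) <= ennreal (C0 * t)"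
 shows False
proof -
 define C where "C = max C0 1"
 have C: "0 < C" by (simp add: C_def)
 have len': "hausdorff1 (sphere 0 t \<inter> G ` B) <= ennreal (C * t)" if "0 < t" "t <= r0" for t
  by (rule order_trans[OF len[OF that]]) (use that(1) in \<open>auto intro!: ennreal_leI mult_right_mono simp: C_def\<close>)
 obtain T0 where T0: "0 < T0" "\<And>T. 0 < T ==> T <= T0 ==>
  \<exists>U. open U & U \<subseteq> {z \<in> B. T / 2 <= norm (G z) & norm (G z) <= 4 * T} & ennreal (1 / (512 * C)) <= emeasure lborel U"
  by (rule shell_area[OF b B inj nz qc lim r0 C len']) (assumption+, rule that, assumption+)
 \<comment> \<open>A shell spans the factor 8 between \<open>T / 2\<close> and \<open>4 * T\<close>;
   the ratio 16 makes consecutive shells disjoint.\<close>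
 define T where "T k = T0 / 16 ^ k" for k :: nat
 have T: "0 < T k" "T k <= T0" "l < k ==> 4 * T k < T l / 2" for k l
 proof -
  show "0 < T k" "T k <= T0" using T0(1) by (simp_all add: T_def divide_le_eq mult_le_cancel_left1)
  assume "l < k"
  hence "(16::real) ^ Suc l <= 16 ^ k" by (intro power_increasing) auto
  hence "T k <= T0 / 16 ^ Suc l" unfolding T_def using T0(1) by (intro divide_left_mono) auto
  hence "T k <= T l / 16" by (simp add: T_def)
  moreover have "0 < T l" using T0(1) by (simp add: T_def)
  ultimately show "4 * T k < T l / 2" by linarith
 qed
 have "\<forall>k. \<exists>U. open U & U \<subseteq> {z \<in> B. T k / 2 <= norm (G z) & norm (G z) <= 4 * T k} & ennreal (1 / (512 * C)) <= emeasure lborel U"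
  using T0(2) T by blast
 from choice[OF this] obtain U where U: "\<And>k. open (U k)" "\<And>k. U k \<subseteq> {z \<in> B. T k / 2 <= norm (G z) & norm (G z) <= 4 * T k}"
  "\<And>k. ennreal (1 / (512 * C)) <= emeasure lborel (U k)" by blast
 have disj: "U k \<inter> U l = {}" if "l < k" for k l using U(2)[of k] U(2)[of l] T(3)[OF that] by fastforce
 obtain n :: nat where n: "b * (512 * C) < real n" using reals_Archimedean2 by blast
 have "ennreal (real n * (1 / (512 * C))) = (\<Sum>k<n. ennreal (1 / (512 * C)))" using C by (subst sum_ennreal) auto
 also have "\<dots> <= (\<Sum>k<n. emeasure lborel (U k))" by (rule sum_mono) (rule U(3))
 also have "\<dots> = emeasure lborel (\<Union>k<n. U k)"
 proof (rule sum_emeasure)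
  show "disjoint_family_on U {..<n}" unfolding disjoint_family_on_def using disj by (metis Int_commute linorder_neqE_nat)
 qed (use U(1) in auto)
 also have "\<dots> <= emeasure lborel (cbox 0 (Complex 1 b))"
 proof (rule emeasure_mono)
  show "(\<Union>k<n. U k) \<subseteq> cbox 0 (Complex 1 b)" using U(2) by (force simp: B in_cbox_complex_iff)
 qed simp
 also have "\<dots> = ennreal b" using b by (subst emeasure_lborel_cbox) (auto simp: Basis_complex_def)
 finally have "real n * (1 / (512 * C)) <= b" using b by simp
 thus False using n C by (simp add: field_simps)
qed

section \<open>Discs around the singularity\<close>

lemma riemann_pointed:
 assumes S: "open S" "simply_connected S" "S ~= UNIV" "p \<in> S"
 obtains f g where "f holomorphic_on S" "g holomorphic_on D1" "f p = 0" "\<And>z. z \<in> S ==> f z \<in> D1 & g (f z) = z"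
  "\<And>z. z \<in> D1 ==> g z \<in> S & f (g z) = z"
proof -
 have "\<exists>f g. f holomorphic_on S & g holomorphic_on D1 & (\<forall>z\<in>S. f z \<in> D1 & g (f z) = z) & (\<forall>z\<in>D1. g z \<in> S & f (g z) = z)"
  using Riemann_mapping_theorem[of S] S by auto
 then obtain f g where f: "f holomorphic_on S" "g holomorphic_on D1" and fg: "\<And>z. z \<in> S ==> f z \<in> D1 & g (f z) = z"
  "\<And>z. z \<in> D1 ==> g z \<in> S & f (g z) = z" by blast
 obtain m n where m: "m (f p) = 0" "m holomorphic_on D1" "m ` D1 \<subseteq> D1" "n holomorphic_on D1" "n ` D1 \<subseteq> D1"
  and mn: "\<And>z. z \<in> D1 ==> m (n z) = z" "\<And>z. z \<in> D1 ==> n (m z) = z"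
  using ball_biholomorphism_exists[of "f p"] fg(1)[OF S(4)] by metis
 show ?thesis
 proof (rule that[of "m \<circ> f" "g \<circ> n"])
  show "m \<circ> f holomorphic_on S" by (rule holomorphic_on_compose_gen[OF f(1) m(2)]) (use fg(1) in blast)
  show "g \<circ> n holomorphic_on D1" by (rule holomorphic_on_compose_gen[OF m(4) f(2) m(5)])
  show "(m \<circ> f) p = 0" using m(1) by simp
  show "(m \<circ> f) z \<in> D1 & (g \<circ> n) ((m \<circ> f) z) = z" if "z \<in> S" for z
   using fg(1)[OF that] m(3) mn(2)[of "f z"] by (metis comp_apply image_subset_iff)
  show "(g \<circ> n) z \<in> S & (m \<circ> f) ((g \<circ> n) z) = z" if "z \<in> D1" for z
   using fg(2)[of "n z"] m(5) mn(1)[OF that] that by (metis comp_apply image_subset_iff)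
 qed
qed

text \<open>If every tangent vector at \<open>x\<close> is orthogonal to \<open>x\<close>, the Whitney angle is \<open>\<pi>/2\<close>.\<close>

lemma whitney_tangent:
 assumes "whitney_condition M"
 obtains R where "0 < R" "\<And>x. x \<in> M ==> norm x < R ==> \<exists>v\<in>tangent_space M x. v \<bullet> x ~= 0"
proof -
 obtain W where W: "continuous_on (M \<union> {0}) W" "W 0 = 0" "\<And>x. x \<in> M ==> W x = sin (whitney_angle M x)"
  using assms unfolding whitney_condition_def by blast
 from W(1) obtain R where R: "0 < R" "\<forall>x\<in>M \<union> {0}. dist x 0 < R --> dist (W x) (W 0) < 1"
  unfolding continuous_on_iff by (metis UnCI insertI1 zero_less_one)
 show ?thesis
 proof (rule that[OF R(1)], rule ccontr)
  fix x assume x: "x \<in> M" "norm x < R" and "\<not> (\<exists>v\<in>tangent_space M x. v \<bullet> x ~= 0)"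
  hence o: "v \<bullet> x = 0" if "v \<in> tangent_space M x" for v using that by blast
  have 0: "0 \<in> tangent_space M x" unfolding tangent_space_def
   using x(1) by (auto intro!: exI[of _ "%_. x"] exI[of _ 1] derivative_eq_intros C1_differentiable_on_const)
  have "orth_proj (affine_tangent_space M x) 0 = x" unfolding orth_proj_def
  proof (rule the_equality)
   show "x \<in> affine_tangent_space M x & (\<forall>q\<in>affine_tangent_space M x. orthogonal (0 - x) (q - x))"
    using 0 o by (auto simp: affine_tangent_space_def orthogonal_def image_iff inner_commute intro: bexI[of _ 0])
  next
   fix p assume p: "p \<in> affine_tangent_space M x & (\<forall>q\<in>affine_tangent_space M x. orthogonal (0 - p) (q - p))"
   then obtain v where v: "v \<in> tangent_space M x" "p = x + v" by (auto simp: affine_tangent_space_def)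
   have "orthogonal (0 - p) (x - p)" using 0 p by (auto simp: affine_tangent_space_def image_iff)
   hence "(x + v) \<bullet> v = 0" by (simp add: orthogonal_def v(2) inner_diff_left inner_add_left)
   thus "p = x" using o[OF v(1)] v(2) by (simp add: inner_add_left inner_commute[of x v])
  qed
  hence "W x = 1" unfolding W(3)[OF x(1)] by (simp add: whitney_angle_def vec_angle_def)
  thus False using R(2) x W(2) by (auto simp: dist_norm)
 qed
qed

text \<open>Along a curve with velocity \<open>v\<close> the squared norm has derivative
  \<open>2 * (v \<bullet> x)\<close>, which is not 0, so it takes both smaller and larger values
  arbitrarily close to \<open>x\<close>.\<close>

lemma tangent_no_extremum:
 assumes v: "v \<in> tangent_space M x" "v \<bullet> x ~= 0" and ep: "0 < ep"
 shows "\<exists>y\<in>M. dist y x < ep & norm y < norm x" "\<exists>y\<in>M. dist y x < ep & norm x < norm y"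
proof -
 obtain g e where e: "0 < e" "g ` {-e<..<e} \<subseteq> M" "g 0 = x" and d: "(g has_vector_derivative v) (at 0)"
  using v(1) unfolding tangent_space_def by blast
 have "((%t. g t \<bullet> g t) has_derivative (%h. g 0 \<bullet> (h *\<^sub>R v) + (h *\<^sub>R v) \<bullet> g 0)) (at 0)"
  using d unfolding has_vector_derivative_def by (intro has_derivative_inner)
 moreover have "(%h. g 0 \<bullet> (h *\<^sub>R v) + (h *\<^sub>R v) \<bullet> g 0) = (*) (2 * (v \<bullet> x))" by (simp add: e(3) inner_commute fun_eq_iff)
 ultimately have D: "((%t. g t \<bullet> g t) has_real_derivative 2 * (v \<bullet> x)) (at 0)" by (simp add: has_field_derivative_def)
 have "continuous (at 0) g" using d has_vector_derivative_continuous by blast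
 then obtain d1 where d1: "0 < d1" "\<And>t. dist t 0 < d1 ==> dist (g t) x < ep"
  unfolding continuous_at_eps_delta using ep e(3) by metis
 have mem: "g t \<in> M" "dist (g t) x < ep" if "\<bar>0 - t\<bar> < min e d1" for t
 proof -
  have "t \<in> {-e<..<e}" "dist t 0 < d1" using that by (auto simp: dist_real_def)
  thus "g t \<in> M" "dist (g t) x < ep" using e(2) d1(2) by blast+
 qed
 have m: "0 < min e d1" using e d1 by simp
 show "\<exists>y\<in>M. dist y x < ep & norm y < norm x"
 proof (rule ccontr)
  assume "\<not> ?thesis"
  hence "\<forall>t. \<bar>0 - t\<bar> < min e d1 --> g 0 \<bullet> g 0 <= g t \<bullet> g t"
   using mem unfolding e(3) norm_le[symmetric] by (meson not_le)
  from DERIV_local_min[OF D m this] show False using v(2) by simp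
 qed
 show "\<exists>y\<in>M. dist y x < ep & norm x < norm y"
 proof (rule ccontr)
  assume "\<not> ?thesis"
  hence "\<forall>t. \<bar>0 - t\<bar> < min e d1 --> g t \<bullet> g t <= g 0 \<bullet> g 0"
   using mem unfolding e(3) norm_le[symmetric] by (meson not_le)
  from DERIV_local_max[OF D m this] show False using v(2) by simp
 qed
qed

text \<open>In a topological chart the piece is the sublevel set \<open>V\<close> of the norm. A
  component of \<open>V\<close> missing the centre would contain a local minimum of the norm, and a
  hole in \<open>V\<close> would contain a local maximum; both are excluded, so \<open>V\<close> is
  connected and simply connected, and the Riemann map makes it a disc.\<close>

lemma disc_neighbourhoods:
 fixes E :: "'a::euclidean_space set"
 assumes "Ck_surface 0 E" "0 \<in> E" and R: "0 < R"
  and noext: "\<And>x. x \<in> E - {0} ==> norm x < R ==> \<exists>v\<in>tangent_space (E - {0}) x. v \<bullet> x ~= 0"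
 obtains r1 where "0 < r1"
  "\<And>r. 0 < r ==> r <= r1 ==> \<exists>p Ph. homeomorphism D1 (E \<inter> ball 0 r) (p :: complex => 'a) Ph & p 0 = 0"
proof -
 obtain F U where l: "local_param 0 E F U" and "0 \<in> F ` U" using assms(1,2) unfolding Ck_surface_def by blast
 then obtain u0 where u0: "u0 \<in> U" "F u0 = 0" by auto
 have oU: "open U" using l unfolding local_param_def by blast
 note c = local_param_cont[OF l] and inj = local_param_inj[OF l] and sub = local_param_sub[OF l]
 have "open (U \<inter> F -` ball 0 R)" by (rule continuous_open_preimage[OF c oU open_ball])
 moreover have "u0 \<in> U \<inter> F -` ball 0 R" using u0 R by simp
 ultimately obtain rh where rh: "0 < rh" "cball u0 rh \<subseteq> U \<inter> F -` ball 0 R" using open_contains_cball by blast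
 hence bU: "ball u0 rh \<subseteq> U" by auto
 obtain T where T: "open T" "F ` ball u0 rh = E \<inter> T"
  using local_param_open[OF l open_ball bU] unfolding openin_open by blast
 have "0 \<in> T" using T(2) u0 rh(1) by (metis IntD2 centre_in_ball image_eqI)
 from openE[OF T(1) this] obtain r2 where r2: "0 < r2" "ball 0 r2 \<subseteq> T" .
 show ?thesis
 proof (rule that[of "min r2 R"])
  show "0 < min r2 R" using r2 R by simp
  fix r assume r: "0 < r" "r <= min r2 R"
  define V where "V = {u \<in> U. norm (F u) < r}"
  have VB: "V \<subseteq> ball u0 rh"
  proof
   fix u assume u: "u \<in> V"
   hence "F u \<in> E \<inter> T" using sub r2(2) r(2) by (auto simp: V_def)
   then obtain w where "w \<in> ball u0 rh" "F u = F w" using T(2) by (metis imageE)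
   thus "u \<in> ball u0 rh" using inj u bU by (auto simp: V_def dest: inj_onD)
  qed
  have img: "F ` V = E \<inter> ball 0 r"
  proof
   show "F ` V \<subseteq> E \<inter> ball 0 r" using sub by (auto simp: V_def)
   show "E \<inter> ball 0 r \<subseteq> F ` V" using r2(2) r(2) T(2) bU by (force simp: V_def)
  qed
  have oV: "open V" using continuous_open_preimage[OF c oU open_ball[of 0 r]] by (simp add: V_def vimage_def Int_def)
  have cn: "continuous_on U (%u. norm (F u))" by (intro continuous_on_norm c)
  \<comment> \<open>Open sets of the chart correspond to relatively open sets of \<open>E\<close>,
    so an extremum in the parameter is one on the surface.\<close>
  have ext: False if O: "open S" "S \<subseteq> U" "w \<in> S" "F w ~= 0" "norm (F w) < R"
   "(\<forall>u\<in>S. norm (F w) <= norm (F u)) | (\<forall>u\<in>S. norm (F u) <= norm (F w))" for S w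
  proof -
   obtain T' where T': "open T'" "F ` S = E \<inter> T'" using local_param_open[OF l O(1,2)] unfolding openin_open by blast
   have "F w \<in> E \<inter> T'" using T'(2) O(3) by blast
   hence "F w \<in> T'" "F w \<in> E - {0}" using O(4) by auto
   obtain e where e: "0 < e" "ball (F w) e \<subseteq> T'" by (rule openE[OF T'(1) \<open>F w \<in> T'\<close>])
   obtain v where v: "v \<in> tangent_space (E - {0}) (F w)" "v \<bullet> F w ~= 0" using noext[OF \<open>F w \<in> E - {0}\<close> O(5)] by blast
   have S: "y \<in> F ` S" if "y \<in> E - {0}" "dist y (F w) < e" for y
    unfolding T'(2) using that e(2) by (auto simp: dist_commute)
   show False using tangent_no_extremum[OF v e(1)] S O(6) by (metis imageE not_le)
  qed
  have u0V: "u0 \<in> V" using u0 r by (simp add: V_def)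
  have nz: "F w ~= 0" if "w \<in> U" "w ~= u0" for w using inj_onD[OF inj, of w u0] that u0 by auto
  have clsub: "closure S \<subseteq> cball u0 rh" if "S \<subseteq> cball u0 rh" for S by (rule closure_minimal[OF that closed_cball])
  \<comment> \<open>The minimum over the closure of a component stays below \<open>r\<close>, hence
    lies in \<open>V\<close>; components being relatively closed, it is attained in the component
    itself.\<close>
  have comp: "u0 \<in> connected_component_set V x" if x: "x \<in> V" for x
  proof (rule ccontr)
   let ?C = "connected_component_set V x"
   assume n: "u0 \<notin> ?C"
   have CV: "?C \<subseteq> V" by (rule connected_component_subset)
   have xC: "x \<in> ?C" using x by (simp add: connected_component_refl)
   have "closure ?C \<subseteq> cball u0 rh" by (rule clsub) (use CV VB in force)
   hence clU: "closure ?C \<subseteq> U" "compact (closure ?C)"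
    using rh(2) by (auto simp: compact_eq_bounded_closed intro: bounded_subset[OF bounded_cball])
   obtain w where w: "w \<in> closure ?C" "\<And>u. u \<in> closure ?C ==> norm (F w) <= norm (F u)"
    using continuous_attains_inf[OF clU(2) _ continuous_on_subset[OF cn clU(1)]] xC closure_subset by blast
   have "x \<in> closure ?C" by (rule subsetD[OF closure_subset xC])
   from w(2)[OF this] have wx: "norm (F w) < r" using x by (simp add: V_def)
   hence wV: "w \<in> V" using w(1) clU(1) by (auto simp: V_def)
   have wC: "w \<in> ?C"
   proof -
    obtain T' where T': "closed T'" "?C = V \<inter> T'"
     using closedin_connected_component[of V x] unfolding closedin_closed by metis
    moreover have "closure ?C \<subseteq> T'" by (rule closure_minimal[OF _ T'(1)]) (use T'(2) in blast)
    ultimately show ?thesis using w(1) wV by blast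
   qed
   show False
   proof (rule ext[of ?C w])
    show "open ?C" by (rule open_connected_component[OF oV])
    show "?C \<subseteq> U" using CV by (auto simp: V_def)
    show "F w ~= 0" by (rule nz) (use wV wC n in \<open>auto simp: V_def\<close>)
    show "norm (F w) < R" using wx r by simp
    show "(\<forall>u\<in>?C. norm (F w) <= norm (F u)) | (\<forall>u\<in>?C. norm (F u) <= norm (F w))"
     using w(2) closure_subset[of ?C] by blast
   qed (rule wC)
  qed
  have conn: "connected V" unfolding connected_iff_connected_component
   using comp by (metis connected_component_sym connected_component_trans mem_Collect_eq)
  \<comment> \<open>If a loop in \<open>V\<close> winds around a point outside \<open>V\<close>, the
    norm is at least \<open>r\<close> somewhere inside the loop but below \<open>r\<close> on it, so
    its maximum is attained in the interior.\<close>
  have sc: "simply_connected V" unfolding simply_connected_eq_winding_number_zero[OF oV]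
  proof (intro conjI conn allI impI)
   fix ga z assume ga: "path ga & path_image ga \<subseteq> V & pathfinish ga = pathstart ga & z \<notin> V"
   let ?P = "path_image ga"
   show "winding_number ga z = 0"
   proof (rule ccontr)
    assume "winding_number ga z ~= 0"
    hence "z \<notin> outside ?P" using ga winding_number_zero_in_outside by blast
    moreover have "z \<notin> ?P" using ga by blast
    ultimately have zi: "z \<in> inside ?P" using inside_Un_outside[of ?P] by blast
    have clP: "closed ?P" "?P \<subseteq> cball u0 rh" using ga VB by (auto simp: closed_path_image)
    have inB: "inside ?P \<subseteq> cball u0 rh" using outside_mono[OF clP(2)] outside_convex[of "cball u0 rh"] inside_Int_outside[of ?P] by blast
    from clsub[OF inB] have clU: "closure (inside ?P) \<subseteq> U" "compact (closure (inside ?P))"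
     using rh(2) by (auto simp: compact_eq_bounded_closed intro: bounded_subset[OF bounded_cball])
    obtain w where w: "w \<in> closure (inside ?P)" "\<And>u. u \<in> closure (inside ?P) ==> norm (F u) <= norm (F w)"
     using continuous_attains_sup[OF clU(2) _ continuous_on_subset[OF cn clU(1)]] zi closure_subset by blast
    have zU: "z \<in> U" using zi clU(1) closure_subset by blast
    have "r <= norm (F z)" using ga zU by (auto simp: V_def not_less)
    also have "\<dots> <= norm (F w)" using w(2) zi closure_subset by blast
    finally have rw: "r <= norm (F w)" .
    hence "w \<notin> frontier (inside ?P)" using ga frontier_inside_subset[OF clP(1)] by (auto simp: V_def)
    hence wi: "w \<in> inside ?P" using w(1) open_inside[OF clP(1)] by (simp add: frontier_def interior_open)
    show False
    proof (rule ext[of "inside ?P" w])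
     show "inside ?P \<subseteq> U" using clU(1) closure_subset by blast
     show "F w ~= 0" using rw r(1) by auto
     show "norm (F w) < R" using w(1) clsub[OF inB] rh(2) by auto
     show "(\<forall>u\<in>inside ?P. norm (F w) <= norm (F u)) | (\<forall>u\<in>inside ?P. norm (F u) <= norm (F w))"
      using w(2) closure_subset[of "inside ?P"] by blast
    qed (use wi open_inside[OF clP(1)] in auto)
   qed
  qed
  have "V ~= UNIV" using VB bounded_subset[OF bounded_ball VB] not_bounded_UNIV by blast
  then obtain f g where fg: "f holomorphic_on V" "g holomorphic_on D1" "f u0 = 0"
   "\<And>z. z \<in> V ==> f z \<in> D1 & g (f z) = z" "\<And>z. z \<in> D1 ==> g z \<in> V & f (g z) = z"
   by (rule riemann_pointed[OF oV sc _ u0V]) (rule that, assumption+)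
  have VU: "V \<subseteq> U" by (auto simp: V_def)
  have "homeomorphism D1 (E \<inter> ball 0 r) (%z. F (g z)) (%x. f (inv_into U F x))"
  proof (rule homeomorphismI)
   show "continuous_on D1 (%z. F (g z))"
    by (rule continuous_on_compose2[OF c holomorphic_on_imp_continuous_on[OF fg(2)]]) (use fg(5) VU in blast)
   have iV: "inv_into U F x \<in> V" if "x \<in> E \<inter> ball 0 r" for x
    using that inv_into_f_f[OF inj] VU unfolding img[symmetric] by auto
   show "continuous_on (E \<inter> ball 0 r) (%x. f (inv_into U F x))"
    by (rule continuous_on_compose2[OF holomorphic_on_imp_continuous_on[OF fg(1)] continuous_on_subset[OF local_param_inv_cont[OF l]]])
      (use iV VU in \<open>auto simp: img[symmetric]\<close>)
   show "(%z. F (g z)) ` D1 \<subseteq> E \<inter> ball 0 r" using fg(5) img by blast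
   show "(%x. f (inv_into U F x)) ` (E \<inter> ball 0 r) \<subseteq> D1" using iV fg(4) by blast
   show "f (inv_into U F (F (g z))) = z" if "z \<in> D1" for z
    using fg(5)[OF that] VU by (simp add: inv_into_f_f[OF inj] subset_iff)
   show "F (g (f (inv_into U F x))) = x" if "x \<in> E \<inter> ball 0 r" for x
    using fg(4)[OF iV[OF that]] that VU unfolding img[symmetric] by (auto simp: f_inv_into_f)
  qed
  moreover have "F (g 0) = 0" using fg(4)[OF u0V] fg(3) u0 by simp
  ultimately show "\<exists>p Ph. homeomorphism D1 (E \<inter> ball 0 r) (p :: complex => 'a) Ph & p 0 = 0"
   by (intro exI[of _ "%z. F (g z)"] exI[of _ "%x. f (inv_into U F x)"]) simp
 qed
qed

section \<open>Uniformization of the punctured disc\<close>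

text \<open>After a Moebius map that moves \<open>S 0\<close> to 0, Schwarz's lemma for the map and
  for its inverse leaves only a rotation. The formula is stated without division so that it can be
  rearranged freely.\<close>

lemma disc_automorphism_form:
 assumes S: "S holomorphic_on D1" "bij_betw S D1 D1"
 obtains e w where "cmod e = 1" "cmod w < 1" "\<And>z. z \<in> D1 ==> S z * (1 + cnj w * e * z) = e * z + w"
proof -
 define w where "w = S 0"
 have b: "S z \<in> D1" if "z \<in> D1" for z using S(2) that unfolding bij_betw_def by blast
 have w: "cmod w < 1" using b[of 0] by (simp add: w_def)
 define f where "f z = Moebius_function 0 w (S z)" for z
 have fb: "cmod (f z) < 1" if "cmod z < 1" for z
  unfolding f_def using Moebius_function_norm_lt_1[OF w] b[of z] that by simp
 have fh: "f holomorphic_on D1"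
  using holomorphic_on_compose_gen[OF S(1) Moebius_function_holomorphic[OF w]] b by (simp add: f_def[abs_def] o_def image_subset_iff)
 have f0: "f 0 = 0" by (simp add: f_def w_def Moebius_function_eq_zero)
 have bk: "Moebius_function 0 (- w) (f z) = S z" if "z \<in> D1" for z
  unfolding f_def by (rule Moebius_function_compose) (use w b[OF that] in auto)
 have finj: "inj_on f D1" using bk inj_onD[OF bij_betw_imp_inj_on[OF S(2)]] inj_onI by metis
 have fim: "f ` D1 = D1"
 proof
  show "f ` D1 \<subseteq> D1" using fb by auto
  show "D1 \<subseteq> f ` D1"
  proof
   fix y :: complex assume y: "y \<in> D1"
   have "Moebius_function 0 (- w) y \<in> D1" using Moebius_function_norm_lt_1[of "- w" y 0] w y by simp
   then obtain z where z: "z \<in> D1" "S z = Moebius_function 0 (- w) y" using S(2) unfolding bij_betw_def by (metis imageE)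
   have "f z = y" unfolding f_def z(2) by (rule Moebius_function_compose) (use w y in auto)
   thus "y \<in> f ` D1" using z(1) by blast
  qed
 qed
 obtain g where g: "g holomorphic_on D1" "\<And>z. z \<in> D1 ==> g (f z) = z"
  by (rule holomorphic_has_inverse[OF fh open_ball finj, unfolded fim]) (rule that, assumption+)
 have gb: "cmod (g z) < 1" if "cmod z < 1" for z
 proof -
  have "z \<in> f ` D1" unfolding fim using that by simp
  then obtain y where "y \<in> D1" "z = f y" by blast
  thus ?thesis using g(2) by simp
 qed
 have g0: "g 0 = 0" using g(2)[of 0] f0 by simp
 have h: "(1/2 :: complex) \<in> D1" "cmod (1/2) < 1" by simp_all
 have "cmod (f (1/2)) <= cmod (1/2)" by (rule Schwarz_Lemma(1)[OF fh f0 fb h(2)])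
 moreover have "cmod (g (f (1/2))) <= cmod (f (1/2))" by (rule Schwarz_Lemma(1)[OF g(1) g0 gb fb[OF h(2)]])
 ultimately have "cmod (f (1/2)) = cmod (1/2)" using g(2)[OF h(1)] by simp
 hence "\<exists>z. cmod z < 1 & z ~= 0 & cmod (f z) = cmod z" using h(2) by (intro exI[of _ "1/2"]) simp
 then obtain e where e: "\<And>z. cmod z < 1 ==> f z = e * z" "cmod e = 1"
  using Schwarz_Lemma(3)[OF fh f0 fb h(2)] by blast
 show ?thesis
 proof (rule that[OF e(2) w])
  fix z :: complex assume z: "z \<in> D1"
  have "cmod (cnj w * S z) < 1 * 1" unfolding norm_mult using w b[OF z] by (intro mult_strict_mono') auto
  hence n: "1 - cnj w * S z ~= 0" by (metis eq_iff_diff_eq_0 less_irrefl mult_1 norm_one)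
  have "(S z - w) / (1 - cnj w * S z) = e * z" using e(1)[of z] z by (simp add: f_def Moebius_function_simple)
  thus "S z * (1 + cnj w * e * z) = e * z + w" using n by (simp add: field_simps)
 qed
qed

text \<open>The quadratic is the fixed point equation of the automorphism, and it is invariant under
  reflection in the unit circle. A root outside the disc would reflect to a root inside, which
  \<open>nofix\<close> forbids; so the root lies on the circle.\<close>

lemma unit_fixed_point:
 assumes e: "cmod e = 1" and w: "w ~= 0" "cmod w < 1"
  and nofix: "\<And>z. cmod z < 1 ==> cnj w * e * z\<^sup>2 + (1 - e) * z - w ~= 0"
 obtains c where "cmod c = 1" "cnj w * e * c\<^sup>2 + (1 - e) * c - w = 0"
proof -
 define a where "a = cnj w * e"
 have a: "a ~= 0" using w e by (auto simp: a_def)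
 define c where "c = (e - 1 + csqrt ((1 - e)\<^sup>2 + 4 * a * w)) / (2 * a)"
 have "(2 * a * c + (1 - e))\<^sup>2 = (1 - e)\<^sup>2 + 4 * a * w" using a by (simp add: c_def)
 hence "4 * a * (a * c\<^sup>2 + (1 - e) * c - w) = 0" by (simp add: power2_eq_square algebra_simps)
 hence root: "a * c\<^sup>2 + (1 - e) * c - w = 0" using a by simp
 have z0: "c ~= 0" using root w by auto
 have ee: "e * cnj e = 1" using e complex_norm_square[of e] by simp
 have "\<not> 1 < cmod c"
 proof
  assume b: "1 < cmod c"
  define h where "h = inverse (cnj c)"
  have h: "h * cnj c = 1" using z0 by (simp add: h_def)
  have "cnj (a * c\<^sup>2 + (1 - e) * c - w) = 0" using root by simp
  hence r: "w * cnj e * (cnj c)\<^sup>2 + (1 - cnj e) * cnj c - cnj w = 0" by (simp add: a_def)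
  have "a * h\<^sup>2 + (1 - e) * h - w = - (e * h\<^sup>2) * (w * cnj e * (cnj c)\<^sup>2 + (1 - cnj e) * cnj c - cnj w)"
  proof -
   have "- (e * h\<^sup>2) * (w * cnj e * (cnj c)\<^sup>2 + (1 - cnj e) * cnj c - cnj w)
     = - w * (e * cnj e) * (h * cnj c)\<^sup>2 + (e * cnj e - e) * h * (h * cnj c) + a * h\<^sup>2"
    by (simp add: a_def power2_eq_square algebra_simps)
   thus ?thesis unfolding ee h by simp
  qed
  hence "a * h\<^sup>2 + (1 - e) * h - w = 0" using r by simp
  moreover have "cmod h < 1" using b by (simp add: h_def norm_inverse inverse_less_1_iff)
  ultimately show False using nofix[of h] by (simp add: a_def)
 qed
 moreover have "\<not> cmod c < 1" using nofix[of c] root by (auto simp: a_def)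
 ultimately show ?thesis using that[of c] root by (simp add: a_def)
qed

lemma cayley_disc:
 assumes c: "cmod c = 1"
 defines "S \<equiv> %z. \<i> * (c + z) / (c - z)"
 shows "S holomorphic_on D1" "bij_betw S D1 {s. 0 < Im s}" "\<And>z. z \<in> D1 ==> c - z ~= 0"
proof -
 show nz: "c - z ~= 0" if "z \<in> D1" for z using that c by auto
 show "S holomorphic_on D1" unfolding S_def by (intro holomorphic_intros) (use nz in auto)
 have z0: "c ~= 0" using c by auto
 have im: "Im (S z) = (1 - (cmod z)\<^sup>2) / (cmod (c - z))\<^sup>2" if "c - z ~= 0" for z
 proof -
  have "cnj (c - z) ~= 0" using that by (simp add: complex_cnj_cancel_iff del: complex_cnj_diff)
  hence "S z = \<i> * ((c + z) * cnj (c - z)) / of_real ((cmod (c - z))\<^sup>2)" unfolding S_def complex_norm_square by simp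
  hence "Im (S z) = Re ((c + z) * cnj (c - z)) / (cmod (c - z))\<^sup>2"
   by (simp only: Im_divide_of_real) simp
  also have "Re ((c + z) * cnj (c - z)) = (cmod c)\<^sup>2 - (cmod z)\<^sup>2"
   unfolding cmod_power2 by (simp add: power2_eq_square algebra_simps)
  finally show ?thesis by (simp add: c)
 qed
 define T where "T s = c * (s - \<i>) / (s + \<i>)" for s
 have si: "s + \<i> ~= 0" if "0 < Im s" for s using that by (auto simp: complex_eq_iff)
 have ST: "S (T s) = s" if "0 < Im s" for s
 proof -
  have "c + T s = c * (2 * s) / (s + \<i>)" "c - T s = c * (2 * \<i>) / (s + \<i>)"
   using si[OF that] by (simp_all add: T_def field_simps)
  thus ?thesis using si[OF that] z0 by (simp add: S_def)
 qed
 have TS: "T (S z) = z" if "z \<in> D1" for z using nz[OF that] z0 by (simp add: S_def field_simps T_def)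
 show "bij_betw S D1 {s. 0 < Im s}"
 proof (rule bij_betw_byWitness[where f' = T])
  show "S ` D1 \<subseteq> {s. 0 < Im s}"
  proof clarify
   fix z :: complex assume z: "z \<in> D1"
   have "(cmod z)\<^sup>2 < 1" using z by (simp add: abs_square_less_1)
   thus "0 < Im (S z)" unfolding im[OF nz[OF z]] using nz[OF z] by simp
  qed
  show "T ` {s. 0 < Im s} \<subseteq> D1"
  proof clarify
   fix s assume s: "0 < Im s"
   have "c - T s = c * (2 * \<i>) / (s + \<i>)" using si[OF s] by (simp add: T_def field_simps)
   hence n: "c - T s ~= 0" using si[OF s] z0 by simp
   have "(cmod (T s))\<^sup>2 < 1" using im[OF n] ST[OF s] s n by (simp add: zero_less_divide_iff)
   thus "T s \<in> D1" by (simp add: abs_square_less_1)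
  qed
 qed (use ST TS in auto)
qed

text \<open>An automorphism without fixed points inside has one on the circle. Sending it to
  infinity by a Cayley transform turns the map into an affine one, and affine bijections of the
  upper half plane have positive factor and real translation.\<close>

lemma disc_automorphism_halfplane:
 assumes si: "si holomorphic_on D1" "bij_betw si D1 D1" and nofix: "\<And>z. z \<in> D1 ==> si z ~= z"
 obtains S :: "complex => complex" and a b :: real where "S holomorphic_on D1" "bij_betw S D1 {s. 0 < Im s}" "0 < a"
  "\<And>z. z \<in> D1 ==> S (si z) = of_real a * S z + of_real b"
proof -
 obtain e w where e: "cmod e = 1" and w: "cmod w < 1" and eq: "\<And>z. z \<in> D1 ==> si z * (1 + cnj w * e * z) = e * z + w"
  by (rule disc_automorphism_form[OF si]) (rule that, assumption+)
 have den: "1 + cnj w * e * z ~= 0" if "cmod z <= 1" for z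
 proof
  assume "1 + cnj w * e * z = 0"
  hence "cmod (cnj w * e * z) = 1" by (simp add: add_eq_0_iff)
  moreover have "cmod w * cmod z <= cmod w * 1" using that by (intro mult_left_mono) auto
  ultimately show False using w e by (simp add: norm_mult)
 qed
 have "w ~= 0" using eq[of 0] nofix[of 0] by auto
 moreover have "cnj w * e * z\<^sup>2 + (1 - e) * z - w ~= 0" if "cmod z < 1" for z
 proof
  assume "cnj w * e * z\<^sup>2 + (1 - e) * z - w = 0"
  hence "z * (1 + cnj w * e * z) = si z * (1 + cnj w * e * z)"
   using eq[of z] that by (simp add: power2_eq_square algebra_simps)
  thus False using den[of z] nofix[of z] that by auto
 qed
 ultimately obtain ze where ze: "cmod ze = 1" and r: "cnj w * e * ze\<^sup>2 + (1 - e) * ze - w = 0"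
  using unit_fixed_point[OF e _ w] by metis
 define S where "S = (%z. \<i> * (ze + z) / (ze - z))"
 note S = cayley_disc[OF ze, folded S_def]
 define k where "k = 1 + cnj w * e * ze"
 have k0: "k ~= 0" unfolding k_def by (rule den) (simp add: ze)
 have ee: "e * cnj e = 1" "ze * cnj ze = 1" using e ze complex_norm_square[of e] complex_norm_square[of ze] by simp_all
 have k1: "e * ze + w = ze * k" using r by (simp add: k_def power2_eq_square algebra_simps)
 define d where "d = 1 - (cmod w)\<^sup>2"
 have d: "0 < d" using w by (simp add: d_def abs_square_less_1)
 have dw: "complex_of_real d = 1 - w * cnj w" unfolding d_def of_real_diff complex_norm_square by simp
 \<comment> \<open>The reciprocal of the derivative of \<open>si\<close> at its boundary fixed point
   \<open>ze\<close>.\<close>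
 define a where "a = (cmod k)\<^sup>2 / d"
 have a: "0 < a" using k0 d by (simp add: a_def)
 have kk: "k\<^sup>2 * cnj e = of_real ((cmod k)\<^sup>2)"
 proof -
  have "cnj k = (cnj e * cnj ze) * (e * ze) + w * cnj e * cnj ze" using ee by (simp add: k_def algebra_simps)
  also have "\<dots> = cnj e * cnj ze * (ze * k)" unfolding k1[symmetric] by (simp add: algebra_simps)
  also have "\<dots> = cnj e * k" using ee by (simp add: algebra_simps)
  finally show ?thesis unfolding complex_norm_square by (simp add: power2_eq_square mult_ac)
 qed
 have aff: "\<exists>c. \<forall>z\<in>D1. S (si z) = of_real a * S z + c"
 proof (intro exI ballI)
  fix z :: complex assume z: "z \<in> D1"
  define m where "m = 1 + cnj w * e * z"
  have m0: "m ~= 0" unfolding m_def by (rule den) (use z in auto)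
  have sz: "si z * m = e * z + w" using eq[OF z] by (simp add: m_def)
  define u where "u = ze - z"
  have u0: "u ~= 0" unfolding u_def by (rule S(3)[OF z])
  have "k * m * (ze - si z) = (e * ze + w) * m - k * (e * z + w)" unfolding k1 sz[symmetric] by (simp add: algebra_simps)
  also have "\<dots> = e * of_real d * u" by (simp add: k_def m_def u_def dw algebra_simps)
  finally have h: "k * m * (ze - si z) = e * of_real d * u" .
  have e0: "e ~= 0" and d0: "complex_of_real d ~= 0" using e d by auto
  have n0: "ze - si z ~= 0" using h e0 d0 u0 by auto
  have inv: "1 / (ze - si z) = cnj e * k * m / (of_real d * u)"
  proof -
   have "cnj e * k * m * (ze - si z) = (e * cnj e) * of_real d * u" using arg_cong[OF h, of "%x. cnj e * x"] by (simp add: mult_ac)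
   thus ?thesis unfolding ee using n0 d0 u0 by (simp add: field_simps)
  qed
  have Sz: "S y = \<i> * (2 * ze * (1 / (ze - y)) - 1)" if "ze - y ~= 0" for y
   using that by (simp add: S_def field_simps)
  have mk: "m = k - cnj w * e * u" by (simp add: m_def k_def u_def algebra_simps)
  have "S (si z) = \<i> * (2 * ze * (cnj e * k * k / of_real d * (1 / u) - cnj e * k * cnj w * e / of_real d) - 1)"
   unfolding Sz[OF n0] inv mk using u0 d0 by (simp add: field_simps)
  also have "cnj e * k * k = of_real ((cmod k)\<^sup>2)" using kk by (simp add: power2_eq_square mult_ac)
  also have "of_real ((cmod k)\<^sup>2) / complex_of_real d = of_real a" by (simp add: a_def)
  also have "\<i> * (2 * ze * (of_real a * (1 / u) - cnj e * k * cnj w * e / of_real d) - 1)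
   = of_real a * (\<i> * (2 * ze * (1 / u) - 1)) + (of_real a * \<i> - \<i> - \<i> * 2 * ze * (cnj e * k * cnj w * e / of_real d))"
   by (simp add: algebra_simps)
  finally show "S (si z) = of_real a * S z + (of_real a * \<i> - \<i> - \<i> * 2 * ze * (cnj e * k * cnj w * e / of_real d))"
   unfolding Sz[OF S(3)[OF z]] u_def[symmetric] .
 qed
 then obtain c where c: "\<And>z. z \<in> D1 ==> S (si z) = of_real a * S z + c" by blast
 have SH: "S ` D1 = {s. 0 < Im s}" "si ` D1 = D1" using S(2) si(2) by (simp_all add: bij_betw_def)
 have pos: "0 < a * y + Im c" if "0 < y" for y :: real
 proof -
  have "\<i> * of_real y \<in> S ` D1" unfolding SH using that by simp
  then obtain z where z: "z \<in> D1" "S z = \<i> * of_real y" by auto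
  show ?thesis using SH z(1) c[OF z(1)] z(2) by force
 qed
 \<comment> \<open>A positive imaginary part would leave points near the real axis without preimage,
   a negative one would push points out of the half plane.\<close>
 have "Im c = 0"
 proof (rule antisym)
  show "Im c <= 0"
  proof (rule ccontr)
   assume "\<not> Im c <= 0"
   hence "\<i> * of_real (Im c) \<in> S ` D1" unfolding SH by simp
   then obtain z where z: "z \<in> D1" "S z = \<i> * of_real (Im c)" by auto
   then obtain y where y: "y \<in> D1" "z = si y" using SH(2) by blast
   have "Im (\<i> * of_real (Im c)) = Im (of_real a * S y + c)" using c[OF y(1)] z(2) y(2) by simp
   hence "a * Im (S y) = 0" by simp
   moreover have "S y \<in> {s. 0 < Im s}" using SH y(1) by blast
   ultimately show False using a by simp
  qed
  show "0 <= Im c"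
  proof (rule ccontr)
   assume "\<not> 0 <= Im c"
   hence "0 < - Im c / (2 * a)" using a by (simp add: divide_neg_pos)
   from pos[OF this] show False using a \<open>\<not> 0 <= Im c\<close> by simp
  qed
 qed
 hence cr: "c = of_real (Re c)" by (simp add: complex_eq_iff)
 have "S (si z) = of_real a * S z + of_real (Re c)" if "z \<in> D1" for z
  by (subst cr[symmetric]) (rule c[OF that])
 thus ?thesis by (rule that[OF S(1,2) a])
qed

text \<open>Factor 1 is the parabolic case, where scaling alone gives a unit translation of the half
  plane. Otherwise the map is hyperbolic, and the logarithm centred at its real fixed point gives a
  unit translation of a strip. The sign \<open>e\<close> records the direction.\<close>

lemma disc_automorphism_strip:
 assumes si: "si holomorphic_on D1" "bij_betw si D1 D1" and nofix: "\<And>z. z \<in> D1 ==> si z ~= z"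
 obtains h and e :: int and Y where "h holomorphic_on D1" "bij_betw h D1 Y" "e = 1 | e = - 1"
  "\<And>z. z \<in> D1 ==> h (si z) = h z + of_int e" "Y = {y. 0 < Im y} | (\<exists>t>0. Y = {y. 0 < Im y & Im y < t})"
proof -
 obtain S a b where S: "S holomorphic_on D1" "bij_betw S D1 {s. 0 < Im s}" and a: "(0::real) < a"
  and eq: "\<And>z. z \<in> D1 ==> S (si z) = of_real a * S z + of_real b"
  by (rule disc_automorphism_halfplane[OF si nofix]) (assumption, rule that, assumption+)
 have SH: "0 < Im (S z)" if "z \<in> D1" for z using S(2) that unfolding bij_betw_def by blast
 show ?thesis
 proof (cases "a = 1")
  case True
  have b: "b ~= 0"
  proof
   assume "b = 0"
   hence "S (si 0) = S 0" using eq[of 0] True by simp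
   moreover have "si 0 \<in> D1" using si(2) unfolding bij_betw_def by (metis centre_in_ball image_eqI zero_less_one)
   ultimately have "si 0 = 0" using S(2) unfolding bij_betw_def inj_on_def by simp
   thus False using nofix[of 0] by simp
  qed
  have b0: "complex_of_real \<bar>b\<bar> ~= 0" using b by simp
  show ?thesis
  proof (rule that[of "%z. S z / of_real \<bar>b\<bar>" "{y. 0 < Im y}" "if 0 < b then 1 else - 1"])
   show "(%z. S z / of_real \<bar>b\<bar>) holomorphic_on D1" by (intro holomorphic_intros S) (use b0 in auto)
   have "bij_betw (%s. s / of_real \<bar>b\<bar>) {s. 0 < Im s} {y. 0 < Im y}"
    by (rule bij_betw_byWitness[where f' = "%y. y * of_real \<bar>b\<bar>"]) (use b in \<open>auto simp: Im_divide_of_real\<close>)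
   from bij_betw_trans[OF S(2) this] show "bij_betw (%z. S z / of_real \<bar>b\<bar>) D1 {y. 0 < Im y}" by (simp add: o_def)
   show "S (si z) / of_real \<bar>b\<bar> = S z / of_real \<bar>b\<bar> + of_int (if 0 < b then 1 else - 1)" if "z \<in> D1" for z
    unfolding eq[OF that] using True b by (auto simp: add_divide_distrib)
  qed auto
 next
  case False
  define x0 where "x0 = b / (1 - a)"
  have x0: "a * x0 + b = x0" using False by (simp add: x0_def field_simps)
  define L where "L = \<bar>ln a\<bar>"
  have L: "0 < L" using a False by (simp add: L_def)
  have L0: "complex_of_real L ~= 0" using L by simp
  have ims: "0 < Im (S z - of_real x0)" if "z \<in> D1" for z using SH[OF that] by simp
  have nn: "s \<notin> \<real>\<^sub>\<le>\<^sub>0" "s ~= 0" if "0 < Im s" for s using that by (auto simp: complex_nonpos_Reals_iff)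
  show ?thesis
  proof (rule that[of "%z. Ln (S z - of_real x0) / of_real L" "{y. 0 < Im y & Im y < pi / L}" "if 0 < ln a then 1 else - 1"])
   show "(%z. Ln (S z - of_real x0) / of_real L) holomorphic_on D1"
    by (intro holomorphic_intros S) (use L0 nn(1)[OF ims] in auto)
   have "bij_betw (%s. Ln (s - of_real x0) / of_real L) {s. 0 < Im s} {y. 0 < Im y & Im y < pi / L}"
   proof (rule bij_betw_byWitness[where f' = "%y. exp (y * of_real L) + of_real x0"])
    show "\<forall>s\<in>{s. 0 < Im s}. exp (Ln (s - of_real x0) / of_real L * of_real L) + of_real x0 = s"
     using L0 nn(2) by (auto simp: complex_eq_iff)
    have y: "0 < Im (y * of_real L)" "Im (y * of_real L) < pi" if "0 < Im y" "Im y < pi / L" for y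
     using that L by (simp_all add: field_simps)
    have "Ln (exp (y * of_real L)) = y * of_real L" if "0 < Im y" "Im y < pi / L" for y
     by (rule Ln_exp) (use y[OF that] pi_gt_zero in linarith)+
    thus "\<forall>y\<in>{y. 0 < Im y & Im y < pi / L}. Ln (exp (y * of_real L) + of_real x0 - of_real x0) / of_real L = y"
     using L0 by auto
    show "(%s. Ln (s - of_real x0) / of_real L) ` {s. 0 < Im s} \<subseteq> {y. 0 < Im y & Im y < pi / L}" using Im_Ln_pos_lt[OF nn(2)] L by (force simp: Im_divide_of_real divide_strict_right_mono)
    show "(%y. exp (y * of_real L) + of_real x0) ` {y. 0 < Im y & Im y < pi / L} \<subseteq> {s. 0 < Im s}"
     using y by (auto simp: Im_exp sin_gt_zero)
   qed
   from bij_betw_trans[OF S(2) this]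
   show "bij_betw (%z. Ln (S z - of_real x0) / of_real L) D1 {y. 0 < Im y & Im y < pi / L}" by (simp add: o_def)
   have "\<exists>t>0. {y. 0 < Im y & Im y < pi / L} = {y. 0 < Im y & Im y < t}" using L by (intro exI[of _ "pi / L"]) simp
   thus "{y. 0 < Im y & Im y < pi / L} = {y. 0 < Im y} | (\<exists>t>0. {y. 0 < Im y & Im y < pi / L} = {y. 0 < Im y & Im y < t})" by simp
   fix z :: complex assume z: "z \<in> D1"
   have "S (si z) - of_real x0 = of_real a * (S z - of_real x0)"
    unfolding eq[OF z] by (subst x0[symmetric]) (simp add: algebra_simps)
   hence "Ln (S (si z) - of_real x0) = of_real (ln a) + Ln (S z - of_real x0)"
    by (simp only: Ln_times_of_real[OF a nn(2)[OF ims[OF z]]] Ln_of_real[OF a])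
   moreover have "complex_of_real (ln a) / of_real L = of_int (if 0 < ln a then 1 else - 1)"
    using L0 by (auto simp: L_def)
   ultimately show "Ln (S (si z) - of_real x0) / of_real L = Ln (S z - of_real x0) / of_real L + of_int (if 0 < ln a then 1 else - 1)"
    by (simp add: add_divide_distrib)
  qed auto
 qed
qed

text \<open>The exponential lifts the atlas to a half plane, whose smaller half plane
  \<open>W\<close> is mapped onto the disc. The deck transformation becomes a disc automorphism and
  then a unit translation, so exponentiating once more descends to the punctured disc.
  \<open>small\<close> provides charts that fit under a branch of the logarithm.\<close>

theorem annulus_uniformization:
 assumes pa: "planar_atlas (D1 - {0}) CD"
  and small: "\<And>p V. p \<in> D1 - {0} ==> open V ==> p \<in> V ==> \<exists>c\<in>CD. c 0 = p & c ` D1 \<subseteq> V"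
 obtains f rh where "0 <= rh" "rh < 1" "bij_betw f {z. 0 < cmod z & cmod z < exp (- 1)} {w. rh < cmod w & cmod w < 1}"
  "planar_atlas.holo CD f {z. 0 < cmod z & cmod z < exp (- 1)}"
proof -
 interpret D: planar_atlas "D1 - {0}" CD by fact
 let ?B = "D1"
 define X where "X = {z::complex. Re z < 0}"
 \<comment> \<open>The lifted atlas: all continuous lifts of charts through the exponential, so that
   it is invariant under the deck translation.\<close>
 define CC where "CC = {ka. continuous_on ?B ka & inj_on ka ?B & ka ` ?B \<subseteq> X & (\<exists>c\<in>CD. \<forall>w\<in>?B. exp (ka w) = c w)}"
 have CC: "continuous_on ?B ka" "inj_on ka ?B" "ka ` ?B \<subseteq> X" "\<exists>c\<in>CD. \<forall>w\<in>?B. exp (ka w) = c w" if "ka \<in> CC" for ka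
  using that by (auto simp: CC_def)
 have chart: "\<exists>ka\<in>CC. ka 0 = p" if p: "p \<in> X" for p
 proof -
  have "exp p \<in> ?B - {0}" using p by (simp add: X_def)
  then obtain c where c: "c \<in> CD" "c 0 = exp p" "c ` ?B \<subseteq> ball (exp p) (norm (exp p))"
   using small[of "exp p" "ball (exp p) (norm (exp p))"] by auto
  have re: "c w / exp p \<notin> \<real>\<^sub>\<le>\<^sub>0" "c w ~= 0" if "w \<in> ?B" for w
  proof -
   have "dist (exp p) (c w) < norm (exp p)" using c(3) that by force
   hence "norm ((exp p - c w) / exp p) < 1" unfolding norm_divide dist_norm by simp
   hence "0 < Re (c w / exp p)" using abs_Re_le_cmod[of "1 - c w / exp p"] by (simp add: diff_divide_distrib)
   thus "c w / exp p \<notin> \<real>\<^sub>\<le>\<^sub>0" "c w ~= 0" by (auto simp: complex_nonpos_Reals_iff)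
  qed
  define ka where "ka w = p + Ln (c w / exp p)" for w
  have ek: "exp (ka w) = c w" if "w \<in> ?B" for w using re(2)[OF that] by (simp add: ka_def exp_add)
  have "continuous_on ?B ka" unfolding ka_def[abs_def]
   by (intro continuous_intros D.chart_cont[OF c(1)]) (use re in auto)
  moreover have "inj_on ka ?B" by (rule inj_onI) (metis ek inj_onD[OF D.chart_inj[OF c(1)]])
  moreover have "ka w \<in> X" if w: "w \<in> ?B" for w
  proof -
   have "cmod (exp (ka w)) < 1" using D.chart_sub[OF c(1)] w unfolding ek[OF w] by force
   thus ?thesis by (simp add: X_def)
  qed
  moreover have "\<exists>c\<in>CD. \<forall>w\<in>?B. exp (ka w) = c w" using c(1) ek by blast
  ultimately have "ka \<in> CC" unfolding CC_def by blast
  moreover have "ka 0 = p" using c(2) by (simp add: ka_def)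
  ultimately show ?thesis by blast
 qed
 interpret P: planar_atlas X CC
 proof
  show "open X" "connected X" unfolding X_def by (auto simp: open_halfspace_Re_lt intro: convex_connected convex_halfspace_Re_lt)
  fix ka k' assume k: "ka \<in> CC" "k' \<in> CC"
  let ?N = "{w \<in> ?B. ka w \<in> k' ` ?B}"
  obtain c c' where c: "c \<in> CD" "\<And>w. w \<in> ?B ==> exp (ka w) = c w" "c' \<in> CD" "\<And>w. w \<in> ?B ==> exp (k' w) = c' w"
   using CC(4)[OF k(1)] CC(4)[OF k(2)] by blast
  have eq: "inv_into ?B c' (c w) = inv_into ?B k' (ka w) & c w \<in> c' ` ?B" if w: "w \<in> ?N" for w using w c inv_into_f_f[OF D.chart_inj[OF c(3)]] inv_into_f_f[OF CC(2)[OF k(2)]] by force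
  have "(inv_into ?B c' \<circ> c) holomorphic_on ?N"
   by (rule holomorphic_on_subset[OF D.transition[OF c(1,3)]]) (use eq in blast)
  thus "(inv_into ?B k' \<circ> ka) holomorphic_on ?N" by (rule holomorphic_transform) (use eq in simp)
 qed (use CC chart in blast)+
 \<comment> \<open>Smaller than \<open>X\<close>, so that the strip between the two half planes can
   serve as the open set \<open>O'\<close> of the Green function. Its image under the exponential is
   the punctured disc of radius \<open>exp (- 1)\<close>.\<close>
 define W where "W = {z::complex. Re z < - 1}"
 have oW: "open W" "W \<subseteq> X" unfolding W_def X_def by (auto simp: open_halfspace_Re_lt)
 have "\<exists>F. P.holo F W & inj_on F W & F ` W \<subseteq> D1"
 proof (rule P.halfplane_uniformization[OF W_def oW(2), of "{z. - 1 < Re z} \<inter> {z. Re z < 0}"])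
  have "Complex (- 1 / 2) 0 \<in> {z. - 1 < Re z} \<inter> {z. Re z < 0}" by simp
  thus "{z. - 1 < Re z} \<inter> {z. Re z < 0} ~= {}" by blast
 qed (auto simp: X_def W_def intro: open_Int open_halfspace_Re_lt open_halfspace_Re_gt)
 then obtain F where F: "P.holo F W" "inj_on F W" "F ` W \<subseteq> D1" by blast
 have cF: "continuous_on W F" by (rule P.holo_cont[OF F(1) oW])
 have oFW: "open (F ` W)" by (rule invariance_of_domain[OF cF oW(1) F(2)])
 obtain G0 where "homeomorphism W (F ` W) F G0" by (rule invariance_of_domain_homeomorphism[OF oW(1) cF _ F(2)]) simp_all
 hence "W homeomorphic F ` W" unfolding homeomorphic_def by blast
 moreover have "simply_connected W" unfolding W_def by (intro convex_imp_simply_connected convex_halfspace_Re_lt)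
 ultimately have sc: "simply_connected (F ` W)" using homeomorphic_simply_connected by blast
 have nU: "F ` W ~= UNIV" using bounded_subset[OF bounded_ball F(3)] not_bounded_UNIV by metis
 have pW: "- 2 \<in> W" by (simp add: W_def)
 obtain R R' where R: "R holomorphic_on F ` W" "\<And>z. z \<in> F ` W ==> R z \<in> ?B & R' (R z) = z" "\<And>z. z \<in> ?B ==> R' z \<in> F ` W & R (R' z) = z"
  by (rule riemann_pointed[OF oFW sc nU imageI[OF pW]]) (rule that, assumption+)
 define F1 where "F1 z = R (F z)" for z
 have "bij_betw R (F ` W) ?B" by (rule bij_betw_byWitness[where f' = R']) (use R in auto)
 hence bF1: "bij_betw F1 W ?B"
  using bij_betw_trans[OF inj_on_imp_bij_betw[OF F(2)]] by (simp add: F1_def[abs_def] o_def)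
 have F1B: "F1 z \<in> ?B" if "z \<in> W" for z using bF1 that unfolding bij_betw_def by blast
 have oN: "open {w \<in> ?B. ka w \<in> W}" if "ka \<in> CC" for ka
  using continuous_open_preimage[OF CC(1)[OF that] open_ball oW(1)] by (simp add: vimage_def Int_def)
 have hF1: "(%w. F1 (ka w)) holomorphic_on {w \<in> ?B. ka w \<in> W}" if "ka \<in> CC" for ka
 proof -
  have "(F \<circ> ka) holomorphic_on {w \<in> ?B. ka w \<in> W}" using F(1) that unfolding P.holo_def by blast
  from holomorphic_on_compose_gen[OF this R(1)] show ?thesis by (auto simp: F1_def o_def)
 qed
 define t :: complex where "t = 2 * of_real pi * \<i>"
 have tW: "z + t * of_int n \<in> W \<longleftrightarrow> z \<in> W" for z n by (simp add: W_def t_def)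
 have tW1: "z + t \<in> W \<longleftrightarrow> z \<in> W" for z by (simp add: W_def t_def)
 have expt: "exp (t * of_int n) = 1" for n
  using exp_integer_2pi[of "of_int n"] by (simp add: t_def mult_ac)
 have tCC: "(%w. ka w + t) \<in> CC" if "ka \<in> CC" for ka
 proof -
  have "exp (z + t) = exp z" for z using expt[of 1] by (simp add: exp_add)
  moreover have "\<And>z. Re (z + t) = Re z" by (simp add: t_def)
  ultimately show ?thesis using that unfolding CC_def X_def by (auto intro!: continuous_intros simp: inj_on_def image_subset_iff)
 qed
 define G1 where "G1 = inv_into W F1"
 have G1: "G1 y \<in> W" "F1 (G1 y) = y" if "y \<in> ?B" for y
  using that bF1 unfolding G1_def bij_betw_def by (auto simp: inv_into_into f_inv_into_f)
 have GF1: "G1 (F1 z) = z" if "z \<in> W" for z unfolding G1_def by (rule inv_into_f_f[OF bij_betw_imp_inj_on[OF bF1] that])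
 \<comment> \<open>The deck translation by \<open>2 * pi * \<i>\<close>, transported to the
   disc.\<close>
 define S where "S y = F1 (G1 y + t)" for y
 have bs: "bij_betw S ?B ?B"
 proof (rule bij_betw_byWitness[where f' = "%y. F1 (G1 y - t)"])
  have m: "z - t \<in> W" if "z \<in> W" for z using that by (simp add: W_def t_def)
  show "\<forall>y\<in>?B. F1 (G1 (S y) - t) = y" using GF1 G1 tW1 by (simp add: S_def)
  show "\<forall>y\<in>?B. S (F1 (G1 y - t)) = y" using GF1[OF m] G1 by (simp add: S_def)
  show "S ` ?B \<subseteq> ?B" "(%y. F1 (G1 y - t)) ` ?B \<subseteq> ?B" using F1B G1(1) tW1 m unfolding S_def by blast+
 qed
 have hsi: "S holomorphic_on ?B" unfolding holomorphic_on_def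
 proof
  fix y assume y: "y \<in> ?B"
  have "G1 y \<in> X" using G1(1)[OF y] oW(2) by blast
  from chart[OF this] obtain ka where ka: "ka \<in> CC" "ka 0 = G1 y" by blast
  define N where "N = {w \<in> ?B. ka w \<in> W}"
  have N: "open N" "0 \<in> N" using oN[OF ka(1)] ka(2) G1(1)[OF y] by (auto simp: N_def)
  let ?k = "%w. F1 (ka w)"
  have hk: "?k holomorphic_on N" unfolding N_def by (rule hF1[OF ka(1)])
  have ik: "inj_on ?k N"
  proof (rule inj_onI)
   fix v w assume vw: "v \<in> N" "w \<in> N" "F1 (ka v) = F1 (ka w)"
   hence "ka v = ka w" using inj_onD[OF bij_betw_imp_inj_on[OF bF1] vw(3)] by (simp add: N_def)
   thus "v = w" by (rule inj_onD[OF CC(2)[OF ka(1)]]) (use vw in \<open>simp_all add: N_def\<close>)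
  qed
  obtain g where g: "g holomorphic_on (?k ` N)" "\<And>w. w \<in> N ==> g (?k w) = w"
   by (rule holomorphic_has_inverse[OF hk N(1) ik]) (rule that, assumption+)
  have oi: "open (?k ` N)" by (rule open_mapping_thm3[OF hk N(1) ik])
  have h2: "(%w. F1 (ka w + t)) holomorphic_on N" using hF1[OF tCC[OF ka(1)]] by (simp add: N_def tW1)
  have "((%w. F1 (ka w + t)) \<circ> g) holomorphic_on (?k ` N)"
   by (rule holomorphic_on_compose_gen[OF g(1) h2]) (use g(2) in auto)
  hence hs: "S holomorphic_on (?k ` N)"
   by (rule holomorphic_transform) (use g(2) GF1 in \<open>auto simp: S_def N_def\<close>)
  have "y \<in> ?k ` N" using N(2) ka(2) G1(2)[OF y] by force
  thus "S field_differentiable at y within ?B"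
   by (rule field_differentiable_at_within[OF holomorphic_on_imp_differentiable_at[OF hs oi]])
 qed
 have nofix: "S y ~= y" if y: "y \<in> ?B" for y using GF1 G1(1)[OF y] tW1 by (force simp: S_def t_def)
 obtain h Y and e :: int where h: "h holomorphic_on ?B" "bij_betw h ?B Y" and e: "e = 1 | e = - 1"
  and hsi: "\<And>z. z \<in> ?B ==> h (S z) = h z + of_int e" and Y: "Y = {y. 0 < Im y} | (\<exists>ta>0. Y = {y. 0 < Im y & Im y < ta})"
  by (rule disc_automorphism_strip[OF hsi bs nofix]) (assumption, rule that, assumption+)
 define H where "H z = h (F1 z)" for z
 have bH: "bij_betw H W Y" using bij_betw_trans[OF bF1 h(2)] by (simp add: H_def[abs_def] o_def)
 have H1: "H (z + t) = H z + of_int e" if "z \<in> W" for z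
  using hsi[OF F1B[OF that]] GF1[OF that] by (simp add: H_def S_def)
 have Hnat: "H (z + t * of_nat n) = H z + of_nat n * of_int e" if "z \<in> W" for z n
 proof (induction n)
  case (Suc n)
  have "z + t * of_nat n \<in> W" using that tW[of z "int n"] by simp
  from H1[OF this] show ?case using Suc by (simp add: algebra_simps)
 qed simp
 have Hint: "H (z + t * of_int n) = H z + of_int (n * e)" if z: "z \<in> W" for z n
 proof (cases "0 <= n")
  case True
  thus ?thesis using Hnat[OF z, of "nat n"] by simp
 next
  case False
  hence n: "(of_nat (nat (- n)) :: complex) = - of_int n" by simp
  have "z + t * of_int n \<in> W" using z tW by simp
  from Hnat[OF this, of "nat (- n)"] show ?thesis unfolding n by (simp add: algebra_simps)
 qed
 define A where "A = {z. 0 < cmod z & cmod z < exp (- 1)}"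
 have LA: "Ln x \<in> W" "exp (Ln x) = x" if "x \<in> A" for x using that ln_less_cancel_iff[of "cmod x" "exp (- 1)"] by (auto simp: A_def W_def)
 have eA: "exp z \<in> A" if "z \<in> W" for z using that by (simp add: A_def W_def)
 \<comment> \<open>Independent of the branch of \<open>Ln\<close>: a deck translation changes
   \<open>H\<close> by an integer, which the factor \<open>t\<close> makes a period of
   \<open>exp\<close>.\<close>
 define f where "f x = exp (t * H (Ln x))" for x
 have fe: "f (exp z) = exp (t * H z)" if z: "z \<in> W" for z
 proof -
  have "exp (Ln (exp z)) = exp z" by simp
  then obtain n :: int where "Ln (exp z) = z + of_int (2 * n) * pi * \<i>" unfolding exp_eq by blast
  hence "Ln (exp z) = z + t * of_int n" by (simp add: t_def mult_ac)
  hence "f (exp z) = exp (t * H z) * exp (t * of_int (n * e))"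
   unfolding f_def by (simp only: Hint[OF z] distrib_left exp_add)
  thus ?thesis by (simp only: expt mult_1_right)
 qed
 \<comment> \<open>The inner radius: 0 if \<open>Y\<close> is a half plane, and determined by the
   height of the strip otherwise.\<close>
 define rh where "rh = (if Y = {y. 0 < Im y} then 0 else exp (- 2 * pi * (SOME ta. 0 < ta & Y = {y. 0 < Im y & Im y < ta})))"
 have rh: "0 <= rh" "rh < 1" and Yr: "y \<in> Y \<longleftrightarrow> rh < exp (- 2 * pi * Im y) & exp (- 2 * pi * Im y) < 1" for y
 proof -
  have "0 <= rh & rh < 1 & (\<forall>y. y \<in> Y \<longleftrightarrow> rh < exp (- 2 * pi * Im y) & exp (- 2 * pi * Im y) < 1)"
  proof (cases "Y = {y. 0 < Im y}")
   case True
   thus ?thesis by (simp add: rh_def zero_less_mult_iff)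
  next
   case False
   define ta where "ta = (SOME ta. 0 < ta & Y = {y. 0 < Im y & Im y < ta})"
   have ta: "0 < ta & Y = {y. 0 < Im y & Im y < ta}" unfolding ta_def by (rule someI_ex) (use Y False in blast)
   have r: "rh = exp (- 2 * pi * ta)" using False by (simp add: rh_def ta_def)
   show ?thesis using ta unfolding r by (auto simp: zero_less_mult_iff)
  qed
  thus "0 <= rh" "rh < 1" "y \<in> Y \<longleftrightarrow> rh < exp (- 2 * pi * Im y) & exp (- 2 * pi * Im y) < 1" by blast+
 qed
 have nt: "cmod (exp (t * y)) = exp (- 2 * pi * Im y)" for y by (simp add: t_def)
 show ?thesis
 proof (rule that[OF rh])
  show "bij_betw f {z. 0 < cmod z & cmod z < exp (- 1)} {w. rh < cmod w & cmod w < 1}"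
   unfolding A_def[symmetric] bij_betw_def
  proof (intro conjI subset_antisym subsetI)
   show "inj_on f A"
   proof (rule inj_onI)
    fix x x' assume x: "x \<in> A" "x' \<in> A" "f x = f x'"
    hence "exp (t * H (Ln x)) = exp (t * H (Ln x'))" by (simp add: f_def)
    then obtain n :: int where "t * H (Ln x) = t * H (Ln x') + of_int (2 * n) * pi * \<i>" unfolding exp_eq by blast
    hence "t * H (Ln x) = t * (H (Ln x') + of_int n)" by (simp add: t_def algebra_simps)
    moreover have "t ~= 0" by (simp add: t_def)
    ultimately have "H (Ln x) = H (Ln x') + of_int n" by simp
    also have "\<dots> = H (Ln x' + t * of_int (n * e))" unfolding Hint[OF LA(1)[OF x(2)]] using e by auto
    finally have "Ln x = Ln x' + t * of_int (n * e)"
     using inj_onD[OF bij_betw_imp_inj_on[OF bH]] LA(1) x tW by blast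
    hence "exp (Ln x) = exp (Ln x') * exp (t * of_int (n * e))" by (simp only: exp_add)
    thus "x = x'" using LA(2) x by (simp only: expt mult_1_right)
   qed
   fix w assume "w \<in> f ` A"
   then obtain x where x: "x \<in> A" "w = exp (t * H (Ln x))" by (auto simp: f_def)
   have "H (Ln x) \<in> Y" using bH LA(1)[OF x(1)] unfolding bij_betw_def by blast
   thus "w \<in> {w. rh < cmod w & cmod w < 1}" unfolding x(2) mem_Collect_eq nt Yr .
  next
   fix w assume w: "w \<in> {w. rh < cmod w & cmod w < 1}"
   hence w0: "w ~= 0" using rh by auto
   have ew: "exp (t * (Ln w / t)) = w" using w0 by (simp add: t_def)
   hence "cmod w = exp (- 2 * pi * Im (Ln w / t))" using nt[of "Ln w / t"] by simp
   hence "Ln w / t \<in> Y" unfolding Yr using w by simp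
   then obtain z where z: "z \<in> W" "H z = Ln w / t" using bH unfolding bij_betw_def by (metis imageE)
   hence "f (exp z) = w" unfolding fe[OF z(1)] using ew by simp
   thus "w \<in> f ` A" using eA[OF z(1)] by blast
  qed
  show "D.holo f {z. 0 < cmod z & cmod z < exp (- 1)}" unfolding A_def[symmetric]
  proof (rule D.holoI)
   fix p assume p: "p \<in> A"
   have "Ln p \<in> X" using LA(1)[OF p] oW(2) by blast
   from chart[OF this] obtain ka where ka: "ka \<in> CC" "ka 0 = Ln p" by blast
   obtain c where c: "c \<in> CD" "\<And>w. w \<in> ?B ==> exp (ka w) = c w" using CC(4)[OF ka(1)] by blast
   define N where "N = {w \<in> ?B. ka w \<in> W}"
   have N: "open N" "0 \<in> N" "N \<subseteq> ?B" using oN[OF ka(1)] ka(2) LA(1)[OF p] by (auto simp: N_def)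
   have "(%w. h (F1 (ka w))) holomorphic_on N"
    using holomorphic_on_compose_gen[OF hF1[OF ka(1)] h(1)] F1B by (force simp: o_def N_def)
   hence "(%w. exp (t * h (F1 (ka w)))) holomorphic_on N" by (intro holomorphic_intros)
   moreover have "exp (t * h (F1 (ka w))) = (f \<circ> c) w" if "w \<in> N" for w
    using fe[of "ka w"] c(2)[of w] that by (simp add: N_def H_def)
   ultimately have "(f \<circ> c) holomorphic_on N" by (rule holomorphic_transform)
   moreover have "p \<in> c ` N" using c(2)[of 0] ka(2) LA(2)[OF p] N(2) by force
   ultimately show "\<exists>ka\<in>CD. \<exists>U. open U & U \<subseteq> ?B & p \<in> ka ` U & (f \<circ> ka) holomorphic_on U"
    using c(1) N by blast
  qed
 qed
qed

section \<open>The end at the singularity\<close>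

lemma hausdorff1_mono: "X \<subseteq> Y ==> hausdorff1 X <= hausdorff1 Y"
 unfolding hausdorff1_def by (intro SUP_mono' INF_superset_mono) auto

lemma bilipschitz_at:
 fixes G :: "complex => 'a::real_normed_vector"
 assumes N: "open N" "z0 \<in> N" and d: "\<And>z. z \<in> N ==> (G has_derivative D z) (at z)"
  and c: "continuous_on N (%z. D z 1)" "continuous_on N (%z. D z \<i>)" and l: "0 < l" "\<And>h. norm (D z0 h) = l * cmod h"
 obtains e where "0 < e" "ball z0 e \<subseteq> N"
  "\<And>x y. x \<in> ball z0 e ==> y \<in> ball z0 e ==> 2/3 * l * dist x y <= dist (G x) (G y) & dist (G x) (G y) <= 4/3 * l * dist x y"
proof -
 have e6: "0 < l / 6" using l by simp
 obtain e1 where e1: "0 < e1" "ball z0 e1 \<subseteq> N" using openE[OF N] .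
 obtain e2 where e2: "0 < e2" "\<And>z. z \<in> N ==> dist z z0 < e2 ==> dist (D z 1) (D z0 1) < l / 6"
  using c(1) N(2) e6 unfolding continuous_on_iff by metis
 obtain e3 where e3: "0 < e3" "\<And>z. z \<in> N ==> dist z z0 < e3 ==> dist (D z \<i>) (D z0 \<i>) < l / 6"
  using c(2) N(2) e6 unfolding continuous_on_iff by metis
 define e where "e = min e1 (min e2 e3)"
 have eN: "ball z0 e \<subseteq> N" using e1(2) by (auto simp: e_def)
 have bd: "norm (D z h - D z0 h) <= l / 3 * norm h" if z: "z \<in> ball z0 e" for z h
 proof -
  have zN: "z \<in> N" using z eN by blast
  have dz: "dist z z0 < e2" "dist z z0 < e3" using z by (auto simp: e_def dist_commute)
  have lin: "D w h = Re h *\<^sub>R D w 1 + Im h *\<^sub>R D w \<i>" if "w \<in> N" for w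
  proof -
   have "h = Re h *\<^sub>R 1 + Im h *\<^sub>R \<i>" by (simp add: complex_eq_iff)
   hence "D w h = D w (Re h *\<^sub>R 1 + Im h *\<^sub>R \<i>)" by (rule arg_cong)
   thus ?thesis using has_derivative_linear[OF d[OF that]] by (simp only: linear_add linear_scale)
  qed
  have "D z h - D z0 h = Re h *\<^sub>R (D z 1 - D z0 1) + Im h *\<^sub>R (D z \<i> - D z0 \<i>)"
   unfolding lin[OF zN] lin[OF N(2)] by (simp add: scaleR_diff_right)
  also have "norm \<dots> <= \<bar>Re h\<bar> * norm (D z 1 - D z0 1) + \<bar>Im h\<bar> * norm (D z \<i> - D z0 \<i>)"
   by (rule order_trans[OF norm_triangle_ineq]) simp
  also have "\<dots> <= cmod h * (l / 6) + cmod h * (l / 6)"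
   using e2(2)[OF zN dz(1)] e3(2)[OF zN dz(2)]
   by (intro add_mono mult_mono) (auto simp: dist_norm abs_Re_le_cmod abs_Im_le_cmod)
  finally show ?thesis by simp
 qed
 show ?thesis
 proof (rule that[OF _ eN])
  show "0 < e" using e1 e2 e3 by (simp add: e_def)
  fix x y assume xy: "x \<in> ball z0 e" "y \<in> ball z0 e"
  have bl: "bounded_linear (D z0)" using d[OF N(2)] has_derivative_bounded_linear by blast
  have "norm ((G x - D z0 x) - (G y - D z0 y)) <= l / 3 * norm (x - y)"
  proof (rule differentiable_bound[OF convex_ball, of z0 e "%z. G z - D z0 z" "%z h. D z h - D z0 h"])
   fix z assume z: "z \<in> ball z0 e"
   hence zN: "z \<in> N" using eN by blast
   show "((%z. G z - D z0 z) has_derivative (%h. D z h - D z0 h)) (at z within ball z0 e)"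
    by (rule has_derivative_at_withinI[OF has_derivative_diff[OF d[OF zN] bounded_linear_imp_has_derivative[OF bl]]])
   show "onorm (%h. D z h - D z0 h) <= l / 3" by (rule onorm_le[OF bd[OF z]])
  qed (use xy in auto)
  moreover have "(G x - D z0 x) - (G y - D z0 y) = (G x - G y) - D z0 (x - y)"
   using linear_diff[OF bounded_linear.linear[OF bl], of x y] by simp
  ultimately have "norm ((G x - G y) - D z0 (x - y)) <= l / 3 * norm (x - y)" by simp
  thus "2/3 * l * dist x y <= dist (G x) (G y) & dist (G x) (G y) <= 4/3 * l * dist x y"
   using norm_triangle_ineq2[of "D z0 (x - y)" "G x - G y"] norm_triangle_ineq2[of "G x - G y" "D z0 (x - y)"] l(2)[of "x - y"]
   unfolding dist_norm by (simp add: norm_minus_commute)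
 qed
qed

lemma punctured_disc_connected: "connected {z::complex. 0 < cmod z & cmod z < a}"
proof -
 have "{z::complex. 0 < cmod z & cmod z < a} = ball 0 a - {0}" by auto
 thus ?thesis using connected_punctured_ball[of "0::complex" a] by simp
qed

lemma connected_image_avoids:
 fixes u :: "'a::topological_space => real"
 assumes "connected S" "continuous_on S u" and c: "\<And>x. x \<in> S ==> u x ~= c"
 shows "(\<forall>x\<in>S. u x < c) | (\<forall>x\<in>S. c < u x)"
proof (rule ccontr)
 assume "\<not> ?thesis"
 then obtain x y where xy: "x \<in> S" "y \<in> S" "u x <= c" "c <= u y" by (meson not_less)
 have "c \<in> u ` S"
  by (rule connectedD_interval[OF connected_continuous_image[OF assms(2,1)] imageI[OF xy(1)] imageI[OF xy(2)] xy(3,4)])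
 thus False using c by blast
qed

text \<open>The preimage of a compact subannulus is compact and stays away from 0, so near 0 the
  values leave every such subannulus. A small punctured disc is connected, so they all leave towards
  the same boundary circle.\<close>

lemma punctured_end:
 fixes f g :: "complex => complex"
 assumes a: "0 < a" and r: "r < 1" "0 <= r" and A: "A = {z. 0 < cmod z & cmod z < a}" and R: "R = {w. r < cmod w & cmod w < 1}"
  and h: "homeomorphism A R f g"
 shows "(\<forall>s<1. \<exists>e>0. \<forall>z. 0 < cmod z & cmod z < e --> s < cmod (f z)) |
  (\<forall>s>r. \<exists>e>0. \<forall>z. 0 < cmod z & cmod z < e --> z \<in> A & cmod (f z) < s)"
proof -
 note fg = homeomorphism_apply1[OF h] homeomorphism_apply2[OF h] and im = homeomorphism_image1[OF h] homeomorphism_image2[OF h]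
  and cont = homeomorphism_cont1[OF h] homeomorphism_cont2[OF h]
 have away: "\<exists>e>0. e <= a & (\<forall>z. 0 < cmod z & cmod z < e --> cmod (f z) < s1 | s2 < cmod (f z))" if s: "r < s1" "s1 <= s2" "s2 < 1" for s1 s2
 proof -
  define K where "K = {w::complex. s1 <= cmod w & cmod w <= s2}"
  have "K = cball 0 s2 - ball 0 s1" by (auto simp: K_def)
  hence cK: "compact K" by (simp add: compact_diff)
  have KR: "K \<subseteq> R" using s by (auto simp: K_def R)
  have "compact (g ` K)" by (rule compact_continuous_image[OF continuous_on_subset[OF cont(2) KR] cK])
  hence "open (- g ` K)" by (simp add: compact_imp_closed open_Compl)
  moreover have "0 \<in> - g ` K" using im(2) KR by (auto simp: A)
  ultimately obtain e where e: "0 < e" "ball 0 e \<subseteq> - g ` K" by (rule openE)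
  show ?thesis
  proof (intro exI[of _ "min e a"] conjI allI impI)
   fix z assume z: "0 < cmod z & cmod z < min e a"
   hence zA: "z \<in> A" by (simp add: A)
   have "f z \<notin> K" using e(2) z fg(1)[OF zA] by force
   thus "cmod (f z) < s1 | s2 < cmod (f z)" by (auto simp: K_def)
  qed (use e(1) a in auto)
 qed
 define s0 where "s0 = (r + 1) / 2"
 have s0: "r < s0" "s0 < 1" using r by (simp_all add: s0_def)
 obtain e0 where e0: "0 < e0" "e0 <= a" "\<And>z. 0 < cmod z & cmod z < e0 ==> cmod (f z) < s0 | s0 < cmod (f z)"
  using away[OF s0(1) order_refl s0(2)] by blast
 let ?P = "{z::complex. 0 < cmod z & cmod z < e0}"
 have PA: "?P \<subseteq> A" using e0(2) by (auto simp: A)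
 have "cmod (f z) ~= s0" if "z \<in> ?P" for z using e0(3)[of z] that by auto
 hence side: "(\<forall>z\<in>?P. cmod (f z) < s0) | (\<forall>z\<in>?P. s0 < cmod (f z))"
  by (rule connected_image_avoids[OF punctured_disc_connected continuous_on_norm[OF continuous_on_subset[OF cont(1) PA]]])
 thus ?thesis
 proof
  assume lt: "\<forall>z\<in>?P. cmod (f z) < s0"
  have "\<exists>e>0. \<forall>z. 0 < cmod z & cmod z < e --> z \<in> A & cmod (f z) < s" if sr: "r < s" for s
  proof -
   obtain e where e: "0 < e" "\<And>z. 0 < cmod z & cmod z < e ==> cmod (f z) < min s s0 | s0 < cmod (f z)"
    using away[of "min s s0" s0] s0 sr by auto
   have "z \<in> A & cmod (f z) < s" if z: "0 < cmod z & cmod z < min e e0" for z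
    using e(2)[of z] lt PA z by fastforce
   thus ?thesis using e(1) e0(1) by (intro exI[of _ "min e e0"]) auto
  qed
  thus ?thesis by blast
 next
  assume gt: "\<forall>z\<in>?P. s0 < cmod (f z)"
  have "\<exists>e>0. \<forall>z. 0 < cmod z & cmod z < e --> s < cmod (f z)" if sr: "s < 1" for s
  proof -
   obtain e where e: "0 < e" "\<And>z. 0 < cmod z & cmod z < e ==> cmod (f z) < s0 | max s s0 < cmod (f z)"
    using away[of s0 "max s s0"] s0 sr by auto
   have "s < cmod (f z)" if z: "0 < cmod z & cmod z < min e e0" for z
    using e(2)[of z] gt z by fastforce
   thus ?thesis using e(1) e0(1) by (intro exI[of _ "min e e0"]) auto
  qed
  thus ?thesis by blast
 qed
qed

text \<open>Let \<open>s\<close> be the largest modulus on the image of a small circle around 0. The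
  ring beyond \<open>s\<close> is connected and its preimage avoids that circle; as it contains
  points near 0, it lies entirely within the circle.\<close>

lemma punctured_end_inverse:
 fixes f g :: "complex => complex"
 assumes a: "0 < a" and r: "r < 1" "0 <= r" and A: "A = {z. 0 < cmod z & cmod z < a}" and R: "R = {w. r < cmod w & cmod w < 1}"
  and h: "homeomorphism A R f g" and e: "\<And>s. s < 1 ==> \<exists>ep>0. \<forall>z. 0 < cmod z & cmod z < ep --> s < cmod (f z)" and T: "0 < T"
 obtains s where "r <= s" "s < 1" "\<And>w. s < cmod w ==> cmod w < 1 ==> cmod (g w) < T"
proof -
 note fg = homeomorphism_apply1[OF h] homeomorphism_apply2[OF h] and im = homeomorphism_image1[OF h] homeomorphism_image2[OF h]
  and cont = homeomorphism_cont1[OF h] homeomorphism_cont2[OF h]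
 define ep where "ep = min T a / 2"
 have ep: "0 < ep" "ep < T" "ep < a" using T a by (auto simp: ep_def min_def)
 have SA: "sphere 0 ep \<subseteq> A" using ep by (auto simp: A)
 have ne: "sphere 0 ep ~= ({} :: complex set)" using ep(1) by simp
 obtain z1 where z1: "z1 \<in> sphere 0 ep" "\<And>z. z \<in> sphere 0 ep ==> cmod (f z) <= cmod (f z1)"
  using continuous_attains_sup[OF compact_sphere ne continuous_on_norm[OF continuous_on_subset[OF cont(1) SA]]] by blast
 define s where "s = cmod (f z1)"
 have "f z1 \<in> R" using im(1) SA z1(1) by blast
 hence s: "r <= s" "s < 1" by (auto simp: s_def R)
 let ?V = "{w::complex. s < cmod w & cmod w < 1}"
 have VR: "?V \<subseteq> R" using s by (auto simp: R)
 have cV: "connected ?V" using connected_annulus(1)[of s "0::complex" 1] by simp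
 have ns: "cmod (g w) ~= ep" if "w \<in> ?V" for w using z1(2)[of "g w"] fg(2)[of w] VR that by (auto simp: s_def)
 have ex: "\<exists>w\<in>?V. cmod (g w) < ep"
 proof -
  obtain d where d: "0 < d" "\<forall>z. 0 < cmod z & cmod z < d --> s < cmod (f z)" using e[OF s(2)] by blast
  define z :: complex where "z = of_real (min d ep / 2)"
  have z: "0 < cmod z" "cmod z < d" "cmod z < ep" using d(1) ep(1) by (auto simp: z_def min_def)
  hence zA: "z \<in> A" using ep by (simp add: A)
  hence "f z \<in> R" using im(1) by blast
  thus ?thesis using d(2) z fg(1)[OF zA] by (auto simp: R)
 qed
 have "(\<forall>w\<in>?V. cmod (g w) < ep) | (\<forall>w\<in>?V. ep < cmod (g w))"
  by (rule connected_image_avoids[OF cV continuous_on_norm[OF continuous_on_subset[OF cont(2) VR]] ns])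
 thus ?thesis using ex that[OF s] ep(2) by force
qed

text \<open>If 0 went to the unit circle, the logarithmic coordinate would turn a sector near that
  circle into a rectangle over a real interval on which the position vector tends to 0 at the base.
  This is what \<open>no_length_area_collapse\<close> rules out.\<close>

lemma end_not_circle:
 fixes P :: "complex => 'a::euclidean_space"
 assumes pa: "planar_atlas (D1 - {0}) CD"
  and P: "inj_on P D1" "continuous_on D1 P" "P 0 = 0" "P ` D1 \<subseteq> E"
  and conf: "\<And>c. c \<in> CD ==> \<exists>e>0. \<exists>s>0. \<forall>x\<in>ball 0 e. \<forall>y\<in>ball 0 e.
   2/3 * s * dist x y <= dist (P (c x)) (P (c y)) & dist (P (c x)) (P (c y)) <= 4/3 * s * dist x y"
  and r0: "0 < r0" and len: "\<And>t. 0 < t ==> t <= r0 ==> hausdorff1 (sphere 0 t \<inter> E) <= ennreal (C * t)"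
  and a: "0 < a" "a < 1" and r: "r < 1" "0 <= r" and A: "A = {z. 0 < cmod z & cmod z < a}" and R: "R = {w. r < cmod w & cmod w < 1}"
  and f: "planar_atlas.holo CD f A" and h: "homeomorphism A R f g"
  and e: "\<And>s. s < 1 ==> \<exists>ep>0. \<forall>z. 0 < cmod z & cmod z < ep --> s < cmod (f z)"
 shows False
proof -
 interpret D: planar_atlas "D1 - {0}" CD by fact
 let ?B = "D1"
 note fg = homeomorphism_apply1[OF h] homeomorphism_apply2[OF h] and im = homeomorphism_image1[OF h] homeomorphism_image2[OF h]
  and cont = homeomorphism_cont1[OF h] homeomorphism_cont2[OF h]
 have AD: "A \<subseteq> ?B - {0}" using a by (auto simp: A)
 have oA: "open A"
 proof -
  have "A = ball 0 a - {0}" by (auto simp: A)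
  thus ?thesis by (simp add: open_delete)
 qed
 \<comment> \<open>Height of the rectangle: up to it \<open>exp (- Im z)\<close> stays above the
   inner radius \<open>r\<close>.\<close>
 define b where "b = (if r = 0 then 1 else - ln r / 2)"
 have b: "0 < b" using r by (auto simp: b_def)
 have br: "r < exp (- y)" if "y <= b" for y
 proof (cases "r = 0")
  case False
  have "0 < r" "ln r < 0" using r False by auto
  moreover have "y <= - ln r / 2" using that False by (simp add: b_def)
  ultimately have "ln r < - y" by linarith
  hence "exp (ln r) < exp (- y)" by (simp only: exp_less_cancel_iff)
  thus ?thesis using \<open>0 < r\<close> by simp
 qed simp
 define B where "B = {z::complex. 0 <= Re z & Re z <= 1 & 0 < Im z & Im z <= b}"
 define E1 where "E1 z = exp (\<i> * z)" for z
 have nE: "cmod (E1 z) = exp (- Im z)" for z by (simp add: E1_def)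
 have BR: "E1 z \<in> R" if "z \<in> B" for z using that br[of "Im z"] by (simp add: R nE B_def)
 have injE: "z = z'" if zz: "E1 z = E1 z'" "\<bar>Re z - Re z'\<bar> < 2 * pi" for z z'
 proof -
  obtain n :: int where "\<i> * z = \<i> * z' + of_int (2 * n) * pi * \<i>" using zz(1) unfolding E1_def exp_eq by blast
  hence "\<i> * z = \<i> * (z' + of_int n * (2 * of_real pi))" by (simp add: algebra_simps)
  hence n: "z = z' + of_int n * (2 * of_real pi)" by simp
  hence "Re z - Re z' = of_int n * (2 * pi)" by simp
  hence "\<bar>of_int n :: real\<bar> < 1" using zz(2) by (simp add: abs_mult)
  thus ?thesis using n by simp
 qed
 \<comment> \<open>The rectangle has width 1, below the period \<open>2 * pi\<close> of
   \<open>E1\<close>, so this parametrization of a sector is injective.\<close>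
 define G where "G z = P (g (E1 z))" for z
 have gA: "g w \<in> A" if "w \<in> R" for w using im(2) that by blast
 have pig: "1 < 2 * pi" using pi_gt3 by simp
 show False
 proof (rule no_length_area_collapse[of b B G r0 C])
  show "0 < b" by fact
  show "B = {z. 0 <= Re z & Re z <= 1 & 0 < Im z & Im z <= b}" by (rule B_def)
  show "inj_on G B"
  proof (rule inj_onI)
   fix z z' assume z: "z \<in> B" "z' \<in> B" "G z = G z'"
   have "g (E1 z) = g (E1 z')"
    by (rule inj_onD[OF P(1) z(3)[unfolded G_def]]) (use gA[OF BR[OF z(1)]] gA[OF BR[OF z(2)]] AD in blast)+
   hence "f (g (E1 z)) = f (g (E1 z'))" by (rule arg_cong)
   hence "E1 z = E1 z'" by (simp only: fg(2)[OF BR[OF z(1)]] fg(2)[OF BR[OF z(2)]])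
   moreover have "\<bar>Re z - Re z'\<bar> <= 1" using z(1,2) unfolding B_def mem_Collect_eq by linarith
   hence "\<bar>Re z - Re z'\<bar> < 2 * pi" using pig by linarith
   ultimately show "z = z'" by (rule injE)
  qed
  show "G z ~= 0" if "z \<in> B" for z using P(3) gA[OF BR[OF that]] AD inj_onD[OF P(1), of "g (E1 z)" 0] by (auto simp: G_def)
  show "\<exists>y0>0. \<forall>z\<in>B. Im z <= y0 --> norm (G z) < T" if T: "0 < T" for T
  proof -
   obtain d where d: "0 < d" "\<And>z. z \<in> ?B ==> dist z 0 < d ==> dist (P z) (P 0) < T"
    using P(2) T unfolding continuous_on_iff by (metis centre_in_ball zero_less_one)
   obtain s where s: "r <= s" "s < 1" "\<And>w. s < cmod w ==> cmod w < 1 ==> cmod (g w) < d"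
    by (rule punctured_end_inverse[OF a(1) r A R h e d(1)]) (assumption, rule that, assumption+)
   define s' where "s' = (s + 1) / 2"
   have s': "0 < s'" "s < s'" "s' < 1" using s r by (auto simp: s'_def)
   show ?thesis
   proof (intro exI[of _ "- ln s'"] conjI ballI impI)
    show "0 < - ln s'" using s' by simp
    fix z assume z: "z \<in> B" "Im z <= - ln s'"
    have "exp (ln s') <= exp (- Im z)" using z(2) by (subst exp_le_cancel_iff) simp
    hence "s < cmod (E1 z)" using s' by (simp add: nE)
    moreover have "cmod (E1 z) < 1" using BR[OF z(1)] by (simp add: R)
    ultimately have "cmod (g (E1 z)) < d" by (rule s(3))
    thus "norm (G z) < T" using d(2)[of "g (E1 z)"] gA[OF BR[OF z(1)]] AD P(3) by (auto simp: G_def)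
   qed
  qed
  show "0 < r0" by fact
  show "hausdorff1 (sphere 0 t \<inter> G ` B) <= ennreal (C * t)" if "0 < t" "t <= r0" for t
  proof (rule order_trans[OF hausdorff1_mono len[OF that]])
   show "sphere 0 t \<inter> G ` B \<subseteq> sphere 0 t \<inter> E" using gA[OF BR] AD P(4) unfolding G_def by blast
  qed
  fix z0 assume z0: "z0 \<in> B"
  have pA: "g (E1 z0) \<in> A" by (rule gA[OF BR[OF z0]])
  hence "g (E1 z0) \<in> ?B - {0}" using AD by blast
  from D.chart_at[OF this] obtain c where c: "c \<in> CD" "c 0 = g (E1 z0)" by blast
  define N where "N = {w \<in> ?B. c w \<in> A}"
  have N: "open N" "0 \<in> N" using continuous_open_preimage[OF D.chart_cont[OF c(1)] open_ball oA] c(2) pA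
   by (simp_all add: N_def vimage_def Int_def)
  define k where "k w = f (c w)" for w
  have hk: "k holomorphic_on N" using f c(1) unfolding D.holo_def by (auto simp: o_def k_def[abs_def] N_def)
  have ik: "inj_on k N"
  proof (rule inj_onI)
   fix v w assume vw: "v \<in> N" "w \<in> N" "k v = k w"
   have m: "c v \<in> A" "c w \<in> A" using vw by (simp_all add: N_def)
   have "g (k v) = g (k w)" using vw(3) by (rule arg_cong)
   hence "c v = c w" by (simp only: k_def fg(1)[OF m(1)] fg(1)[OF m(2)])
   thus "v = w" by (rule inj_onD[OF D.chart_inj[OF c(1)]]) (use vw in \<open>simp_all add: N_def\<close>)
  qed
  obtain k' where k': "k' holomorphic_on (k ` N)" "\<And>w. w \<in> N ==> k' (k w) = w"
   by (rule holomorphic_has_inverse[OF hk N(1) ik]) (rule that, assumption+)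
  have oi: "open (k ` N)" by (rule open_mapping_thm3[OF hk N(1) ik])
  have k0: "k 0 = E1 z0" unfolding k_def c(2) by (rule fg(2)[OF BR[OF z0]])
  define M where "M = {z \<in> ball z0 1. E1 z \<in> k ` N}"
  have cE: "continuous_on (ball z0 1) E1" unfolding E1_def[abs_def] by (intro continuous_intros)
  have M: "open M" "z0 \<in> M"
  proof -
   show "open M" using continuous_open_preimage[OF cE open_ball oi] by (simp add: M_def vimage_def Int_def)
   show "z0 \<in> M" using N(2) by (force simp: M_def k0)
  qed
  define H where "H z = k' (E1 z)" for z
  have hN: "H z \<in> N" "k (H z) = E1 z" if "z \<in> M" for z
   using that k'(2) by (auto simp: M_def H_def)
  have hh: "H holomorphic_on M"
  proof -
   have "E1 holomorphic_on M" unfolding E1_def[abs_def] by (intro holomorphic_intros)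
   from holomorphic_on_compose_gen[OF this k'(1)] show ?thesis by (auto simp: o_def H_def[abs_def] M_def)
  qed
  have "inj_on H M"
  proof (rule inj_onI)
   fix z z' assume z: "z \<in> M" "z' \<in> M" "H z = H z'"
   hence "k (H z) = k (H z')" by simp
   hence "E1 z = E1 z'" by (simp only: hN(2)[OF z(1)] hN(2)[OF z(2)])
   moreover have "dist z0 z < 1" "dist z0 z' < 1" using z by (auto simp: M_def)
   hence "\<bar>Re z - Re z'\<bar> < 2 * pi" using abs_Re_le_cmod[of "z - z'"] dist_triangle2[of z z' z0] pi_gt3 by (simp add: dist_norm norm_minus_commute)
   ultimately show "z = z'" by (rule injE)
  qed
  hence d0: "deriv H z0 ~= 0" using holomorphic_injective_imp_regular[OF hh M(1) _ M(2)] by blast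
  obtain e1 where e1: "0 < e1" "ball z0 e1 \<subseteq> M" and b1: "\<And>x y. x \<in> ball z0 e1 ==> y \<in> ball z0 e1 ==>
    2/3 * cmod (deriv H z0) * dist x y <= dist (H x) (H y) & dist (H x) (H y) <= 4/3 * cmod (deriv H z0) * dist x y"
  proof (rule bilipschitz_at[OF M, of H "%z h. deriv H z * h" "cmod (deriv H z0)"])
   show "(H has_derivative (%h. deriv H z * h)) (at z)" if "z \<in> M" for z
    using holomorphic_derivI[OF hh M(1) that] by (simp add: has_field_derivative_def)
   have "continuous_on M (deriv H)" by (rule holomorphic_on_imp_continuous_on[OF holomorphic_deriv[OF hh M(1)]])
   thus "continuous_on M (%z. deriv H z * 1)" "continuous_on M (%z. deriv H z * \<i>)" by (auto intro: continuous_intros)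
  qed (use d0 in \<open>auto simp: norm_mult\<close>)
  obtain e2 s2 where e2: "0 < e2" "0 < s2" and b2: "\<And>x y. x \<in> ball 0 e2 ==> y \<in> ball 0 e2 ==>
    2/3 * s2 * dist x y <= dist (P (c x)) (P (c y)) & dist (P (c x)) (P (c y)) <= 4/3 * s2 * dist x y"
   using conf[OF c(1)] by metis
  have h0: "H z0 = 0" using k'(2)[OF N(2)] k0 by (simp add: H_def)
  have "continuous_on M H" using hh by (rule holomorphic_on_imp_continuous_on)
  then obtain e3 where e3: "0 < e3" "\<And>z. z \<in> M ==> dist z z0 < e3 ==> dist (H z) (H z0) < e2"
   using M(2) e2(1) unfolding continuous_on_iff by metis
  have Gh: "G z = P (c (H z))" if "z \<in> M" for z
  proof -
   have "c (H z) \<in> A" using hN(1)[OF that] by (simp add: N_def)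
   hence "g (k (H z)) = c (H z)" unfolding k_def by (rule fg(1))
   thus ?thesis by (simp only: G_def hN(2)[OF that])
  qed
  let ?d = "cmod (deriv H z0)"
  \<comment> \<open>The common scale collects the two lower factors 2/3; the two upper factors 4/3
    give 16/9, four times as much.\<close>
  have "0 < min e1 e3" "0 < 4/9 * ?d * s2" using e1 e2 e3 d0 by auto
  moreover have "\<forall>x\<in>ball z0 (min e1 e3) \<inter> B. \<forall>y\<in>ball z0 (min e1 e3) \<inter> B.
   4/9 * ?d * s2 * dist x y <= dist (G x) (G y) & dist (G x) (G y) <= 4 * (4/9 * ?d * s2) * dist x y"
  proof (intro conjI ballI)
   fix x y assume "x \<in> ball z0 (min e1 e3) \<inter> B" "y \<in> ball z0 (min e1 e3) \<inter> B"
   hence x: "x \<in> ball z0 e1" "dist x z0 < e3" and y: "y \<in> ball z0 e1" "dist y z0 < e3" by (auto simp: dist_commute)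
   hence m: "x \<in> M" "y \<in> M" using e1(2) by blast+
   have xy: "H x \<in> ball 0 e2" "H y \<in> ball 0 e2" using e3(2)[OF m(1) x(2)] e3(2)[OF m(2) y(2)] by (simp_all add: h0)
   have "2/3 * s2 * (2/3 * ?d * dist x y) <= 2/3 * s2 * dist (H x) (H y)"
    using b1[OF x(1) y(1)] e2(2) by (intro mult_left_mono) auto
   thus "4/9 * ?d * s2 * dist x y <= dist (G x) (G y)"
    using b2[OF xy] unfolding Gh[OF m(1)] Gh[OF m(2)] by (simp add: mult_ac)
   have "4/3 * s2 * dist (H x) (H y) <= 4/3 * s2 * (4/3 * ?d * dist x y)"
    using b1[OF x(1) y(1)] e2(2) by (intro mult_left_mono) auto
   thus "dist (G x) (G y) <= 4 * (4/9 * ?d * s2) * dist x y"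
    using b2[OF xy] unfolding Gh[OF m(1)] Gh[OF m(2)] by (simp add: mult_ac)
  qed
  ultimately show "\<exists>e>0. \<exists>s>0. \<forall>x\<in>ball z0 e \<inter> B. \<forall>y\<in>ball z0 e \<inter> B. s * dist x y <= dist (G x) (G y) & dist (G x) (G y) <= 4 * s * dist x y"
   by blast
 qed
qed

lemma conformal_chart_mono:
 assumes c: "conformal_chart M0 a f U" and o: "openin (top_of_set M) M0"
 shows "conformal_chart M a f U" using c o openin_trans by (auto simp: conformal_chart_def isothermal_param_def local_param_def)

lemma conformal_chart_bilipschitz:
 assumes c: "conformal_chart M a f D1"
 shows "\<exists>e>0. \<exists>s>0. e <= 1 & (\<forall>x\<in>ball 0 e. \<forall>y\<in>ball 0 e.
   2/3 * s * dist x y <= dist (f x) (f y) & dist (f x) (f y) <= 4/3 * s * dist x y)"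
proof -
 let ?D = "%z. frechet_derivative f (at z)"
 have z: "(0::complex) \<in> D1" by simp
 have iso: "\<forall>w\<in>D1. \<exists>m>0. \<forall>h. (norm (?D w h))\<^sup>2 = m * (cmod h)\<^sup>2" and ck: "Ck_on 1 f D1"
  using c unfolding conformal_chart_def isothermal_param_def local_param_def by blast+
 obtain m where m: "0 < m" "\<And>h. (norm (?D 0 h))\<^sup>2 = m * (cmod h)\<^sup>2" using iso z by blast
 have n: "norm (?D 0 h) = sqrt m * cmod h" for h
  using m(2)[of h] by (metis norm_ge_zero real_sqrt_abs real_sqrt_mult abs_of_nonneg)
 have d: "(f has_derivative ?D w) (at w)" if "w \<in> D1" for w using ck that by (simp add: frechet_derivative_works)
 have cont: "continuous_on D1 (%z. ?D z h)" for h using ck by simp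
 obtain e where e: "0 < e" "ball (0::complex) e \<subseteq> D1" "\<And>x y. x \<in> ball 0 e ==> y \<in> ball 0 e ==>
   2/3 * sqrt m * dist x y <= dist (f x) (f y) & dist (f x) (f y) <= 4/3 * sqrt m * dist x y"
  by (rule bilipschitz_at[OF open_ball z d cont cont _ n]) (assumption, use m(1) in simp, rule that, assumption+)
 have "e <= 1" using e(1,2) by (simp add: ball_subset_ball_iff)
 thus ?thesis using e(1,3) m(1) by (intro exI[of _ e] conjI exI[of _ "sqrt m"]) auto
qed

text \<open>The homeomorphism \<open>Ps\<close> carries the conformal charts to a punctured disc,
  whose uniformization \<open>f\<close> extends over 0 once both boundary circles are excluded as
  images of the end. The piece of radius \<open>r\<close> is itself a disc through
  \<open>P2\<close>, so its image is simply connected and a pointed Riemann map takes it to the unit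
  disc with 0 fixed.\<close>

lemma conformal_punctured:
 fixes E :: "'a::euclidean_space set" and Ps P2 :: "complex => 'a"
 assumes at: "oriented_atlas (E - {0}) AA" and Ps: "homeomorphism D1 (E \<inter> ball 0 r1) Ps Ph" "Ps 0 = 0"
  and r: "0 < r" "r <= r1" "E \<inter> ball 0 r \<subseteq> Ps ` ball 0 (exp (- 1))"
  and P2: "homeomorphism D1 (E \<inter> ball 0 r) P2 F2"
  and len: "0 < r0" "\<And>t. 0 < t ==> t <= r0 ==> hausdorff1 (sphere 0 t \<inter> E) <= ennreal (C * t)"
 shows "conformal_to_domain (ball 0 r \<inter> (E - {0})) AA punctured_disc"
proof -
 let ?B = "D1" and ?D = "D1 - {0}" and ?M = "E - {0}"
 note P = homeomorphism_apply1[OF Ps(1)] homeomorphism_apply2[OF Ps(1)] and Pim = homeomorphism_image1[OF Ps(1)] homeomorphism_image2[OF Ps(1)]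
  and Pc = homeomorphism_cont1[OF Ps(1)] homeomorphism_cont2[OF Ps(1)]
 have PE: "Ps z \<in> E \<inter> ball 0 r1" if "z \<in> ?B" for z using Pim(1) that by blast
 have FB: "Ph x \<in> ?B" if "x \<in> E \<inter> ball 0 r1" for x using Pim(2) that by blast
 have P0: "Ph 0 = 0" using P(1)[of 0] Ps(2) by simp
 have Pinj: "inj_on Ps ?B" using P(1) by (rule inj_on_inverseI)
 have Ps0: "Ps z ~= 0" if "z \<in> ?D" for z using P(1)[of z] P0 that by auto
 have op: "openin (top_of_set ?M) (Ps ` V)" if V: "open V" "V \<subseteq> ?D" for V
 proof -
  have "openin (top_of_set ?B) V" using V by (intro open_subset) auto
  hence "openin (top_of_set (E \<inter> ball 0 r1)) (Ps ` V)" by (rule homeomorphism_imp_open_map[OF Ps(1)])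
  hence "openin (top_of_set E) (Ps ` V)" by (rule openin_trans) (simp add: openin_open_Int)
  moreover have "Ps ` V \<subseteq> ?M"
  proof (rule image_subsetI)
   fix z assume "z \<in> V"
   thus "Ps z \<in> ?M" using V(2) PE[of z] Ps0[of z] by blast
  qed
  ultimately show ?thesis by (rule openin_subset_trans) simp
 qed
 \<comment> \<open>All plane charts that \<open>Ps\<close> turns into conformal charts of the
   surface.\<close>
 define CD where "CD = {c. continuous_on ?B c & inj_on c ?B & c ` ?B \<subseteq> ?D &
   (\<exists>ph. conformal_chart ?M AA ph ?B & (\<forall>w\<in>?B. Ps (c w) = ph w))}"
 have mk: "(%w. Ph (ph w)) \<in> CD" "\<And>w. w \<in> ?B ==> Ps (Ph (ph w)) = ph w" "\<And>w. w \<in> ?B ==> Ph (ph w) \<in> V"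
  if ph: "conformal_chart M0 AA ph ?B" "M0 \<subseteq> Ps ` V" "V \<subseteq> ?D" "openin (top_of_set ?M) M0" for ph M0 V
 proof -
  have l: "local_param 1 M0 ph ?B" using ph(1) unfolding conformal_chart_def isothermal_param_def by blast
  have in0: "ph w \<in> Ps ` V" if "w \<in> ?B" for w using local_param_sub[OF l] ph(2) that by blast
  show 1: "Ps (Ph (ph w)) = ph w" "Ph (ph w) \<in> V" if w: "w \<in> ?B" for w
  proof -
   obtain z where z: "z \<in> V" "ph w = Ps z" using in0[OF w] by blast
   have "z \<in> ?B" using z(1) ph(3) by blast
   thus "Ps (Ph (ph w)) = ph w" "Ph (ph w) \<in> V" using P(1)[of z] z by simp_all
  qed
  have "continuous_on ?B (%w. Ph (ph w))"
  proof (rule continuous_on_compose2[OF Pc(2) local_param_cont[OF l]])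
   show "ph ` ?B \<subseteq> E \<inter> ball 0 r1"
   proof (rule image_subsetI)
    fix w assume w: "w \<in> ?B"
    show "ph w \<in> E \<inter> ball 0 r1" using 1(2)[OF w] ph(3) PE[of "Ph (ph w)"] 1(1)[OF w] by auto
   qed
  qed
  moreover have "inj_on (%w. Ph (ph w)) ?B"
  proof (rule inj_onI)
   fix v w assume vw: "v \<in> ?B" "w \<in> ?B" "Ph (ph v) = Ph (ph w)"
   hence "Ps (Ph (ph v)) = Ps (Ph (ph w))" by simp
   hence "ph v = ph w" by (simp only: 1(1)[OF vw(1)] 1(1)[OF vw(2)])
   thus "v = w" using inj_onD[OF local_param_inj[OF l]] vw by blast
  qed
  moreover have "(%w. Ph (ph w)) ` ?B \<subseteq> ?D"
   by (rule image_subsetI) (rule subsetD[OF ph(3) 1(2)])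
  moreover have "conformal_chart ?M AA ph ?B" by (rule conformal_chart_mono[OF ph(1,4)])
  ultimately show "(%w. Ph (ph w)) \<in> CD"
   unfolding CD_def mem_Collect_eq by (intro conjI exI[of _ ph] ballI) (assumption | erule 1(1))+
 qed
 have small: "\<exists>c\<in>CD. c 0 = p & c ` ?B \<subseteq> V" if p: "p \<in> ?D" "open V" "p \<in> V" for p V
 proof -
  let ?V = "V \<inter> ?D"
  have V: "open ?V" "?V \<subseteq> ?D" using p(2) by (auto simp: open_delete)
  have "Ps p \<in> Ps ` ?V" using p by blast
  from conformal_chart_exists[OF at op[OF V] this] obtain ph where ph: "conformal_chart (Ps ` ?V) AA ph ?B" "ph 0 = Ps p" by metis
  note m = mk[OF ph(1) order_refl V(2) op[OF V]]
  show ?thesis using P(1)[of p] p(1) ph(2) m(1) m(3) by force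
 qed
 have CDc: "\<exists>ph. conformal_chart ?M AA ph ?B & (\<forall>w\<in>?B. Ps (c w) = ph w)" "inj_on c ?B" if "c \<in> CD" for c
  using that unfolding CD_def mem_Collect_eq by simp_all
 have pa: "planar_atlas ?D CD"
 proof
  show "open ?D" by (simp add: open_delete)
  show "connected ?D" by (rule connected_punctured_ball) simp
  show "\<exists>c\<in>CD. c 0 = p" if "p \<in> ?D" for p using small[OF that open_UNIV] by blast
  fix c c' assume c: "c \<in> CD" "c' \<in> CD"
  obtain ph where ph: "conformal_chart ?M AA ph ?B" "\<forall>w\<in>?B. Ps (c w) = ph w" using CDc(1)[OF c(1)] by (elim exE conjE)
  obtain f' where f': "conformal_chart ?M AA f' ?B" "\<forall>w\<in>?B. Ps (c' w) = f' w" using CDc(1)[OF c(2)] by (elim exE conjE)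
  have "local_param 1 ?M f' ?B" using f'(1) unfolding conformal_chart_def isothermal_param_def by blast
  from local_param_inj[OF this] CDc(2)[OF c(2)] have inj: "inj_on c' ?B" "inj_on f' ?B" by simp_all
  let ?N = "{w \<in> ?B. c w \<in> c' ` ?B}"
  have eq: "inv_into ?B f' (ph w) = inv_into ?B c' (c w) & ph w \<in> f' ` ?B" if w: "w \<in> ?N" for w
  proof -
   obtain v where v: "v \<in> ?B" "c w = c' v" using w by blast
   have "ph w = f' v" using ph(2) f'(2) v w by (metis (mono_tags, lifting) mem_Collect_eq)
   thus ?thesis using v inv_into_f_f[OF inj(1)] inv_into_f_f[OF inj(2)] by simp
  qed
  have "(%z. inv_into ?B f' (ph z)) holomorphic_on ?N"
   by (rule holomorphic_on_subset[OF conformal_transition[OF at order_refl ph(1) f'(1)]]) (use eq in blast)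
  thus "(inv_into ?B c' \<circ> c) holomorphic_on ?N" by (rule holomorphic_transform) (use eq in simp)
 qed (auto simp: CD_def)
 interpret D: planar_atlas ?D CD by (rule pa)
 define a where "a = exp (- 1 :: real)"
 have a: "0 < a" "a < 1" by (simp_all add: a_def)
 define A where "A = {z::complex. 0 < cmod z & cmod z < a}"
 have AB: "A = ball 0 a - {0}" by (auto simp: A_def)
 have oA: "open A" and AD: "A \<subseteq> ?D" using a by (auto simp: AB open_delete)
 obtain f rh where rh: "0 <= rh" "rh < 1" and bf: "bij_betw f A {w. rh < cmod w & cmod w < 1}" and hf: "D.holo f A"
 proof (rule annulus_uniformization[OF pa, folded a_def, folded A_def])
  fix f rh assume "0 <= rh" "rh < 1" "bij_betw f A {w. rh < cmod w & cmod w < 1}" "D.holo f A"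
  thus thesis by (rule that)
 qed (rule small)
 define R where "R = {w::complex. rh < cmod w & cmod w < 1}"
 have cf: "continuous_on A f" by (rule D.holo_cont[OF hf oA AD])
 obtain g where h: "homeomorphism A R f g"
 proof (rule invariance_of_domain_homeomorphism[OF oA cf _ bij_betw_imp_inj_on[OF bf]])
  fix g assume "homeomorphism A (f ` A) f g"
  thus thesis using that bf by (simp add: bij_betw_def R_def)
 qed simp
 note fg = homeomorphism_apply1[OF h] homeomorphism_apply2[OF h] and fim = homeomorphism_image1[OF h] homeomorphism_image2[OF h]
  and fcont = homeomorphism_cont1[OF h] homeomorphism_cont2[OF h]
 have conf: "\<exists>e>0. \<exists>s>0. \<forall>x\<in>ball 0 e. \<forall>y\<in>ball 0 e.
   2/3 * s * dist x y <= dist (Ps (c x)) (Ps (c y)) & dist (Ps (c x)) (Ps (c y)) <= 4/3 * s * dist x y" if cC: "c \<in> CD" for c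
 proof -
  obtain ph where ph: "conformal_chart ?M AA ph ?B" "\<forall>w\<in>?B. Ps (c w) = ph w" using CDc(1)[OF cC] by (elim exE conjE)
  obtain e s where e: "0 < e" "0 < s" "e <= 1" "\<forall>x\<in>ball 0 e. \<forall>y\<in>ball 0 e.
    2/3 * s * dist x y <= dist (ph x) (ph y) & dist (ph x) (ph y) <= 4/3 * s * dist x y"
   using conformal_chart_bilipschitz[OF ph(1)] by blast
  have "Ps (c x) = ph x" if "x \<in> ball 0 e" for x using that e(3) ph(2) by simp
  thus ?thesis using e by (intro exI[of _ e] conjI exI[of _ s]) auto
 qed
 have notcircle: False if "homeomorphism A R F G" "D.holo F A" "\<And>s. s < 1 ==> \<exists>ep>0. \<forall>z. 0 < cmod z & cmod z < ep --> s < cmod (F z)" for F G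
 proof (rule end_not_circle[OF pa Pinj Pc(1) Ps(2) _ conf len a rh(2,1) A_def R_def that(2,1,3)])
  show "Ps ` ?B \<subseteq> E" using Pim(1) by blast
 qed
 have alt2: "\<exists>ep>0. \<forall>z. 0 < cmod z & cmod z < ep --> z \<in> A & cmod (f z) < s" if "rh < s" for s
  using punctured_end[OF a(1) rh(2,1) A_def R_def h] notcircle[OF h hf] that by blast
 \<comment> \<open>Near 0 the modulus of \<open>f\<close> tends to \<open>rh\<close>. If this were
   positive, the inversion \<open>rh / f\<close> would map onto the same annulus and send the end to
   the outer circle, which is already excluded.\<close>
 have rh0: "rh = 0"
 proof (rule ccontr)
  assume "rh ~= 0"
  hence pos: "0 < rh" using rh by simp
  have inR: "of_real rh / w \<in> R" "w ~= 0" "of_real rh / (of_real rh / w) = w" if "w \<in> R" for w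
  proof -
   have w: "rh < cmod w" "cmod w < 1" using that by (simp_all add: R_def)
   thus w0: "w ~= 0" using pos by auto
   show "of_real rh / w \<in> R" using w(2) pos w w0 by (simp add: R_def norm_divide field_simps)
   show "of_real rh / (of_real rh / w) = w" using w0 pos by simp
  qed
  have h': "homeomorphism A R (%z. of_real rh / f z) (%w. g (of_real rh / w))"
  proof (rule homeomorphismI)
   have fR: "f z \<in> R" if "z \<in> A" for z using fim(1) that by blast
   show "continuous_on A (%z. of_real rh / f z)" by (intro continuous_intros fcont(1)) (use inR(2)[OF fR] in auto)
   show "continuous_on R (%w. g (of_real rh / w))"
    by (rule continuous_on_compose2[OF fcont(2)]) (use inR in \<open>auto intro!: continuous_intros\<close>)
   show "(%z. of_real rh / f z) ` A \<subseteq> R" using inR(1) fR by blast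
   show "(%w. g (of_real rh / w)) ` R \<subseteq> A" using inR(1) fim(2) by blast
   show "g (of_real rh / (of_real rh / f z)) = z" if "z \<in> A" for z unfolding inR(3)[OF fR[OF that]] by (rule fg(1)[OF that])
   show "of_real rh / f (g (of_real rh / w)) = w" if "w \<in> R" for w unfolding fg(2)[OF inR(1)[OF that]] by (rule inR(3)[OF that])
  qed
  have holo': "D.holo (%z. of_real rh / f z) A" unfolding D.holo_def
  proof
   fix c assume c: "c \<in> CD"
   have "(%w. f (c w)) holomorphic_on {w \<in> ?B. c w \<in> A}" using hf c unfolding D.holo_def by (simp add: o_def)
   moreover have "f (c w) ~= 0" if "w \<in> {w \<in> ?B. c w \<in> A}" for w using that fim(1) by (intro inR(2)) blast
   ultimately have "(%w. of_real rh / f (c w)) holomorphic_on {w \<in> ?B. c w \<in> A}" by (intro holomorphic_intros)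
   thus "((%z. of_real rh / f z) \<circ> c) holomorphic_on {w \<in> ?B. c w \<in> A}" by (simp add: o_def)
  qed
  show False
  proof (rule notcircle[OF h' holo'])
   fix s :: real assume s: "s < 1"
   define s1 where "s1 = max s (1/2)"
   have s1: "0 < s1" "s1 < 1" "s <= s1" using s by (auto simp: s1_def)
   have "rh < rh / s1" using pos s1 by (simp add: pos_less_divide_eq)
   from alt2[OF this] obtain ep where ep: "0 < ep" "\<And>z. 0 < cmod z & cmod z < ep ==> z \<in> A & cmod (f z) < rh / s1" by blast
   have "s < cmod (of_real rh / f z)" if z: "0 < cmod z & cmod z < ep" for z
   proof -
    have "s1 < rh / cmod (f z)" using inR(2)[of "f z"] ep(2)[OF z] fim(1) s1(1) by (auto simp: pos_less_divide_eq mult.commute)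
    thus ?thesis using s1(3) pos by (simp add: norm_divide)
   qed
   thus "\<exists>ep>0. \<forall>z. 0 < cmod z & cmod z < ep --> s < cmod (of_real rh / f z)" using ep(1) by blast
  qed
 qed
 have fR: "f z ~= 0" "cmod (f z) < 1" if "z \<in> A" for z using fim(1) that by (auto simp: R_def rh0)
 \<comment> \<open>As the inner radius is 0, \<open>f\<close> tends to 0 at the puncture and the
   extension by 0 is continuous and injective.\<close>
 define F0 where "F0 z = (if z = 0 then 0 else f z)" for z
 have cF0: "continuous_on (ball 0 a) F0" unfolding continuous_on_eq_continuous_at[OF open_ball]
 proof
  fix z :: complex assume z: "z \<in> ball 0 a"
  show "isCont F0 z"
  proof (cases "z = 0")
   case True
   show ?thesis unfolding continuous_at_eps_delta
   proof (intro allI impI)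
    fix s :: real assume "0 < s"
    then obtain ep where ep: "0 < ep" "\<And>z. 0 < cmod z & cmod z < ep ==> cmod (f z) < s" using alt2[of s] rh0 by blast
    thus "\<exists>d>0. \<forall>x'. dist x' z < d --> dist (F0 x') (F0 z) < s"
     using True \<open>0 < s\<close> by (intro exI[of _ ep]) (auto simp: F0_def)
   qed
  next
   case False
   hence zA: "z \<in> A" using z by (simp add: AB)
   hence "isCont f z" using fcont(1) oA by (simp add: continuous_on_eq_continuous_at)
   moreover have "\<forall>\<^sub>F x in nhds z. F0 x = f x"
    using eventually_nhds_in_open[OF oA zA] by eventually_elim (auto simp: F0_def AB)
   ultimately show ?thesis using isCont_cong by blast
  qed
 qed
 have iF0: "inj_on F0 (ball 0 a)"
 proof (rule inj_onI)
  fix x y :: complex assume xy: "x \<in> ball 0 a" "y \<in> ball 0 a" "F0 x = F0 y"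
  show "x = y"
  proof (cases "x = 0 | y = 0")
   case True
   thus ?thesis using xy fR(1) by (auto simp: F0_def AB split: if_splits)
  next
   case False
   hence m: "x \<in> A" "y \<in> A" "f x = f y" using xy by (auto simp: F0_def AB)
   thus ?thesis using inj_onD[OF bij_betw_imp_inj_on[OF bf]] by blast
  qed
 qed
 have Er: "E \<inter> ball 0 r \<subseteq> E \<inter> ball 0 r1" using r(2) by auto
 have Fa: "Ph x \<in> ball 0 a" if "x \<in> E \<inter> ball 0 r" for x
 proof -
  obtain z where z: "z \<in> ball 0 a" "x = Ps z" using r(3) \<open>x \<in> E \<inter> ball 0 r\<close> unfolding a_def by blast
  thus ?thesis using a P(1) z by simp
 qed
 \<comment> \<open>The image of the piece in the uniformized disc, written as an injective
   continuous image of the disc through \<open>P2\<close>, which makes it open and simply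
   connected.\<close>
 define u where "u = (%w. F0 (Ph (P2 w))) ` ?B"
 note Q = homeomorphism_image1[OF P2] homeomorphism_cont1[OF P2] homeomorphism_apply1[OF P2]
 have P2E: "P2 w \<in> E \<inter> ball 0 r" if "w \<in> ?B" for w using Q(1) that by blast
 have cU: "continuous_on ?B (%w. F0 (Ph (P2 w)))"
 proof (rule continuous_on_compose2[OF cF0 continuous_on_compose2[OF Pc(2) Q(2)]])
  show "P2 ` ?B \<subseteq> E \<inter> ball 0 r1" by (rule image_subsetI) (rule subsetD[OF Er P2E])
  show "(%w. Ph (P2 w)) ` ?B \<subseteq> ball 0 a" by (rule image_subsetI) (rule Fa[OF P2E])
 qed
 have iU: "inj_on (%w. F0 (Ph (P2 w))) ?B"
 proof (rule inj_onI)
  fix v w assume vw: "v \<in> ?B" "w \<in> ?B" "F0 (Ph (P2 v)) = F0 (Ph (P2 w))"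
  have "Ph (P2 v) = Ph (P2 w)" by (rule inj_onD[OF iF0 vw(3) Fa[OF P2E[OF vw(1)]] Fa[OF P2E[OF vw(2)]]])
  hence "Ps (Ph (P2 v)) = Ps (Ph (P2 w))" by (rule arg_cong)
  hence "F2 (P2 v) = F2 (P2 w)" by (simp only: P(2)[OF subsetD[OF Er P2E[OF vw(1)]]] P(2)[OF subsetD[OF Er P2E[OF vw(2)]]])
  thus "v = w" by (simp only: Q(3)[OF vw(1)] Q(3)[OF vw(2)])
 qed
 have UE: "u = (%x. F0 (Ph x)) ` (E \<inter> ball 0 r)" unfolding u_def Q(1)[symmetric] image_image ..
 have oU: "open u" unfolding u_def by (rule invariance_of_domain[OF cU open_ball iU])
 obtain G2 where "homeomorphism ?B u (%w. F0 (Ph (P2 w))) G2"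
  by (rule invariance_of_domain_homeomorphism[OF open_ball cU _ iU, folded u_def]) (simp, rule that)
 hence "?B homeomorphic u" unfolding homeomorphic_def by blast
 hence sc: "simply_connected u"
  using homeomorphic_simply_connected convex_imp_simply_connected convex_ball by blast
 have U1: "u \<subseteq> ?B"
 proof
  fix y assume "y \<in> u"
  then obtain x where x: "x \<in> E \<inter> ball 0 r" "y = F0 (Ph x)" unfolding UE by blast
  show "y \<in> ?B" using fR(2)[of "Ph x"] Fa[OF x(1)] by (auto simp: x(2) F0_def AB)
 qed
 have nU: "u ~= UNIV" using bounded_subset[OF bounded_ball U1] not_bounded_UNIV by metis
 have "0 \<in> E" using PE[of 0] Ps(2) by simp
 hence zU: "0 \<in> u" unfolding UE using r(1) P0 by (intro image_eqI[of _ _ 0]) (auto simp: F0_def)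
 obtain q q' where q: "q holomorphic_on u" "q' holomorphic_on ?B" "q 0 = 0" "\<And>z. z \<in> u ==> q z \<in> ?B & q' (q z) = z"
  "\<And>z. z \<in> ?B ==> q' z \<in> u & q (q' z) = z"
  by (rule riemann_pointed[OF oU sc nU zU]) (rule that, assumption+)
 define K where "K = ball 0 r \<inter> ?M"
 have KA: "Ph x \<in> A" "f (Ph x) \<in> u" "Ps (Ph x) = x" if x: "x \<in> K" for x
 proof -
  have xE: "x \<in> E \<inter> ball 0 r" "x ~= 0" using x by (auto simp: K_def)
  show 1: "Ps (Ph x) = x" by (rule P(2)[OF subsetD[OF Er xE(1)]])
  hence "Ph x ~= 0" using xE(2) Ps(2) by auto
  thus 2: "Ph x \<in> A" using Fa[OF xE(1)] by (simp add: AB)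
  have "F0 (Ph x) \<in> u" unfolding UE using xE(1) by blast
  thus "f (Ph x) \<in> u" using \<open>Ph x ~= 0\<close> by (simp add: F0_def)
 qed
 define Fin where "Fin x = q (f (Ph x))" for x
 define Gin where "Gin y = Ps (g (q' y))" for y
 have inv1: "Gin (Fin x) = x" "Fin x \<in> punctured_disc" if x: "x \<in> K" for x
 proof -
  note k = KA[OF x]
  have q1: "q (f (Ph x)) \<in> ?B" "q' (q (f (Ph x))) = f (Ph x)" using q(4)[OF k(2)] by blast+
  show "Gin (Fin x) = x" unfolding Gin_def Fin_def q1(2) fg(1)[OF k(1)] by (rule k(3))
  have "q (f (Ph x)) ~= 0"
  proof
   assume "q (f (Ph x)) = 0"
   hence "q' 0 = f (Ph x)" using q1(2) by simp
   moreover have "q' 0 = 0" using q(4)[OF zU] q(3) by simp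
   ultimately show False using fR(1)[OF k(1)] by simp
  qed
  thus "Fin x \<in> punctured_disc" using q1(1) by (simp add: Fin_def punctured_disc_def)
 qed
 have inv2: "Gin y \<in> K" "Fin (Gin y) = y" "q' y \<in> R" if y: "y \<in> punctured_disc" for y
 proof -
  have yB: "y \<in> ?B" "y ~= 0" using y by (auto simp: punctured_disc_def)
  hence "q' y ~= 0" using q(3) q(5)[OF yB(1)] by auto
  obtain x where x: "x \<in> E \<inter> ball 0 r" "q' y = F0 (Ph x)" using q(5)[OF yB(1)] unfolding UE by blast
  hence p0: "Ph x ~= 0" using \<open>q' y ~= 0\<close> by (auto simp: F0_def)
  hence "x ~= 0" using P0 by auto
  hence xK: "x \<in> K" using x(1) by (simp add: K_def)
  have qf: "q' y = f (Ph x)" using x(2) p0 by (simp add: F0_def)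
  have Gx: "Gin y = x" unfolding Gin_def qf fg(1)[OF KA(1)[OF xK]] by (simp only: KA(3)[OF xK])
  thus "Gin y \<in> K" using xK by simp
  show "Fin (Gin y) = y" unfolding Gx Fin_def qf[symmetric] using q(5)[OF yB(1)] by blast
  show "q' y \<in> R" unfolding qf using fim(1) KA(1)[OF xK] by blast
 qed
 have hom: "homeomorphism K punctured_disc Fin Gin"
 proof (rule homeomorphismI)
  have KE: "K \<subseteq> E \<inter> ball 0 r1" using Er by (auto simp: K_def)
  show "continuous_on K Fin" unfolding Fin_def[abs_def]
  proof (rule continuous_on_compose2[OF holomorphic_on_imp_continuous_on[OF q(1)] continuous_on_compose2[OF fcont(1) continuous_on_subset[OF Pc(2) KE]]])
   show "(%x. f (Ph x)) ` K \<subseteq> u" by (rule image_subsetI) (rule KA(2))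
   show "Ph ` K \<subseteq> A" by (rule image_subsetI) (rule KA(1))
  qed
  have PB: "punctured_disc \<subseteq> ?B" by (auto simp: punctured_disc_def)
  show "continuous_on punctured_disc Gin" unfolding Gin_def[abs_def]
  proof (rule continuous_on_compose2[OF Pc(1) continuous_on_compose2[OF fcont(2) continuous_on_subset[OF holomorphic_on_imp_continuous_on[OF q(2)] PB]]])
   show "q' ` punctured_disc \<subseteq> R" by (rule image_subsetI) (rule inv2(3))
   show "(%x. g (q' x)) ` punctured_disc \<subseteq> ?B"
   proof (rule image_subsetI)
    fix y assume "y \<in> punctured_disc"
    thus "g (q' y) \<in> ?B" using fim(2) inv2(3) AD by blast
   qed
  qed
  show "Fin ` K \<subseteq> punctured_disc" by (rule image_subsetI) (rule inv1(2))
  show "Gin ` punctured_disc \<subseteq> K" by (rule image_subsetI) (rule inv2(1))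
  show "Gin (Fin x) = x" if "x \<in> K" for x by (rule inv1(1)[OF that])
  show "Fin (Gin y) = y" if "y \<in> punctured_disc" for y by (rule inv2(2)[OF that])
 qed
 have oK: "openin (top_of_set ?M) K" unfolding K_def by (metis Int_commute open_ball openin_open_Int)
 have charts: "\<exists>ph U. conformal_chart K AA ph U & p \<in> ph ` U & (Fin \<circ> ph) holomorphic_on U &
   (inv_into U ph \<circ> Gin) holomorphic_on (Fin ` ph ` U)" if p: "p \<in> K" for p
 proof -
  obtain ph where ph: "conformal_chart K AA ph ?B" "ph 0 = p" by (rule conformal_chart_exists[OF at oK p])
  have l: "local_param 1 K ph ?B" using ph(1) unfolding conformal_chart_def isothermal_param_def by blast
  have fK: "ph w \<in> K" if "w \<in> ?B" for w using local_param_sub[OF l] that by blast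
  have "K \<subseteq> Ps ` A" using KA by (metis image_eqI subsetI)
  note m = mk[OF ph(1) this AD oK]
  have "(f \<circ> (%w. Ph (ph w))) holomorphic_on {w \<in> ?B. Ph (ph w) \<in> A}" using hf m(1) unfolding D.holo_def by blast
  moreover have "{w \<in> ?B. Ph (ph w) \<in> A} = ?B" using m(3) by blast
  ultimately have "(%w. f (Ph (ph w))) holomorphic_on ?B" by (simp add: o_def)
  from holomorphic_on_compose_gen[OF this q(1)] have hF: "(Fin \<circ> ph) holomorphic_on ?B"
   using KA(2)[OF fK] by (simp add: o_def Fin_def image_subset_iff)
  have iF: "inj_on (Fin \<circ> ph) ?B"
  proof (rule inj_onI)
   fix v w assume vw: "v \<in> ?B" "w \<in> ?B" "(Fin \<circ> ph) v = (Fin \<circ> ph) w"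
   hence "Gin (Fin (ph v)) = Gin (Fin (ph w))" by simp
   thus "v = w" using inj_onD[OF local_param_inj[OF l]] vw by (simp only: inv1(1)[OF fK[OF vw(1)]] inv1(1)[OF fK[OF vw(2)]])
  qed
  obtain k where k: "k holomorphic_on ((Fin \<circ> ph) ` ?B)" "\<And>w. w \<in> ?B ==> k ((Fin \<circ> ph) w) = w"
   by (rule holomorphic_has_inverse[OF hF open_ball iF]) (rule that, assumption+)
  have "(inv_into ?B ph \<circ> Gin) holomorphic_on ((Fin \<circ> ph) ` ?B)"
  proof (rule holomorphic_transform[OF k(1)])
   fix y assume "y \<in> (Fin \<circ> ph) ` ?B"
   then obtain w where w: "w \<in> ?B" "y = (Fin \<circ> ph) w" by blast
   have "(inv_into ?B ph \<circ> Gin) y = inv_into ?B ph (ph w)" unfolding w(2) o_def inv1(1)[OF fK[OF w(1)]] ..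
   also have "\<dots> = w" by (rule inv_into_f_f[OF local_param_inj[OF l] w(1)])
   finally show "k y = (inv_into ?B ph \<circ> Gin) y" using k(2)[OF w(1)] w(2) by simp
  qed
  hence "(inv_into ?B ph \<circ> Gin) holomorphic_on (Fin ` ph ` ?B)" by (simp only: image_comp)
  moreover have "p \<in> ph ` ?B" using ph(2) by force
  ultimately show ?thesis using ph(1) hF by blast
 qed
 show ?thesis unfolding conformal_to_domain_def K_def[symmetric] using hom charts by blast
qed

section \<open>Choice of the radius\<close>

theorem theorem5p3:
 fixes E :: "(real ^ 'n) set"
 assumes "Ck_surface 0 E"
  and "0 \<in> E"
  and "orientable_C2_surface (E - {0})"
  and "M_regular_singularity E"
 shows "conformally_point_like E"
proof -
 obtain r0 C where wc: "whitney_condition (E - {0})" and len: "0 < r0" "\<And>t. 0 < t ==> t <= r0 ==> hausdorff1 (sphere 0 t \<inter> E) <= ennreal (C * t)"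
  using assms(4) unfolding M_regular_singularity_def by blast
 obtain R where R: "0 < R" "\<And>x. x \<in> E - {0} ==> norm x < R ==> \<exists>v\<in>tangent_space (E - {0}) x. v \<bullet> x ~= 0"
  by (rule whitney_tangent[OF wc]) (rule that, assumption+)
 obtain r1 where r1: "0 < r1" and disc: "\<And>r. 0 < r ==> r <= r1 ==>
   \<exists>P F. homeomorphism D1 (E \<inter> ball 0 r) (P :: complex => real ^ 'n) F & P 0 = 0"
  by (rule disc_neighbourhoods[OF assms(1,2) R]) (assumption+, rule that, assumption+)
 obtain P :: "complex => real ^ 'n" and F where P: "homeomorphism D1 (E \<inter> ball 0 r1) P F" "P 0 = 0"
  using disc[OF r1 order_refl] by blast
 \<comment> \<open>\<open>annulus_uniformization\<close> covers only the punctured disc of radius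
   \<open>exp (- 1)\<close>, so \<open>r\<close> must keep the piece of \<open>E\<close> inside the
   image of that disc.\<close>
 have "ball (0::complex) (exp (- 1)) \<subseteq> D1" by (rule subset_ball) simp
 hence "openin (top_of_set D1) (ball 0 (exp (- 1)))" by (simp add: open_subset)
 hence "openin (top_of_set (E \<inter> ball 0 r1)) (P ` ball 0 (exp (- 1)))" by (rule homeomorphism_imp_open_map[OF P(1)])
 then obtain T where T: "open T" "P ` ball 0 (exp (- 1)) = (E \<inter> ball 0 r1) \<inter> T" unfolding openin_open by blast
 have "P 0 \<in> P ` ball 0 (exp (- 1))" by (rule imageI) simp
 hence "0 \<in> T" using T(2) P(2) by simp
 from openE[OF T(1) this] obtain r2 where r2: "0 < r2" "ball 0 r2 \<subseteq> T" .
 define r where "r = min r1 r2"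
 have r: "0 < r" "r <= r1" "E \<inter> ball 0 r \<subseteq> P ` ball 0 (exp (- 1))" using r1 r2 unfolding T(2) r_def by auto
 obtain P2 :: "complex => real ^ 'n" and F2 where P2: "homeomorphism D1 (E \<inter> ball 0 r) P2 F2" using disc[OF r(1,2)] by blast
 have "conformal_to_domain K a punctured_disc" if a: "oriented_atlas (E - {0}) a" and K: "K \<in> components (ball 0 r \<inter> (E - {0}))" for a K
 proof -
  have c: "conformal_to_domain (ball 0 r \<inter> (E - {0})) a punctured_disc"
   by (rule conformal_punctured[OF a P r P2 len])
  then obtain f g where "homeomorphism (ball 0 r \<inter> (E - {0})) punctured_disc f g" unfolding conformal_to_domain_def by blast
  hence "g ` punctured_disc = ball 0 r \<inter> (E - {0})" "continuous_on punctured_disc g" unfolding homeomorphism_def by blast+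
  moreover have "connected punctured_disc" unfolding punctured_disc_def by (rule punctured_disc_connected)
  ultimately have "connected (ball 0 r \<inter> (E - {0}))" by (metis connected_continuous_image)
  \<comment> \<open>The punctured piece is connected, being a continuous image of the punctured
    disc, so \<open>K\<close> is all of it.\<close>
  thus ?thesis using K c by (metis connected_eq_components_subset_sing singletonD subsetD)
 qed
 thus ?thesis unfolding conformally_point_like_def using r(1) by blast
qed

end
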